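(* Let $\mathcal{A}=\{A_k,\alpha_k\}$ and $\mathcal{A}'=\{A'_k,\alpha'_k\}$ be direct systems of finite dimensional nest algebras in which all (star extendible) embeddings are order preserving (resp. order conserving), and let $A_0,A_0'$ be their algebraic direct limit algebras. Then the following are equivalent: (i) The systems $\mathcal{A}$ and $\mathcal{A}'$ are regularly isomorphic by a commuting diagram isomorphism in which all the crossover maps are order preserving (resp. order conserving); (ii) $A_0$ and $A_0'$ are star extendibly isomorphic. Moreover, every star extendible isomorphism $\Phi\colon A_0\to A_0'$ is induced by a system isomorphism as in (i).
   Context: A finite dimensional nest algebra is a unital algebra $A\subseteq M_n(\mathbb{C})$ (or an operator algebra star extendibly isomorphic to one) associated with an ordered decomposition $1=q_1+\dots+q_l$ of the identity into nonzero orthogonal projections: $A$ consists of all $a\in M_n(\mathbb{C})$ with $(1-f)af=0$ for every $f=q_1+\dots+q_k$, $1\le k\le l$. The $q_i$ are the atoms of $A$; $A$ is the algebra of block upper triangular matrices for the block structure $v=(q_ivq_j)$, and $C^*(A)=M_n(\mathbb{C})$. A homomorphism $A_1\to A_2$ is star extendible if it is the restriction of a $*$-homomorphism $C^*(A_1)\to C^*(A_2)$; it has multiplicity one if this extension maps rank one projections to rank one projections. It is regular if it is a direct sum of multiplicity one star extendible embeddings $A_1\to A_2$ (with pairwise orthogonal images of $1$). $\mathrm{Pisom}_{\mathrm{reg}}(A)$ is the set of partial isometries $v\in A$ all of whose blocks $q_ivq_j$ are partial isometries. $\mathrm{Pisom}_{\mathrm{oc}}(A)$ is the set of $v\in \mathrm{Pisom}_{\mathrm{reg}}(A)$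 such that $q_ivq_j\neq 0$ implies $q_svq_t=0$ for all $s<i$, $t>j$. $\mathrm{Pisom}_{\mathrm{op}}(A)$ is the set of $v\in \mathrm{Pisom}_{\mathrm{reg}}(A)$ such that $q_ivq_j\neq 0$ implies $q_svq_t=0$ for all $(s,t)\ne(i,j)$ with $s\le i$, $t\ge j$. A star extendible embedding $\phi\colon A_1\to A_2$ is order conserving if it maps $\mathrm{Pisom}_{\mathrm{oc}}(A_1)$ into $\mathrm{Pisom}_{\mathrm{oc}}(A_2)$, and order preserving if it maps $\mathrm{Pisom}_{\mathrm{op}}(A_1)$ into $\mathrm{Pisom}_{\mathrm{op}}(A_2)$. Here $\alpha_k\colon A_k\to A_{k+1}$ ($k\geq1$) are star extendible (injective) embeddings. The systems are regularly isomorphic if there are increasing sequences $(n_k)$, $(m_k)$ and regular star extendible embeddings (crossover maps) $\phi_k\colon A_{n_k}\to A'_{m_k}$, $\psi_k\colon A'_{m_k}\to A_{n_{k+1}}$ such that $\psi_k\circ\phi_k$ and $\phi_{k+1}\circ\psi_k$ equal the given system maps $A_{n_k}\to A_{n_{k+1}}$ and $A'_{m_k}\to A'_{m_{k+1}}$ for all $k$. Such a commuting diagram induces an isomorphism $A_0\to A_0'$ of the limits; an isomorphism $\Phi$ is induced by it if $\Phi$ is the isomorphism so obtained. The limits $A_0,A_0'$ are star extendibly isomorphic if there is an algebra isomorphism $A_0\to A_0'$ (a star extendible isomorphism) which extends to a $*$-algebra isomorphism between the generated C*-algebras (the C*-algebra generated by $A_0$ being the C*-direct limit of the $C^*(A_k)$).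 *)

theory Defs
  imports
    Complex_Main
    "Jordan_Normal_Form.Schur_Decomposition"
    "Jordan_Normal_Form.DL_Rank"
begin

section \<open>Matrices\<close>

definition mat_sum :: "nat \<Rightarrow> nat set \<Rightarrow> (nat \<Rightarrow> complex mat) \<Rightarrow> complex mat" where
  "mat_sum d S f = mat d d (\<lambda>(i, j). \<Sum>k\<in>S. f k $$ (i, j))"

definition vnorm :: "complex vec \<Rightarrow> real" where
  "vnorm v = sqrt (Re (v \<bullet>c v))"

definition opnorm :: "complex mat \<Rightarrow> real" where
  "opnorm a = (SUP v\<in>{v \<in> carrier_vec (dim_col a). vnorm v \<le> 1}. vnorm (a *\<^sub>v v))"

definition projection :: "nat \<Rightarrow> complex mat \<Rightarrow> bool" where
  "projection d p \<longleftrightarrow> p \<in> carrier_mat d d \<and> mat_adjoint p = p \<and> p * p = p"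

definition partial_isometry :: "nat \<Rightarrow> complex mat \<Rightarrow> bool" where
  "partial_isometry d v \<longleftrightarrow> v \<in> carrier_mat d d \<and> projection d (mat_adjoint v * v)"

definition rank_one_projection :: "nat \<Rightarrow> complex mat \<Rightarrow> bool" where
  "rank_one_projection d p \<longleftrightarrow> projection d p \<and> vec_space.rank d p = 1"

text \<open>Star homomorphisms between full matrix algebras; they need not be unital.\<close>

definition star_hom :: "nat \<Rightarrow> nat \<Rightarrow> (complex mat \<Rightarrow> complex mat) \<Rightarrow> bool" where
  "star_hom d e \<pi> \<longleftrightarrow>
     (\<forall>a\<in>carrier_mat d d. \<pi> a \<in> carrier_mat e e) \<and>
     (\<forall>a\<in>carrier_mat d d. \<forall>b\<in>carrier_mat d d. \<pi> (a + b) = \<pi> a + \<pi> b) \<and>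
     (\<forall>c. \<forall>a\<in>carrier_mat d d. \<pi> (c \<cdot>\<^sub>m a) = c \<cdot>\<^sub>m \<pi> a) \<and>
     (\<forall>a\<in>carrier_mat d d. \<forall>b\<in>carrier_mat d d. \<pi> (a * b) = \<pi> a * \<pi> b) \<and>
     (\<forall>a\<in>carrier_mat d d. \<pi> (mat_adjoint a) = mat_adjoint (\<pi> a))"

section \<open>Finite dimensional nest algebras\<close>

text \<open>A finite dimensional nest algebra is given by the size of the ambient matrix algebra
  and the list of its atoms. Atoms are numbered from 0. The atoms are arbitrary
  projections, not necessarily diagonal.\<close>

record nest =
  ndim :: nat
  atoms :: "complex mat list"

abbreviation natoms :: "nest \<Rightarrow> nat" where
  "natoms N \<equiv> length (atoms N)"

definition nest_data :: "nest \<Rightarrow> bool" where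
  "nest_data N \<longleftrightarrow> ndim N > 0 \<and>
     (\<forall>i<natoms N. projection (ndim N) (atoms N ! i) \<and> atoms N ! i \<noteq> 0\<^sub>m (ndim N) (ndim N)) \<and>
     (\<forall>i<natoms N. \<forall>j<natoms N. i \<noteq> j \<longrightarrow>
        atoms N ! i * atoms N ! j = 0\<^sub>m (ndim N) (ndim N)) \<and>
     mat_sum (ndim N) {..<natoms N} (\<lambda>i. atoms N ! i) = 1\<^sub>m (ndim N)"

definition nest_proj :: "nest \<Rightarrow> nat \<Rightarrow> complex mat" where
  "nest_proj N k = mat_sum (ndim N) {..<k} (\<lambda>i. atoms N ! i)"

definition nest_alg :: "nest \<Rightarrow> complex mat set" where
  "nest_alg N = {a \<in> carrier_mat (ndim N) (ndim N). \<forall>k\<in>{1..natoms N}.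
     (1\<^sub>m (ndim N) - nest_proj N k) * a * nest_proj N k = 0\<^sub>m (ndim N) (ndim N)}"

text \<open>The C*-algebra generated by \<open>nest_alg N\<close> is the full matrix algebra.\<close>

abbreviation full_alg :: "nest \<Rightarrow> complex mat set" where
  "full_alg N \<equiv> carrier_mat (ndim N) (ndim N)"

definition block :: "nest \<Rightarrow> complex mat \<Rightarrow> nat \<Rightarrow> nat \<Rightarrow> complex mat" where
  "block N v i j = atoms N ! i * v * atoms N ! j"

abbreviation block_zero :: "nest \<Rightarrow> complex mat \<Rightarrow> nat \<Rightarrow> nat \<Rightarrow> bool" where
  "block_zero N v i j \<equiv> block N v i j = 0\<^sub>m (ndim N) (ndim N)"

definition Pisom_reg :: "nest \<Rightarrow> complex mat set" where
  "Pisom_reg N = {v \<in> nest_alg N. partial_isometry (ndim N) v \<and>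
     (\<forall>i<natoms N. \<forall>j<natoms N. partial_isometry (ndim N) (block N v i j))}"

definition Pisom_oc :: "nest \<Rightarrow> complex mat set" where
  "Pisom_oc N = {v \<in> Pisom_reg N. \<forall>i<natoms N. \<forall>j<natoms N. \<not> block_zero N v i j \<longrightarrow>
     (\<forall>s<natoms N. \<forall>t<natoms N. s < i \<and> t > j \<longrightarrow> block_zero N v s t)}"

definition Pisom_op :: "nest \<Rightarrow> complex mat set" where
  "Pisom_op N = {v \<in> Pisom_reg N. \<forall>i<natoms N. \<forall>j<natoms N. \<not> block_zero N v i j \<longrightarrow>
     (\<forall>s<natoms N. \<forall>t<natoms N. (s, t) \<noteq> (i, j) \<and> s \<le> i \<and> t \<ge> j \<longrightarrow> block_zero N v s t)}"

section \<open>Maps between nest algebras\<close>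

text \<open>Maps between nest algebras are only considered on the domain algebra; their values
  elsewhere are irrelevant.\<close>

definition star_extends :: "nest \<Rightarrow> nest \<Rightarrow> (complex mat \<Rightarrow> complex mat) \<Rightarrow> (complex mat \<Rightarrow> complex mat) \<Rightarrow> bool" where
  "star_extends N N' \<phi> \<pi> \<longleftrightarrow> star_hom (ndim N) (ndim N') \<pi> \<and> (\<forall>a\<in>nest_alg N. \<pi> a = \<phi> a)"

definition star_ext_embedding :: "nest \<Rightarrow> nest \<Rightarrow> (complex mat \<Rightarrow> complex mat) \<Rightarrow> bool" where
  "star_ext_embedding N N' \<phi> \<longleftrightarrow>
     (\<forall>a\<in>nest_alg N. \<phi> a \<in> nest_alg N') \<and> inj_on \<phi> (nest_alg N) \<and> (\<exists>\<pi>. star_extends N N' \<phi> \<pi>)"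

text \<open>Since \<open>nest_alg N\<close> together with its adjoints spans \<open>full_alg N\<close>, the extension is unique
  on \<open>full_alg N\<close>.\<close>

definition star_extension :: "nest \<Rightarrow> nest \<Rightarrow> (complex mat \<Rightarrow> complex mat) \<Rightarrow> complex mat \<Rightarrow> complex mat" where
  "star_extension N N' \<phi> = (SOME \<pi>. star_extends N N' \<phi> \<pi>)"

definition mult_one_embedding :: "nest \<Rightarrow> nest \<Rightarrow> (complex mat \<Rightarrow> complex mat) \<Rightarrow> bool" where
  "mult_one_embedding N N' \<phi> \<longleftrightarrow> star_ext_embedding N N' \<phi> \<and>
     (\<exists>\<pi>. star_extends N N' \<phi> \<pi> \<and>
        (\<forall>p. rank_one_projection (ndim N) p \<longrightarrow> rank_one_projection (ndim N') (\<pi> p)))"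

definition regular_embedding :: "nest \<Rightarrow> nest \<Rightarrow> (complex mat \<Rightarrow> complex mat) \<Rightarrow> bool" where
  "regular_embedding N N' \<phi> \<longleftrightarrow> star_ext_embedding N N' \<phi> \<and>
     (\<exists>(r::nat) \<phi>s.
        (\<forall>i<r. mult_one_embedding N N' (\<phi>s i)) \<and>
        (\<forall>i<r. \<forall>j<r. i \<noteq> j \<longrightarrow>
           \<phi>s i (1\<^sub>m (ndim N)) * \<phi>s j (1\<^sub>m (ndim N)) = 0\<^sub>m (ndim N') (ndim N')) \<and>
        (\<forall>a\<in>nest_alg N. \<phi> a = mat_sum (ndim N') {..<r} (\<lambda>i. \<phi>s i a)))"

definition order_conserving :: "nest \<Rightarrow> nest \<Rightarrow> (complex mat \<Rightarrow> complex mat) \<Rightarrow> bool" where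
  "order_conserving N N' \<phi> \<longleftrightarrow> star_ext_embedding N N' \<phi> \<and> \<phi> ` Pisom_oc N \<subseteq> Pisom_oc N'"

definition order_preserving :: "nest \<Rightarrow> nest \<Rightarrow> (complex mat \<Rightarrow> complex mat) \<Rightarrow> bool" where
  "order_preserving N N' \<phi> \<longleftrightarrow> star_ext_embedding N N' \<phi> \<and> \<phi> ` Pisom_op N \<subseteq> Pisom_op N'"

section \<open>Algebras and star algebras as structures\<close>

record 'a alg_struct =
  acarrier :: "'a set"
  aadd :: "'a \<Rightarrow> 'a \<Rightarrow> 'a"
  amult :: "'a \<Rightarrow> 'a \<Rightarrow> 'a"
  ascale :: "complex \<Rightarrow> 'a \<Rightarrow> 'a"

record 'a star_alg_struct = "'a alg_struct" +
  astar :: "'a \<Rightarrow> 'a"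

definition alg_iso :: "('a, 'm) alg_struct_scheme \<Rightarrow> ('b, 'n) alg_struct_scheme \<Rightarrow> ('a \<Rightarrow> 'b) \<Rightarrow> bool" where
  "alg_iso A B \<Phi> \<longleftrightarrow> bij_betw \<Phi> (acarrier A) (acarrier B) \<and>
     (\<forall>x\<in>acarrier A. \<forall>y\<in>acarrier A. \<Phi> (aadd A x y) = aadd B (\<Phi> x) (\<Phi> y)) \<and>
     (\<forall>x\<in>acarrier A. \<forall>y\<in>acarrier A. \<Phi> (amult A x y) = amult B (\<Phi> x) (\<Phi> y)) \<and>
     (\<forall>c. \<forall>x\<in>acarrier A. \<Phi> (ascale A c x) = ascale B c (\<Phi> x))"

definition star_alg_iso :: "('a, 'm) star_alg_struct_scheme \<Rightarrow> ('b, 'n) star_alg_struct_scheme \<Rightarrow> ('a \<Rightarrow> 'b) \<Rightarrow> bool" where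
  "star_alg_iso A B \<Psi> \<longleftrightarrow> alg_iso A B \<Psi> \<and> (\<forall>x\<in>acarrier A. \<Psi> (astar A x) = astar B (\<Psi> x))"

section \<open>Direct systems and their algebraic limits\<close>

definition direct_system :: "(nat \<Rightarrow> nest) \<Rightarrow> (nat \<Rightarrow> complex mat \<Rightarrow> complex mat) \<Rightarrow> bool" where
  "direct_system N \<alpha> \<longleftrightarrow>
     (\<forall>k. nest_data (N k)) \<and> (\<forall>k. star_ext_embedding (N k) (N (Suc k)) (\<alpha> k))"

text \<open>The composition of the maps \<open>\<alpha> i, \<dots>, \<alpha> (j - 1)\<close>, that is, the system map from level
  \<open>i\<close> to level \<open>j \<ge> i\<close>.\<close>

definition sysmap :: "(nat \<Rightarrow> 'a \<Rightarrow> 'a) \<Rightarrow> nat \<Rightarrow> nat \<Rightarrow> 'a \<Rightarrow> 'a" where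
  "sysmap \<alpha> i j = fold \<alpha> [i..<j]"

definition germ_rel :: "(nat \<Rightarrow> nest) \<Rightarrow> (nat \<Rightarrow> complex mat \<Rightarrow> complex mat) \<Rightarrow> (nat \<times> complex mat) rel" where
  "germ_rel N \<alpha> = {((k, a), (l, b)). a \<in> nest_alg (N k) \<and> b \<in> nest_alg (N l) \<and>
     (\<exists>j. k \<le> j \<and> l \<le> j \<and> sysmap \<alpha> k j a = sysmap \<alpha> l j b)}"

definition germ :: "(nat \<Rightarrow> nest) \<Rightarrow> (nat \<Rightarrow> complex mat \<Rightarrow> complex mat) \<Rightarrow> nat \<Rightarrow> complex mat \<Rightarrow> (nat \<times> complex mat) set" where
  "germ N \<alpha> k a = germ_rel N \<alpha> `` {(k, a)}"

text \<open>The operations are computed on representatives at a common level. Each union below is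
  over a family of copies of one and the same equivalence class.\<close>

definition limit_alg :: "(nat \<Rightarrow> nest) \<Rightarrow> (nat \<Rightarrow> complex mat \<Rightarrow> complex mat) \<Rightarrow> (nat \<times> complex mat) set alg_struct" where
  "limit_alg N \<alpha> = \<lparr>
     acarrier = (SIGMA k:UNIV. nest_alg (N k)) // germ_rel N \<alpha>,
     aadd = (\<lambda>X Y. \<Union>{germ N \<alpha> k (a + b) | k a b. (k, a) \<in> X \<and> (k, b) \<in> Y}),
     amult = (\<lambda>X Y. \<Union>{germ N \<alpha> k (a * b) | k a b. (k, a) \<in> X \<and> (k, b) \<in> Y}),
     ascale = (\<lambda>c X. \<Union>{germ N \<alpha> k (c \<cdot>\<^sub>m a) | k a. (k, a) \<in> X}) \<rparr>"

section \<open>The C*-direct limit of the generated C*-algebras\<close>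

definition ext_maps :: "(nat \<Rightarrow> nest) \<Rightarrow> (nat \<Rightarrow> complex mat \<Rightarrow> complex mat) \<Rightarrow> nat \<Rightarrow> complex mat \<Rightarrow> complex mat" where
  "ext_maps N \<alpha> k = star_extension (N k) (N (Suc k)) (\<alpha> k)"

text \<open>The C*-direct limit is realised in the usual way inside the quotient of the C*-product of
  the algebras \<open>full_alg (N k)\<close> by the ideal of null sequences, as the closure of the union of the
  canonical images of these algebras. The image of \<open>a \<in> full_alg (N k)\<close> is the class of
  the sequence \<open>thread N \<alpha> k a\<close>. The set \<open>lim_seqs\<close> is the preimage of this closure in the product; its
  members are automatically bounded, as star homomorphisms are contractive.\<close>

definition thread :: "(nat \<Rightarrow> nest) \<Rightarrow> (nat \<Rightarrow> complex mat \<Rightarrow> complex mat) \<Rightarrow> nat \<Rightarrow> complex mat \<Rightarrow> nat \<Rightarrow> complex mat" where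
  "thread N \<alpha> k a = (\<lambda>j. if k \<le> j then sysmap (ext_maps N \<alpha>) k j a else 0\<^sub>m (ndim (N j)) (ndim (N j)))"

definition lim_seqs :: "(nat \<Rightarrow> nest) \<Rightarrow> (nat \<Rightarrow> complex mat \<Rightarrow> complex mat) \<Rightarrow> (nat \<Rightarrow> complex mat) set" where
  "lim_seqs N \<alpha> = {x. (\<forall>j. x j \<in> full_alg (N j)) \<and>
     (\<forall>\<epsilon>>0. \<exists>k. \<exists>a\<in>full_alg (N k). \<exists>j0. \<forall>j\<ge>j0. opnorm (x j - thread N \<alpha> k a j) < \<epsilon>)}"

definition null_rel :: "(nat \<Rightarrow> nest) \<Rightarrow> (nat \<Rightarrow> complex mat \<Rightarrow> complex mat) \<Rightarrow> (nat \<Rightarrow> complex mat) rel" where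
  "null_rel N \<alpha> = {(x, y). x \<in> lim_seqs N \<alpha> \<and> y \<in> lim_seqs N \<alpha> \<and>
     (\<lambda>j. opnorm (x j - y j)) \<longlonglongrightarrow> 0}"

definition cstar_limit :: "(nat \<Rightarrow> nest) \<Rightarrow> (nat \<Rightarrow> complex mat \<Rightarrow> complex mat) \<Rightarrow> (nat \<Rightarrow> complex mat) set star_alg_struct" where
  "cstar_limit N \<alpha> = \<lparr>
     acarrier = lim_seqs N \<alpha> // null_rel N \<alpha>,
     aadd = (\<lambda>X Y. \<Union>{null_rel N \<alpha> `` {\<lambda>j. x j + y j} | x y. x \<in> X \<and> y \<in> Y}),
     amult = (\<lambda>X Y. \<Union>{null_rel N \<alpha> `` {\<lambda>j. x j * y j} | x y. x \<in> X \<and> y \<in> Y}),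
     ascale = (\<lambda>c X. \<Union>{null_rel N \<alpha> `` {\<lambda>j. c \<cdot>\<^sub>m x j} | x. x \<in> X}),
     astar = (\<lambda>X. \<Union>{null_rel N \<alpha> `` {\<lambda>j. mat_adjoint (x j)} | x. x \<in> X}) \<rparr>"

text \<open>The canonical inclusion of the algebraic limit into the C*-limit that it generates.\<close>

definition limit_incl :: "(nat \<Rightarrow> nest) \<Rightarrow> (nat \<Rightarrow> complex mat \<Rightarrow> complex mat) \<Rightarrow> (nat \<times> complex mat) set \<Rightarrow> (nat \<Rightarrow> complex mat) set" where
  "limit_incl N \<alpha> X = \<Union>{null_rel N \<alpha> `` {thread N \<alpha> k a} | k a. (k, a) \<in> X}"

definition star_ext_iso ::
  "(nat \<Rightarrow> nest) \<Rightarrow> (nat \<Rightarrow> complex mat \<Rightarrow> complex mat) \<Rightarrow>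
   (nat \<Rightarrow> nest) \<Rightarrow> (nat \<Rightarrow> complex mat \<Rightarrow> complex mat) \<Rightarrow>
   ((nat \<times> complex mat) set \<Rightarrow> (nat \<times> complex mat) set) \<Rightarrow> bool" where
  "star_ext_iso N \<alpha> N' \<alpha>' \<Phi> \<longleftrightarrow> alg_iso (limit_alg N \<alpha>) (limit_alg N' \<alpha>') \<Phi> \<and>
     (\<exists>\<Psi>. star_alg_iso (cstar_limit N \<alpha>) (cstar_limit N' \<alpha>') \<Psi> \<and>
        (\<forall>X\<in>acarrier (limit_alg N \<alpha>). \<Psi> (limit_incl N \<alpha> X) = limit_incl N' \<alpha>' (\<Phi> X)))"

section \<open>Regular isomorphisms of systems\<close>

definition regular_system_iso ::
  "(nat \<Rightarrow> nest) \<Rightarrow> (nat \<Rightarrow> complex mat \<Rightarrow> complex mat) \<Rightarrow>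
   (nat \<Rightarrow> nest) \<Rightarrow> (nat \<Rightarrow> complex mat \<Rightarrow> complex mat) \<Rightarrow>
   (nat \<Rightarrow> nat) \<Rightarrow> (nat \<Rightarrow> nat) \<Rightarrow>
   (nat \<Rightarrow> complex mat \<Rightarrow> complex mat) \<Rightarrow> (nat \<Rightarrow> complex mat \<Rightarrow> complex mat) \<Rightarrow> bool" where
  "regular_system_iso N \<alpha> N' \<alpha>' n m \<phi> \<psi> \<longleftrightarrow>
     strict_mono n \<and> strict_mono m \<and>
     (\<forall>k. regular_embedding (N (n k)) (N' (m k)) (\<phi> k)) \<and>
     (\<forall>k. regular_embedding (N' (m k)) (N (n (Suc k))) (\<psi> k)) \<and>
     (\<forall>k. \<forall>a\<in>nest_alg (N (n k)). \<psi> k (\<phi> k a) = sysmap \<alpha> (n k) (n (Suc k)) a) \<and>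
     (\<forall>k. \<forall>b\<in>nest_alg (N' (m k)). \<phi> (Suc k) (\<psi> k b) = sysmap \<alpha>' (m k) (m (Suc k)) b)"

text \<open>The isomorphism induced by a commuting diagram sends the class of \<open>a\<close> at level \<open>n k\<close> to
  the class of \<open>\<phi> k a\<close> at level \<open>m k\<close>. As \<open>n\<close> is cofinal, this determines it on the whole limit.\<close>

definition induces ::
  "(nat \<Rightarrow> nest) \<Rightarrow> (nat \<Rightarrow> complex mat \<Rightarrow> complex mat) \<Rightarrow>
   (nat \<Rightarrow> nest) \<Rightarrow> (nat \<Rightarrow> complex mat \<Rightarrow> complex mat) \<Rightarrow>
   (nat \<Rightarrow> nat) \<Rightarrow> (nat \<Rightarrow> nat) \<Rightarrow> (nat \<Rightarrow> complex mat \<Rightarrow> complex mat) \<Rightarrow>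
   ((nat \<times> complex mat) set \<Rightarrow> (nat \<times> complex mat) set) \<Rightarrow> bool" where
  "induces N \<alpha> N' \<alpha>' n m \<phi> \<Phi> \<longleftrightarrow>
     (\<forall>k. \<forall>a\<in>nest_alg (N (n k)). \<Phi> (germ N \<alpha> (n k) a) = germ N' \<alpha>' (m k) (\<phi> k a))"

end

theory Submission
  imports Defs "HOL-Analysis.L2_Norm"
begin

text \<open>An isomorphism of the limits extends to the C*-limits, and since the algebras are finite
  dimensional it restricts to star extendible crossover maps from each \<open>A\<^sub>k\<close> into all late \<open>A'\<^sub>m\<close>. A single such map
  need be neither regular nor order preserving (conserving). It is, however, a composition of three
  crossover maps in which any two consecutive ones compose to a system map, and this forces the
  composition of all three to respect the order: in the multiplicity space of a star extendible
  map the nest of the target induces a chain of projections for each atom of the source, and order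
  relations between these chains are transported along the three maps. A map that respects the order is
  regular, because the projections of all these chains commute and a basis of the multiplicity space
  diagonalising them splits the map into multiplicity one embeddings.\<close>

section \<open>Finitely supported matrices\<close>

text \<open>Up to a unitary and a zero summand a star homomorphism is an amplification, so all it
  does to the nests happens in its multiplicity space. Images of block diagonal elements are block
  diagonal, hence a nest projection of the target is described by one projection of that space for
  each atom of the source; these form the chains, and the chain of a later atom lies below that of
  an earlier one. Three maps enter because the order hypothesis speaks only about pairs. If the
  first map breaks order preservation, the second has to repair the damage, and can do so only by
  giving two atoms the same chain; the third cannot separate them again, and order preservation of
  the last two together then makes their composition diagonal. In the conserving case nothing need
  collapse: a failure at one pair of positions in the last nest is traced back to blocks in the
  algebra after the first map and refuted by a partial isometry of rank at most two there. To make
  this possible both classes are restated through nest projections instead of single blocks.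
  Matrices of all sizes share one ring, so that algebraic simplification meets no dimension
  conditions.\<close>

typedef fmat = "{f :: nat \<Rightarrow> nat \<Rightarrow> complex. \<exists>n. \<forall>i j. f i j \<noteq> 0 \<longrightarrow> i < n \<and> j < n}"
  morphisms ent Abs_fmat
  by (rule exI[of _ "\<lambda>i j. 0"]) auto

setup_lifting type_definition_fmat

lemma fmat_eqI: "(\<And>i j. ent x i j = ent y i j) \<Longrightarrow> x = y"
  by (metis ent_inject ext)

lemma ent_bound: "\<exists>n. \<forall>i j. ent x i j \<noteq> 0 \<longrightarrow> i < n \<and> j < n"
  using ent[of x] by auto

lemma ent_bound2:
  obtains n where "\<And>i j. ent x i j \<noteq> 0 \<Longrightarrow> i < n \<and> j < n" "\<And>i j. ent y i j \<noteq> 0 \<Longrightarrow> i < n \<and> j < n"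
proof -
  obtain n where n: "\<forall>i j. ent x i j \<noteq> 0 \<longrightarrow> i < n \<and> j < n" using ent_bound by blast
  obtain m where m: "\<forall>i j. ent y i j \<noteq> 0 \<longrightarrow> i < m \<and> j < m" using ent_bound by blast
  show ?thesis by (rule that[of "max n m"]) (use n m less_max_iff_disj in blast)+
qed

instantiation fmat :: ab_group_add
begin

lift_definition zero_fmat :: fmat is "\<lambda>i j. 0" by auto

lift_definition plus_fmat :: "fmat \<Rightarrow> fmat \<Rightarrow> fmat" is "\<lambda>f g i j. f i j + g i j"
proof -
  fix f g :: "nat \<Rightarrow> nat \<Rightarrow> complex"
  assume "\<exists>n. \<forall>i j. f i j \<noteq> 0 \<longrightarrow> i < n \<and> j < n" "\<exists>n. \<forall>i j. g i j \<noteq> 0 \<longrightarrow> i < n \<and> j < n"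
  then obtain n m where "\<forall>i j. f i j \<noteq> 0 \<longrightarrow> i < n \<and> j < n" "\<forall>i j. g i j \<noteq> 0 \<longrightarrow> i < m \<and> j < m" by blast
  then show "\<exists>n. \<forall>i j. f i j + g i j \<noteq> 0 \<longrightarrow> i < n \<and> j < n"
    by (intro exI[of _ "max n m"]) (metis add_0 less_max_iff_disj)
qed

lift_definition uminus_fmat :: "fmat \<Rightarrow> fmat" is "\<lambda>f i j. - f i j" by auto

definition minus_fmat :: "fmat \<Rightarrow> fmat \<Rightarrow> fmat" where "minus_fmat x y = x + - y"

instance
  by standard (auto simp: minus_fmat_def intro!: fmat_eqI simp: plus_fmat.rep_eq zero_fmat.rep_eq uminus_fmat.rep_eq)

end

lemma ent_zero [simp]: "ent 0 i j = 0" by (simp add: zero_fmat.rep_eq)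
lemma ent_plus [simp]: "ent (x + y) i j = ent x i j + ent y i j" by (simp add: plus_fmat.rep_eq)
lemma ent_uminus [simp]: "ent (- x) i j = - ent x i j" by (simp add: uminus_fmat.rep_eq)
lemma ent_minus [simp]: "ent (x - y) i j = ent x i j - ent y i j"
  by (simp only: minus_fmat_def ent_plus ent_uminus) simp

lemma ent_sum: "ent (\<Sum>k\<in>S. f k) i j = (\<Sum>k\<in>S. ent (f k) i j)"
  by (induction S rule: infinite_finite_induct) auto

instantiation fmat :: times
begin

text \<open>Summing over the support of row \<open>i\<close> of the left factor keeps the sum finite
  without choosing a bound.\<close>

lift_definition times_fmat :: "fmat \<Rightarrow> fmat \<Rightarrow> fmat" is "\<lambda>f g i j. \<Sum>k | f i k \<noteq> 0. f i k * g k j"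
proof -
  fix f g :: "nat \<Rightarrow> nat \<Rightarrow> complex"
  assume "\<exists>n. \<forall>i j. f i j \<noteq> 0 \<longrightarrow> i < n \<and> j < n" "\<exists>n. \<forall>i j. g i j \<noteq> 0 \<longrightarrow> i < n \<and> j < n"
  then obtain n m where n: "\<forall>i j. f i j \<noteq> 0 \<longrightarrow> i < n \<and> j < n" and m: "\<forall>i j. g i j \<noteq> 0 \<longrightarrow> i < m \<and> j < m" by blast
  show "\<exists>n. \<forall>i j. (\<Sum>k | f i k \<noteq> 0. f i k * g k j) \<noteq> 0 \<longrightarrow> i < n \<and> j < n"
  proof (intro exI[of _ "max n m"] allI impI)
    fix i j assume "(\<Sum>k | f i k \<noteq> 0. f i k * g k j) \<noteq> 0"
    then obtain k where "f i k * g k j \<noteq> 0" by (meson sum.not_neutral_contains_not_neutral)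
    then have "i < n" "j < m" using n m by auto
    then show "i < max n m \<and> j < max n m" by auto
  qed
qed

instance ..
end

text \<open>Only an index at which both factors are nonzero has to lie below \<open>n\<close>, so a
  bound for either factor suffices. This is the way back from the support sum to an ordinary finite
  range.\<close>

lemma ent_times:
  assumes "\<And>k. ent x i k \<noteq> 0 \<Longrightarrow> ent y k j \<noteq> 0 \<Longrightarrow> k < n"
  shows "ent (x * y) i j = (\<Sum>k<n. ent x i k * ent y k j)"
proof -
  obtain m where m: "\<forall>i j. ent x i j \<noteq> 0 \<longrightarrow> i < m \<and> j < m" using ent_bound by blast
  have fin: "finite {k. ent x i k \<noteq> 0}" by (rule finite_subset[of _ "{..<m}"]) (use m in auto)
  have "(\<Sum>k | ent x i k \<noteq> 0. ent x i k * ent y k j) = (\<Sum>k | ent x i k \<noteq> 0 \<and> k < n. ent x i k * ent y k j)"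
    using fin assms by (intro sum.mono_neutral_right) auto
  also have "\<dots> = (\<Sum>k<n. ent x i k * ent y k j)"
    by (intro sum.mono_neutral_left) auto
  finally show ?thesis by (simp add: times_fmat.rep_eq)
qed

instance fmat :: ring
proof
  fix a b c :: fmat
  obtain n where n: "\<And>i j. ent a i j \<noteq> 0 \<Longrightarrow> i < n \<and> j < n" "\<And>i j. ent b i j \<noteq> 0 \<Longrightarrow> i < n \<and> j < n"
    using ent_bound2 by blast
  show "a * b * c = a * (b * c)"
  proof (rule fmat_eqI)
    fix i j
    have 1: "ent (a * b) i k = (\<Sum>l<n. ent a i l * ent b l k)" for k
      by (rule ent_times) (use n in auto)
    have 2: "ent (b * c) l j = (\<Sum>k<n. ent b l k * ent c k j)" for l
      by (rule ent_times) (use n in auto)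
    have 3: "k < n" if "ent (a * b) i k \<noteq> 0" for k
    proof -
      have "(\<Sum>l<n. ent a i l * ent b l k) \<noteq> 0" using that 1 by simp
      then obtain l where "ent a i l * ent b l k \<noteq> 0" by (meson sum.not_neutral_contains_not_neutral)
      then show ?thesis using n by auto
    qed
    have "ent (a * b * c) i j = (\<Sum>k<n. ent (a * b) i k * ent c k j)"
      by (rule ent_times) (use 3 in auto)
    also have "\<dots> = (\<Sum>l<n. ent a i l * ent (b * c) l j)"
      unfolding 1 2 sum_distrib_left sum_distrib_right by (subst sum.swap) (simp add: mult.assoc)
    also have "\<dots> = ent (a * (b * c)) i j" by (rule ent_times[symmetric]) (use n in auto)
    finally show "ent (a * b * c) i j = ent (a * (b * c)) i j" .
  qed
next
  fix a b c :: fmat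
  show "(a + b) * c = a * c + b * c"
  proof (rule fmat_eqI)
    fix i j
    obtain n where n: "\<And>i j. ent c i j \<noteq> 0 \<Longrightarrow> i < n \<and> j < n"
      using ent_bound2 by metis
    have e: "ent (x * c) i j = (\<Sum>k<n. ent x i k * ent c k j)" for x by (rule ent_times) (use n in auto)
    show "ent ((a + b) * c) i j = ent (a * c + b * c) i j"
      by (simp add: e distrib_right sum.distrib)
  qed
  show "a * (b + c) = a * b + a * c"
  proof (rule fmat_eqI)
    fix i j
    obtain n where n: "\<And>i j. ent a i j \<noteq> 0 \<Longrightarrow> i < n \<and> j < n"
      using ent_bound2 by metis
    have e: "ent (a * x) i j = (\<Sum>k<n. ent a i k * ent x k j)" for x by (rule ent_times) (use n in auto)
    show "ent (a * (b + c)) i j = ent (a * b + a * c) i j"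
      by (simp add: e distrib_left sum.distrib)
  qed
qed

lift_definition adj :: "fmat \<Rightarrow> fmat" is "\<lambda>f i j. cnj (f j i)" by auto
lift_definition scl :: "complex \<Rightarrow> fmat \<Rightarrow> fmat" is "\<lambda>c f i j. c * f i j" by auto
lift_definition munit :: "nat \<Rightarrow> nat \<Rightarrow> fmat" is "\<lambda>a b i j. if i = a \<and> j = b then 1 else 0"
proof -
  fix a b :: nat
  show "\<exists>n. \<forall>i j. (if i = a \<and> j = b then 1 else 0 :: complex) \<noteq> 0 \<longrightarrow> i < n \<and> j < n"
    by (rule exI[of _ "Suc (a + b)"]) auto
qed
lift_definition idm :: "nat \<Rightarrow> fmat" is "\<lambda>n i j. if i = j \<and> i < n then 1 else 0" by auto

lemma ent_adj [simp]: "ent (adj x) i j = cnj (ent x j i)" by (simp add: adj.rep_eq)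
lemma ent_scl [simp]: "ent (scl c x) i j = c * ent x i j" by (simp add: scl.rep_eq)
lemma ent_munit [simp]: "ent (munit a b) i j = (if i = a \<and> j = b then 1 else 0)" by (simp add: munit.rep_eq)
lemma ent_idm [simp]: "ent (idm n) i j = (if i = j \<and> i < n then 1 else 0)" by (simp add: idm.rep_eq)

lemma adj_adj [simp]: "adj (adj x) = x" by (rule fmat_eqI) simp
lemma adj_zero [simp]: "adj 0 = 0" by (rule fmat_eqI) simp
lemma adj_add [simp]: "adj (x + y) = adj x + adj y" by (rule fmat_eqI) simp
lemma adj_minus [simp]: "adj (x - y) = adj x - adj y" by (rule fmat_eqI) simp
lemma adj_sum: "adj (\<Sum>k\<in>S. f k) = (\<Sum>k\<in>S. adj (f k))" by (rule fmat_eqI) (simp add: ent_sum)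
lemma adj_scl [simp]: "adj (scl c x) = scl (cnj c) (adj x)" by (rule fmat_eqI) simp
lemma adj_munit [simp]: "adj (munit i j) = munit j i" by (rule fmat_eqI) auto
lemma adj_idm [simp]: "adj (idm n) = idm n" by (rule fmat_eqI) auto
lemma adj_eq_0 [simp]: "adj x = 0 \<longleftrightarrow> x = 0" by (metis adj_adj adj_zero)

lemma adj_mult [simp]: "adj (x * y) = adj y * adj x"
proof (rule fmat_eqI)
  fix i j
  obtain n where n: "\<And>i j. ent x i j \<noteq> 0 \<Longrightarrow> i < n \<and> j < n" using ent_bound2 by metis
  have "ent (x * y) j i = (\<Sum>k<n. ent x j k * ent y k i)" by (rule ent_times) (use n in auto)
  moreover have "ent (adj y * adj x) i j = (\<Sum>k<n. ent (adj y) i k * ent (adj x) k j)"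
    by (rule ent_times) (use n in auto)
  ultimately show "ent (adj (x * y)) i j = ent (adj y * adj x) i j" by (simp add: mult.commute)
qed

lemma scl_zero [simp]: "scl 0 x = 0" "scl c 0 = 0" by (rule fmat_eqI, simp)+
lemma scl_one [simp]: "scl 1 x = x" by (rule fmat_eqI) simp
lemma scl_scl [simp]: "scl a (scl b x) = scl (a * b) x" by (rule fmat_eqI) simp
lemma scl_eq_0 [simp]: "scl c x = 0 \<longleftrightarrow> c = 0 \<or> x = 0"
proof
  assume *: "scl c x = 0"
  have "scl (inverse c) (scl c x) = x" if "c \<noteq> 0" using that by simp
  then show "c = 0 \<or> x = 0" using * by auto
qed auto

lemma scl_mult_left [simp]: "scl c x * y = scl c (x * y)"
proof (rule fmat_eqI)
  fix i j
  obtain n where n: "\<And>i j. ent x i j \<noteq> 0 \<Longrightarrow> i < n \<and> j < n" using ent_bound2 by metis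
  have "ent (x * y) i j = (\<Sum>k<n. ent x i k * ent y k j)"
    "ent (scl c x * y) i j = (\<Sum>k<n. ent (scl c x) i k * ent y k j)"
    by (rule ent_times; use n in auto)+
  then show "ent (scl c x * y) i j = ent (scl c (x * y)) i j" by (simp add: sum_distrib_left mult.assoc)
qed

lemma scl_mult_right [simp]: "x * scl c y = scl c (x * y)"
proof -
  have "adj (x * scl c y) = adj (scl c (x * y))" by simp
  then show ?thesis using adj_adj by metis
qed

lemma ent_munit_mult: "ent (munit a b * x) i j = (if i = a then ent x b j else 0)"
proof -
  have "ent (munit a b * x) i j = (\<Sum>k<Suc b. ent (munit a b) i k * ent x k j)"
    by (rule ent_times) (auto split: if_splits)
  then show ?thesis by (simp add: if_distrib[of "\<lambda>c. c * _"] cong: if_cong)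
qed

lemma ent_mult_munit: "ent (x * munit a b) i j = (if j = b then ent x i a else 0)"
proof -
  have "ent (x * munit a b) i j = (\<Sum>k<Suc a. ent x i k * ent (munit a b) k j)"
    by (rule ent_times) (auto split: if_splits)
  then show ?thesis by (simp add: if_distrib[of "\<lambda>c. _ * c"] cong: if_cong)
qed

lemma munit_mult: "munit a b * munit c d = (if b = c then munit a d else 0)"
  by (rule fmat_eqI) (simp add: ent_munit_mult)

lemma munit_mult_same [simp]: "munit a b * munit b d = munit a d" by (simp add: munit_mult)

lemma munit_nonzero [simp]: "munit a b \<noteq> 0"
proof
  assume "munit a b = 0"
  then have "ent (munit a b) a b = ent 0 a b" by simp
  then show False by simp
qed

lemma munit_mult_munit: "munit a i * x * munit j b = scl (ent x i j) (munit a b)"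
  by (rule fmat_eqI) (simp add: ent_mult_munit ent_munit_mult)

lemma nonzero_ent: "x \<noteq> 0 \<Longrightarrow> \<exists>i j. ent x i j \<noteq> 0"
  by (metis fmat_eqI ent_zero)

lemma ent_adj_mult_diag:
  assumes "\<And>k. ent x k j \<noteq> 0 \<Longrightarrow> k < n"
  shows "ent (adj x * x) j j = of_real (\<Sum>k<n. (cmod (ent x k j))\<^sup>2)"
proof -
  have "ent (adj x * x) j j = (\<Sum>k<n. ent (adj x) j k * ent x k j)"
    by (rule ent_times) (use assms in auto)
  also have "\<dots> = (\<Sum>k<n. of_real ((cmod (ent x k j))\<^sup>2))"
    by (intro sum.cong refl) (simp add: complex_norm_square mult.commute del: of_real_power)
  finally show ?thesis by simp
qed

text \<open>Positivity: the diagonal entries of \<open>adj x * x\<close> are sums of squares. It is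
  the device for proving an equation \<open>x = y\<close> between products: expand
  \<open>adj (x - y) * (x - y)\<close> and see it vanish.\<close>

lemma adj_mult_eq_0 [simp]: "adj x * x = 0 \<longleftrightarrow> x = 0"
proof
  assume *: "adj x * x = 0"
  show "x = 0"
  proof (rule ccontr)
    assume "x \<noteq> 0"
    then obtain i j where ij: "ent x i j \<noteq> 0" using nonzero_ent by blast
    obtain n where n: "\<And>i j. ent x i j \<noteq> 0 \<Longrightarrow> i < n \<and> j < n" using ent_bound2 by metis
    have "(\<Sum>k<n. (cmod (ent x k j))\<^sup>2) = 0"
      using ent_adj_mult_diag[of x j n] n * by (metis ent_zero of_real_eq_0_iff)
    then have "(cmod (ent x i j))\<^sup>2 = 0"
      using n[OF ij] by (subst (asm) sum_nonneg_eq_0_iff) auto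
    then show False using ij by simp
  qed
qed simp

lemma mult_adj_eq_0 [simp]: "x * adj x = 0 \<longleftrightarrow> x = 0"
  by (metis adj_adj adj_mult_eq_0 adj_eq_0)

lemma double_eq_0: "x + x = (0::fmat) \<Longrightarrow> x = 0"
proof (rule fmat_eqI)
  fix i j assume "x + x = 0"
  then have "ent (x + x) i j = 0" by simp
  then show "ent x i j = ent 0 i j" by simp
qed

text \<open>The square matrices of size \<open>n\<close>, as the upper left corner of the common
  ring. Their unit is \<open>idm n\<close>, and membership here replaces carrier conditions.\<close>

definition corner :: "nat \<Rightarrow> fmat set" where
  "corner n = {x. \<forall>i j. ent x i j \<noteq> 0 \<longrightarrow> i < n \<and> j < n}"

lemma corner_iff: "x \<in> corner n \<longleftrightarrow> idm n * x = x \<and> x * idm n = x"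
proof -
  have 1: "ent (idm n * x) i j = (if i < n then ent x i j else 0)" for i j
  proof -
    have "ent (idm n * x) i j = (\<Sum>k<n. ent (idm n) i k * ent x k j)" by (rule ent_times) (auto split: if_splits)
    also have "\<dots> = (\<Sum>k<n. if k = i then (if i < n then ent x i j else 0) else 0)"
      by (intro sum.cong refl) auto
    finally show ?thesis by simp
  qed
  have 2: "ent (x * idm n) i j = (if j < n then ent x i j else 0)" for i j
  proof -
    have "ent (x * idm n) i j = (\<Sum>k<n. ent x i k * ent (idm n) k j)" by (rule ent_times) (auto split: if_splits)
    also have "\<dots> = (\<Sum>k<n. if k = j then (if j < n then ent x i j else 0) else 0)"
      by (intro sum.cong refl) auto
    finally show ?thesis by simp
  qed
  show ?thesis
  proof
    assume "x \<in> corner n"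
    then show "idm n * x = x \<and> x * idm n = x"
      by (intro conjI fmat_eqI) (auto simp: 1 2 corner_def)
  next
    assume *: "idm n * x = x \<and> x * idm n = x"
    have "i < n \<and> j < n" if "ent x i j \<noteq> 0" for i j
      using that 1[of i j] 2[of i j] * by (auto split: if_splits)
    then show "x \<in> corner n" by (simp add: corner_def)
  qed
qed

lemma corner_zero [simp]: "0 \<in> corner n" by (simp add: corner_def)
lemma corner_idm [simp]: "idm n \<in> corner n" by (simp add: corner_def)
lemma corner_add [simp]: "x \<in> corner n \<Longrightarrow> y \<in> corner n \<Longrightarrow> x + y \<in> corner n"
  by (simp add: corner_iff algebra_simps)
lemma corner_minus [simp]: "x \<in> corner n \<Longrightarrow> y \<in> corner n \<Longrightarrow> x - y \<in> corner n"
  by (simp add: corner_iff algebra_simps)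
lemma corner_mult [simp]: "x \<in> corner n \<Longrightarrow> y \<in> corner n \<Longrightarrow> x * y \<in> corner n"
  using mult.assoc[of "idm n" x y, symmetric] mult.assoc[of x y "idm n"] by (simp add: corner_iff)
lemma corner_idm_mult [simp]: "x \<in> corner n \<Longrightarrow> idm n * x = x" "x \<in> corner n \<Longrightarrow> x * idm n = x"
  by (simp_all add: corner_iff)

lemma corner_adj [simp]: "adj x \<in> corner n \<longleftrightarrow> x \<in> corner n"
  by (auto simp: corner_def)
lemma corner_scl [simp]: "x \<in> corner n \<Longrightarrow> scl c x \<in> corner n"
  by (auto simp: corner_def)
lemma corner_munit [simp]: "i < n \<Longrightarrow> j < n \<Longrightarrow> munit i j \<in> corner n"
  by (simp add: corner_def)
lemma corner_sum [simp]: "(\<And>k. k \<in> S \<Longrightarrow> f k \<in> corner n) \<Longrightarrow> (\<Sum>k\<in>S. f k) \<in> corner n"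
  by (induction S rule: infinite_finite_induct) auto

lemma idm_eq_sum: "idm n = (\<Sum>k<n. munit k k)"
  by (rule fmat_eqI) (auto simp: ent_sum)

lemma corner_expand:
  assumes "x \<in> corner n"
  shows "x = (\<Sum>i<n. \<Sum>j<n. scl (ent x i j) (munit i j))"
proof (rule fmat_eqI)
  fix a b
  have in_row: "(\<Sum>j<n. ent x i j * (if a = i \<and> b = j then 1 else 0)) = (if i = a then ent x a b else 0)" for i
  proof (cases "b < n")
    case True
    have "(\<Sum>j<n. ent x i j * (if a = i \<and> b = j then 1 else 0)) = (\<Sum>j<n. if j = b then (if i = a then ent x a b else 0) else 0)"
      by (rule sum.cong[OF refl]) simp
    then show ?thesis using True by (simp add: sum.delta)
  next
    case False
    then have "ent x a b = 0" using assms by (auto simp: corner_def)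
    moreover have "(\<Sum>j<n. ent x i j * (if a = i \<and> b = j then 1 else 0)) = 0"
      using False by (intro sum.neutral) auto
    ultimately show ?thesis by simp
  qed
  have "ent (\<Sum>i<n. \<Sum>j<n. scl (ent x i j) (munit i j)) a b = (\<Sum>i<n. if i = a then ent x a b else 0)"
    by (simp add: ent_sum in_row)
  also have "\<dots> = ent x a b"
  proof (cases "a < n")
    case False
    then have "ent x a b = 0" using assms by (auto simp: corner_def)
    then show ?thesis by simp
  qed (simp add: sum.delta)
  finally show "ent x a b = ent (\<Sum>i<n. \<Sum>j<n. scl (ent x i j) (munit i j)) a b" by simp
qed

text \<open>Simplicity of the full matrix algebra as an induction rule: the nonzero \<open>w\<close>
  generates everything as a two-sided ideal. Scalars are absorbed into \<open>s\<close>, so additive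
  closure and the sandwiched elements are all that \<open>K\<close> has to provide.\<close>

lemma corner_ideal_induct:
  assumes "w \<in> corner n" "w \<noteq> 0" "y \<in> corner n"
    and zero: "K 0" and add: "\<And>x y. K x \<Longrightarrow> K y \<Longrightarrow> K (x + y)"
    and sand: "\<And>s t. s \<in> corner n \<Longrightarrow> t \<in> corner n \<Longrightarrow> K (s * w * t)"
  shows "K y"
proof -
  obtain i j where ij: "ent w i j \<noteq> 0" using assms(2) nonzero_ent by blast
  then have lt: "i < n" "j < n" using assms(1) by (auto simp: corner_def)
  \<comment> \<open>A nonzero entry of \<open>w\<close> is isolated by matrix units on both sides,
    which gives every multiple of every matrix unit.\<close>
  have u: "K (scl c (munit a b))" if "a < n" "b < n" for a b c
  proof -
    have "K (scl (c / ent w i j) (munit a i) * w * munit j b)"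
      using that lt by (intro sand) auto
    then show ?thesis using ij by (simp add: munit_mult_munit)
  qed
  have s: "K (\<Sum>k\<in>S. f k)" if "finite S" "\<And>k. k \<in> S \<Longrightarrow> K (f k)" for S :: "nat set" and f
    using that by (induction S rule: finite_induct) (auto intro: zero add)
  show ?thesis
    by (subst corner_expand[OF assms(3)], rule s[OF finite_lessThan], rule s[OF finite_lessThan], rule u) auto
qed

section \<open>Transfer of matrices\<close>

lift_definition fm_of :: "complex mat \<Rightarrow> fmat" is
  "\<lambda>a i j. if i < dim_row a \<and> j < dim_col a then a $$ (i, j) else 0"
proof -
  fix a :: "complex mat"
  show "\<exists>n. \<forall>i j. (if i < dim_row a \<and> j < dim_col a then a $$ (i, j) else 0) \<noteq> 0 \<longrightarrow> i < n \<and> j < n"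
    by (rule exI[of _ "max (dim_row a) (dim_col a)"]) (auto simp: less_max_iff_disj)
qed

definition mat_of :: "nat \<Rightarrow> fmat \<Rightarrow> complex mat" where
  "mat_of n x = mat n n (\<lambda>(i, j). ent x i j)"

lemma ent_fm_of: "ent (fm_of a) i j = (if i < dim_row a \<and> j < dim_col a then a $$ (i, j) else 0)"
  by (simp add: fm_of.rep_eq)

lemma fm_of_corner [simp]: "a \<in> carrier_mat n n \<Longrightarrow> fm_of a \<in> corner n"
  by (auto simp: corner_def ent_fm_of)

lemma mat_of_carrier [simp]: "mat_of n x \<in> carrier_mat n n" by (simp add: mat_of_def)

lemma mat_of_fm_of [simp]: "a \<in> carrier_mat n n \<Longrightarrow> mat_of n (fm_of a) = a"
  by (rule eq_matI) (auto simp: mat_of_def ent_fm_of)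

lemma fm_of_mat_of [simp]: "x \<in> corner n \<Longrightarrow> fm_of (mat_of n x) = x"
  by (rule fmat_eqI) (auto simp: mat_of_def ent_fm_of corner_def)

text \<open>\<open>fm_of\<close> forgets the size of a matrix, so its injectivity is stated on a
  common carrier.\<close>

lemma fm_of_inj: "a \<in> carrier_mat n n \<Longrightarrow> b \<in> carrier_mat n n \<Longrightarrow> fm_of a = fm_of b \<longleftrightarrow> a = b"
  by (metis mat_of_fm_of)

lemma fm_of_add: "a \<in> carrier_mat n m \<Longrightarrow> b \<in> carrier_mat n m \<Longrightarrow> fm_of (a + b) = fm_of a + fm_of b"
  by (rule fmat_eqI) (auto simp: ent_fm_of)

lemma fm_of_minus: "a \<in> carrier_mat n m \<Longrightarrow> b \<in> carrier_mat n m \<Longrightarrow> fm_of (a - b) = fm_of a - fm_of b"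
  by (rule fmat_eqI) (auto simp: ent_fm_of)

lemma fm_of_mult:
  assumes "a \<in> carrier_mat n m" "b \<in> carrier_mat m p"
  shows "fm_of (a * b) = fm_of a * fm_of b"
proof (rule fmat_eqI)
  fix i j
  have "ent (fm_of a * fm_of b) i j = (\<Sum>k<m. ent (fm_of a) i k * ent (fm_of b) k j)"
    by (rule ent_times) (use assms in \<open>auto simp: ent_fm_of split: if_splits\<close>)
  also have "\<dots> = ent (fm_of (a * b)) i j"
    using assms by (auto simp: ent_fm_of scalar_prod_def lessThan_atLeast0)
  finally show "ent (fm_of (a * b)) i j = ent (fm_of a * fm_of b) i j" by simp
qed

lemma fm_of_smult: "fm_of (c \<cdot>\<^sub>m a) = scl c (fm_of a)"
  by (rule fmat_eqI) (auto simp: ent_fm_of)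

lemma fm_of_zero [simp]: "fm_of (0\<^sub>m n m) = 0"
  by (rule fmat_eqI) (auto simp: ent_fm_of)

lemma fm_of_one [simp]: "fm_of (1\<^sub>m n) = idm n"
  by (rule fmat_eqI) (auto simp: ent_fm_of)

lemma dim_mat_adjoint [simp]: "dim_row (mat_adjoint a) = dim_col a" "dim_col (mat_adjoint a) = dim_row a"
  by (auto simp: mat_adjoint_def)

lemma mat_adjoint_carrier [simp]: "a \<in> carrier_mat n m \<Longrightarrow> mat_adjoint a \<in> carrier_mat m n"
  by auto

lemma fm_of_adjoint: "fm_of (mat_adjoint a) = adj (fm_of a)"
  by (rule fmat_eqI) (auto simp: ent_fm_of mat_adjoint_def mat_of_rows_def)

lemma fm_of_mat_sum:
  assumes "\<And>k. k \<in> S \<Longrightarrow> f k \<in> carrier_mat n n"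
  shows "fm_of (mat_sum n S f) = (\<Sum>k\<in>S. fm_of (f k))"
proof -
  have d: "dim_row (f k) = n" "dim_col (f k) = n" if "k \<in> S" for k using assms[OF that] by auto
  show ?thesis
    by (rule fmat_eqI) (auto simp: ent_sum ent_fm_of mat_sum_def d intro!: sum.neutral[symmetric] sum.cong)
qed

lemma mat_sum_carrier [simp]: "mat_sum n S f \<in> carrier_mat n n"
  by (simp add: mat_sum_def)

section \<open>Nests and partial isometries in corners\<close>

text \<open>The value 0 beyond the last atom lets the statements on blocks range over all natural
  numbers; blocks outside the matrix vanish.\<close>

definition natom :: "nest \<Rightarrow> nat \<Rightarrow> fmat" where
  "natom N i = (if i < natoms N then fm_of (atoms N ! i) else 0)"

definition nproj :: "nest \<Rightarrow> nat \<Rightarrow> fmat" where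
  "nproj N k = (\<Sum>i<k. natom N i)"

abbreviation ncorner :: "nest \<Rightarrow> fmat set" where
  "ncorner N \<equiv> corner (ndim N)"

definition tri :: "nest \<Rightarrow> fmat set" where
  "tri N = {x \<in> ncorner N. \<forall>k. nproj N k * x * nproj N k = x * nproj N k}"

text \<open>The commutant of the nest, that is, the block diagonal matrices; it is the intersection
  of \<open>tri N\<close> with its adjoint.\<close>

definition dia :: "nest \<Rightarrow> fmat set" where
  "dia N = {x \<in> ncorner N. \<forall>k. nproj N k * x = x * nproj N k}"

abbreviation blk :: "nest \<Rightarrow> fmat \<Rightarrow> nat \<Rightarrow> nat \<Rightarrow> fmat" where
  "blk N x i j \<equiv> natom N i * x * natom N j"

lemma natom_carrier: "nest_data N \<Longrightarrow> i < natoms N \<Longrightarrow> atoms N ! i \<in> carrier_mat (ndim N) (ndim N)"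
  by (simp add: nest_data_def projection_def)

lemma natom_corner [simp]: "nest_data N \<Longrightarrow> natom N i \<in> ncorner N"
  by (simp add: natom_def natom_carrier)

lemma natom_adj [simp]: "nest_data N \<Longrightarrow> adj (natom N i) = natom N i"
  by (auto simp: natom_def nest_data_def projection_def fm_of_adjoint[symmetric])

lemma natom_mult: "nest_data N \<Longrightarrow> natom N i * natom N j = (if i = j then natom N i else 0)"
proof (cases "i < natoms N \<and> j < natoms N")
  case True
  assume nd: "nest_data N"
  have "natom N i * natom N j = fm_of (atoms N ! i * atoms N ! j)"
    using True natom_carrier[OF nd, of i] natom_carrier[OF nd, of j]
    by (simp add: natom_def fm_of_mult[of _ "ndim N" "ndim N" _ "ndim N"])
  also have "atoms N ! i * atoms N ! j = (if i = j then atoms N ! i else 0\<^sub>m (ndim N) (ndim N))"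
    using nd True by (auto simp: nest_data_def projection_def)
  finally show ?thesis using True by (simp add: natom_def)
qed (auto simp: natom_def)

lemma natom_mult_assoc: "nest_data N \<Longrightarrow> natom N i * (natom N j * x) = (if i = j then natom N i * x else 0)"
  by (simp add: mult.assoc[symmetric] natom_mult)

lemma natom_nonzero: "nest_data N \<Longrightarrow> natom N i \<noteq> 0 \<longleftrightarrow> i < natoms N"
proof
  assume nd: "nest_data N" and i: "i < natoms N"
  then have "atoms N ! i \<noteq> 0\<^sub>m (ndim N) (ndim N)" by (simp add: nest_data_def)
  then show "natom N i \<noteq> 0"
    using i natom_carrier[OF nd i] fm_of_inj[of "atoms N ! i" "ndim N" "0\<^sub>m (ndim N) (ndim N)"]
    by (simp add: natom_def)
qed (auto simp: natom_def split: if_splits)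

lemma natom_idm [simp]: "nest_data N \<Longrightarrow> idm (ndim N) * natom N i = natom N i"
  "nest_data N \<Longrightarrow> natom N i * idm (ndim N) = natom N i"
  by simp_all

lemma sum_natom: "nest_data N \<Longrightarrow> (\<Sum>i<natoms N. natom N i) = idm (ndim N)"
proof -
  assume nd: "nest_data N"
  have "(\<Sum>i<natoms N. natom N i) = (\<Sum>i<natoms N. fm_of (atoms N ! i))"
    by (intro sum.cong) (auto simp: natom_def)
  also have "\<dots> = fm_of (mat_sum (ndim N) {..<natoms N} (\<lambda>i. atoms N ! i))"
    using natom_carrier[OF nd] by (subst fm_of_mat_sum) auto
  also have "\<dots> = idm (ndim N)" using nd by (simp add: nest_data_def)
  finally show ?thesis .
qed

lemma nproj_corner [simp]: "nest_data N \<Longrightarrow> nproj N k \<in> ncorner N"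
  by (simp add: nproj_def)

lemma nproj_adj [simp]: "nest_data N \<Longrightarrow> adj (nproj N k) = nproj N k"
  by (simp add: nproj_def adj_sum)

lemma nproj_0 [simp]: "nproj N 0 = 0" by (simp add: nproj_def)

lemma nproj_Suc: "nproj N (Suc k) = nproj N k + natom N k" by (simp add: nproj_def)

lemma nproj_natom: "nest_data N \<Longrightarrow> nproj N k * natom N i = (if i < k then natom N i else 0)"
  by (simp add: nproj_def sum_distrib_right natom_mult if_distrib cong: if_cong)

lemma natom_nproj: "nest_data N \<Longrightarrow> natom N i * nproj N k = (if i < k then natom N i else 0)"
  by (simp add: nproj_def sum_distrib_left natom_mult)

lemma natom_nproj_assoc: "nest_data N \<Longrightarrow> natom N i * (nproj N k * x) = (if i < k then natom N i * x else 0)"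
  by (simp add: mult.assoc[symmetric] natom_nproj)

lemma nproj_natom_assoc: "nest_data N \<Longrightarrow> nproj N k * (natom N i * x) = (if i < k then natom N i * x else 0)"
  by (simp add: mult.assoc[symmetric] nproj_natom)

lemma nproj_mult: "nest_data N \<Longrightarrow> nproj N m * nproj N n = nproj N (min m n)"
proof -
  assume nd: "nest_data N"
  have "nproj N m * nproj N n = (\<Sum>i<n. if i < m then natom N i else 0)"
    unfolding nproj_def[of N n] sum_distrib_left nproj_natom[OF nd] ..
  also have "\<dots> = (\<Sum>i<min m n. natom N i)"
    by (intro sum.mono_neutral_cong_right) auto
  finally show ?thesis by (simp add: nproj_def)
qed

lemma nproj_mult_assoc: "nest_data N \<Longrightarrow> nproj N m * (nproj N n * x) = nproj N (min m n) * x"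
  by (simp add: mult.assoc[symmetric] nproj_mult)

lemma nproj_ge: "nest_data N \<Longrightarrow> natoms N \<le> k \<Longrightarrow> nproj N k = idm (ndim N)"
proof -
  assume nd: "nest_data N" and k: "natoms N \<le> k"
  have "nproj N k = (\<Sum>i<natoms N. natom N i)"
    unfolding nproj_def using k by (intro sum.mono_neutral_right) (auto simp: natom_def)
  then show ?thesis using sum_natom[OF nd] by simp
qed

lemmas nsimps = natom_mult natom_mult_assoc nproj_natom natom_nproj natom_nproj_assoc nproj_natom_assoc
  nproj_mult nproj_mult_assoc

lemma fm_of_nest_proj: "nest_data N \<Longrightarrow> k \<le> natoms N \<Longrightarrow> fm_of (nest_proj N k) = nproj N k"
  unfolding nest_proj_def nproj_def
  by (subst fm_of_mat_sum) (auto simp: natom_carrier natom_def intro!: sum.cong)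

lemma nest_alg_iff:
  assumes nd: "nest_data N"
  shows "a \<in> nest_alg N \<longleftrightarrow> a \<in> full_alg N \<and> fm_of a \<in> tri N"
proof (cases "a \<in> full_alg N")
  case True
  let ?n = "ndim N"
  have pc: "nest_proj N k \<in> full_alg N" for k by (simp add: nest_proj_def)
  have "((1\<^sub>m ?n - nest_proj N k) * a * nest_proj N k = 0\<^sub>m ?n ?n) \<longleftrightarrow>
      nproj N k * fm_of a * nproj N k = fm_of a * nproj N k" if k: "k \<le> natoms N" for k
  proof -
    have "((1\<^sub>m ?n - nest_proj N k) * a * nest_proj N k = 0\<^sub>m ?n ?n) \<longleftrightarrow>
       fm_of ((1\<^sub>m ?n - nest_proj N k) * a * nest_proj N k) = fm_of (0\<^sub>m ?n ?n)"
      using True pc[of k] by (intro fm_of_inj[symmetric]) auto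
    also have "fm_of ((1\<^sub>m ?n - nest_proj N k) * a * nest_proj N k) = (idm ?n - nproj N k) * fm_of a * nproj N k"
    proof -
      have 1: "1\<^sub>m ?n - nest_proj N k \<in> carrier_mat ?n ?n" by (rule minus_carrier_mat[OF pc])
      have 2: "(1\<^sub>m ?n - nest_proj N k) * a \<in> carrier_mat ?n ?n" using 1 True by auto
      show ?thesis
        using fm_of_mult[OF 2 pc] fm_of_mult[OF 1 True] fm_of_minus[OF one_carrier_mat pc]
          fm_of_nest_proj[OF nd k] by simp
    qed
    finally show ?thesis using True by (auto simp: left_diff_distrib)
  qed
  then have "a \<in> nest_alg N \<longleftrightarrow> (\<forall>k\<in>{1..natoms N}. nproj N k * fm_of a * nproj N k = fm_of a * nproj N k)"
    using True by (auto simp: nest_alg_def)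
  also have "\<dots> \<longleftrightarrow> (\<forall>k. nproj N k * fm_of a * nproj N k = fm_of a * nproj N k)"
  proof safe
    fix k assume *: "\<forall>k\<in>{1..natoms N}. nproj N k * fm_of a * nproj N k = fm_of a * nproj N k"
    \<comment> \<open>At the positions outside the range of the definition, \<open>nproj\<close> is
      0 or the identity and the equation is automatic.\<close>
    consider "k = 0" | "k \<in> {1..natoms N}" | "natoms N \<le> k" by force
    then show "nproj N k * fm_of a * nproj N k = fm_of a * nproj N k"
      using * True by cases (auto simp: nproj_ge[OF nd])
  qed auto
  finally show ?thesis using True by (simp add: tri_def)
qed (auto simp: nest_alg_def)

section \<open>Block expansion and its dictionary with compressions by nest projections\<close>

lemma corner_expand_blocks:
  assumes nd: "nest_data N" and x: "x \<in> ncorner N"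
  shows "x = (\<Sum>i<natoms N. \<Sum>j<natoms N. blk N x i j)"
proof -
  have "x = idm (ndim N) * x * idm (ndim N)" using x by simp
  also have "\<dots> = (\<Sum>i<natoms N. \<Sum>j<natoms N. blk N x i j)"
    unfolding sum_natom[OF nd, symmetric] sum_distrib_left sum_distrib_right
    by (rule sum.swap)
  finally show ?thesis .
qed

lemma corner_eqI:
  assumes "nest_data N" "x \<in> ncorner N" "y \<in> ncorner N" "\<And>i j. blk N x i j = blk N y i j"
  shows "x = y"
  using corner_expand_blocks[OF assms(1,2)] corner_expand_blocks[OF assms(1,3)] assms(4) by simp

lemma blk_nproj_left: "nest_data N \<Longrightarrow> blk N (nproj N m * x) i j = (if i < m then blk N x i j else 0)"
  by (simp add: mult.assoc nsimps)

lemma blk_nproj_right: "nest_data N \<Longrightarrow> blk N (x * nproj N m) i j = (if j < m then blk N x i j else 0)"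
  by (simp add: mult.assoc nsimps)

text \<open>Multiplication by nest projections keeps the initial rows or columns of blocks, so the
  equation says that an upper right rectangle of blocks vanishes. Rows and columns have separate cut
  positions, as the order conditions compare rows with columns.\<close>

lemma compress_rows_iff:
  assumes nd: "nest_data N" and x: "x \<in> ncorner N"
  shows "nproj N m * x * nproj N n = nproj N m * x \<longleftrightarrow> (\<forall>s t. s < m \<longrightarrow> n \<le> t \<longrightarrow> blk N x s t = 0)"
proof
  assume *: "nproj N m * x * nproj N n = nproj N m * x"
  show "\<forall>s t. s < m \<longrightarrow> n \<le> t \<longrightarrow> blk N x s t = 0"
  proof (intro allI impI)
    fix s t assume "s < m" "n \<le> t"
    then show "blk N x s t = 0"
      using arg_cong[OF *, of "\<lambda>y. blk N y s t"] by (simp add: blk_nproj_left[OF nd] blk_nproj_right[OF nd])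
  qed
next
  assume "\<forall>s t. s < m \<longrightarrow> n \<le> t \<longrightarrow> blk N x s t = 0"
  then show "nproj N m * x * nproj N n = nproj N m * x"
    using nd x by - (rule corner_eqI[OF nd]; auto simp: blk_nproj_left blk_nproj_right)
qed

lemma compress_cols_iff:
  assumes nd: "nest_data N" and x: "x \<in> ncorner N"
  shows "nproj N m * x * nproj N n = x * nproj N n \<longleftrightarrow> (\<forall>s t. m \<le> s \<longrightarrow> t < n \<longrightarrow> blk N x s t = 0)"
proof
  assume *: "nproj N m * x * nproj N n = x * nproj N n"
  show "\<forall>s t. m \<le> s \<longrightarrow> t < n \<longrightarrow> blk N x s t = 0"
  proof (intro allI impI)
    fix s t assume "m \<le> s" "t < n"
    then show "blk N x s t = 0"
      using arg_cong[OF *, of "\<lambda>y. blk N y s t"] by (simp add: blk_nproj_left[OF nd] blk_nproj_right[OF nd])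
  qed
next
  assume "\<forall>s t. m \<le> s \<longrightarrow> t < n \<longrightarrow> blk N x s t = 0"
  then show "nproj N m * x * nproj N n = x * nproj N n"
    using nd x by - (rule corner_eqI[OF nd]; auto simp: blk_nproj_left blk_nproj_right)
qed

lemma nproj_intertwine_iff:
  assumes nd: "nest_data N" and x: "x \<in> ncorner N"
  shows "nproj N m * x = x * nproj N n \<longleftrightarrow> (\<forall>s t. blk N x s t \<noteq> 0 \<longrightarrow> (s < m \<longleftrightarrow> t < n))"
proof
  assume *: "nproj N m * x = x * nproj N n"
  show "\<forall>s t. blk N x s t \<noteq> 0 \<longrightarrow> (s < m \<longleftrightarrow> t < n)"
  proof (intro allI impI)
    fix s t assume "blk N x s t \<noteq> 0"
    then show "s < m \<longleftrightarrow> t < n"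
      using arg_cong[OF *, of "\<lambda>y. blk N y s t"] by (simp add: blk_nproj_left[OF nd] blk_nproj_right[OF nd] split: if_splits)
  qed
next
  assume "\<forall>s t. blk N x s t \<noteq> 0 \<longrightarrow> (s < m \<longleftrightarrow> t < n)"
  then show "nproj N m * x = x * nproj N n"
    using nd x by - (rule corner_eqI[OF nd]; auto simp: blk_nproj_left blk_nproj_right)
qed

lemma tri_iff_blocks:
  assumes nd: "nest_data N"
  shows "x \<in> tri N \<longleftrightarrow> x \<in> ncorner N \<and> (\<forall>i j. j < i \<longrightarrow> blk N x i j = 0)"
proof -
  have "(\<forall>k. nproj N k * x * nproj N k = x * nproj N k) \<longleftrightarrow> (\<forall>i j. j < i \<longrightarrow> blk N x i j = 0)"
    if "x \<in> ncorner N"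
    unfolding compress_cols_iff[OF nd that] by (metis less_le_trans lessI less_imp_le_nat less_or_eq_imp_le)
  then show ?thesis by (auto simp: tri_def)
qed

lemma dia_iff_blocks:
  assumes nd: "nest_data N"
  shows "x \<in> dia N \<longleftrightarrow> x \<in> ncorner N \<and> (\<forall>i j. i \<noteq> j \<longrightarrow> blk N x i j = 0)"
proof -
  have "(\<forall>k. nproj N k * x = x * nproj N k) \<longleftrightarrow> (\<forall>i j. i \<noteq> j \<longrightarrow> blk N x i j = 0)" if x: "x \<in> ncorner N"
    unfolding nproj_intertwine_iff[OF nd x] by (metis linorder_less_linear less_irrefl_nat)
  then show ?thesis by (auto simp: dia_def)
qed

lemma tri_corner: "x \<in> tri N \<Longrightarrow> x \<in> ncorner N" by (simp add: tri_def)
lemma dia_corner: "x \<in> dia N \<Longrightarrow> x \<in> ncorner N" by (simp add: dia_def)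
lemma dia_commute: "x \<in> dia N \<Longrightarrow> nproj N k * x = x * nproj N k" by (simp add: dia_def)

lemma adj_blk: "nest_data N \<Longrightarrow> adj (blk N x i j) = blk N (adj x) j i"
  by (simp add: mult.assoc)

lemma blk_eq_0_adj: "nest_data N \<Longrightarrow> blk N (adj x) i j = 0 \<longleftrightarrow> blk N x j i = 0"
  by (metis adj_blk adj_eq_0)

text \<open>Expresses the diagonal by the nest algebra and the adjoint alone, both of which a star
  extendible map respects; hence such a map sends diagonals to diagonals.\<close>

lemma dia_iff_tri: "nest_data N \<Longrightarrow> x \<in> dia N \<longleftrightarrow> x \<in> tri N \<and> adj x \<in> tri N"
  by (simp add: tri_iff_blocks dia_iff_blocks blk_eq_0_adj) (metis linorder_less_linear less_irrefl_nat)

lemma dia_tri: "nest_data N \<Longrightarrow> x \<in> dia N \<Longrightarrow> x \<in> tri N" by (simp add: dia_iff_tri)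

lemma blk_diag_dia: "nest_data N \<Longrightarrow> x \<in> ncorner N \<Longrightarrow> blk N x i i \<in> dia N"
  by (auto simp: dia_iff_blocks mult.assoc nsimps)

lemma blk_tri: "nest_data N \<Longrightarrow> x \<in> ncorner N \<Longrightarrow> i \<le> j \<Longrightarrow> blk N x i j \<in> tri N"
  by (auto simp: tri_iff_blocks mult.assoc nsimps)

lemma tri_add: "x \<in> tri N \<Longrightarrow> y \<in> tri N \<Longrightarrow> x + y \<in> tri N"
  by (simp add: tri_def algebra_simps)

lemma tri_zero: "0 \<in> tri N" by (simp add: tri_def)

lemma tri_sum: "(\<And>k. k \<in> S \<Longrightarrow> f k \<in> tri N) \<Longrightarrow> (\<Sum>k\<in>S. f k) \<in> tri N"
  by (induction S rule: infinite_finite_induct) (auto intro: tri_add tri_zero)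

lemma tri_scl: "x \<in> tri N \<Longrightarrow> scl c x \<in> tri N"
  by (simp add: tri_def)

lemma tri_mult: "x \<in> tri N \<Longrightarrow> y \<in> tri N \<Longrightarrow> x * y \<in> tri N"
proof -
  assume x: "x \<in> tri N" and y: "y \<in> tri N"
  have "nproj N k * (x * y) * nproj N k = x * y * nproj N k" for k
  proof -
    have "nproj N k * (x * y) * nproj N k = nproj N k * x * (y * nproj N k)" by (simp add: mult.assoc)
    also have "\<dots> = (nproj N k * x * nproj N k) * (y * nproj N k)"
      using y by (simp add: tri_def mult.assoc)
    also have "\<dots> = x * (nproj N k * y * nproj N k)" using x by (simp add: tri_def mult.assoc)
    also have "\<dots> = x * y * nproj N k" using y by (simp add: tri_def mult.assoc)
    finally show ?thesis .
  qed
  then show ?thesis using x y by (simp add: tri_def)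
qed

lemma tri_block_le: "nest_data N \<Longrightarrow> x \<in> tri N \<Longrightarrow> blk N x i j \<noteq> 0 \<Longrightarrow> i \<le> j"
  using not_less by (auto simp: tri_iff_blocks)

lemma blk_nonzero_less: "nest_data N \<Longrightarrow> blk N x i j \<noteq> 0 \<Longrightarrow> i < natoms N \<and> j < natoms N"
  by (metis mult_zero_left mult_zero_right natom_nonzero)

text \<open>The blocks on and above the diagonal go to \<open>y\<close>, the adjoints of those
  strictly below to \<open>z\<close>. So a nest algebra and its adjoint span the full matrix
  algebra, which makes star extensions unique.\<close>

lemma corner_split_tri:
  assumes nd: "nest_data N" and x: "x \<in> ncorner N"
  obtains y z where "y \<in> tri N" "z \<in> tri N" "x = y + adj z"
proof -
  let ?l = "natoms N"
  define y where "y = (\<Sum>i<?l. \<Sum>j<?l. if i \<le> j then blk N x i j else 0)"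
  define z where "z = (\<Sum>i<?l. \<Sum>j<?l. if i \<le> j then 0 else blk N (adj x) j i)"
  have "y \<in> tri N" unfolding y_def
    by (intro tri_sum) (simp add: blk_tri[OF nd x] tri_zero)
  moreover have "z \<in> tri N" unfolding z_def
    using nd x by (intro tri_sum) (simp add: blk_tri tri_zero)
  moreover have "x = y + adj z"
  proof -
    have "adj z = (\<Sum>i<?l. \<Sum>j<?l. if i \<le> j then 0 else blk N x i j)"
      unfolding z_def adj_sum by (intro sum.cong refl) (simp add: nd mult.assoc)
    then have "y + adj z = (\<Sum>i<?l. \<Sum>j<?l. (if i \<le> j then blk N x i j else 0) + (if i \<le> j then 0 else blk N x i j))"
      unfolding y_def by (simp only: sum.distrib)
    also have "\<dots> = (\<Sum>i<?l. \<Sum>j<?l. blk N x i j)"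
      by (intro sum.cong refl) simp
    finally have "y + adj z = (\<Sum>i<?l. \<Sum>j<?l. blk N x i j)" .
    then show ?thesis using corner_expand_blocks[OF nd x] by simp
  qed
  ultimately show ?thesis using that by blast
qed

section \<open>Partial isometries and the two order classes\<close>

definition is_pis :: "fmat \<Rightarrow> bool" where
  "is_pis x \<longleftrightarrow> x * adj x * x = x"

text \<open>For idempotent \<open>e = adj x * x\<close>, the product of \<open>x - x * e\<close>
  with its adjoint on the left is \<open>e - e - e + e\<close>, so \<open>x = x * e\<close>.\<close>

lemma is_pis_iff: "is_pis x \<longleftrightarrow> (adj x * x) * (adj x * x) = adj x * x"
proof
  assume "is_pis x"
  then show "(adj x * x) * (adj x * x) = adj x * x" by (simp add: is_pis_def mult.assoc)
next
  assume *: "(adj x * x) * (adj x * x) = adj x * x"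
  let ?e = "adj x * x"
  have a: "adj (x - x * ?e) = adj x - ?e * adj x" by (simp add: mult.assoc)
  have "adj (x - x * ?e) * (x - x * ?e) = ?e - ?e * ?e - ?e * ?e + ?e * (?e * ?e)"
    unfolding a by (simp add: algebra_simps)
  also have "\<dots> = 0" using * by simp
  finally have "x - x * ?e = 0" by (simp only: adj_mult_eq_0)
  then show "is_pis x" by (simp add: is_pis_def mult.assoc)
qed

lemma is_pis_adj: "is_pis x \<Longrightarrow> is_pis (adj x)"
  unfolding is_pis_def by (metis adj_adj adj_mult mult.assoc)

lemma partial_isometry_iff: "partial_isometry n v \<longleftrightarrow> v \<in> carrier_mat n n \<and> is_pis (fm_of v)"
proof (cases "v \<in> carrier_mat n n")
  case True
  let ?e = "mat_adjoint v * v"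
  have e: "?e \<in> carrier_mat n n" using True by auto
  have fe: "fm_of ?e = adj (fm_of v) * fm_of v"
    using True fm_of_mult[of "mat_adjoint v" n n v n] by (simp add: fm_of_adjoint)
  have a: "mat_adjoint ?e = ?e"
    using e fm_of_inj[of "mat_adjoint ?e" n ?e] by (simp add: fm_of_adjoint fe)
  have "?e * ?e = ?e \<longleftrightarrow> fm_of (?e * ?e) = fm_of ?e" using e fm_of_inj[of "?e * ?e" n ?e] by auto
  also have "\<dots> \<longleftrightarrow> is_pis (fm_of v)" unfolding fm_of_mult[OF e e] fe is_pis_iff ..
  finally show ?thesis using True e a by (simp add: partial_isometry_def projection_def)
qed (simp add: partial_isometry_def)

lemma fm_of_block:
  assumes "nest_data N" "v \<in> full_alg N" "i < natoms N" "j < natoms N"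
  shows "fm_of (block N v i j) = blk N (fm_of v) i j" "block N v i j \<in> full_alg N"
proof -
  note c = natom_carrier[OF assms(1)]
  have 1: "atoms N ! i * v \<in> full_alg N" by (rule mult_carrier_mat[OF c[OF assms(3)] assms(2)])
  show "fm_of (block N v i j) = blk N (fm_of v) i j"
    using fm_of_mult[OF 1 c[OF assms(4)]] fm_of_mult[OF c[OF assms(3)] assms(2)] assms
    by (simp add: block_def natom_def)
  show "block N v i j \<in> full_alg N" unfolding block_def by (rule mult_carrier_mat[OF 1 c[OF assms(4)]])
qed

lemma block_zero_iff:
  assumes "nest_data N" "v \<in> full_alg N" "i < natoms N" "j < natoms N"
  shows "block_zero N v i j \<longleftrightarrow> blk N (fm_of v) i j = 0"
  using fm_of_block[OF assms] fm_of_inj[of "block N v i j" "ndim N" "0\<^sub>m (ndim N) (ndim N)"] by simp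

lemma Pisom_reg_iff:
  assumes nd: "nest_data N"
  shows "v \<in> Pisom_reg N \<longleftrightarrow> v \<in> full_alg N \<and> fm_of v \<in> tri N \<and> is_pis (fm_of v) \<and>
    (\<forall>i j. is_pis (blk N (fm_of v) i j))"
proof -
  have "(\<forall>i<natoms N. \<forall>j<natoms N. partial_isometry (ndim N) (block N v i j)) \<longleftrightarrow>
     (\<forall>i j. is_pis (blk N (fm_of v) i j))" if v: "v \<in> full_alg N"
  proof -
    have "partial_isometry (ndim N) (block N v i j) \<longleftrightarrow> is_pis (blk N (fm_of v) i j)"
      if "i < natoms N" "j < natoms N" for i j
      using fm_of_block[OF nd v that] by (simp add: partial_isometry_iff)
    moreover have "is_pis (blk N (fm_of v) i j)" if "\<not> (i < natoms N \<and> j < natoms N)" for i j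
    proof -
      have "blk N (fm_of v) i j = 0" using blk_nonzero_less[OF nd, of i "fm_of v" j] that by blast
      then show ?thesis by (simp only: is_pis_def mult_zero_right)
    qed
    ultimately show ?thesis by blast
  qed
  then show ?thesis
    unfolding Pisom_reg_def nest_alg_iff[OF nd] partial_isometry_iff by blast
qed

text \<open>\<open>Pisom_op\<close> without blocks: \<open>x\<close> intertwines the nest with
  itself, each nest projection on one side matching one on the other. That the blocks of such an
  \<open>x\<close> are partial isometries is a consequence, drawn in \<open>OP_imp_OC\<close> and
  \<open>OC_blocks\<close>.\<close>

definition OP :: "nest \<Rightarrow> fmat \<Rightarrow> bool" where
  "OP N x \<longleftrightarrow> x \<in> tri N \<and> is_pis x \<and> (\<forall>m. \<exists>n. nproj N m * x = x * nproj N n) \<and>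
     (\<forall>n. \<exists>m. nproj N m * x = x * nproj N n)"

text \<open>\<open>Pisom_oc\<close> without blocks: at each pair of positions the compression loses
  nothing on one of its two sides, and the initial and final projections are block diagonal. The
  last two clauses stand for the condition on the blocks in \<open>Pisom_reg\<close>.\<close>

definition OC :: "nest \<Rightarrow> fmat \<Rightarrow> bool" where
  "OC N x \<longleftrightarrow> x \<in> tri N \<and> is_pis x \<and>
     (\<forall>m n. nproj N m * x * nproj N n = nproj N m * x \<or> nproj N m * x * nproj N n = x * nproj N n) \<and>
     adj x * x \<in> dia N \<and> x * adj x \<in> dia N"

lemma OP_iff_blocks:
  assumes nd: "nest_data N"
  shows "OP N x \<longleftrightarrow> x \<in> tri N \<and> is_pis x \<and>
    (\<forall>i j s t. blk N x i j \<noteq> 0 \<longrightarrow> blk N x s t \<noteq> 0 \<longrightarrow> s \<le> i \<longrightarrow> j \<le> t \<longrightarrow> s = i \<and> t = j)"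
proof (cases "x \<in> ncorner N")
  case x: True
  have "(\<forall>m. \<exists>n. nproj N m * x = x * nproj N n) \<and> (\<forall>n. \<exists>m. nproj N m * x = x * nproj N n) \<longleftrightarrow>
    (\<forall>i j s t. blk N x i j \<noteq> 0 \<longrightarrow> blk N x s t \<noteq> 0 \<longrightarrow> s \<le> i \<longrightarrow> j \<le> t \<longrightarrow> s = i \<and> t = j)"
    (is "?A \<longleftrightarrow> ?B")
  proof
    assume A: ?A
    show ?B
    proof (intro allI impI)
      fix i j s t assume h: "blk N x i j \<noteq> 0" "blk N x s t \<noteq> 0" "s \<le> i" "j \<le> t"
      obtain n where n: "nproj N i * x = x * nproj N n" using A by blast
      obtain m where m: "nproj N m * x = x * nproj N t" using A by blast
      note n' = n[unfolded nproj_intertwine_iff[OF nd x], rule_format]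
        and m' = m[unfolded nproj_intertwine_iff[OF nd x], rule_format]
      show "s = i \<and> t = j"
        using n'[OF h(1)] n'[OF h(2)] m'[OF h(1)] m'[OF h(2)] h(3,4) by linarith
    qed
  next
    assume B: ?B
    have "\<exists>n. nproj N m * x = x * nproj N n" for m
    proof -
      let ?Q = "\<lambda>n. nproj N m * x * nproj N n = nproj N m * x"
      have "?Q (natoms N)" using nd x nproj_ge[OF nd order_refl] by simp
      then have L: "?Q (LEAST n. ?Q n)" by (rule LeastI)
      \<comment> \<open>\<open>n\<close> is the first column position that contains all nonzero
        blocks of the rows before \<open>m\<close>. By minimality one of these blocks lies in column
        \<open>n - 1\<close> or later, and a nonzero block further down but before column
        \<open>n\<close> would be nested with it.\<close>
      define n where "n = (LEAST n. ?Q n)"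
      have "nproj N m * x * nproj N n = x * nproj N n"
        unfolding compress_cols_iff[OF nd x]
      proof (intro allI impI)
        fix s t assume st: "m \<le> s" "t < n"
        show "blk N x s t = 0"
        proof (rule ccontr)
          assume nz: "blk N x s t \<noteq> 0"
          have "\<not> ?Q (n - 1)" using st not_less_Least[of "n - 1" ?Q] by (simp add: n_def)
          then obtain s' t' where s': "s' < m" "n - 1 \<le> t'" "blk N x s' t' \<noteq> 0"
            unfolding compress_rows_iff[OF nd x] by blast
          have "s' \<le> s" "t \<le> t'" using st s' by auto
          then have "s' = s" using B nz s'(3) by blast
          then show False using st s' by simp
        qed
      qed
      then show ?thesis using L by (metis n_def)
    qed
    moreover have "\<exists>m. nproj N m * x = x * nproj N n" for n
    proof -
      let ?Q = "\<lambda>m. nproj N m * x * nproj N n = x * nproj N n"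
      have "?Q (natoms N)" using nd x nproj_ge[OF nd order_refl] by simp
      then have L: "?Q (LEAST m. ?Q m)" by (rule LeastI)
      define m where "m = (LEAST m. ?Q m)"
      have "nproj N m * x * nproj N n = nproj N m * x"
        unfolding compress_rows_iff[OF nd x]
      proof (intro allI impI)
        fix s t assume st: "s < m" "n \<le> t"
        show "blk N x s t = 0"
        proof (rule ccontr)
          assume nz: "blk N x s t \<noteq> 0"
          have "\<not> ?Q (m - 1)" using st not_less_Least[of "m - 1" ?Q] by (simp add: m_def)
          then obtain s' t' where s': "m - 1 \<le> s'" "t' < n" "blk N x s' t' \<noteq> 0"
            unfolding compress_cols_iff[OF nd x] by blast
          have "s \<le> s'" "t' \<le> t" using st s' by auto
          then have "t = t'" using B nz s'(3) by blast
          then show False using st s' by simp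
        qed
      qed
      then show ?thesis using L by (metis m_def)
    qed
    ultimately show ?A by blast
  qed
  then show ?thesis by (auto simp: OP_def)
qed (auto simp: OP_def tri_def)

lemma comparable_iff_blocks:
  assumes nd: "nest_data N" and x: "x \<in> ncorner N"
  shows "(\<forall>m n. nproj N m * x * nproj N n = nproj N m * x \<or> nproj N m * x * nproj N n = x * nproj N n) \<longleftrightarrow>
    (\<forall>i j s t. blk N x i j \<noteq> 0 \<longrightarrow> blk N x s t \<noteq> 0 \<longrightarrow> \<not> (s < i \<and> j < t))" (is "?A \<longleftrightarrow> ?B")
proof
  assume A: ?A
  show ?B
  proof (intro allI impI notI)
    fix i j s t assume h: "blk N x i j \<noteq> 0" "blk N x s t \<noteq> 0" "s < i \<and> j < t"
    \<comment> \<open>Cutting above row \<open>i\<close> and before column \<open>t\<close> puts the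
      two blocks into opposite rectangles, so neither alternative can hold.\<close>
    have "nproj N i * x * nproj N t = nproj N i * x \<or> nproj N i * x * nproj N t = x * nproj N t" using A by blast
    then show False
      unfolding compress_rows_iff[OF nd x] compress_cols_iff[OF nd x] using h by blast
  qed
next
  assume B: ?B
  show ?A
    unfolding compress_rows_iff[OF nd x] compress_cols_iff[OF nd x]
    using B by (metis not_less less_le_trans order_less_le_trans)
qed

text \<open>Taking adjoints turns the intertwining relation around, so a nest projection can be
  moved through \<open>x\<close> and back through \<open>adj x\<close>; the initial and final
  projections thus commute with the nest.\<close>

lemma OP_imp_OC:
  assumes nd: "nest_data N" and "OP N x"
  shows "OC N x"
proof -
  have x: "x \<in> tri N" "is_pis x" and A: "\<And>m. \<exists>n. nproj N m * x = x * nproj N n" "\<And>n. \<exists>m. nproj N m * x = x * nproj N n"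
    using assms(2) by (auto simp: OP_def)
  have xc: "x \<in> ncorner N" using x tri_corner by blast
  have "\<forall>i j s t. blk N x i j \<noteq> 0 \<longrightarrow> blk N x s t \<noteq> 0 \<longrightarrow> \<not> (s < i \<and> j < t)"
    using assms(2)[unfolded OP_iff_blocks[OF nd]] by (metis less_imp_le_nat nat_neq_iff)
  then have "\<forall>m n. nproj N m * x * nproj N n = nproj N m * x \<or> nproj N m * x * nproj N n = x * nproj N n"
    using comparable_iff_blocks[OF nd xc] by blast
  moreover have "nproj N n * (adj x * x) = adj x * x * nproj N n" for n
  proof -
    obtain m where m: "nproj N m * x = x * nproj N n" using A by blast
    have "adj x * nproj N m = nproj N n * adj x" using arg_cong[OF m, of adj] nd by simp
    then show ?thesis using m by (metis mult.assoc)
  qed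
  moreover have "nproj N m * (x * adj x) = x * adj x * nproj N m" for m
  proof -
    obtain n where m: "nproj N m * x = x * nproj N n" using A by blast
    have "adj x * nproj N m = nproj N n * adj x" using arg_cong[OF m, of adj] nd by simp
    then show ?thesis using m by (metis mult.assoc)
  qed
  ultimately show ?thesis using x xc by (simp add: OC_def dia_def)
qed

text \<open>A projection whose compression to \<open>p\<close> is again a projection commutes with
  \<open>p\<close>: the off-diagonal corner \<open>z = e * p - p * e * p\<close> satisfies
  \<open>adj z * z = c - c * c\<close> for the compression \<open>c = p * e * p\<close>.\<close>

lemma compressed_projection_commute:
  fixes e p :: fmat
  assumes "p * p = p" "adj p = p" "e * e = e" "adj e = e" "(p * e * p) * (p * e * p) = p * e * p"
  shows "e * p = p * e * p" "p * e = p * e * p"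
proof -
  let ?z = "e * p - p * e * p"
  have pp: "p * (p * x) = p * x" "e * (e * x) = e * x" for x
    using assms(1,3) by (simp_all add: mult.assoc[symmetric])
  have "adj ?z = p * e - p * e * p" using assms by (simp add: mult.assoc)
  then have "adj ?z * ?z = (p * e - p * e * p) * ?z" by (simp only:)
  also have "\<dots> = p * e * p - (p * e * p) * (p * e * p)"
    using pp assms(1,3) by (simp add: algebra_simps)
  finally have "adj ?z * ?z = p * e * p - (p * e * p) * (p * e * p)" .
  then have "adj ?z * ?z = 0" using assms(5) by simp
  then have z: "?z = 0" by (simp only: adj_mult_eq_0)
  then show 1: "e * p = p * e * p" by simp
  show "p * e = p * e * p" using arg_cong[OF 1, of adj] assms by (simp add: mult.assoc)
qed

text \<open>The nonzero blocks form a staircase: from one row to a lower one, columns never move to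
  the left.\<close>

abbreviation no_strict_nest :: "nest \<Rightarrow> fmat \<Rightarrow> bool" where
  "no_strict_nest N x \<equiv> (\<forall>i j s t. blk N x i j \<noteq> 0 \<longrightarrow> blk N x s t \<noteq> 0 \<longrightarrow> \<not> (s < i \<and> j < t))"

lemma no_strict_nest_adj: "nest_data N \<Longrightarrow> no_strict_nest N x \<Longrightarrow> no_strict_nest N (adj x)"
  unfolding blk_eq_0_adj by blast

lemma sum_natom_insert:
  assumes nd: "nest_data N" and x: "x \<in> ncorner N"
  shows "(\<Sum>s<natoms N. x * natom N s * y) = x * y"
  unfolding sum_distrib_left[symmetric] sum_distrib_right[symmetric] sum_natom[OF nd] using x by simp

text \<open>The block of \<open>x * adj x\<close> in rows \<open>s\<close> and \<open>s'\<close> is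
  a sum over columns of products of blocks. On a staircase two different rows share at most one
  column, so when this block vanishes the single remaining product does too.\<close>

lemma column_orthogonal:
  assumes nd: "nest_data N" and x: "x \<in> ncorner N"
    and ns: "no_strict_nest N x"
    and row: "\<And>s'. s' \<noteq> s \<Longrightarrow> blk N (x * adj x) s s' = 0"
    and "s \<noteq> s'"
  shows "blk N x s n * adj (blk N x s' n) = 0"
proof (cases "blk N x s n = 0 \<or> blk N x s' n = 0")
  case False
  have z: "blk N x s t * adj (blk N x s' t) = 0" if "t \<noteq> n" for t
  proof (rule ccontr)
    assume h: "blk N x s t * adj (blk N x s' t) \<noteq> 0"
    have nz: "blk N x s t \<noteq> 0" using h by (metis mult_zero_left)
    have nz': "blk N x s' t \<noteq> 0" using h by (metis adj_zero mult_zero_right)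
    have "s < s' \<and> t < n \<or> s < s' \<and> n < t \<or> s' < s \<and> t < n \<or> s' < s \<and> n < t"
      using that \<open>s \<noteq> s'\<close> by linarith
    then show False using ns nz nz' False by blast
  qed
  have nl: "n < natoms N" using False blk_nonzero_less[OF nd] by blast
  have "0 = blk N (x * adj x) s s'" using row \<open>s \<noteq> s'\<close> by simp
  also have "\<dots> = (\<Sum>t<natoms N. (natom N s * x) * natom N t * (adj x * natom N s'))"
    using nd x by (subst sum_natom_insert) (auto simp: mult.assoc)
  also have "\<dots> = (\<Sum>t<natoms N. blk N x s t * adj (blk N x s' t))"
    by (intro sum.cong refl) (simp add: nd mult.assoc nsimps)
  also have "\<dots> = blk N x s n * adj (blk N x s' n)"
    using nl z by (subst sum.remove[of _ n]) auto
  finally show ?thesis by simp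
next
  case True
  then show ?thesis by (metis adj_zero mult_zero_left mult_zero_right)
qed

text \<open>Rows before \<open>m\<close> are already known to be orthogonal and rows after
  \<open>m\<close> do not meet column \<open>n\<close>, so of two different rows at least one is
  harmless, and the blocks of column \<open>n\<close> have orthogonal initial spaces. The
  compression of \<open>adj x * x\<close> to the atom is then a sum of orthogonal projections, and
  \<open>compressed_projection_commute\<close> applies.\<close>

lemma column_commute:
  assumes nd: "nest_data N" and x: "x \<in> ncorner N" and pis: "is_pis x" "\<And>i j. is_pis (blk N x i j)"
    and ns: "no_strict_nest N x"
    and rows: "\<And>s s'. s < m \<Longrightarrow> s' \<noteq> s \<Longrightarrow> blk N (x * adj x) s s' = 0"
    and stop: "\<And>s. m < s \<Longrightarrow> blk N x s n = 0"
    and "t \<noteq> n"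
  shows "blk N (adj x * x) n t = 0"
proof -
  let ?b = "\<lambda>s. blk N x s n" and ?l = "natoms N"
  have orth: "?b s * adj (?b s') = 0" if "s \<noteq> s'" for s s'
  proof -
    have "s < m \<or> s' < m \<or> m < s \<or> m < s'" using that by linarith
    then consider "s < m" | "s' < m" | "m < s \<or> m < s'" by blast
    then show ?thesis
    proof cases
      case 1 then show ?thesis using column_orthogonal[OF nd x ns _ that] rows by blast
    next
      case 2
      then have "?b s' * adj (?b s) = 0" using column_orthogonal[OF nd x ns _ that[symmetric]] rows by blast
      then have "adj (?b s' * adj (?b s)) = adj 0" by (simp only:)
      then show ?thesis unfolding adj_mult adj_adj adj_zero .
    next
      case 3
      then have "?b s = 0 \<or> ?b s' = 0" using stop by blast
      then show ?thesis by (metis adj_zero mult_zero_left mult_zero_right)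
    qed
  qed
  let ?p = "natom N n" and ?e = "adj x * x"
  have pep: "?p * ?e * ?p = (\<Sum>s<?l. adj (?b s) * ?b s)"
  proof -
    have "?p * ?e * ?p = (\<Sum>s<?l. (?p * adj x) * natom N s * (x * ?p))"
      using nd x by (subst sum_natom_insert) (auto simp: mult.assoc)
    also have "\<dots> = (\<Sum>s<?l. adj (?b s) * ?b s)"
      by (intro sum.cong refl) (simp add: nd mult.assoc nsimps)
    finally show ?thesis .
  qed
  have "(?p * ?e * ?p) * (?p * ?e * ?p) = (\<Sum>s<?l. \<Sum>s'<?l. adj (?b s) * (?b s * adj (?b s')) * ?b s')"
    unfolding pep sum_product by (simp add: mult.assoc)
  also have "\<dots> = (\<Sum>s<?l. adj (?b s) * ?b s)"
  proof (intro sum.cong refl)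
    fix s assume s: "s \<in> {..<?l}"
    have "(\<Sum>s'<?l. adj (?b s) * (?b s * adj (?b s')) * ?b s') =
        (\<Sum>s'<?l. if s' = s then adj (?b s) * (?b s * adj (?b s)) * ?b s else 0)"
      by (intro sum.cong refl) (use orth in auto)
    also have "\<dots> = adj (?b s) * (?b s * adj (?b s) * ?b s)" using s by (simp add: mult.assoc)
    also have "\<dots> = adj (?b s) * ?b s" using pis(2)[of s n] by (simp only: is_pis_def)
    finally show "(\<Sum>s'<?l. adj (?b s) * (?b s * adj (?b s')) * ?b s') = adj (?b s) * ?b s" .
  qed
  finally have idem: "(?p * ?e * ?p) * (?p * ?e * ?p) = ?p * ?e * ?p" unfolding pep .
  have "?p * ?e = ?p * ?e * ?p"
    by (rule compressed_projection_commute(2)) (use nd idem pis(1) in \<open>auto simp: natom_mult is_pis_iff\<close>)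
  then have "blk N ?e n t = ?p * ?e * ?p * natom N t" by simp
  then show ?thesis using \<open>t \<noteq> n\<close> nd by (simp add: mult.assoc nsimps)
qed

text \<open>A walk along the staircase, with \<open>S m\<close> and \<open>T n\<close> recording
  that the first \<open>m\<close> rows and the first \<open>n\<close> columns are settled. Either
  column \<open>n\<close> has no block below row \<open>m\<close> or row \<open>m\<close> has none
  right of column \<open>n\<close>, since two such blocks would be strictly nested; so a column or a
  row can always be settled next.\<close>

lemma staircase_dia:
  assumes nd: "nest_data N" and x: "x \<in> ncorner N" and pis: "is_pis x" "\<And>i j. is_pis (blk N x i j)"
    and ns: "no_strict_nest N x"
  shows "adj x * x \<in> dia N" "x * adj x \<in> dia N"
proof -
  define S where "S = (\<lambda>m. \<forall>s s'. s < m \<longrightarrow> s' \<noteq> s \<longrightarrow> blk N (x * adj x) s s' = 0)"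
  define T where "T = (\<lambda>n. \<forall>t t'. t < n \<longrightarrow> t' \<noteq> t \<longrightarrow> blk N (adj x * x) t t' = 0)"
  let ?l = "natoms N"
  have pis': "is_pis (adj x)" "is_pis (blk N (adj x) i j)" for i j
    using pis is_pis_adj[OF pis(1)] is_pis_adj[OF pis(2)[of j i]] adj_blk[OF nd, of j x i] by simp_all
  have stepT: "T (Suc n)" if "T n" "S m" "\<And>s. m < s \<Longrightarrow> blk N x s n = 0" for m n
  proof -
    have "blk N (adj x * x) n t' = 0" if "t' \<noteq> n" for t'
      by (rule column_commute[OF nd x pis ns _ _ that, where m = m])
        (use \<open>S m\<close> S_def \<open>\<And>s. m < s \<Longrightarrow> blk N x s n = 0\<close> in auto)
    then show ?thesis using \<open>T n\<close> unfolding T_def by (metis less_antisym)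
  qed
  have stepS: "S (Suc m)" if "S m" "T n" "\<And>t. n < t \<Longrightarrow> blk N x m t = 0" for m n
  proof -
    have z: "blk N (adj x) t m = 0" if "n < t" for t
      using that \<open>\<And>t. n < t \<Longrightarrow> blk N x m t = 0\<close> blk_eq_0_adj[OF nd] by blast
    have "blk N (adj (adj x) * adj x) m s' = 0" if "s' \<noteq> m" for s'
      by (rule column_commute[OF nd _ pis' no_strict_nest_adj[OF nd ns] _ z that])
        (use x \<open>T n\<close> T_def in auto)
    then show ?thesis using \<open>S m\<close> unfolding S_def adj_adj by (metis less_antisym)
  qed
  have zero_ge: "blk N x s t = 0" if "?l \<le> s \<or> ?l \<le> t" for s t
    using blk_nonzero_less[OF nd, of s x t] that by (meson not_less)
  have "\<exists>m n. m + n = k \<and> S m \<and> T n" for k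
  proof (induction k)
    case 0
    then show ?case by (auto simp: S_def T_def)
  next
    case (Suc k)
    then obtain m n where mn: "m + n = k" "S m" "T n" by blast
    show ?case
    proof (cases "\<forall>s>m. blk N x s n = 0")
      case True
      then have "T (Suc n)" using stepT mn by blast
      then show ?thesis using mn by (metis add_Suc_right)
    next
      case False
      then have "\<forall>t>n. blk N x m t = 0" using ns by blast
      then have "S (Suc m)" using stepS mn by blast
      then show ?thesis using mn by (metis add_Suc)
    qed
  qed
  \<comment> \<open>After twice as many steps as there are atoms, one counter has passed all atoms.
    The other can then be advanced freely, because no block lies beyond the last row or
    column.\<close>
  then obtain m n where mn: "m + n = 2 * ?l" "S m" "T n" by blast
  have ST: "S m' \<Longrightarrow> ?l \<le> m' \<Longrightarrow> T n'" for m' n'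
  proof (induction n')
    case (Suc n')
    then show ?case using stepT zero_ge by (meson less_or_eq_imp_le order_le_less_trans)
  qed (simp add: T_def)
  have TS: "T n' \<Longrightarrow> ?l \<le> n' \<Longrightarrow> S m'" for m' n'
  proof (induction m')
    case (Suc m')
    then show ?case using stepS zero_ge by (meson less_or_eq_imp_le order_le_less_trans)
  qed (simp add: S_def)
  have "?l \<le> m \<or> ?l \<le> n" using mn by linarith
  then have "S k \<and> T k" for k
    using ST TS mn by (meson order_refl)
  then have "blk N (x * adj x) i j = 0 \<and> blk N (adj x * x) i j = 0" if "i \<noteq> j" for i j
    using that unfolding S_def T_def by (metis lessI)
  then show "adj x * x \<in> dia N" "x * adj x \<in> dia N" using x by (auto simp: dia_iff_blocks[OF nd])
qed

text \<open>By comparability, cutting \<open>adj x * nproj N m * x\<close> by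
  \<open>nproj N n\<close> either changes nothing or gives the same as cutting
  \<open>adj x * x\<close>; in both cases it commutes with the nest. Differences for consecutive
  \<open>m\<close> are projections commuting with all atoms, and their products with atoms are the
  initial projections of the blocks.\<close>

lemma OC_blocks:
  assumes nd: "nest_data N" and oc: "OC N x"
  shows "is_pis (blk N x s t)"
proof -
  have x: "x \<in> tri N" "is_pis x" "adj x * x \<in> dia N" "x * adj x \<in> dia N"
    and cmp: "\<And>m n. nproj N m * x * nproj N n = nproj N m * x \<or> nproj N m * x * nproj N n = x * nproj N n"
    using oc by (auto simp: OC_def)
  have xc: "x \<in> ncorner N" using x(1) tri_corner by blast
  have qF: "natom N s * (x * adj x) = x * adj x * natom N s" for s
    using dia_commute[OF x(4), of "Suc s"] dia_commute[OF x(4), of s] by (simp add: nproj_Suc distrib_left distrib_right)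
  define f where "f = (\<lambda>m. adj x * nproj N m * x)"
  have fcomm: "f m * nproj N n = nproj N n * f m" for m n
  proof -
    have a: "adj (f m) = f m" using nd by (simp add: f_def mult.assoc)
    show ?thesis using cmp[of m n]
    proof
      assume "nproj N m * x * nproj N n = nproj N m * x"
      then have 1: "f m * nproj N n = f m" by (simp add: f_def mult.assoc)
      have "adj (f m * nproj N n) = adj (f m)" by (simp only: 1)
      then have "nproj N n * f m = f m" using a nd by simp
      then show ?thesis using 1 by simp
    next
      assume "nproj N m * x * nproj N n = x * nproj N n"
      then have 1: "f m * nproj N n = adj x * x * nproj N n" by (simp add: f_def mult.assoc)
      have "adj (f m * nproj N n) = adj (adj x * x * nproj N n)" by (simp only: 1)
      then have "nproj N n * f m = nproj N n * (adj x * x)" using a nd by simp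
      then show ?thesis using 1 dia_commute[OF x(3)] by simp
    qed
  qed
  define g where "g = adj x * natom N s * x"
  have gf: "g = f (Suc s) - f s" by (simp add: g_def f_def nproj_Suc algebra_simps)
  have gP: "g * nproj N n = nproj N n * g" for n
    unfolding gf left_diff_distrib right_diff_distrib fcomm ..
  have gc: "g * natom N t = natom N t * g"
    using gP[of "Suc t"] gP[of t] by (simp add: nproj_Suc distrib_left distrib_right)
  have gg: "g * g = g"
  proof -
    have "g * g = adj x * (natom N s * (x * adj x)) * natom N s * x" by (simp add: g_def mult.assoc)
    also have "\<dots> = adj x * x * adj x * natom N s * x"
      unfolding qF using nd by (simp add: mult.assoc nsimps)
    also have "adj x * x * adj x = adj x" using is_pis_adj[OF x(2)] by (simp add: is_pis_def)
    finally show ?thesis by (simp add: g_def)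
  qed
  have e: "adj (blk N x s t) * blk N x s t = natom N t * g * natom N t"
    using nd by (simp add: g_def mult.assoc nsimps)
  have "natom N t * g * natom N t = g * natom N t" using gc nd by (metis mult.assoc natom_mult)
  moreover have "(g * natom N t) * (g * natom N t) = g * natom N t"
    using gc gg nd by (metis mult.assoc natom_mult)
  ultimately show ?thesis unfolding is_pis_iff e by simp
qed

lemma OC_iff_blocks:
  assumes nd: "nest_data N"
  shows "OC N x \<longleftrightarrow> x \<in> tri N \<and> is_pis x \<and> (\<forall>i j. is_pis (blk N x i j)) \<and> no_strict_nest N x"
proof
  assume oc: "OC N x"
  then have "x \<in> tri N" "is_pis x" by (auto simp: OC_def)
  moreover have "no_strict_nest N x"
    using oc comparable_iff_blocks[OF nd tri_corner[OF \<open>x \<in> tri N\<close>]] unfolding OC_def by blast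
  ultimately show "x \<in> tri N \<and> is_pis x \<and> (\<forall>i j. is_pis (blk N x i j)) \<and> no_strict_nest N x"
    using OC_blocks[OF nd oc] by blast
next
  assume *: "x \<in> tri N \<and> is_pis x \<and> (\<forall>i j. is_pis (blk N x i j)) \<and> no_strict_nest N x"
  then have xc: "x \<in> ncorner N" using tri_corner by blast
  show "OC N x" unfolding OC_def comparable_iff_blocks[OF nd xc]
    using * staircase_dia[OF nd xc] by blast
qed

text \<open>Blocks outside the matrix vanish, so a condition stated for actual atoms extends to all
  indices. The relation \<open>R\<close> is left open to serve both order classes.\<close>

lemma bounded_vanishing_iff:
  fixes B Z :: "nat \<Rightarrow> nat \<Rightarrow> bool"
  assumes BZ: "\<And>i j. i < l \<Longrightarrow> j < l \<Longrightarrow> B i j \<longleftrightarrow> Z i j" and lt: "\<And>i j. \<not> Z i j \<Longrightarrow> i < l \<and> j < l"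
  shows "(\<forall>i<l. \<forall>j<l. \<not> B i j \<longrightarrow> (\<forall>s<l. \<forall>t<l. R i j s t \<longrightarrow> B s t)) \<longleftrightarrow>
    (\<forall>i j s t. \<not> Z i j \<longrightarrow> \<not> Z s t \<longrightarrow> \<not> R i j s t)" (is "?A \<longleftrightarrow> ?B")
proof
  assume A: ?A
  show ?B
  proof (intro allI impI notI)
    fix i j s t assume h: "\<not> Z i j" "\<not> Z s t" "R i j s t"
    then have "B s t" using A lt[OF h(1)] lt[OF h(2)] BZ by blast
    then show False using h(2) lt[OF h(2)] BZ by blast
  qed
next
  assume B: ?B
  show ?A
  proof (intro allI impI)
    fix i j s t assume h: "i < l" "j < l" "\<not> B i j" "s < l" "t < l" "R i j s t"
    then have "\<not> Z i j" using BZ by blast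
    then have "Z s t" using B h(6) by blast
    then show "B s t" using BZ h by blast
  qed
qed

lemma Pisom_oc_iff:
  assumes nd: "nest_data N"
  shows "v \<in> Pisom_oc N \<longleftrightarrow> v \<in> full_alg N \<and> OC N (fm_of v)"
proof (cases "v \<in> full_alg N")
  case v: True
  have "(\<forall>i<natoms N. \<forall>j<natoms N. \<not> block_zero N v i j \<longrightarrow>
     (\<forall>s<natoms N. \<forall>t<natoms N. s < i \<and> t > j \<longrightarrow> block_zero N v s t)) \<longleftrightarrow> no_strict_nest N (fm_of v)"
    by (rule bounded_vanishing_iff) (rule block_zero_iff[OF nd v] blk_nonzero_less[OF nd]; assumption)+
  then show ?thesis unfolding Pisom_oc_def OC_iff_blocks[OF nd] using Pisom_reg_iff[OF nd, of v] v by blast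
qed (auto simp: Pisom_oc_def Pisom_reg_def nest_alg_def)

lemma Pisom_op_iff:
  assumes nd: "nest_data N"
  shows "v \<in> Pisom_op N \<longleftrightarrow> v \<in> full_alg N \<and> OP N (fm_of v)"
proof (cases "v \<in> full_alg N")
  case v: True
  let ?x = "fm_of v"
  have 1: "(\<forall>i<natoms N. \<forall>j<natoms N. \<not> block_zero N v i j \<longrightarrow>
     (\<forall>s<natoms N. \<forall>t<natoms N. (s, t) \<noteq> (i, j) \<and> s \<le> i \<and> t \<ge> j \<longrightarrow> block_zero N v s t)) \<longleftrightarrow>
     (\<forall>i j s t. blk N ?x i j \<noteq> 0 \<longrightarrow> blk N ?x s t \<noteq> 0 \<longrightarrow> \<not> ((s, t) \<noteq> (i, j) \<and> s \<le> i \<and> t \<ge> j))"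
    by (rule bounded_vanishing_iff) (rule block_zero_iff[OF nd v] blk_nonzero_less[OF nd]; assumption)+
  have 2: "OP N ?x \<longleftrightarrow> ?x \<in> tri N \<and> is_pis ?x \<and>
     (\<forall>i j s t. blk N ?x i j \<noteq> 0 \<longrightarrow> blk N ?x s t \<noteq> 0 \<longrightarrow> \<not> ((s, t) \<noteq> (i, j) \<and> s \<le> i \<and> t \<ge> j))"
    unfolding OP_iff_blocks[OF nd] by blast
  show ?thesis
  proof
    assume "v \<in> Pisom_op N"
    then show "v \<in> full_alg N \<and> OP N ?x"
      unfolding Pisom_op_def 2 mem_Collect_eq 1 Pisom_reg_iff[OF nd, of v] by blast
  next
    assume *: "v \<in> full_alg N \<and> OP N ?x"
    then have "v \<in> Pisom_reg N"
      using OP_imp_OC[OF nd] OC_blocks[OF nd] Pisom_reg_iff[OF nd, of v] by (auto simp: OP_def)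
    then show "v \<in> Pisom_op N" unfolding Pisom_op_def mem_Collect_eq 1 using * 2 by blast
  qed
qed (auto simp: Pisom_op_def Pisom_reg_def nest_alg_def)

section \<open>Star homomorphisms between nest algebras\<close>

definition corner_hom :: "nat \<Rightarrow> nat \<Rightarrow> (fmat \<Rightarrow> fmat) \<Rightarrow> bool" where
  "corner_hom d e \<beta> \<longleftrightarrow>
     (\<forall>x\<in>corner d. \<beta> x \<in> corner e) \<and>
     (\<forall>x\<in>corner d. \<forall>y\<in>corner d. \<beta> (x + y) = \<beta> x + \<beta> y) \<and>
     (\<forall>c. \<forall>x\<in>corner d. \<beta> (scl c x) = scl c (\<beta> x)) \<and>
     (\<forall>x\<in>corner d. \<forall>y\<in>corner d. \<beta> (x * y) = \<beta> x * \<beta> y) \<and>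
     (\<forall>x\<in>corner d. \<beta> (adj x) = adj (\<beta> x))"

definition nest_hom :: "nest \<Rightarrow> nest \<Rightarrow> (fmat \<Rightarrow> fmat) \<Rightarrow> bool" where
  "nest_hom N N' \<beta> \<longleftrightarrow> corner_hom (ndim N) (ndim N') \<beta> \<and> (\<forall>x\<in>tri N. \<beta> x \<in> tri N')"

lemma corner_homD:
  assumes "corner_hom d e \<beta>"
  shows "x \<in> corner d \<Longrightarrow> \<beta> x \<in> corner e"
    "x \<in> corner d \<Longrightarrow> y \<in> corner d \<Longrightarrow> \<beta> (x + y) = \<beta> x + \<beta> y"
    "x \<in> corner d \<Longrightarrow> \<beta> (scl c x) = scl c (\<beta> x)"
    "x \<in> corner d \<Longrightarrow> y \<in> corner d \<Longrightarrow> \<beta> (x * y) = \<beta> x * \<beta> y"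
    "x \<in> corner d \<Longrightarrow> \<beta> (adj x) = adj (\<beta> x)"
  using assms unfolding corner_hom_def by blast+

lemma corner_hom_zero: "corner_hom d e \<beta> \<Longrightarrow> \<beta> 0 = 0"
  using corner_homD(3)[of d e \<beta> 0 0] by simp

lemma corner_hom_sum: "corner_hom d e \<beta> \<Longrightarrow> (\<And>k. k \<in> S \<Longrightarrow> f k \<in> corner d) \<Longrightarrow> \<beta> (\<Sum>k\<in>S. f k) = (\<Sum>k\<in>S. \<beta> (f k))"
  by (induction S rule: infinite_finite_induct) (auto simp: corner_hom_zero corner_homD(2))

lemma nest_hom_corner: "nest_hom N N' \<beta> \<Longrightarrow> corner_hom (ndim N) (ndim N') \<beta>"
  by (simp add: nest_hom_def)

lemma nest_hom_tri: "nest_hom N N' \<beta> \<Longrightarrow> x \<in> tri N \<Longrightarrow> \<beta> x \<in> tri N'"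
  by (simp add: nest_hom_def)

lemma nest_hom_dia: "nest_data N \<Longrightarrow> nest_data N' \<Longrightarrow> nest_hom N N' \<beta> \<Longrightarrow> x \<in> dia N \<Longrightarrow> \<beta> x \<in> dia N'"
  using corner_homD(5)[OF nest_hom_corner, of N N' \<beta> x] nest_hom_tri[of N N' \<beta> x] nest_hom_tri[of N N' \<beta> "adj x"]
    dia_corner[of x N]
  by (simp add: dia_iff_tri)

lemma nest_hom_comp: "nest_hom N N' \<beta> \<Longrightarrow> nest_hom N' N'' \<beta>' \<Longrightarrow> nest_hom N N'' (\<lambda>x. \<beta>' (\<beta> x))"
  by (simp add: nest_hom_def corner_hom_def)

lemma corner_hom_pis: "corner_hom d e \<beta> \<Longrightarrow> x \<in> corner d \<Longrightarrow> is_pis x \<Longrightarrow> is_pis (\<beta> x)"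
proof -
  assume h: "corner_hom d e \<beta>" and x: "x \<in> corner d" and p: "is_pis x"
  have "\<beta> (x * adj x * x) = \<beta> x * adj (\<beta> x) * \<beta> x" using x by (simp add: corner_homD[OF h])
  then show ?thesis using p by (simp add: is_pis_def)
qed

text \<open>Nest projections, atoms, 0 and the unit of the target have this property. It lets them
  pass the images of block diagonal elements.\<close>

definition centralizes_dia :: "nest \<Rightarrow> fmat \<Rightarrow> bool" where
  "centralizes_dia N a \<longleftrightarrow> (\<forall>x\<in>dia N. a * x = x * a)"

lemma centralizes_nproj: "centralizes_dia N (nproj N m)"
  by (simp add: centralizes_dia_def dia_commute)

lemma centralizes_natom: "centralizes_dia N (natom N i)"
proof -
  have "natom N i = nproj N (Suc i) - nproj N i" by (simp add: nproj_Suc)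
  then show ?thesis
    by (simp add: centralizes_dia_def dia_commute left_diff_distrib right_diff_distrib)
qed

lemma centralizes_zero: "centralizes_dia N 0" by (simp add: centralizes_dia_def)
lemma centralizes_idm: "centralizes_dia N (idm (ndim N))"
  using dia_corner corner_idm_mult unfolding centralizes_dia_def by metis

text \<open>A relation between compressions of \<open>\<beta> w\<close> passes from one element \<open>w\<close> to a whole block,
  because the block of \<open>w\<close> generates its off-diagonal corner as a bimodule over the diagonal.\<close>

lemma block_spread:
  assumes nd: "nest_data N" "nest_data N'" and h: "nest_hom N N' \<beta>"
    and w: "w \<in> ncorner N" "blk N w i j \<noteq> 0"
    and c: "centralizes_dia N' a" "centralizes_dia N' b" "centralizes_dia N' c"
    and eq: "a * \<beta> w * b = a * \<beta> w * c"
    and y: "y \<in> ncorner N"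
  shows "a * \<beta> (blk N y i j) * b = a * \<beta> (blk N y i j) * c"
proof -
  note ch = nest_hom_corner[OF h]
  note hs = corner_homD[OF ch]
  have wb: "blk N w i j \<in> ncorner N" using nd w by simp
  show ?thesis
  proof (rule corner_ideal_induct[OF wb w(2) y,
      where K = "\<lambda>y. y \<in> ncorner N \<and> a * \<beta> (blk N y i j) * b = a * \<beta> (blk N y i j) * c", THEN conjunct2])
    show "0 \<in> ncorner N \<and> a * \<beta> (blk N 0 i j) * b = a * \<beta> (blk N 0 i j) * c"
      by (simp add: corner_hom_zero[OF ch])
  next
    fix x y assume *: "x \<in> ncorner N \<and> a * \<beta> (blk N x i j) * b = a * \<beta> (blk N x i j) * c"
      "y \<in> ncorner N \<and> a * \<beta> (blk N y i j) * b = a * \<beta> (blk N y i j) * c"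
    then have "\<beta> (blk N (x + y) i j) = \<beta> (blk N x i j) + \<beta> (blk N y i j)"
      using nd by (simp add: distrib_left distrib_right hs)
    then show "x + y \<in> ncorner N \<and> a * \<beta> (blk N (x + y) i j) * b = a * \<beta> (blk N (x + y) i j) * c"
      using * by (simp add: distrib_left distrib_right)
  next
    fix s t assume st: "s \<in> ncorner N" "t \<in> ncorner N"
    \<comment> \<open>Only these diagonal compressions of \<open>s\<close> and \<open>t\<close>
      reach block \<open>(i, j)\<close>, and their images commute with \<open>a\<close>,
      \<open>b\<close> and \<open>c\<close>.\<close>
    let ?s = "blk N s i i" and ?t = "blk N t j j"
    have e: "blk N (s * blk N w i j * t) i j = ?s * w * ?t" by (simp add: mult.assoc)
    have d: "\<beta> ?s \<in> dia N'" "\<beta> ?t \<in> dia N'"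
      using nest_hom_dia[OF nd h] blk_diag_dia[OF nd(1)] st by blast+
    have be: "\<beta> (?s * w * ?t) = \<beta> ?s * \<beta> w * \<beta> ?t"
      using nd w st by (simp add: hs)
    have ca: "a * \<beta> ?s = \<beta> ?s * a" "b * \<beta> ?t = \<beta> ?t * b" "c * \<beta> ?t = \<beta> ?t * c"
      using c d by (auto simp: centralizes_dia_def)
    have "a * \<beta> (?s * w * ?t) * b = \<beta> ?s * (a * \<beta> w * b) * \<beta> ?t"
      unfolding be using ca by (metis mult.assoc)
    also have "\<dots> = \<beta> ?s * (a * \<beta> w * c) * \<beta> ?t" using eq by simp
    also have "\<dots> = a * \<beta> (?s * w * ?t) * c"
      unfolding be using ca by (metis mult.assoc)
    finally show "s * blk N w i j * t \<in> ncorner N \<and> a * \<beta> (blk N (s * blk N w i j * t) i j) * b =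
        a * \<beta> (blk N (s * blk N w i j * t) i j) * c"
      unfolding e using nd w st by simp
  qed
qed

text \<open>In the multiplicity space of \<open>\<beta>\<close> the nest of the target induces for every atom \<open>i\<close> of the source
  an increasing chain of projections indexed by \<open>m\<close>. The relation below says that the \<open>m\<close>-th projection
  for atom \<open>i\<close> is dominated by the \<open>n\<close>-th one for atom \<open>j\<close>.\<close>

definition ple :: "nest \<Rightarrow> nest \<Rightarrow> (fmat \<Rightarrow> fmat) \<Rightarrow> nat \<Rightarrow> nat \<Rightarrow> nat \<Rightarrow> nat \<Rightarrow> bool" where
  "ple N N' \<beta> i m j n \<longleftrightarrow> (\<forall>y\<in>ncorner N.
     nproj N' m * \<beta> (blk N y i j) * nproj N' n = nproj N' m * \<beta> (blk N y i j))"

text \<open>In the multiplicity space: the \<open>a\<close>-th increment of the chain of atom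
  \<open>i\<close> is orthogonal to the \<open>b\<close>-th increment of the chain of atom
  \<open>j\<close>.\<close>

definition unlinked :: "nest \<Rightarrow> nest \<Rightarrow> (fmat \<Rightarrow> fmat) \<Rightarrow> nat \<Rightarrow> nat \<Rightarrow> nat \<Rightarrow> nat \<Rightarrow> bool" where
  "unlinked N N' \<beta> i j a b \<longleftrightarrow> (\<forall>y\<in>ncorner N. natom N' a * \<beta> (blk N y i j) * natom N' b = 0)"

text \<open>By \<open>block_spread\<close> a single element with a nonzero block decides the
  relation for the whole block; this is why test elements of rank one or two are enough
  later.\<close>

lemma ple_rowsI:
  assumes nd: "nest_data N" "nest_data N'" and h: "nest_hom N N' \<beta>"
    and w: "w \<in> ncorner N" "blk N w i j \<noteq> 0"
    and eq: "nproj N' m * \<beta> w * nproj N' n = nproj N' m * \<beta> w"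
  shows "ple N N' \<beta> i m j n"
  unfolding ple_def
proof
  fix y assume y: "y \<in> ncorner N"
  note hs = corner_homD[OF nest_hom_corner[OF h]]
  have "nproj N' m * \<beta> w * nproj N' n = nproj N' m * \<beta> w * idm (ndim N')"
    using eq hs(1)[OF w(1)] nd by (simp add: mult.assoc)
  then have "nproj N' m * \<beta> (blk N y i j) * nproj N' n = nproj N' m * \<beta> (blk N y i j) * idm (ndim N')"
    by (intro block_spread[OF nd h w _ _ _ _ y] centralizes_nproj centralizes_idm)
  moreover have "\<beta> (blk N y i j) \<in> ncorner N'" using hs(1) nd y by simp
  ultimately show "nproj N' m * \<beta> (blk N y i j) * nproj N' n = nproj N' m * \<beta> (blk N y i j)"
    by (simp add: mult.assoc)
qed

lemma adj_swap_nproj: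
  assumes "nest_data N'"
  shows "nproj N' n * adj x * nproj N' m = nproj N' n * adj x \<longleftrightarrow> nproj N' m * x * nproj N' n = x * nproj N' n"
proof -
  have "nproj N' m * x * nproj N' n = x * nproj N' n \<longleftrightarrow> adj (nproj N' m * x * nproj N' n) = adj (x * nproj N' n)"
    by (metis adj_adj)
  then show ?thesis using assms by (simp add: mult.assoc)
qed

lemma ple_colsI:
  assumes nd: "nest_data N" "nest_data N'" and h: "nest_hom N N' \<beta>"
    and w: "w \<in> ncorner N" "blk N w i j \<noteq> 0"
    and eq: "nproj N' m * \<beta> w * nproj N' n = \<beta> w * nproj N' n"
  shows "ple N N' \<beta> j n i m"
proof (rule ple_rowsI[OF nd h, of "adj w"])
  show "adj w \<in> ncorner N" using w by simp
  show "blk N (adj w) j i \<noteq> 0" using w blk_eq_0_adj[OF nd(1)] by blast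
  show "nproj N' n * \<beta> (adj w) * nproj N' m = nproj N' n * \<beta> (adj w)"
    using eq adj_swap_nproj[OF nd(2)] corner_homD(5)[OF nest_hom_corner[OF h] w(1)] by simp
qed

lemma hom_expand_blocks:
  assumes "nest_data N" "corner_hom (ndim N) e \<beta>" "w \<in> ncorner N"
  shows "\<beta> w = (\<Sum>i<natoms N. \<Sum>j<natoms N. \<beta> (blk N w i j))"
proof -
  have "\<beta> w = \<beta> (\<Sum>i<natoms N. \<Sum>j<natoms N. blk N w i j)"
    using corner_expand_blocks[OF assms(1,3)] by simp
  also have "\<dots> = (\<Sum>i<natoms N. \<beta> (\<Sum>j<natoms N. blk N w i j))"
    using assms by (intro corner_hom_sum) auto
  also have "\<dots> = (\<Sum>i<natoms N. \<Sum>j<natoms N. \<beta> (blk N w i j))"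
    using assms by (intro sum.cong refl corner_hom_sum) auto
  finally show ?thesis .
qed

lemma ple_rowsD:
  assumes nd: "nest_data N" "nest_data N'" and h: "nest_hom N N' \<beta>" and w: "w \<in> ncorner N"
    and ple: "\<And>i j. blk N w i j \<noteq> 0 \<Longrightarrow> ple N N' \<beta> i m j n"
  shows "nproj N' m * \<beta> w * nproj N' n = nproj N' m * \<beta> w"
proof -
  have "nproj N' m * \<beta> (blk N w i j) * nproj N' n = nproj N' m * \<beta> (blk N w i j)" for i j
  proof (cases "blk N w i j = 0")
    case False
    then show ?thesis using ple w unfolding ple_def by blast
  qed (simp add: corner_hom_zero[OF nest_hom_corner[OF h]])
  then show ?thesis
    unfolding hom_expand_blocks[OF nd(1) nest_hom_corner[OF h] w] sum_distrib_left sum_distrib_right by simp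
qed

lemma ple_colsD:
  assumes nd: "nest_data N" "nest_data N'" and h: "nest_hom N N' \<beta>" and w: "w \<in> ncorner N"
    and ple: "\<And>i j. blk N w i j \<noteq> 0 \<Longrightarrow> ple N N' \<beta> j n i m"
  shows "nproj N' m * \<beta> w * nproj N' n = \<beta> w * nproj N' n"
proof -
  have "nproj N' n * \<beta> (adj w) * nproj N' m = nproj N' n * \<beta> (adj w)"
    using ple blk_eq_0_adj[OF nd(1)] w by (intro ple_rowsD[OF nd h]) auto
  then show ?thesis
    using adj_swap_nproj[OF nd(2)] corner_homD(5)[OF nest_hom_corner[OF h] w] by simp
qed

text \<open>Block \<open>(i, k)\<close> is generated by products that pass through the nonzero atom
  \<open>j\<close>. Between the two factors \<open>nproj N' n\<close> is inserted by the first
  relation; then the second one absorbs \<open>nproj N' p\<close>.\<close>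

lemma ple_trans:
  assumes nd: "nest_data N" "nest_data N'" and h: "nest_hom N N' \<beta>" and j: "j < natoms N"
    and 1: "ple N N' \<beta> i m j n" and 2: "ple N N' \<beta> j n k p"
  shows "ple N N' \<beta> i m k p"
  unfolding ple_def
proof
  fix y assume y: "y \<in> ncorner N"
  note ch = nest_hom_corner[OF h]
  note hs = corner_homD[OF ch]
  let ?P = "nproj N' m" and ?R = "nproj N' p"
  show "?P * \<beta> (blk N y i k) * ?R = ?P * \<beta> (blk N y i k)"
  proof (rule corner_ideal_induct[OF natom_corner[OF nd(1), of j] _ y,
      where K = "\<lambda>y. y \<in> ncorner N \<and> ?P * \<beta> (blk N y i k) * ?R = ?P * \<beta> (blk N y i k)", THEN conjunct2])
    show "natom N j \<noteq> 0" using natom_nonzero[OF nd(1)] j by blast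
    show "0 \<in> ncorner N \<and> ?P * \<beta> (blk N 0 i k) * ?R = ?P * \<beta> (blk N 0 i k)"
      by (simp add: corner_hom_zero[OF ch])
  next
    fix x y assume *: "x \<in> ncorner N \<and> ?P * \<beta> (blk N x i k) * ?R = ?P * \<beta> (blk N x i k)"
      "y \<in> ncorner N \<and> ?P * \<beta> (blk N y i k) * ?R = ?P * \<beta> (blk N y i k)"
    then have "\<beta> (blk N (x + y) i k) = \<beta> (blk N x i k) + \<beta> (blk N y i k)"
      using nd by (simp add: distrib_left distrib_right hs)
    then show "x + y \<in> ncorner N \<and> ?P * \<beta> (blk N (x + y) i k) * ?R = ?P * \<beta> (blk N (x + y) i k)"
      using * by (simp add: distrib_left distrib_right)
  next
    fix s t assume st: "s \<in> ncorner N" "t \<in> ncorner N"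
    let ?s = "blk N s i j" and ?t = "blk N t j k"
    have e: "blk N (s * natom N j * t) i k = ?s * ?t"
      using nd by (simp add: mult.assoc nsimps)
    have be: "\<beta> (?s * ?t) = \<beta> ?s * \<beta> ?t" using nd st by (intro hs(4)) auto
    have "?P * \<beta> (?s * ?t) * ?R = ?P * \<beta> ?s * nproj N' n * \<beta> ?t * ?R"
      unfolding be using 1 st unfolding ple_def by (simp add: mult.assoc[symmetric])
    also have "\<dots> = ?P * \<beta> ?s * (nproj N' n * \<beta> ?t * ?R)" by (simp add: mult.assoc)
    also have "\<dots> = ?P * \<beta> ?s * (nproj N' n * \<beta> ?t)" using 2 st unfolding ple_def by simp
    also have "\<dots> = ?P * \<beta> ?s * nproj N' n * \<beta> ?t" by (simp add: mult.assoc)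
    also have "\<dots> = ?P * \<beta> (?s * ?t)" unfolding be using 1 st unfolding ple_def by (simp add: mult.assoc)
    finally show "s * natom N j * t \<in> ncorner N \<and>
        ?P * \<beta> (blk N (s * natom N j * t) i k) * ?R = ?P * \<beta> (blk N (s * natom N j * t) i k)"
      unfolding e using nd st by simp
  qed
qed

text \<open>For \<open>i \<le> j\<close> block \<open>(i, j)\<close> belongs to the nest algebra, so
  its image leaves every nest projection of the target invariant. Read through the adjoint, this
  puts the chain of the later atom below that of the earlier one.\<close>

lemma ple_atom_mono:
  assumes nd: "nest_data N" "nest_data N'" and h: "nest_hom N N' \<beta>" and "i \<le> j"
  shows "ple N N' \<beta> j m i m"
  unfolding ple_def
proof
  fix y assume y: "y \<in> ncorner N"
  have "blk N (adj y) i j \<in> tri N" using nd y assms(4) by (intro blk_tri) auto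
  then have "\<beta> (blk N (adj y) i j) \<in> tri N'" using nest_hom_tri[OF h] by blast
  then have "nproj N' m * \<beta> (blk N (adj y) i j) * nproj N' m = \<beta> (blk N (adj y) i j) * nproj N' m"
    by (simp add: tri_def)
  moreover have "adj (\<beta> (blk N (adj y) i j)) = \<beta> (blk N y j i)"
    using corner_homD(5)[OF nest_hom_corner[OF h], of "blk N (adj y) i j"] nd y by (simp add: mult.assoc)
  ultimately show "nproj N' m * \<beta> (blk N y j i) * nproj N' m = nproj N' m * \<beta> (blk N y j i)"
    using adj_swap_nproj[OF nd(2), of m "\<beta> (blk N (adj y) i j)" m] by simp
qed

text \<open>When the two atoms joined by any block of \<open>w\<close> have equal chains, the nest
  of the target does not see a difference between row and column.\<close>

lemma hom_dia_of_ple: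
  assumes nd: "nest_data N" "nest_data N'" and h: "nest_hom N N' \<beta>" and w: "w \<in> ncorner N"
    and ple: "\<And>i j m. blk N w i j \<noteq> 0 \<Longrightarrow> ple N N' \<beta> i m j m \<and> ple N N' \<beta> j m i m"
  shows "\<beta> w \<in> dia N'"
  using ple_rowsD[OF nd h w, of m m for m] ple_colsD[OF nd h w, of m m for m] ple
    corner_homD(1)[OF nest_hom_corner[OF h] w]
  by (auto simp: dia_def)

section \<open>Unit vectors\<close>

text \<open>Vectors are matrices supported in column 0; \<open>x * adj y\<close> is then the rank one operator of \<open>x\<close> and \<open>y\<close>.\<close>

definition unit_vec_in :: "nat \<Rightarrow> fmat \<Rightarrow> bool" where
  "unit_vec_in n x \<longleftrightarrow> x \<in> corner n \<and> adj x * x = munit 0 0"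

lemma unit_vec_col: "unit_vec_in n x \<Longrightarrow> x * munit 0 0 = x"
proof -
  assume "unit_vec_in n x"
  then have 1: "adj x * x = munit 0 0" by (simp add: unit_vec_in_def)
  have 2: "adj x * (x * z) = munit 0 0 * z" for z using 1 by (simp add: mult.assoc[symmetric])
  have "adj (x * munit 0 0 - x) * (x * munit 0 0 - x) = 0"
    unfolding adj_minus adj_mult adj_munit
    by (simp add: left_diff_distrib right_diff_distrib mult.assoc 1 2)
  then have "x * munit 0 0 - x = 0" by (simp only: adj_mult_eq_0)
  then show ?thesis by simp
qed

lemma unit_vec_row: "unit_vec_in n x \<Longrightarrow> munit 0 0 * adj x = adj x"
  using arg_cong[OF unit_vec_col, of n x adj] by simp

lemma unit_vec_nonzero: "unit_vec_in n x \<Longrightarrow> x \<noteq> 0"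
  by (metis unit_vec_in_def mult_zero_right munit_nonzero)

lemma unit_vec_simps:
  assumes "unit_vec_in n x"
  shows "adj x * x = munit 0 0" "adj x * (x * z) = munit 0 0 * z" "x * (munit 0 0 * z) = x * z"
    "x * munit 0 0 = x" "munit 0 0 * adj x = adj x" "munit 0 0 * (adj x * z) = adj x * z" "x \<in> corner n"
  using assms unit_vec_col[OF assms] unit_vec_row[OF assms]
  by (auto simp: unit_vec_in_def mult.assoc[symmetric])

text \<open>A nonzero column of \<open>a\<close> is moved to column 0 by a matrix unit and divided
  by its Euclidean length.\<close>

lemma range_unit_vec:
  assumes a: "a \<in> corner n" "a \<noteq> 0"
  obtains t where "t \<in> corner n" "unit_vec_in n (a * t)"
proof -
  obtain i j where ij: "ent a i j \<noteq> 0" using nonzero_ent a(2) by blast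
  then have lt: "i < n" "j < n" using a(1) by (auto simp: corner_def)
  define r where "r = (\<Sum>k<n. (cmod (ent a k j))\<^sup>2)"
  have "(cmod (ent a i j))\<^sup>2 \<le> r" unfolding r_def
    by (rule member_le_sum) (use lt in auto)
  then have r: "r > 0" using ij by (metis norm_le_zero_iff not_le order_less_le_trans zero_less_power)
  define c where "c = complex_of_real (1 / sqrt r)"
  define t where "t = scl c (munit j 0)"
  have e: "ent (adj a * a) j j = of_real r" unfolding r_def
    by (rule ent_adj_mult_diag) (use a(1) in \<open>auto simp: corner_def\<close>)
  have "adj (a * t) * (a * t) = scl (cnj c * c) (munit 0 j * (adj a * a) * munit j 0)"
    by (simp add: t_def mult.assoc mult.commute[of c])
  also have "\<dots> = scl (cnj c * c * of_real r) (munit 0 0)"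
    unfolding munit_mult_munit e by simp
  also have "cnj c * c * of_real r = 1"
  proof -
    have "cnj c * c * of_real r = complex_of_real (1 / sqrt r * (1 / sqrt r) * r)"
      by (simp only: c_def complex_cnj_complex_of_real of_real_mult)
    also have "1 / sqrt r * (1 / sqrt r) * r = 1" using r by simp
    finally show ?thesis by simp
  qed
  finally have "adj (a * t) * (a * t) = munit 0 0" by simp
  moreover have "t \<in> corner n" using lt by (simp add: t_def)
  ultimately show ?thesis using that a(1) by (simp add: unit_vec_in_def)
qed

lemma atom_unit_vec_exists:
  assumes nd: "nest_data N" and i: "i < natoms N"
  shows "\<exists>x. unit_vec_in (ndim N) x \<and> natom N i * x = x"
proof -
  obtain t where "t \<in> ncorner N" "unit_vec_in (ndim N) (natom N i * t)"
    using range_unit_vec[of "natom N i" "ndim N"] nd i natom_nonzero[OF nd] by auto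
  then show ?thesis using nd by (metis natom_mult mult.assoc)
qed

definition avec :: "nest \<Rightarrow> nat \<Rightarrow> fmat" where
  "avec N i = (SOME x. unit_vec_in (ndim N) x \<and> natom N i * x = x)"

lemma avec:
  assumes "nest_data N" "i < natoms N"
  shows "unit_vec_in (ndim N) (avec N i)" "natom N i * avec N i = avec N i"
  using someI_ex[OF atom_unit_vec_exists[OF assms]] by (simp_all add: avec_def)

lemma atom_vec_row: "nest_data N \<Longrightarrow> natom N i * x = x \<Longrightarrow> adj x * natom N i = adj x"
  by (metis adj_mult natom_adj)

lemma atom_vec_block:
  assumes nd: "nest_data N" and "natom N k * y = y" "natom N k' * x = x"
  shows "blk N (y * adj x) i j = (if i = k \<and> j = k' then y * adj x else 0)"
proof -
  have "blk N (y * adj x) i j = natom N i * (natom N k * y) * (adj x * natom N k' * natom N j)"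
    using assms atom_vec_row[OF nd assms(3)] by (simp add: mult.assoc)
  also have "\<dots> = (if i = k \<and> j = k' then natom N k * y * (adj x * natom N k') else 0)"
    using nd by (auto simp: mult.assoc nsimps)
  finally show ?thesis using assms atom_vec_row[OF nd assms(3)] by simp
qed

section \<open>Test partial isometries of rank one and two\<close>

lemma rank_one_nonzero: "unit_vec_in n x \<Longrightarrow> unit_vec_in m y \<Longrightarrow> x * adj y \<noteq> 0"
proof
  assume u: "unit_vec_in n x" "unit_vec_in m y" and "x * adj y = 0"
  then have "x * (adj y * y) = 0" by (simp add: mult.assoc[symmetric])
  then show False using unit_vec_simps[OF u(1)] unit_vec_simps[OF u(2)] unit_vec_nonzero[OF u(1)] by simp
qed

lemma rank_one_pis: "unit_vec_in n x \<Longrightarrow> unit_vec_in m y \<Longrightarrow> is_pis (x * adj y)"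
  using unit_vec_simps[of n x] unit_vec_simps[of m y] by (simp add: is_pis_def mult.assoc)

lemma rank_two_pis:
  assumes u: "unit_vec_in n x" "unit_vec_in n y" "unit_vec_in n x'" "unit_vec_in n y'"
    and o: "adj y * y' = 0" "adj x * x' = 0"
  shows "is_pis (y * adj x + y' * adj x')"
proof -
  have o': "adj y' * y = 0" "adj x' * x = 0"
    using arg_cong[OF o(1), of adj] arg_cong[OF o(2), of adj] by simp_all
  have oz: "adj y * (y' * z) = 0" "adj x * (x' * z) = 0" "adj y' * (y * z) = 0" "adj x' * (x * z) = 0" for z
    using o o' by (simp_all add: mult.assoc[symmetric])
  show ?thesis
    using unit_vec_simps[OF u(1)] unit_vec_simps[OF u(2)] unit_vec_simps[OF u(3)] unit_vec_simps[OF u(4)] o o' oz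
    by (simp add: is_pis_def algebra_simps)
qed

lemma single_block_OP:
  assumes nd: "nest_data N" and u: "unit_vec_in (ndim N) y" "unit_vec_in (ndim N) x"
    and q: "natom N k * y = y" "natom N k' * x = x" and k: "k \<le> k'"
  shows "OP N (y * adj x)"
proof -
  note b = atom_vec_block[OF nd q]
  have "y * adj x \<in> tri N" using u k by (auto simp: tri_iff_blocks[OF nd] b unit_vec_in_def)
  then show ?thesis unfolding OP_iff_blocks[OF nd] b using rank_one_pis[OF u] by (auto split: if_splits)
qed

text \<open>Provides test elements with two prescribed nonzero blocks. Orthogonality of the vectors
  is a premise because the blocks may share a row or a column, where it does not come from distinct
  atoms.\<close>

lemma two_block_facts:
  assumes nd: "nest_data N"
    and u: "unit_vec_in (ndim N) y" "unit_vec_in (ndim N) x" "unit_vec_in (ndim N) y'" "unit_vec_in (ndim N) x'"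
    and q: "natom N k * y = y" "natom N k' * x = x" "natom N l * y' = y'" "natom N l' * x' = x'"
    and o: "adj y * y' = 0" "adj x * x' = 0" and ne: "(k, k') \<noteq> (l, l')"
    and le: "k \<le> k'" "l \<le> l'"
  defines "z \<equiv> y * adj x + y' * adj x'"
  shows "z \<in> tri N" "is_pis z"
    "blk N z i j = (if i = k \<and> j = k' then y * adj x else if i = l \<and> j = l' then y' * adj x' else 0)"
proof -
  have b: "blk N z i j = (if i = k \<and> j = k' then y * adj x else if i = l \<and> j = l' then y' * adj x' else 0)" for i j
    using atom_vec_block[OF nd q(1,2), of i j] atom_vec_block[OF nd q(3,4), of i j] ne
    by (auto simp: z_def distrib_left distrib_right)
  then show "blk N z i j = (if i = k \<and> j = k' then y * adj x else if i = l \<and> j = l' then y' * adj x' else 0)" .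
  have "z \<in> ncorner N" using u by (simp add: z_def unit_vec_in_def)
  then show "z \<in> tri N" using le by (auto simp: tri_iff_blocks[OF nd] b)
  show "is_pis z" unfolding z_def using rank_two_pis[OF u(2,1,4,3) o] .
qed

lemma two_block_OC:
  assumes nd: "nest_data N"
    and u: "unit_vec_in (ndim N) y" "unit_vec_in (ndim N) x" "unit_vec_in (ndim N) y'" "unit_vec_in (ndim N) x'"
    and q: "natom N k * y = y" "natom N k' * x = x" "natom N l * y' = y'" "natom N l' * x' = x'"
    and o: "adj y * y' = 0" "adj x * x' = 0" and ne: "(k, k') \<noteq> (l, l')"
    and le: "k \<le> k'" "l \<le> l'" and nn: "\<not> (k < l \<and> l' < k')" "\<not> (l < k \<and> k' < l')"
  shows "OC N (y * adj x + y' * adj x')"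
  using two_block_facts[OF nd u q o ne le] nn rank_one_pis[OF u(1,2)] rank_one_pis[OF u(3,4)]
  by (auto simp: OC_iff_blocks[OF nd] is_pis_def split: if_splits)

lemma two_block_OP:
  assumes nd: "nest_data N"
    and u: "unit_vec_in (ndim N) y" "unit_vec_in (ndim N) x" "unit_vec_in (ndim N) y'" "unit_vec_in (ndim N) x'"
    and q: "natom N k * y = y" "natom N k' * x = x" "natom N l * y' = y'" "natom N l' * x' = x'"
    and o: "adj y * y' = 0" "adj x * x' = 0"
    and le: "k \<le> k'" "l \<le> l'" and lt: "k < l" "k' < l'"
  shows "OP N (y * adj x + y' * adj x')"
proof -
  have ne: "(k, k') \<noteq> (l, l')" using lt by auto
  show ?thesis
    using two_block_facts[OF nd u q o ne le] lt
    by (auto simp: OP_iff_blocks[OF nd] split: if_splits)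
qed

lemma atom_vec_orthogonal:
  assumes nd: "nest_data N" and "natom N k * y = y" "natom N l * y' = y'" "k \<noteq> l"
  shows "adj y * y' = 0"
proof -
  have "adj y * y' = adj y * (natom N k * (natom N l * y'))"
    using assms(3) atom_vec_row[OF nd assms(2)] by (simp add: mult.assoc[symmetric])
  then show ?thesis using nd assms(4) by (simp add: nsimps)
qed

section \<open>Threefold compositions\<close>

lemma atom_rank_one_block:
  assumes nd: "nest_data N" and "i < natoms N" "j < natoms N"
  shows "blk N (avec N i * adj (avec N j)) i j = avec N i * adj (avec N j)"
    "avec N i * adj (avec N j) \<noteq> 0" "avec N i * adj (avec N j) \<in> ncorner N"
  using atom_vec_block[OF nd, of i "avec N i" j "avec N j"] avec[OF nd assms(2)] avec[OF nd assms(3)]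
    rank_one_nonzero by (auto simp: unit_vec_in_def)

text \<open>The intertwining of nest projections by \<open>\<beta> w\<close> becomes equality of
  chain members, with one partner position valid for all nonzero blocks of \<open>w\<close> at once.
  Comparing two blocks through the common partner drives the order preserving case.\<close>

lemma OP_hom_ple:
  assumes nd: "nest_data N" "nest_data N'" and h: "nest_hom N N' \<beta>" and w: "w \<in> ncorner N"
    and op: "OP N' (\<beta> w)"
  shows "\<exists>n. \<forall>i j. blk N w i j \<noteq> 0 \<longrightarrow> ple N N' \<beta> i m j n \<and> ple N N' \<beta> j n i m"
    "\<exists>m. \<forall>i j. blk N w i j \<noteq> 0 \<longrightarrow> ple N N' \<beta> i m j n \<and> ple N N' \<beta> j n i m"
proof -
  have *: "\<forall>i j. blk N w i j \<noteq> 0 \<longrightarrow> ple N N' \<beta> i m j n \<and> ple N N' \<beta> j n i m"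
    if eq: "nproj N' m * \<beta> w = \<beta> w * nproj N' n" for m n
  proof (intro allI impI conjI)
    fix i j assume nz: "blk N w i j \<noteq> 0"
    have pp: "nproj N' m * nproj N' m = nproj N' m" "nproj N' n * nproj N' n = nproj N' n"
      using nproj_mult[OF nd(2)] by simp_all
    have 1: "nproj N' m * \<beta> w * nproj N' n = nproj N' m * \<beta> w" using eq pp by (simp add: mult.assoc)
    then show "ple N N' \<beta> i m j n" using ple_rowsI[OF nd h w nz] by blast
    have "nproj N' m * \<beta> w * nproj N' n = \<beta> w * nproj N' n" using 1 eq by simp
    then show "ple N N' \<beta> j n i m" using ple_colsI[OF nd h w nz] by blast
  qed
  show "\<exists>n. \<forall>i j. blk N w i j \<noteq> 0 \<longrightarrow> ple N N' \<beta> i m j n \<and> ple N N' \<beta> j n i m"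
    using op * unfolding OP_def by blast
  show "\<exists>m. \<forall>i j. blk N w i j \<noteq> 0 \<longrightarrow> ple N N' \<beta> i m j n \<and> ple N N' \<beta> j n i m"
    using op * unfolding OP_def by blast
qed

text \<open>If an order preserving map does not separate two atoms, it separates none: compare with the
  image of \<open>e\<^sub>a\<^sub>b + e\<^sub>b\<^sub>c\<close>.\<close>

lemma OP_hom_collapse:
  assumes nd: "nest_data N" "nest_data N'" and h: "nest_hom N N' \<beta>"
    and op: "\<And>v. OP N v \<Longrightarrow> OP N' (\<beta> v)"
    and ab: "a < b" "b < natoms N" and eq: "\<And>m. ple N N' \<beta> a m b m"
    and x: "x \<in> ncorner N"
  shows "\<beta> x \<in> dia N'"
proof -
  let ?L = "\<lambda>i j. \<forall>m. ple N N' \<beta> i m j m"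
  note tr = ple_trans[OF nd h]
  have mono: "?L j i" if "i \<le> j" for i j using ple_atom_mono[OF nd h that] by blast
  have a: "a < natoms N" using ab by simp
  \<comment> \<open>The test elements are sums of two rank one operators that share the middle atom
    \<open>j\<close>, once as column and once as row.\<close>
  have z: "OP N' (\<beta> (avec N i * adj (avec N j) + avec N j * adj (avec N k)))"
    "avec N i * adj (avec N j) + avec N j * adj (avec N k) \<in> ncorner N"
    "blk N (avec N i * adj (avec N j) + avec N j * adj (avec N k)) i j \<noteq> 0"
    "blk N (avec N i * adj (avec N j) + avec N j * adj (avec N k)) j k \<noteq> 0"
    if "i < j" "j < k" "k < natoms N" for i j k
  proof -
    have lt: "i < natoms N" "j < natoms N" using that by auto
    note v = avec[OF nd(1) lt(1)] avec[OF nd(1) lt(2)] avec[OF nd(1) that(3)]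
    have o: "adj (avec N i) * avec N j = 0" "adj (avec N j) * avec N k = 0"
      using atom_vec_orthogonal[OF nd(1) v(2,4)] atom_vec_orthogonal[OF nd(1) v(4,6)] that by auto
    show "OP N' (\<beta> (avec N i * adj (avec N j) + avec N j * adj (avec N k)))"
      by (intro op two_block_OP[OF nd(1) v(1,3,3,5) v(2,4,4,6) o]) (use that in auto)
    have ne: "(i, j) \<noteq> (j, k)" using that by auto
    note f = two_block_facts[OF nd(1) v(1,3,3,5) v(2,4,4,6) o ne]
    show "avec N i * adj (avec N j) + avec N j * adj (avec N k) \<in> ncorner N"
      using f(1) that tri_corner by auto
    show "blk N (avec N i * adj (avec N j) + avec N j * adj (avec N k)) i j \<noteq> 0"
      "blk N (avec N i * adj (avec N j) + avec N j * adj (avec N k)) j k \<noteq> 0"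
      unfolding f(3)[OF less_imp_le[OF that(1)] less_imp_le[OF that(2)]]
      using rank_one_nonzero[OF v(1,3)] rank_one_nonzero[OF v(3,5)] that by auto
  qed
  have up: "?L b c" if c: "b < c" "c < natoms N" for c
  proof
    fix n
    note zz = z[OF ab(1) c]
    obtain m where m: "\<forall>i j. blk N (avec N a * adj (avec N b) + avec N b * adj (avec N c)) i j \<noteq> 0 \<longrightarrow>
        ple N N' \<beta> i m j n \<and> ple N N' \<beta> j n i m"
      using OP_hom_ple(2)[OF nd h zz(2) zz(1)] by blast
    \<comment> \<open>Member \<open>n\<close> of the chain of \<open>b\<close> is below member
      \<open>m\<close> of \<open>a\<close>, which by assumption is below member \<open>m\<close> of
      \<open>b\<close>, which is below member \<open>n\<close> of \<open>c\<close>.\<close>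
    have "ple N N' \<beta> b n a m" "ple N N' \<beta> b m c n" using m zz(3,4) by blast+
    then show "ple N N' \<beta> b n c n" using tr[OF a _ eq] tr[OF ab(2)] by blast
  qed
  have down: "?L c a" if c: "c < a" for c
  proof
    fix m
    note zz = z[OF c ab]
    obtain n where n: "\<forall>i j. blk N (avec N c * adj (avec N a) + avec N a * adj (avec N b)) i j \<noteq> 0 \<longrightarrow>
        ple N N' \<beta> i m j n \<and> ple N N' \<beta> j n i m"
      using OP_hom_ple(1)[OF nd h zz(2) zz(1)] by blast
    have "ple N N' \<beta> c m a n" "ple N N' \<beta> b n a m" using n zz(3,4) by blast+
    then show "ple N N' \<beta> c m a m" using tr[OF a _ eq] tr[OF ab(2)] by blast
  qed
  \<comment> \<open>Atom \<open>a\<close> serves as a hub: its chain is compared with every other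
    one, so all chains agree.\<close>
  have toa: "?L c a" if "c < natoms N" for c
    using down[of c] mono[of a c] by (meson not_less)
  have ofa: "?L a c" if "c < natoms N" for c
  proof (cases "c \<le> b")
    case True
    then show ?thesis using tr[OF ab(2) eq] mono[of c b] by blast
  next
    case False
    then show ?thesis using tr[OF ab(2) eq] up[of c] that by auto
  qed
  have "?L i j" if "i < natoms N" "j < natoms N" for i j
    using tr[OF a] toa[OF that(1)] ofa[OF that(2)] by blast
  then show ?thesis
    using blk_nonzero_less[OF nd(1)] by (intro hom_dia_of_ple[OF nd h x]) blast
qed

text \<open>If \<open>\<beta>0\<close> is order preserving, the pair \<beta>1, \<beta>2 does the
  rest. Otherwise some \<open>\<beta>0 v'\<close> has nested blocks while
  \<open>\<beta>1 (\<beta>0 v')\<close> is order preserving, which forces two atoms to have equal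
  chains under \<beta>1. Then \<open>OP_hom_collapse\<close> sends everything to the diagonal, in
  particular the image of the given \<open>v\<close>, and a diagonal partial isometry is order
  preserving.\<close>

lemma OP_triple:
  assumes nd: "nest_data N0" "nest_data N1" "nest_data N2" "nest_data N3"
    and h: "nest_hom N0 N1 \<beta>0" "nest_hom N1 N2 \<beta>1" "nest_hom N2 N3 \<beta>2"
    and op: "\<And>v. OP N0 v \<Longrightarrow> OP N2 (\<beta>1 (\<beta>0 v))" "\<And>v. OP N1 v \<Longrightarrow> OP N3 (\<beta>2 (\<beta>1 v))"
    and v: "OP N0 v"
  shows "OP N3 (\<beta>2 (\<beta>1 (\<beta>0 v)))"
proof (cases "\<forall>v. OP N0 v \<longrightarrow> OP N1 (\<beta>0 v)")
  case True
  then show ?thesis using op v by blast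
next
  case False
  then obtain v' where v': "OP N0 v'" "\<not> OP N1 (\<beta>0 v')" by blast
  define w where "w = \<beta>0 v'"
  have tri: "w \<in> tri N1" and pis: "is_pis w"
    using v' nest_hom_tri[OF h(1)] corner_hom_pis[OF nest_hom_corner[OF h(1)] tri_corner]
    by (auto simp: w_def OP_def)
  have w: "w \<in> ncorner N1" using tri tri_corner by blast
  obtain i j s t where nz: "blk N1 w i j \<noteq> 0" "blk N1 w s t \<noteq> 0" and st: "s \<le> i" "j \<le> t" "\<not> (s = i \<and> t = j)"
    using v'(2) tri pis unfolding w_def[symmetric] OP_iff_blocks[OF nd(2)] by blast
  have opw: "OP N2 (\<beta>1 w)" using op v' by (simp add: w_def)
  note lt = blk_nonzero_less[OF nd(2) nz(1)] blk_nonzero_less[OF nd(2) nz(2)]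
  note tr = ple_trans[OF nd(2,3) h(2)]
  have ij: "i \<le> j" using tri_block_le[OF nd(2) tri nz(1)] .
  \<comment> \<open>Nested blocks differ in their rows or in their columns. Their common partner
    position, combined with monotonicity in the atoms, gives the two differing atoms equal
    chains.\<close>
  have "\<exists>a b. a < b \<and> b < natoms N1 \<and> (\<forall>m. ple N1 N2 \<beta>1 a m b m)"
  proof (cases "s = i")
    case False
    have "ple N1 N2 \<beta>1 s m i m" for m
    proof -
      obtain n where n: "\<forall>i j. blk N1 w i j \<noteq> 0 \<longrightarrow> ple N1 N2 \<beta>1 i m j n \<and> ple N1 N2 \<beta>1 j n i m"
        using OP_hom_ple(1)[OF nd(2,3) h(2) w opw] by blast
      have "ple N1 N2 \<beta>1 s m t n" using n nz by blast
      moreover have "ple N1 N2 \<beta>1 t n j n" using ple_atom_mono[OF nd(2,3) h(2) st(2)] .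
      moreover have "ple N1 N2 \<beta>1 j n i m" using n nz by blast
      ultimately show ?thesis using tr lt by meson
    qed
    then show ?thesis using False st lt by (intro exI[of _ s] exI[of _ i]) auto
  next
    case True
    have "ple N1 N2 \<beta>1 j n t n" for n
    proof -
      obtain m where n: "\<forall>i j. blk N1 w i j \<noteq> 0 \<longrightarrow> ple N1 N2 \<beta>1 i m j n \<and> ple N1 N2 \<beta>1 j n i m"
        using OP_hom_ple(2)[OF nd(2,3) h(2) w opw] by blast
      have "ple N1 N2 \<beta>1 j n i m" "ple N1 N2 \<beta>1 s m t n" using n nz by blast+
      moreover have "ple N1 N2 \<beta>1 i m s m" using ple_atom_mono[OF nd(2,3) h(2) st(1)] .
      ultimately show ?thesis using tr lt by meson
    qed
    then show ?thesis using True st lt by (intro exI[of _ j] exI[of _ t]) auto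
  qed
  then obtain a b where ab: "a < b" "b < natoms N1" and eq: "\<And>m. ple N1 N2 \<beta>1 a m b m" by blast
  note hc = nest_hom_comp[OF h(2,3)]
  have eq': "ple N1 N3 (\<lambda>x. \<beta>2 (\<beta>1 x)) a m b m" for m
    unfolding ple_def
  proof
    fix y assume y: "y \<in> ncorner N1"
    have yb: "blk N1 y a b \<in> ncorner N1" using nd y by simp
    \<comment> \<open>Equal chains put the image of block \<open>(a, b)\<close> into the diagonal,
      which \<beta>2 preserves; so \<beta>2 cannot separate the two atoms again.\<close>
    have "\<beta>1 (blk N1 y a b) \<in> dia N2"
    proof (rule hom_dia_of_ple[OF nd(2,3) h(2) yb])
      fix i j m assume "blk N1 (blk N1 y a b) i j \<noteq> 0"
      then have "i = a" "j = b" using nd by (auto simp: mult.assoc nsimps split: if_splits)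
      then show "ple N1 N2 \<beta>1 i m j m \<and> ple N1 N2 \<beta>1 j m i m"
        using eq ple_atom_mono[OF nd(2,3) h(2), of a b] ab by auto
    qed
    then have d: "\<beta>2 (\<beta>1 (blk N1 y a b)) \<in> dia N3" using nest_hom_dia[OF nd(3,4) h(3)] by blast
    show "nproj N3 m * \<beta>2 (\<beta>1 (blk N1 y a b)) * nproj N3 m = nproj N3 m * \<beta>2 (\<beta>1 (blk N1 y a b))"
      using dia_commute[OF d, of m] nd(4) by (simp add: mult.assoc nsimps)
  qed
  have "\<beta>0 v \<in> ncorner N1" using v nest_hom_tri[OF h(1)] tri_corner by (auto simp: OP_def)
  then have d: "\<beta>2 (\<beta>1 (\<beta>0 v)) \<in> dia N3"
    using OP_hom_collapse[OF nd(2,4) hc op(2) ab eq'] by blast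
  have "is_pis (\<beta>2 (\<beta>1 (\<beta>0 v)))"
    using op(1)[OF v] corner_hom_pis[OF nest_hom_corner[OF h(3)] tri_corner] by (auto simp: OP_def)
  then show ?thesis
    using d dia_tri[OF nd(4) d] dia_commute[OF d] unfolding OP_def by blast
qed

text \<open>The chain of atom \<open>i\<close> made concrete: \<open>\<beta> (avec N i)\<close>
  carries the multiplicity space, the range of \<open>\<beta> (munit 0 0)\<close>, isometrically
  into the range of \<open>\<beta> (natom N i)\<close>, and the nest projection is pulled back along
  it.\<close>

definition hproj :: "nest \<Rightarrow> nest \<Rightarrow> (fmat \<Rightarrow> fmat) \<Rightarrow> nat \<Rightarrow> nat \<Rightarrow> fmat" where
  "hproj N N' \<beta> i m = adj (\<beta> (avec N i)) * nproj N' m * \<beta> (avec N i)"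

lemma hproj_adj: "nest_data N' \<Longrightarrow> adj (hproj N N' \<beta> i m) = hproj N N' \<beta> i m"
  by (simp add: hproj_def mult.assoc)

lemma avec_diag_dia:
  assumes nd: "nest_data N" and i: "i < natoms N"
  shows "avec N i * adj (avec N i) \<in> dia N"
  using blk_diag_dia[OF nd, of "avec N i * adj (avec N i)" i] atom_rank_one_block[OF nd i i] by simp

text \<open>The chain relation becomes the order of projections: between the two nest projections
  stands the image of a rank one operator of block \<open>(i, j)\<close>, to which the relation
  applies.\<close>

lemma hproj_mult:
  assumes nd: "nest_data N" "nest_data N'" and h: "nest_hom N N' \<beta>"
    and i: "i < natoms N" "j < natoms N" and le: "ple N N' \<beta> i m j n"
  shows "hproj N N' \<beta> i m * hproj N N' \<beta> j n = hproj N N' \<beta> i m"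
proof -
  note hs = corner_homD[OF nest_hom_corner[OF h]]
  let ?x = "avec N i" and ?y = "avec N j"
  note ux = unit_vec_simps[OF avec(1)[OF nd(1) i(1)]] and uy = unit_vec_simps[OF avec(1)[OF nd(1) i(2)]]
  have e: "\<beta> ?x * adj (\<beta> ?y) = \<beta> (?x * adj ?y)" using ux uy by (simp add: hs)
  have e': "\<beta> (?x * adj ?y) * \<beta> ?y = \<beta> ?x"
    using ux uy hs(4)[of "?x * adj ?y" ?y] by (simp add: mult.assoc)
  have "hproj N N' \<beta> i m * hproj N N' \<beta> j n
      = adj (\<beta> ?x) * (nproj N' m * (\<beta> ?x * adj (\<beta> ?y)) * nproj N' n) * \<beta> ?y"
    by (simp add: hproj_def mult.assoc)
  also have "nproj N' m * (\<beta> ?x * adj (\<beta> ?y)) * nproj N' n = nproj N' m * \<beta> (?x * adj ?y)"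
    unfolding e using le atom_rank_one_block[OF nd(1) i] unfolding ple_def by metis
  also have "adj (\<beta> ?x) * (nproj N' m * \<beta> (?x * adj ?y)) * \<beta> ?y = hproj N N' \<beta> i m"
    using e' by (simp add: hproj_def mult.assoc)
  finally show ?thesis .
qed

text \<open>\<open>avec N i * adj (avec N i)\<close> is block diagonal, so its image commutes with
  \<open>a\<close>; compressing an idempotent by a commuting projection gives an idempotent.\<close>

lemma compressed_central_idem:
  assumes nd: "nest_data N" "nest_data N'" and h: "nest_hom N N' \<beta>" and i: "i < natoms N"
    and a: "centralizes_dia N' a" "a * a = a"
  shows "(adj (\<beta> (avec N i)) * a * \<beta> (avec N i)) * (adj (\<beta> (avec N i)) * a * \<beta> (avec N i)) =
    adj (\<beta> (avec N i)) * a * \<beta> (avec N i)"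
proof -
  note hs = corner_homD[OF nest_hom_corner[OF h]]
  let ?x = "avec N i"
  note ux = unit_vec_simps[OF avec(1)[OF nd(1) i]]
  have e: "\<beta> ?x * adj (\<beta> ?x) = \<beta> (?x * adj ?x)" using ux by (simp add: hs)
  have c: "a * \<beta> (?x * adj ?x) = \<beta> (?x * adj ?x) * a"
    using a(1) nest_hom_dia[OF nd h avec_diag_dia[OF nd(1) i]] by (simp add: centralizes_dia_def)
  have e': "\<beta> (?x * adj ?x) * \<beta> ?x = \<beta> ?x"
    using ux hs(4)[of "?x * adj ?x" ?x] by (simp add: mult.assoc)
  have "(adj (\<beta> ?x) * a * \<beta> ?x) * (adj (\<beta> ?x) * a * \<beta> ?x) = adj (\<beta> ?x) * (a * (\<beta> ?x * adj (\<beta> ?x))) * a * \<beta> ?x"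
    by (simp add: mult.assoc)
  also have "\<dots> = adj (\<beta> ?x) * a * (\<beta> (?x * adj ?x) * a) * \<beta> ?x" unfolding e by (simp add: mult.assoc)
  also have "\<dots> = adj (\<beta> ?x) * (a * a) * (\<beta> (?x * adj ?x) * \<beta> ?x)" unfolding c[symmetric] by (simp add: mult.assoc)
  finally show ?thesis unfolding e' a(2) .
qed

lemma unlinkedI:
  assumes nd: "nest_data N" "nest_data N'" and h: "nest_hom N N' \<beta>"
    and w: "w \<in> ncorner N" "blk N w i j \<noteq> 0" and z: "natom N' a * \<beta> w * natom N' b = 0"
  shows "unlinked N N' \<beta> i j a b"
  unfolding unlinked_def
proof
  fix y assume y: "y \<in> ncorner N"
  have "natom N' a * \<beta> (blk N y i j) * natom N' b = natom N' a * \<beta> (blk N y i j) * 0"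
    by (rule block_spread[OF nd h w centralizes_natom centralizes_natom centralizes_zero _ y]) (simp add: z)
  then show "natom N' a * \<beta> (blk N y i j) * natom N' b = 0" by simp
qed

lemma linked_of_nonzero:
  assumes nd: "nest_data N" and ch: "corner_hom (ndim N) (ndim N') \<beta>" and w: "w \<in> ncorner N"
    and nz: "blk N' (\<beta> w) a b \<noteq> 0"
  shows "\<exists>i j. blk N w i j \<noteq> 0 \<and> \<not> unlinked N N' \<beta> i j a b"
proof (rule ccontr)
  assume *: "\<not> ?thesis"
  have "natom N' a * \<beta> (blk N w i j) * natom N' b = 0" for i j
  proof (cases "blk N w i j = 0")
    case False
    then show ?thesis using * w unfolding unlinked_def by blast
  qed (simp add: corner_hom_zero[OF ch])
  then show False
    using nz unfolding hom_expand_blocks[OF nd ch w] sum_distrib_left sum_distrib_right by simp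
qed

text \<open>A link means that some element of block \<open>(i, j)\<close> has an image with nonzero
  block \<open>(a, b)\<close>; that image is a test element for the second map.\<close>

lemma linked_ple_comp:
  assumes nd: "nest_data N" "nest_data N'" "nest_data N''" and h: "nest_hom N N' \<beta>" "nest_hom N' N'' \<beta>'"
    and le: "ple N N'' (\<lambda>x. \<beta>' (\<beta> x)) i m j n" and nl: "\<not> unlinked N N' \<beta> i j a b"
  shows "ple N' N'' \<beta>' a m b n"
proof -
  obtain y where y: "y \<in> ncorner N" "blk N' (\<beta> (blk N y i j)) a b \<noteq> 0"
    using nl unfolding unlinked_def by blast
  have "\<beta> (blk N y i j) \<in> ncorner N'" using y nd corner_homD(1)[OF nest_hom_corner[OF h(1)]] by simp
  then show ?thesis
    using le y by (intro ple_rowsI[OF nd(2,3) h(2) _ y(2)]) (auto simp: ple_def)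
qed

lemma linked_ple_comp':
  assumes nd: "nest_data N" "nest_data N'" "nest_data N''" and h: "nest_hom N N' \<beta>" "nest_hom N' N'' \<beta>'"
    and le: "ple N N'' (\<lambda>x. \<beta>' (\<beta> x)) j n i m" and nl: "\<not> unlinked N N' \<beta> i j a b"
  shows "ple N' N'' \<beta>' b n a m"
proof -
  have "\<not> unlinked N N' \<beta> j i b a"
  proof
    assume u: "unlinked N N' \<beta> j i b a"
    obtain y where y: "y \<in> ncorner N" "blk N' (\<beta> (blk N y i j)) a b \<noteq> 0"
      using nl unfolding unlinked_def by blast
    have "blk N' (\<beta> (blk N (adj y) j i)) b a = 0" using u y unfolding unlinked_def by simp
    moreover have "\<beta> (blk N (adj y) j i) = adj (\<beta> (blk N y i j))"
      using corner_homD(5)[OF nest_hom_corner[OF h(1)], of "blk N y i j"] nd y by (simp add: mult.assoc)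
    ultimately show False using y blk_eq_0_adj[OF nd(2)] by metis
  qed
  then show ?thesis using linked_ple_comp[OF nd h le] by blast
qed

text \<open>Two strictly nested blocks of \<open>w\<close> with \<open>\<beta> w\<close> order conserving: no part of \<open>\<beta>\<close> separates both the two
  rows and the two columns, so the links of the nested pair are links of the crossed pair.\<close>

lemma nested_links:
  assumes nd: "nest_data N" "nest_data N'" and h: "nest_hom N N' \<beta>" and w: "w \<in> ncorner N"
    and cmp: "\<And>m n. nproj N' m * \<beta> w * nproj N' n = nproj N' m * \<beta> w \<or> nproj N' m * \<beta> w * nproj N' n = \<beta> w * nproj N' n"
    and nz: "blk N w k k' \<noteq> 0" "blk N w l l' \<noteq> 0" and lt: "k < l" "l' < k'"
    and ul: "unlinked N N' \<beta> k l' a b" "unlinked N N' \<beta> l k' a b"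
  shows "unlinked N N' \<beta> k k' a b \<and> unlinked N N' \<beta> l l' a b"
proof -
  note hs = corner_homD[OF nest_hom_corner[OF h]]
  note nat = blk_nonzero_less[OF nd(1) nz(1)] blk_nonzero_less[OF nd(1) nz(2)]
  let ?H = "hproj N N' \<beta>"
  have hm: "?H i m * ?H j n = ?H i m" "?H j n * ?H i m = ?H i m"
    if "ple N N' \<beta> i m j n" "i < natoms N" "j < natoms N" for i j m n
  proof -
    show 1: "?H i m * ?H j n = ?H i m" using hproj_mult[OF nd h that(2,3,1)] .
    show "?H j n * ?H i m = ?H i m" using arg_cong[OF 1, of adj] by (simp add: hproj_adj[OF nd(2)])
  qed
  note tr = ple_trans[OF nd h]
  have mono: "ple N N' \<beta> l m k m" "ple N N' \<beta> k' m l' m" for m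
    using ple_atom_mono[OF nd h] lt by simp_all
  \<comment> \<open>The comparison valid for \<open>\<beta> w\<close> holds for its two blocks, and
    since chains shrink along the atoms it extends to the crossed pairs.\<close>
  have chain: "(\<forall>i\<in>{k, l}. \<forall>j\<in>{k', l'}. ?H i m * ?H j n = ?H i m \<and> ?H j n * ?H i m = ?H i m) \<or>
      (\<forall>i\<in>{k, l}. \<forall>j\<in>{k', l'}. ?H i m * ?H j n = ?H j n \<and> ?H j n * ?H i m = ?H j n)" for m n
    using cmp[of m n]
  proof
    assume "nproj N' m * \<beta> w * nproj N' n = nproj N' m * \<beta> w"
    then have "ple N N' \<beta> k m k' n" "ple N N' \<beta> l m l' n" using ple_rowsI[OF nd h w] nz by blast+
    then have p: "ple N N' \<beta> i m j n" if "i \<in> {k, l}" "j \<in> {k', l'}" for i j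
      using mono tr nat that by (metis insert_iff singletonD)
    show ?thesis by (intro disjI1 ballI conjI hm p) (auto simp: nat)
  next
    assume "nproj N' m * \<beta> w * nproj N' n = \<beta> w * nproj N' n"
    then have "ple N N' \<beta> k' n k m" "ple N N' \<beta> l' n l m" using ple_colsI[OF nd h w] nz by blast+
    then have p: "ple N N' \<beta> j n i m" if "i \<in> {k, l}" "j \<in> {k', l'}" for i j
      using mono tr nat that by (metis insert_iff singletonD)
    show ?thesis by (intro disjI2 ballI conjI hm p) (auto simp: nat)
  qed
  \<comment> \<open>Either all four products equal their row member or all equal their column
    member, and the terms cancel in both cases. What separates the rows is thus orthogonal to what
    separates the columns.\<close>
  have dd: "(?H k m - ?H l m) * (?H l' n - ?H k' n) = 0" for m n
    using chain[of m n] by (auto simp: algebra_simps)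
  have comm: "?H i m * ?H j n = ?H j n * ?H i m" if "i \<in> {k, l}" "j \<in> {k', l'}" for i j m n
    using chain[of m n] that by metis
  define Q where "Q = (\<lambda>i a. adj (\<beta> (avec N i)) * natom N' a * \<beta> (avec N i))"
  have QH: "Q i a = ?H i (Suc a) - ?H i a" for i a
    by (simp add: Q_def hproj_def nproj_Suc algebra_simps)
  have QQ: "Q i a * Q i a = Q i a" if "i < natoms N" for i a
    unfolding Q_def using compressed_central_idem[OF nd h that centralizes_natom] nd by (simp add: natom_mult)
  have Qc: "Q i a * Q j b = Q j b * Q i a" if "i \<in> {k, l}" "j \<in> {k', l'}" for i j
    unfolding QH using comm[OF that] by (simp add: left_diff_distrib right_diff_distrib)
  have Qprod: "Q i a * Q j b = adj (\<beta> (avec N i)) * (natom N' a * \<beta> (avec N i * adj (avec N j)) * natom N' b) * \<beta> (avec N j)"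
    if "i < natoms N" "j < natoms N" for i j
  proof -
    have "\<beta> (avec N i) * adj (\<beta> (avec N j)) = \<beta> (avec N i * adj (avec N j))"
      using avec(1)[OF nd(1) that(1)] avec(1)[OF nd(1) that(2)] by (simp add: hs unit_vec_in_def)
    then show ?thesis by (simp add: Q_def mult.assoc[symmetric]) (simp add: mult.assoc)
  qed
  have Q0: "Q i a * Q j b = 0" if "unlinked N N' \<beta> i j a b" "i < natoms N" "j < natoms N" for i j
    using that(1) atom_rank_one_block[OF nd(1) that(2,3)] unfolding Qprod[OF that(2,3)] unlinked_def
    by (metis mult_zero_left mult_zero_right)
  \<comment> \<open>The converse of \<open>Q0\<close>: flanking a vanishing product of increments by
    \<open>\<beta> (avec N i)\<close> and the adjoint of \<open>\<beta> (avec N j)\<close> returns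
    the rank one operator of the block.\<close>
  have Qu: "unlinked N N' \<beta> i j a b" if "Q i a * Q j b = 0" and ij: "i < natoms N" "j < natoms N" for i j
  proof -
    let ?x = "avec N i" and ?y = "avec N j"
    note u = unit_vec_simps[OF avec(1)[OF nd(1) ij(1)]] unit_vec_simps[OF avec(1)[OF nd(1) ij(2)]]
    note r = atom_rank_one_block[OF nd(1) ij]
    have bx: "\<beta> ?x * adj (\<beta> ?x) = \<beta> (?x * adj ?x)" "\<beta> ?y * adj (\<beta> ?y) = \<beta> (?y * adj ?y)"
      using u by (simp_all add: hs)
    have cx: "natom N' a * \<beta> (?x * adj ?x) = \<beta> (?x * adj ?x) * natom N' a"
      "natom N' b * \<beta> (?y * adj ?y) = \<beta> (?y * adj ?y) * natom N' b"
      using centralizes_natom nest_hom_dia[OF nd h avec_diag_dia[OF nd(1)]] ij unfolding centralizes_dia_def by blast+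
    have e: "\<beta> (?x * adj ?x) * \<beta> (?x * adj ?y) * \<beta> (?y * adj ?y) = \<beta> (?x * adj ?y)"
    proof -
      have "\<beta> (?x * adj ?x) * \<beta> (?x * adj ?y) * \<beta> (?y * adj ?y) = \<beta> ((?x * adj ?x) * (?x * adj ?y) * (?y * adj ?y))"
        using u by (simp add: hs)
      then show ?thesis using u by (simp add: mult.assoc)
    qed
    have "0 = \<beta> ?x * (Q i a * Q j b) * adj (\<beta> ?y)" using that(1) by simp
    also have "\<dots> = (\<beta> ?x * adj (\<beta> ?x)) * natom N' a * \<beta> (?x * adj ?y) * natom N' b * (\<beta> ?y * adj (\<beta> ?y))"
      unfolding Qprod[OF ij] by (simp add: mult.assoc)
    also have "\<dots> = natom N' a * (\<beta> (?x * adj ?x) * \<beta> (?x * adj ?y) * \<beta> (?y * adj ?y)) * natom N' b"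
      unfolding bx cx(1)[symmetric] by (simp add: mult.assoc cx(2))
    finally have "natom N' a * \<beta> (?x * adj ?y) * natom N' b = 0" unfolding e by simp
    then show ?thesis using r by (intro unlinkedI[OF nd h r(3)]) auto
  qed
  have z: "Q k a * Q l' b = 0" "Q l a * Q k' b = 0" using Q0 ul nat by blast+
  \<comment> \<open>This is the mixed second difference of \<open>dd\<close> in \<open>m\<close> and
    \<open>n\<close>.\<close>
  have "(Q k a - Q l a) * (Q l' b - Q k' b) =
     ((?H k (Suc a) - ?H l (Suc a)) - (?H k a - ?H l a)) * ((?H l' (Suc b) - ?H k' (Suc b)) - (?H l' b - ?H k' b))"
    unfolding QH by (simp add: algebra_simps)
  also have "\<dots> = 0" unfolding left_diff_distrib[of "_ - _"] right_diff_distrib[of _ "_ - _"] dd by simp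
  finally have "(Q k a - Q l a) * (Q l' b - Q k' b) = 0" .
  moreover have "(Q k a - Q l a) * (Q l' b - Q k' b) =
      Q k a * Q l' b + Q l a * Q k' b - (Q k a * Q k' b + Q l a * Q l' b)"
    by (simp add: algebra_simps)
  ultimately have "0 + 0 - (Q k a * Q k' b + Q l a * Q l' b) = 0" unfolding z by (simp only:)
  then have s: "Q k a * Q k' b + Q l a * Q l' b = 0" by (simp only: add_0 diff_0 neg_equal_0_iff_equal)
  define X where "X = Q k a * Q k' b"
  define Y where "Y = Q l a * Q l' b"
  have XX: "X * X = X"
  proof -
    have "X * X = Q k a * (Q k' b * Q k a) * Q k' b" by (simp add: X_def mult.assoc)
    also have "\<dots> = (Q k a * Q k a) * (Q k' b * Q k' b)"
      by (subst Qc[of k k', symmetric]) (simp_all add: mult.assoc)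
    finally show ?thesis using QQ nat by (simp add: X_def)
  qed
  have YY: "Y * Y = Y"
  proof -
    have "Y * Y = Q l a * (Q l' b * Q l a) * Q l' b" by (simp add: Y_def mult.assoc)
    also have "\<dots> = (Q l a * Q l a) * (Q l' b * Q l' b)"
      by (subst Qc[of l l', symmetric]) (simp_all add: mult.assoc)
    finally show ?thesis using QQ nat by (simp add: Y_def)
  qed
  \<comment> \<open>\<open>X\<close> and \<open>Y\<close> are idempotent as products of commuting
    projections; together with \<open>Y = - X\<close> this forces \<open>X = - X\<close>.\<close>
  have YX: "Y = - X" using s by (simp add: X_def Y_def eq_neg_iff_add_eq_0 add.commute)
  have "X = - X" using XX YY unfolding YX by simp
  then have "X + X = 0" by (metis add.right_inverse)
  then have X0: "X = 0" by (rule double_eq_0)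
  then have Y0: "Y = 0" using YX by simp
  show ?thesis using Qu[of k k'] Qu[of l l'] X0 Y0 nat unfolding X_def Y_def by blast
qed

lemma nested_links_transfer:
  assumes nd: "nest_data N" "nest_data N'" and h: "nest_hom N N' \<beta>" and w: "w \<in> ncorner N"
    and oc: "OC N' (\<beta> w)"
    and nz: "blk N w k k' \<noteq> 0" "blk N w l l' \<noteq> 0" and lt: "k < l" "l' < k'"
    and bd: "\<And>i j. Bd i j \<longleftrightarrow> (\<exists>a b. \<not> unlinked N N' \<beta> i j a b \<and> R a b)"
    and kl: "Bd k k' \<or> Bd l l'"
  shows "Bd k l' \<or> Bd l k'"
proof -
  have cmp: "nproj N' m * \<beta> w * nproj N' n = nproj N' m * \<beta> w \<or> nproj N' m * \<beta> w * nproj N' n = \<beta> w * nproj N' n" for m n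
    using oc unfolding OC_def by blast
  obtain a b where ab: "\<not> unlinked N N' \<beta> k k' a b \<or> \<not> unlinked N N' \<beta> l l' a b" "R a b"
    using kl unfolding bd by blast
  then have "\<not> unlinked N N' \<beta> k l' a b \<or> \<not> unlinked N N' \<beta> l k' a b"
    using nested_links[OF nd h w cmp nz lt] by blast
  then show ?thesis unfolding bd using ab(2) by blast
qed

text \<open>\<open>Bd1\<close> and \<open>Bd2\<close> mark the blocks witnessing the two ways in which \<open>\<beta>2 (\<beta>1 w)\<close> could fail to be
  comparable at a position of the nest; no order conserving element of the middle algebra meets both.\<close>

lemma OC_no_bad_pair:
  assumes nd: "nest_data N" and w: "w \<in> tri N" and ww: "adj w * w \<in> dia N" "w * adj w \<in> dia N"
    and noz: "\<And>z i j s t. OC N z \<Longrightarrow> blk N z i j \<noteq> 0 \<Longrightarrow> Bd1 i j \<Longrightarrow> blk N z s t \<noteq> 0 \<Longrightarrow> Bd2 s t \<Longrightarrow> False"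
    and tr1: "\<And>k k' l l'. blk N w k k' \<noteq> 0 \<Longrightarrow> blk N w l l' \<noteq> 0 \<Longrightarrow> k < l \<Longrightarrow> l' < k' \<Longrightarrow>
       Bd1 k k' \<or> Bd1 l l' \<Longrightarrow> Bd1 k l' \<or> Bd1 l k'"
    and tr2: "\<And>k k' l l'. blk N w k k' \<noteq> 0 \<Longrightarrow> blk N w l l' \<noteq> 0 \<Longrightarrow> k < l \<Longrightarrow> l' < k' \<Longrightarrow>
       Bd2 k k' \<or> Bd2 l l' \<Longrightarrow> Bd2 k l' \<or> Bd2 l k'"
    and k: "blk N w k k' \<noteq> 0" "Bd1 k k'" and l: "blk N w l l' \<noteq> 0" "Bd2 l l'"
  shows False
proof -
  have wc: "w \<in> ncorner N" using w tri_corner by blast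
  have lt: "i < natoms N" "j < natoms N" "i \<le> j" if "blk N w i j \<noteq> 0" for i j
    using blk_nonzero_less[OF nd that] tri_block_le[OF nd w that] by auto
  \<comment> \<open>The test element built from the two blocks is order conserving and meets both
    kinds of bad block, which \<open>noz\<close> excludes. The disjunctions also cover the case that
    one block is bad in both ways.\<close>
  have two: False
    if u: "unit_vec_in (ndim N) y" "unit_vec_in (ndim N) x" "unit_vec_in (ndim N) y'" "unit_vec_in (ndim N) x'"
    and q: "natom N i * y = y" "natom N i' * x = x" "natom N j * y' = y'" "natom N j' * x' = x'"
    and o: "adj y * y' = 0" "adj x * x' = 0" and ne: "(i, i') \<noteq> (j, j')"
    and le: "i \<le> i'" "j \<le> j'" and nn: "\<not> (i < j \<and> j' < i')" "\<not> (j < i \<and> i' < j')"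
    and bd: "Bd1 i i' \<or> Bd1 j j'" "Bd2 i i' \<or> Bd2 j j'" for y x y' x' i i' j j'
  proof -
    note f = two_block_facts(3)[OF nd u q o ne le]
    have nz: "blk N (y * adj x + y' * adj x') i i' \<noteq> 0" "blk N (y * adj x + y' * adj x') j j' \<noteq> 0"
      unfolding f using rank_one_nonzero[OF u(1,2)] rank_one_nonzero[OF u(3,4)] ne by auto
    show False using noz[OF two_block_OC[OF nd u q o ne le nn]] nz bd by blast
  qed
  have av: False if "i \<noteq> j" "i' \<noteq> j'" "i \<le> i'" "j \<le> j'" "i' < natoms N" "j' < natoms N"
    "\<not> (i < j \<and> j' < i')" "\<not> (j < i \<and> i' < j')" "Bd1 i i' \<or> Bd1 j j'" "Bd2 i i' \<or> Bd2 j j'" for i i' j j'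
  proof -
    have l4: "i < natoms N" "i' < natoms N" "j < natoms N" "j' < natoms N" using that by auto
    note v = avec[OF nd l4(1)] avec[OF nd l4(2)] avec[OF nd l4(3)] avec[OF nd l4(4)]
    show False
      by (rule two[OF v(1,3,5,7) v(2,4,6,8) atom_vec_orthogonal[OF nd v(2,6)] atom_vec_orthogonal[OF nd v(4,8)]])
        (use that in auto)
  qed
  \<comment> \<open>Strictly nested blocks admit no such test element. Here \<open>tr1\<close> and
    \<open>tr2\<close> move the badness to the crossed pair \<open>(i, j')\<close> and
    \<open>(j, i')\<close>, which is still upper triangular and no longer nested.\<close>
  have nested: False
    if "blk N w i i' \<noteq> 0" "blk N w j j' \<noteq> 0" "i < j" "j' < i'"
      "Bd1 i i' \<or> Bd1 j j'" "Bd2 i i' \<or> Bd2 j j'" for i i' j j'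
    using av[of i j j' i'] lt[OF that(1)] lt[OF that(2)] tr1[OF that(1,2,3,4)] tr2[OF that(1,2,3,4)] that by auto
  text \<open>Four corners: if all of them are nonzero, the links of two opposite corners cover those of the others.\<close>
  have corners: False
    if nz: "\<And>a b. a \<in> {i, j} \<Longrightarrow> b \<in> {i', j'} \<Longrightarrow> blk N w a b \<noteq> 0" and ne: "i \<noteq> j" "i' \<noteq> j'"
      and b1: "\<exists>a\<in>{i, j}. \<exists>b\<in>{i', j'}. Bd1 a b" and b2: "\<exists>a\<in>{i, j}. \<exists>b\<in>{i', j'}. Bd2 a b" for i i' j j'
  proof -
    define r where "r = min i j"
    define R where "R = max i j"
    define c where "c = min i' j'"
    define C where "C = max i' j'"
    have sets: "{i, j} = {r, R}" "{i', j'} = {c, C}" unfolding r_def R_def c_def C_def by (auto simp: min_def max_def)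
    have less: "r < R" "c < C" using ne by (auto simp: r_def R_def c_def C_def)
    have n4: "blk N w r c \<noteq> 0" "blk N w r C \<noteq> 0" "blk N w R c \<noteq> 0" "blk N w R C \<noteq> 0"
      using nz unfolding sets by auto
    have "Bd1 r c \<or> Bd1 R C" using b1 tr1[OF n4(2,3) less] unfolding sets by auto
    moreover have "Bd2 r c \<or> Bd2 R C" using b2 tr2[OF n4(2,3) less] unfolding sets by auto
    ultimately show False using av[of r R c C] lt[OF n4(1)] lt[OF n4(4)] less by auto
  qed
  have row: False if "k = l" "k' \<noteq> l'"
  proof (cases "\<exists>s. s \<noteq> k \<and> blk N w s k' \<noteq> 0 \<and> blk N w s l' \<noteq> 0")
    case True
    then obtain s where s: "s \<noteq> k" "blk N w s k' \<noteq> 0" "blk N w s l' \<noteq> 0" by blast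
    have "blk N w a b \<noteq> 0" if "a \<in> {k, s}" "b \<in> {k', l'}" for a b
      using that s k l \<open>k = l\<close> by auto
    then show False using corners[of k s k' l'] s k l that by auto
  next
    case False
    \<comment> \<open>A test element with both blocks in row \<open>k\<close> requires two
      orthogonal vectors in the range of that atom, which might have rank one. Since
      \<open>adj w * w\<close> is diagonal and no other row meets both columns, the two blocks of
      \<open>w\<close> have orthogonal ranges and supply such vectors.\<close>
    have z: "adj (blk N w k k') * blk N w k l' = 0"
    proof -
      have "0 = blk N (adj w * w) k' l'"
        using ww(1)[unfolded dia_iff_blocks[OF nd]] that(2) by simp
      also have "\<dots> = (\<Sum>s<natoms N. (natom N k' * adj w) * natom N s * (w * natom N l'))"
        using nd wc by (subst sum_natom_insert) (auto simp: mult.assoc)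
      also have "\<dots> = (\<Sum>s<natoms N. adj (blk N w s k') * blk N w s l')"
        by (intro sum.cong refl) (simp add: nd mult.assoc nsimps)
      also have "\<dots> = (\<Sum>s\<in>{k}. adj (blk N w s k') * blk N w s l')"
      proof (rule sum.mono_neutral_right)
        show "\<forall>s\<in>{..<natoms N} - {k}. adj (blk N w s k') * blk N w s l' = 0"
          using False by (metis DiffE adj_zero insertCI mult_zero_left mult_zero_right)
      qed (use lt[OF k(1)] in auto)
      finally show ?thesis by simp
    qed
    have bc: "blk N w k k' \<in> ncorner N" "blk N w k l' \<in> ncorner N" using nd wc by simp_all
    obtain t where t: "t \<in> ncorner N" "unit_vec_in (ndim N) (blk N w k k' * t)" using range_unit_vec[OF bc(1) k(1)] .
    have kl: "blk N w k l' \<noteq> 0" using l that by simp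
    obtain t' where t': "t' \<in> ncorner N" "unit_vec_in (ndim N) (blk N w k l' * t')" using range_unit_vec[OF bc(2) kl] .
    note v = avec[OF nd lt(2)[OF k(1)]] avec[OF nd lt(2)[OF l(1)]]
    have o: "adj (blk N w k k' * t) * (blk N w k l' * t') = 0"
    proof -
      have "adj (blk N w k k' * t) * (blk N w k l' * t') = adj t * (adj (blk N w k k') * blk N w k l') * t'"
        by (simp only: adj_mult mult.assoc)
      then show ?thesis unfolding z by simp
    qed
    have q: "natom N k * (blk N w k k' * t) = blk N w k k' * t" "natom N k * (blk N w k l' * t') = blk N w k l' * t'"
      using nd by (simp_all add: mult.assoc nsimps)
    show False
      by (rule two[OF t(2) v(1) t'(2) v(3) q(1) v(2) q(2) v(4) o atom_vec_orthogonal[OF nd v(2,4) that(2)]])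
        (use that lt[OF k(1)] lt[OF l(1)] k l in auto)
  qed
  have col: False if "k' = l'" "k \<noteq> l"
  proof (cases "\<exists>s. s \<noteq> k' \<and> blk N w k s \<noteq> 0 \<and> blk N w l s \<noteq> 0")
    case True
    then obtain s where s: "s \<noteq> k'" "blk N w k s \<noteq> 0" "blk N w l s \<noteq> 0" by blast
    have "blk N w a b \<noteq> 0" if "a \<in> {k, l}" "b \<in> {k', s}" for a b
      using that s k l \<open>k' = l'\<close> by auto
    then show False using corners[of k l k' s] s k l that by auto
  next
    case False
    \<comment> \<open>As for rows, now with \<open>w * adj w\<close> diagonal and with the initial
      spaces of the two blocks.\<close>
    have z: "blk N w k k' * adj (blk N w l k') = 0"
    proof -
      have "0 = blk N (w * adj w) k l"
        using ww(2)[unfolded dia_iff_blocks[OF nd]] that(2) by simp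
      also have "\<dots> = (\<Sum>s<natoms N. (natom N k * w) * natom N s * (adj w * natom N l))"
        using nd wc by (subst sum_natom_insert) (auto simp: mult.assoc)
      also have "\<dots> = (\<Sum>s<natoms N. blk N w k s * adj (blk N w l s))"
        by (intro sum.cong refl) (simp add: nd mult.assoc nsimps)
      also have "\<dots> = (\<Sum>s\<in>{k'}. blk N w k s * adj (blk N w l s))"
      proof (rule sum.mono_neutral_right)
        show "\<forall>s\<in>{..<natoms N} - {k'}. blk N w k s * adj (blk N w l s) = 0"
          using False by (metis DiffE adj_zero insertCI mult_zero_left mult_zero_right)
      qed (use lt[OF k(1)] in auto)
      finally show ?thesis by simp
    qed
    have bc: "adj (blk N w k k') \<in> ncorner N" "adj (blk N w l k') \<in> ncorner N" using nd wc by simp_all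
    have nz: "adj (blk N w k k') \<noteq> 0" "adj (blk N w l k') \<noteq> 0" using k l that by (metis adj_eq_0)+
    obtain t where t: "t \<in> ncorner N" "unit_vec_in (ndim N) (adj (blk N w k k') * t)" using range_unit_vec[OF bc(1) nz(1)] .
    obtain t' where t': "t' \<in> ncorner N" "unit_vec_in (ndim N) (adj (blk N w l k') * t')" using range_unit_vec[OF bc(2) nz(2)] .
    note v = avec[OF nd lt(1)[OF k(1)]] avec[OF nd lt(1)[OF l(1)]]
    have o: "adj (adj (blk N w k k') * t) * (adj (blk N w l k') * t') = 0"
    proof -
      have "adj (adj (blk N w k k') * t) * (adj (blk N w l k') * t') = adj t * (blk N w k k' * adj (blk N w l k')) * t'"
        by (simp only: adj_mult adj_adj mult.assoc)
      then show ?thesis unfolding z by simp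
    qed
    have q: "natom N k' * (adj (blk N w k k') * t) = adj (blk N w k k') * t"
      "natom N k' * (adj (blk N w l k') * t') = adj (blk N w l k') * t'"
      using nd by (simp_all add: mult.assoc nsimps)
    show False
      by (rule two[OF v(1) t(2) v(3) t'(2) v(2) q(1) v(4) q(2) atom_vec_orthogonal[OF nd v(2,4) that(2)] o])
        (use that lt[OF k(1)] lt[OF l(1)] k l in auto)
  qed
  show False
  proof (cases "(k, k') = (l, l')")
    case True
    note v = avec[OF nd lt(1)[OF k(1)]] avec[OF nd lt(2)[OF k(1)]]
    have "OC N (avec N k * adj (avec N k'))"
      using OP_imp_OC[OF nd single_block_OP[OF nd v(1,3,2,4) lt(3)[OF k(1)]]] .
    moreover have "blk N (avec N k * adj (avec N k')) k k' \<noteq> 0"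
      using atom_rank_one_block[OF nd lt(1,2)[OF k(1)]] by simp
    ultimately show False using noz k l True by auto
  next
    case False
    then show False
      using row col nested[OF k(1) l(1)] nested[OF l(1) k(1)]
        av[of k l k' l'] lt[OF k(1)] lt[OF l(1)] k(2) l(2) by blast
  qed
qed

text \<open>Diagonality of the initial and final projections passes through every map of nest
  algebras, so only comparability at some pair \<open>(m, n)\<close> can fail. The failure of each
  alternative comes from a block of \<open>\<beta>1 w\<close> and is traced back along a link to a
  block of \<open>w = \<beta>0 v\<close>, giving one bad block of each kind. As
  \<open>\<beta>1 w\<close> is order conserving, links can be exchanged as
  \<open>OC_no_bad_pair\<close> demands.\<close>

lemma OC_triple:
  assumes nd: "nest_data N0" "nest_data N1" "nest_data N2" "nest_data N3"
    and h: "nest_hom N0 N1 \<beta>0" "nest_hom N1 N2 \<beta>1" "nest_hom N2 N3 \<beta>2"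
    and oc: "\<And>v. OC N0 v \<Longrightarrow> OC N2 (\<beta>1 (\<beta>0 v))" "\<And>v. OC N1 v \<Longrightarrow> OC N3 (\<beta>2 (\<beta>1 v))"
    and v: "OC N0 v"
  shows "OC N3 (\<beta>2 (\<beta>1 (\<beta>0 v)))"
proof -
  define w where "w = \<beta>0 v"
  define u where "u = \<beta>1 w"
  note hs0 = corner_homD[OF nest_hom_corner[OF h(1)]] and hs1 = corner_homD[OF nest_hom_corner[OF h(2)]]
    and hs2 = corner_homD[OF nest_hom_corner[OF h(3)]]
  have vt: "v \<in> tri N0" "is_pis v" "adj v * v \<in> dia N0" "v * adj v \<in> dia N0" using v by (auto simp: OC_def)
  have vc: "v \<in> ncorner N0" using vt tri_corner by blast
  have wt: "w \<in> tri N1" using nest_hom_tri[OF h(1)] vt by (simp add: w_def)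
  have wc: "w \<in> ncorner N1" using wt tri_corner by blast
  have ut: "u \<in> tri N2" using nest_hom_tri[OF h(2) wt] by (simp add: u_def)
  have uc: "u \<in> ncorner N2" using ut tri_corner by blast
  have uo: "OC N2 u" using oc(1)[OF v] by (simp add: u_def w_def)
  have ww: "adj w * w \<in> dia N1" "w * adj w \<in> dia N1"
    using nest_hom_dia[OF nd(1,2) h(1) vt(3)] nest_hom_dia[OF nd(1,2) h(1) vt(4)] vc by (simp_all add: w_def hs0)
  have uu: "adj u * u \<in> dia N2" "u * adj u \<in> dia N2" using uo by (auto simp: OC_def)
  have xx: "adj (\<beta>2 u) * \<beta>2 u \<in> dia N3" "\<beta>2 u * adj (\<beta>2 u) \<in> dia N3"
    using nest_hom_dia[OF nd(3,4) h(3) uu(1)] nest_hom_dia[OF nd(3,4) h(3) uu(2)] uc by (simp_all add: hs2)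
  note hc = nest_hom_comp[OF h(2,3)]
  have cmp: "nproj N3 m * \<beta>2 u * nproj N3 n = nproj N3 m * \<beta>2 u \<or> nproj N3 m * \<beta>2 u * nproj N3 n = \<beta>2 u * nproj N3 n" for m n
  proof (rule ccontr)
    assume "\<not> ?thesis"
    then have no: "nproj N3 m * \<beta>2 u * nproj N3 n \<noteq> nproj N3 m * \<beta>2 u" "nproj N3 m * \<beta>2 u * nproj N3 n \<noteq> \<beta>2 u * nproj N3 n" by auto
    define Bd1 where "Bd1 = (\<lambda>i j. \<exists>a b. \<not> unlinked N1 N2 \<beta>1 i j a b \<and> \<not> ple N2 N3 \<beta>2 a m b n)"
    define Bd2 where "Bd2 = (\<lambda>i j. \<exists>a b. \<not> unlinked N1 N2 \<beta>1 i j a b \<and> \<not> ple N2 N3 \<beta>2 b n a m)"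
    obtain a b where ab: "blk N2 u a b \<noteq> 0" "\<not> ple N2 N3 \<beta>2 a m b n"
      using no(1) ple_rowsD[OF nd(3,4) h(3) uc] by blast
    obtain k k' where k: "blk N1 w k k' \<noteq> 0" "Bd1 k k'"
      using linked_of_nonzero[OF nd(2) nest_hom_corner[OF h(2)] wc] ab unfolding u_def Bd1_def by blast
    obtain c d where cd: "blk N2 u c d \<noteq> 0" "\<not> ple N2 N3 \<beta>2 d n c m"
      using no(2) ple_colsD[OF nd(3,4) h(3) uc] by blast
    obtain l l' where l: "blk N1 w l l' \<noteq> 0" "Bd2 l l'"
      using linked_of_nonzero[OF nd(2) nest_hom_corner[OF h(2)] wc] cd unfolding u_def Bd2_def by blast
    \<comment> \<open>\<open>\<beta>2 (\<beta>1 z)\<close> is comparable at \<open>(m, n)\<close>,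
      and either alternative is inherited by every linked block, against one kind of
      badness.\<close>
    have noz: False if z: "OC N1 z" and i: "blk N1 z i j \<noteq> 0" "Bd1 i j" and s: "blk N1 z s t \<noteq> 0" "Bd2 s t" for z i j s t
    proof -
      have zc: "z \<in> ncorner N1" using z tri_corner by (auto simp: OC_def)
      have "nproj N3 m * \<beta>2 (\<beta>1 z) * nproj N3 n = nproj N3 m * \<beta>2 (\<beta>1 z) \<or>
          nproj N3 m * \<beta>2 (\<beta>1 z) * nproj N3 n = \<beta>2 (\<beta>1 z) * nproj N3 n"
        using oc(2)[OF z] unfolding OC_def by blast
      then show False
      proof
        assume "nproj N3 m * \<beta>2 (\<beta>1 z) * nproj N3 n = nproj N3 m * \<beta>2 (\<beta>1 z)"
        then have "ple N1 N3 (\<lambda>x. \<beta>2 (\<beta>1 x)) i m j n" using ple_rowsI[OF nd(2,4) hc zc i(1)] by blast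
        then show False using linked_ple_comp[OF nd(2,3,4) h(2,3)] i(2) unfolding Bd1_def by blast
      next
        assume "nproj N3 m * \<beta>2 (\<beta>1 z) * nproj N3 n = \<beta>2 (\<beta>1 z) * nproj N3 n"
        then have "ple N1 N3 (\<lambda>x. \<beta>2 (\<beta>1 x)) t n s m" using ple_colsI[OF nd(2,4) hc zc s(1)] by blast
        then show False using linked_ple_comp'[OF nd(2,3,4) h(2,3)] s(2) unfolding Bd2_def by blast
      qed
    qed
    have tr1: "Bd1 i t \<or> Bd1 s j" if "blk N1 w i j \<noteq> 0" "blk N1 w s t \<noteq> 0" "i < s" "t < j" "Bd1 i j \<or> Bd1 s t" for i j s t
      by (rule nested_links_transfer[OF nd(2,3) h(2) wc uo[unfolded u_def] that(1-4) _ that(5)]) (simp add: Bd1_def)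
    have tr2: "Bd2 i t \<or> Bd2 s j" if "blk N1 w i j \<noteq> 0" "blk N1 w s t \<noteq> 0" "i < s" "t < j" "Bd2 i j \<or> Bd2 s t" for i j s t
      by (rule nested_links_transfer[OF nd(2,3) h(2) wc uo[unfolded u_def] that(1-4) _ that(5)]) (simp add: Bd2_def)
    show False
      by (rule OC_no_bad_pair[where ?Bd1.0 = Bd1 and ?Bd2.0 = Bd2, OF nd(2) wt ww noz tr1 tr2 k l])
  qed
  have "\<beta>2 u \<in> tri N3" using nest_hom_tri[OF h(3) ut] .
  moreover have "is_pis (\<beta>2 u)" using corner_hom_pis[OF nest_hom_corner[OF h(3)] uc] uo by (simp add: OC_def)
  ultimately show ?thesis using cmp xx unfolding OC_def u_def w_def by blast
qed

section \<open>Decomposition into multiplicity one maps\<close>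

definition rtrace :: "nat \<Rightarrow> fmat \<Rightarrow> real" where
  "rtrace n x = (\<Sum>i<n. Re (ent x i i))"

lemma rtrace_minus: "rtrace n (x - y) = rtrace n x - rtrace n y"
  by (simp add: rtrace_def sum_subtractf)

lemma ent_mult_adj_diag:
  assumes "x \<in> corner n"
  shows "ent (x * adj x) i i = of_real (\<Sum>k<n. (cmod (ent x i k))\<^sup>2)"
  using ent_adj_mult_diag[of "adj x" i n] assms by (auto simp: corner_def)

lemma rtrace_proj_nonneg:
  assumes "g \<in> corner n" "adj g = g" "g * g = g"
  shows "0 \<le> rtrace n g" "rtrace n g = 0 \<Longrightarrow> g = 0"
proof -
  have e: "Re (ent g i i) = (\<Sum>k<n. (cmod (ent g i k))\<^sup>2)" for i
    using ent_mult_adj_diag[OF assms(1), of i] assms(2,3) by simp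
  have nn: "0 \<le> Re (ent g i i)" for i unfolding e by (rule sum_nonneg) simp
  then show "0 \<le> rtrace n g" unfolding rtrace_def by (rule sum_nonneg)
  assume "rtrace n g = 0"
  then have "Re (ent g i i) = 0" if "i < n" for i
    using nn that unfolding rtrace_def by (subst (asm) sum_nonneg_eq_0_iff) auto
  then have z: "(cmod (ent g i k))\<^sup>2 = 0" if "i < n" "k < n" for i k
    using that unfolding e by (subst (asm) sum_nonneg_eq_0_iff) auto
  show "g = 0"
  proof (rule fmat_eqI)
    fix i k
    show "ent g i k = ent 0 i k"
      using z[of i k] assms(1) by (cases "i < n \<and> k < n") (auto simp: corner_def)
  qed
qed

lemma rtrace_rank_one:
  assumes "unit_vec_in n y"
  shows "rtrace n (y * adj y) = 1"
proof -
  have col: "ent y i k = 0" if "k \<noteq> 0" for i k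
    using unit_vec_col[OF assms] ent_mult_munit[of y 0 0 i k] that by simp
  have c: "y \<in> corner n" "adj y * y = munit 0 0" using assms by (auto simp: unit_vec_in_def)
  have "munit 0 0 \<in> corner n" using corner_mult[of "adj y" n y] c by simp
  then have n: "0 < n" by (auto simp: corner_def)
  have "Re (ent (y * adj y) i i) = (cmod (ent y i 0))\<^sup>2" for i
  proof -
    have "(\<Sum>k<n. (cmod (ent y i k))\<^sup>2) = (\<Sum>k\<in>{0}. (cmod (ent y i k))\<^sup>2)"
      using n col by (intro sum.mono_neutral_right) auto
    then show ?thesis using ent_mult_adj_diag[OF c(1), of i] by simp
  qed
  moreover have "of_real (\<Sum>k<n. (cmod (ent y k 0))\<^sup>2) = (1 :: complex)"
    using ent_adj_mult_diag[of y 0 n] c by (auto simp: corner_def)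
  then have "(\<Sum>k<n. (cmod (ent y k 0))\<^sup>2) = 1" by (metis of_real_eq_1_iff)
  ultimately show ?thesis by (simp add: rtrace_def)
qed

text \<open>Replace \<open>f\<close> by \<open>t * f\<close> whenever this is nonzero; afterwards
  \<open>t\<close> acts on the range of \<open>f\<close> as 0 or 1, and earlier choices persist
  because everything commutes. A nonzero \<open>f\<close> is enough to pick a unit vector in its
  range.\<close>

lemma minimal_subprojection:
  assumes "finite T" "T \<subseteq> S" and g: "g \<in> corner n" "adj g = g" "g * g = g" "g \<noteq> 0"
    and S: "\<And>s. s \<in> S \<Longrightarrow> s \<in> corner n \<and> adj s = s \<and> s * s = s \<and> s * g = g * s"
    and comm: "\<And>s t. s \<in> S \<Longrightarrow> t \<in> S \<Longrightarrow> s * t = t * s"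
  shows "\<exists>f. f \<in> corner n \<and> f \<noteq> 0 \<and> g * f = f \<and> (\<forall>s\<in>S. s * f = f * s) \<and> (\<forall>t\<in>T. t * f = 0 \<or> t * f = f)"
  using assms(1,2)
proof (induction T rule: finite_induct)
  case empty
  then show ?case using g S by (intro exI[of _ g]) auto
next
  case (insert t T)
  then obtain f where f: "f \<in> corner n" "f \<noteq> 0" "g * f = f" "\<And>s. s \<in> S \<Longrightarrow> s * f = f * s"
    "\<And>s. s \<in> T \<Longrightarrow> s * f = 0 \<or> s * f = f" by auto
  have t: "t \<in> S" using insert.prems by auto
  show ?case
  proof (cases "t * f = 0")
    case True
    then show ?thesis using f by (intro exI[of _ f]) auto
  next
    case False
    have "g * (t * f) = t * f" using S[OF t] f(3) by (metis mult.assoc)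
    moreover have "s * (t * f) = t * f * s" if "s \<in> S" for s
      using comm[OF that t] f(4)[OF that] by (metis mult.assoc)
    moreover have "s * (t * f) = 0 \<or> s * (t * f) = t * f" if "s \<in> insert t T" for s
    proof (cases "s = t")
      case True
      then show ?thesis using S[OF t] by (metis mult.assoc)
    next
      case False
      then have "s \<in> T" "s \<in> S" using that insert.prems by auto
      have "s * (t * f) = t * (s * f)" using comm[OF \<open>s \<in> S\<close> t] by (metis mult.assoc)
      then show ?thesis using f(5)[OF \<open>s \<in> T\<close>] by auto
    qed
    ultimately show ?thesis using False f(1) S[OF t] by (intro exI[of _ "t * f"]) auto
  qed
qed

text \<open>Induction on a bound for the trace: a joint eigenvector \<open>y\<close> is taken from a
  minimal piece of \<open>g\<close>, and \<open>g - y * adj y\<close> is a projection of trace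
  smaller by one that still commutes with \<open>S\<close>.\<close>

lemma adapted_orthonormal_basis:
  assumes fin: "finite S" and g: "g \<in> corner n" "adj g = g" "g * g = g"
    and S: "\<And>s. s \<in> S \<Longrightarrow> s \<in> corner n \<and> adj s = s \<and> s * s = s \<and> s * g = g * s"
    and comm: "\<And>s t. s \<in> S \<Longrightarrow> t \<in> S \<Longrightarrow> s * t = t * s"
  shows "\<exists>(r::nat) \<eta>. (\<forall>k<r. unit_vec_in n (\<eta> k) \<and> g * \<eta> k = \<eta> k \<and> (\<forall>s\<in>S. s * \<eta> k = 0 \<or> s * \<eta> k = \<eta> k)) \<and>
    (\<forall>j<r. \<forall>k<r. j \<noteq> k \<longrightarrow> adj (\<eta> j) * \<eta> k = 0) \<and> g = (\<Sum>k<r. \<eta> k * adj (\<eta> k))"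
proof -
  have "rtrace n g \<le> real m \<Longrightarrow> ?thesis" for m
    using g S
  proof (induction m arbitrary: g)
    case 0
    then have "g = 0" using rtrace_proj_nonneg[of g n] by simp
    then show ?case by (intro exI[of _ 0]) auto
  next
    case (Suc m)
    show ?case
    proof (cases "g = 0")
      case True
      then show ?thesis by (intro exI[of _ 0]) auto
    next
      case False
      note g = Suc.prems(2-4) and S = Suc.prems(5)
      obtain f where f: "f \<in> corner n" "f \<noteq> 0" "g * f = f" "\<And>t. t \<in> S \<Longrightarrow> t * f = 0 \<or> t * f = f"
        using minimal_subprojection[OF fin order_refl g False S comm] by auto
      obtain t where t: "t \<in> corner n" "unit_vec_in n (f * t)" using range_unit_vec[OF f(1,2)] .
      define y where "y = f * t"
      have y: "unit_vec_in n y" using t by (simp add: y_def)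
      note u = unit_vec_simps[OF y]
      have gy: "g * y = y" using f(3) by (simp add: y_def mult.assoc[symmetric])
      have gy': "g * (y * z) = y * z" for z using gy by (simp add: mult.assoc[symmetric])
      have yg: "adj y * g = adj y" using arg_cong[OF gy, of adj] g by simp
      have sy: "s * y = 0 \<or> s * y = y" if "s \<in> S" for s
        using f(4)[OF that] by (auto simp: y_def mult.assoc[symmetric])
      have sp: "s * (y * adj y) = y * adj y * s" if "s \<in> S" for s
      proof -
        have "adj y * s = adj (s * y)" using S[OF that] by simp
        then have "s * y = 0 \<and> adj y * s = 0 \<or> s * y = y \<and> adj y * s = adj y" using sy[OF that] by (metis adj_zero)
        then show ?thesis by (metis mult.assoc mult_zero_left mult_zero_right)
      qed
      define g' where "g' = g - y * adj y"
      have g': "g' \<in> corner n" "adj g' = g'" using g u by (simp_all add: g'_def)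
      have yz: "adj y * (y * (adj y * z)) = adj y * z" for z using u by simp
      have yz': "adj y * (y * adj y) = adj y" using u by simp
      have gg': "g' * g' = g'"
        unfolding g'_def using g gy gy' yg u yz' by (simp add: algebra_simps)
      have S': "s \<in> corner n \<and> adj s = s \<and> s * s = s \<and> s * g' = g' * s" if "s \<in> S" for s
        using S[OF that] sp[OF that] by (simp add: g'_def left_diff_distrib right_diff_distrib)
      have "rtrace n g' \<le> real m" using Suc.prems(1) rtrace_rank_one[OF y] by (simp add: g'_def rtrace_minus)
      then obtain r :: nat and \<eta> where \<eta>: "\<And>k. k < r \<Longrightarrow> unit_vec_in n (\<eta> k) \<and> g' * \<eta> k = \<eta> k \<and> (\<forall>s\<in>S. s * \<eta> k = 0 \<or> s * \<eta> k = \<eta> k)"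
        "\<And>j k. j < r \<Longrightarrow> k < r \<Longrightarrow> j \<noteq> k \<Longrightarrow> adj (\<eta> j) * \<eta> k = 0" "g' = (\<Sum>k<r. \<eta> k * adj (\<eta> k))"
        using Suc.IH[OF _ g' gg' S'] by blast
      have yg': "adj y * g' = 0" using yg yz' by (simp add: g'_def right_diff_distrib)
      have gg: "g * g' = g'" unfolding g'_def using g gy' by (simp add: right_diff_distrib)
      have y\<eta>: "adj y * \<eta> k = 0" "adj (\<eta> k) * y = 0" "g * \<eta> k = \<eta> k" if "k < r" for k
      proof -
        have e: "\<eta> k = g' * \<eta> k" using \<eta>(1)[OF that] by simp
        have "adj y * \<eta> k = adj y * g' * \<eta> k" using e by (simp add: mult.assoc)
        then show 1: "adj y * \<eta> k = 0" using yg' by simp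
        show "adj (\<eta> k) * y = 0" using arg_cong[OF 1, of adj] by simp
        have "g * (g' * \<eta> k) = g' * \<eta> k" using gg by (simp add: mult.assoc[symmetric])
        then show "g * \<eta> k = \<eta> k" using e by simp
      qed
      define \<zeta> where "\<zeta> = (\<lambda>k. if k < r then \<eta> k else y)"
      have "\<forall>k<Suc r. unit_vec_in n (\<zeta> k) \<and> g * \<zeta> k = \<zeta> k \<and> (\<forall>s\<in>S. s * \<zeta> k = 0 \<or> s * \<zeta> k = \<zeta> k)"
        using \<eta>(1) y gy sy y\<eta> by (auto simp: \<zeta>_def)
      moreover have "\<forall>j<Suc r. \<forall>k<Suc r. j \<noteq> k \<longrightarrow> adj (\<zeta> j) * \<zeta> k = 0"
        using \<eta>(2) y\<eta> by (auto simp: \<zeta>_def less_Suc_eq)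
      moreover have "g = (\<Sum>k<Suc r. \<zeta> k * adj (\<zeta> k))"
        using \<eta>(3) by (simp add: \<zeta>_def g'_def algebra_simps)
      ultimately show ?thesis by blast
    qed
  qed
  then show ?thesis using real_arch_simple by blast
qed

text \<open>The operator \<open>1 \<otimes> r\<close> of the commutant of \<open>\<beta>\<close>, for \<open>r\<close> in the corner of \<open>\<beta> (e\<^sub>0\<^sub>0)\<close>.\<close>

definition amplify :: "nat \<Rightarrow> (fmat \<Rightarrow> fmat) \<Rightarrow> fmat \<Rightarrow> fmat" where
  "amplify d \<beta> r = (\<Sum>j<d. \<beta> (munit j 0) * r * \<beta> (munit 0 j))"

lemma hom_expand_units:
  assumes "corner_hom d e \<beta>" "y \<in> corner d"
  shows "\<beta> y = (\<Sum>i<d. \<Sum>j<d. scl (ent y i j) (\<beta> (munit i j)))"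
proof -
  have "\<beta> y = \<beta> (\<Sum>i<d. \<Sum>j<d. scl (ent y i j) (munit i j))" using corner_expand[OF assms(2)] by simp
  also have "\<dots> = (\<Sum>i<d. \<beta> (\<Sum>j<d. scl (ent y i j) (munit i j)))"
    using assms by (intro corner_hom_sum) (auto intro!: corner_sum)
  also have "\<dots> = (\<Sum>i<d. \<Sum>j<d. \<beta> (scl (ent y i j) (munit i j)))"
    using assms by (intro sum.cong refl corner_hom_sum) auto
  also have "\<dots> = (\<Sum>i<d. \<Sum>j<d. scl (ent y i j) (\<beta> (munit i j)))"
    using assms by (intro sum.cong refl) (auto simp: corner_homD)
  finally show ?thesis .
qed

text \<open>A matrix unit annihilates all summands of \<open>amplify\<close> but one. Both products
  give the same element, so \<open>amplify\<close> commutes with the images of matrix units and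
  hence with the range of \<beta>.\<close>

lemma amplify_unit:
  assumes h: "corner_hom d e \<beta>" and ab: "a < d" "b < d" and g: "\<beta> (munit 0 0) * r = r" "r * \<beta> (munit 0 0) = r"
  shows "\<beta> (munit a b) * amplify d \<beta> r = \<beta> (munit a 0) * r * \<beta> (munit 0 b)"
    "amplify d \<beta> r * \<beta> (munit a b) = \<beta> (munit a 0) * r * \<beta> (munit 0 b)"
proof -
  have m: "\<beta> (munit i j) * \<beta> (munit k l) = (if j = k then \<beta> (munit i l) else 0)"
    if "i < d" "j < d" "k < d" "l < d" for i j k l
  proof -
    have "\<beta> (munit i j) * \<beta> (munit k l) = \<beta> (munit i j * munit k l)"
      using corner_homD(4)[OF h, of "munit i j" "munit k l"] that by simp
    then show ?thesis by (simp add: munit_mult corner_hom_zero[OF h])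
  qed
  have m': "\<beta> (munit i j) * (\<beta> (munit k l) * z) = (if j = k then \<beta> (munit i l) * z else 0)"
    if "i < d" "j < d" "k < d" "l < d" for i j k l z
    using m[OF that] by (simp add: mult.assoc[symmetric])
  have d: "0 < d" using ab by simp
  have "\<beta> (munit a b) * amplify d \<beta> r = (\<Sum>j<d. if j = b then \<beta> (munit a 0) * r * \<beta> (munit 0 j) else 0)"
    unfolding amplify_def sum_distrib_left using ab d by (intro sum.cong refl) (auto simp: mult.assoc m')
  then show "\<beta> (munit a b) * amplify d \<beta> r = \<beta> (munit a 0) * r * \<beta> (munit 0 b)" using ab by simp
  have "amplify d \<beta> r * \<beta> (munit a b) = (\<Sum>j<d. if j = a then \<beta> (munit j 0) * r * \<beta> (munit 0 b) else 0)"
    unfolding amplify_def sum_distrib_right using ab d by (intro sum.cong refl) (auto simp: mult.assoc m)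
  then show "amplify d \<beta> r * \<beta> (munit a b) = \<beta> (munit a 0) * r * \<beta> (munit 0 b)" using ab by simp
qed

lemma amplify_commute:
  assumes h: "corner_hom d e \<beta>" and g: "\<beta> (munit 0 0) * r = r" "r * \<beta> (munit 0 0) = r" and y: "y \<in> corner d"
  shows "\<beta> y * amplify d \<beta> r = amplify d \<beta> r * \<beta> y"
  unfolding hom_expand_units[OF h y] sum_distrib_left sum_distrib_right
  by (intro sum.cong refl) (simp add: amplify_unit[OF h _ _ g])

lemma amplify_mult:
  assumes h: "corner_hom d e \<beta>" and g: "\<beta> (munit 0 0) * r = r" "r * \<beta> (munit 0 0) = r"
    and g': "\<beta> (munit 0 0) * r' = r'" "r' * \<beta> (munit 0 0) = r'"
  shows "amplify d \<beta> r * amplify d \<beta> r' = amplify d \<beta> (r * r')"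
proof -
  have "amplify d \<beta> r * (\<beta> (munit j 0) * r' * \<beta> (munit 0 j)) = \<beta> (munit j 0) * (r * r') * \<beta> (munit 0 j)" if "j < d" for j
  proof -
    have "amplify d \<beta> r * (\<beta> (munit j 0) * r' * \<beta> (munit 0 j)) = (amplify d \<beta> r * \<beta> (munit j 0)) * r' * \<beta> (munit 0 j)"
      by (simp add: mult.assoc)
    also have "amplify d \<beta> r * \<beta> (munit j 0) = \<beta> (munit j 0) * r * \<beta> (munit 0 0)"
      using amplify_unit(2)[OF h _ _ g, of j 0] that by simp
    finally show ?thesis using g g' by (simp add: mult.assoc)
  qed
  then show ?thesis unfolding amplify_def[of d \<beta> r'] amplify_def[of d \<beta> "r * r'"] sum_distrib_left
    by (intro sum.cong refl) simp
qed

lemma amplify_adj: "corner_hom d e \<beta> \<Longrightarrow> 0 < d \<Longrightarrow> adj (amplify d \<beta> r) = amplify d \<beta> (adj r)"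
  unfolding amplify_def adj_sum
  by (intro sum.cong refl) (simp add: mult.assoc corner_homD(5)[symmetric])

lemma amplify_corner: "corner_hom d e \<beta> \<Longrightarrow> 0 < d \<Longrightarrow> r \<in> corner e \<Longrightarrow> amplify d \<beta> r \<in> corner e"
  unfolding amplify_def by (intro corner_sum) (auto simp: corner_homD(1))

lemma amplify_sum: "amplify d \<beta> (\<Sum>k\<in>S. f k) = (\<Sum>k\<in>S. amplify d \<beta> (f k))"
  unfolding amplify_def sum_distrib_left sum_distrib_right by (rule sum.swap)

lemma amplify_unit_proj:
  assumes h: "corner_hom d e \<beta>" and d: "0 < d"
  shows "amplify d \<beta> (\<beta> (munit 0 0)) = \<beta> (idm d)"
proof -
  have "amplify d \<beta> (\<beta> (munit 0 0)) = (\<Sum>j<d. \<beta> (munit j j))"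
    unfolding amplify_def using d by (intro sum.cong refl) (simp add: corner_homD(4)[OF h, symmetric])
  also have "\<dots> = \<beta> (idm d)" unfolding idm_eq_sum using h by (subst corner_hom_sum) auto
  finally show ?thesis .
qed

text \<open>Every column supported in atom \<open>i\<close> is obtained from \<open>avec N i\<close>
  by a block diagonal factor, whose image commutes with the nest. So the nest projection acts on
  such columns through the same \<open>hproj\<close> on the right.\<close>

lemma hom_col_hproj:
  assumes nd: "nest_data N" "nest_data N'" and h: "nest_hom N N' \<beta>" and i: "i < natoms N"
    and x: "x \<in> ncorner N" "natom N i * x = x" "x * munit 0 0 = x"
  shows "nproj N' m * \<beta> x = \<beta> x * hproj N N' \<beta> i m"
proof -
  note hs = corner_homD[OF nest_hom_corner[OF h]]
  let ?y = "avec N i"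
  note a = avec[OF nd(1) i]
  note u = unit_vec_simps[OF a(1)]
  have "blk N (x * adj ?y) i i = x * adj ?y" using atom_vec_block[OF nd(1) x(2) a(2), of i i] by simp
  then have "x * adj ?y \<in> dia N" using blk_diag_dia[OF nd(1), of "x * adj ?y" i] x(1) u by simp
  then have d: "\<beta> (x * adj ?y) \<in> dia N'" using nest_hom_dia[OF nd h] by blast
  have "\<beta> x * hproj N N' \<beta> i m = \<beta> (x * adj ?y) * nproj N' m * \<beta> ?y"
    using x u by (simp add: hproj_def hs mult.assoc)
  also have "\<dots> = nproj N' m * (\<beta> (x * adj ?y) * \<beta> ?y)"
    using dia_commute[OF d, of m] by (simp add: mult.assoc[symmetric])
  also have "\<beta> (x * adj ?y) * \<beta> ?y = \<beta> x"
    using x u hs(4)[of "x * adj ?y" ?y] by (simp add: mult.assoc)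
  finally show ?thesis by simp
qed

text \<open>On the slice belonging to a joint eigenvector the nest projection acts as
  \<open>\<beta> Z\<close>, where \<open>Z\<close> collects the eigenvalues atom by atom. The slice
  commutes with the range of \<beta> and everything is self-adjoint, so it commutes with the
  nest.\<close>

lemma amplify_dia:
  assumes nd: "nest_data N" "nest_data N'" and h: "nest_hom N N' \<beta>"
    and \<eta>: "unit_vec_in (ndim N') \<eta>" "\<beta> (munit 0 0) * \<eta> = \<eta>"
    and ev: "\<And>i m. i < natoms N \<Longrightarrow> hproj N N' \<beta> i m * \<eta> = 0 \<or> hproj N N' \<beta> i m * \<eta> = \<eta>"
  shows "amplify (ndim N) \<beta> (\<eta> * adj \<eta>) \<in> dia N'"
proof -
  let ?d = "ndim N" and ?r = "\<eta> * adj \<eta>" and ?l = "natoms N"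
  let ?R = "amplify ?d \<beta> ?r"
  note ch = nest_hom_corner[OF h]
  note hs = corner_homD[OF ch]
  have d: "0 < ?d" using nd(1) by (simp add: nest_data_def)
  have g: "\<beta> (munit 0 0) * ?r = ?r" "?r * \<beta> (munit 0 0) = ?r"
  proof -
    have "adj (\<beta> (munit 0 0)) = \<beta> (munit 0 0)" using d hs(5)[of "munit 0 0"] by simp
    then have "adj \<eta> * \<beta> (munit 0 0) = adj \<eta>" using arg_cong[OF \<eta>(2), of adj] by simp
    then show "\<beta> (munit 0 0) * ?r = ?r" "?r * \<beta> (munit 0 0) = ?r"
      using \<eta>(2) by (simp_all add: mult.assoc) (simp add: mult.assoc[symmetric])
  qed
  have aR: "adj ?R = ?R" using amplify_adj[OF ch d] by simp
  have "nproj N' m * ?R = ?R * nproj N' m" for m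
  proof -
    \<comment> \<open>The eigenvalue, 0 or 1, of the \<open>m\<close>-th chain projection of atom
      \<open>i\<close> at \<eta>.\<close>
    define \<epsilon> where "\<epsilon> i = (if hproj N N' \<beta> i m * \<eta> = 0 then 0 else 1 :: complex)" for i
    define Z where "Z = (\<Sum>i<?l. scl (\<epsilon> i) (natom N i))"
    have ev': "hproj N N' \<beta> i m * \<eta> = scl (\<epsilon> i) \<eta>" if "i < ?l" for i
      using ev[OF that, of m] by (auto simp: \<epsilon>_def)
    have Zc: "Z \<in> ncorner N" using nd by (simp add: Z_def)
    have Za: "adj Z = Z" using nd unfolding Z_def adj_sum by (intro sum.cong refl) (simp add: \<epsilon>_def)
    have "nproj N' m * \<beta> (munit j 0) * ?r = \<beta> Z * \<beta> (munit j 0) * ?r" if j: "j < ?d" for j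
    proof -
      have mj: "munit j 0 \<in> ncorner N" using j d by simp
      have "\<beta> (munit j 0) = \<beta> (\<Sum>i<?l. natom N i * munit j 0)"
        unfolding sum_distrib_right[symmetric] sum_natom[OF nd(1)] using mj by simp
      also have "\<dots> = (\<Sum>i<?l. \<beta> (natom N i * munit j 0))" using nd mj by (intro corner_hom_sum[OF ch]) auto
      finally have "nproj N' m * \<beta> (munit j 0) * ?r = (\<Sum>i<?l. nproj N' m * \<beta> (natom N i * munit j 0) * ?r)"
        by (simp add: sum_distrib_left sum_distrib_right)
      also have "\<dots> = (\<Sum>i<?l. scl (\<epsilon> i) (\<beta> (natom N i * munit j 0) * ?r))"
      proof (intro sum.cong refl)
        fix i assume "i \<in> {..<?l}"
        then have i: "i < ?l" by simp
        have "nproj N' m * \<beta> (natom N i * munit j 0) = \<beta> (natom N i * munit j 0) * hproj N N' \<beta> i m"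
          using nd mj by (intro hom_col_hproj[OF nd h i]) (auto simp: nsimps mult.assoc)
        then have "nproj N' m * \<beta> (natom N i * munit j 0) * ?r = \<beta> (natom N i * munit j 0) * (hproj N N' \<beta> i m * \<eta>) * adj \<eta>"
          by (simp add: mult.assoc)
        then show "nproj N' m * \<beta> (natom N i * munit j 0) * ?r = scl (\<epsilon> i) (\<beta> (natom N i * munit j 0) * ?r)"
          unfolding ev'[OF i] by (simp add: mult.assoc)
      qed
      also have "\<dots> = (\<Sum>i<?l. \<beta> (scl (\<epsilon> i) (natom N i) * munit j 0)) * ?r"
        unfolding sum_distrib_right using nd mj by (intro sum.cong refl) (simp add: hs)
      also have "(\<Sum>i<?l. \<beta> (scl (\<epsilon> i) (natom N i) * munit j 0)) = \<beta> (Z * munit j 0)"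
        unfolding Z_def sum_distrib_right using nd mj by (intro corner_hom_sum[OF ch, symmetric]) auto
      finally show ?thesis using Zc mj by (simp add: hs)
    qed
    then have 1: "nproj N' m * ?R = \<beta> Z * ?R"
      unfolding amplify_def sum_distrib_left by (intro sum.cong refl) (simp add: mult.assoc[symmetric])
    have 2: "\<beta> Z * ?R = ?R * \<beta> Z" by (rule amplify_commute[OF ch g Zc])
    have "?R * nproj N' m = adj (nproj N' m * ?R)" using aR nd by simp
    also have "\<dots> = adj (\<beta> Z * ?R)" unfolding 1 ..
    also have "\<dots> = ?R * \<beta> Z" using aR Za hs(5)[OF Zc] by simp
    finally show ?thesis using 1 2 by simp
  qed
  moreover have "?R \<in> ncorner N'" using amplify_corner[OF ch d] \<eta>(1) by (simp add: unit_vec_in_def)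
  ultimately show ?thesis by (simp add: dia_def)
qed

text \<open>A joint eigenbasis of all chain projections in the range of
  \<open>\<beta> (munit 0 0)\<close> splits \<open>\<beta> (idm (ndim N))\<close> into projections
  of the commutant. Each is block diagonal, so multiplication by it stays in the nest algebra, and
  as it belongs to a single eigenvector the map cut down by it has multiplicity one.\<close>

lemma regular_decomposition:
  assumes nd: "nest_data N" "nest_data N'" and h: "nest_hom N N' \<beta>"
    and comm: "\<forall>i<natoms N. \<forall>j<natoms N. \<forall>m n.
      hproj N N' \<beta> i m * hproj N N' \<beta> j n = hproj N N' \<beta> j n * hproj N N' \<beta> i m"
  shows "\<exists>(r::nat) R. (\<forall>k<r. R k \<in> dia N' \<and> adj (R k) = R k \<and> R k * R k = R k \<and>
        (\<forall>y\<in>ncorner N. \<beta> y * R k = R k * \<beta> y) \<and>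
        (\<forall>y. unit_vec_in (ndim N) y \<longrightarrow> (\<exists>\<eta>. unit_vec_in (ndim N') \<eta> \<and> \<beta> (y * adj y) * R k = \<eta> * adj \<eta>))) \<and>
      (\<forall>j<r. \<forall>k<r. j \<noteq> k \<longrightarrow> R j * R k = 0) \<and> \<beta> (idm (ndim N)) = (\<Sum>k<r. R k)"
proof -
  let ?d = "ndim N" and ?e = "ndim N'"
  note ch = nest_hom_corner[OF h]
  note hs = corner_homD[OF ch]
  have d: "0 < ?d" using nd(1) by (simp add: nest_data_def)
  have m00: "munit 0 0 \<in> corner ?d" using d by simp
  define g where "g = \<beta> (munit 0 0)"
  have g: "g \<in> corner ?e" "adj g = g" "g * g = g"
    using hs(1)[OF m00] hs(5)[OF m00] hs(4)[OF m00 m00] by (simp_all add: g_def)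
  \<comment> \<open>Chains are constant beyond position \<open>natoms N'\<close>, so finitely many
    projections exhaust them.\<close>
  define S where "S = (\<lambda>(i, m). hproj N N' \<beta> i m) ` ({..<natoms N} \<times> {..natoms N'})"
  have hS: "hproj N N' \<beta> i m \<in> S" if "i < natoms N" for i m
  proof (cases "m \<le> natoms N'")
    case True
    then show ?thesis using that by (auto simp: S_def)
  next
    case False
    then have "nproj N' m = nproj N' (natoms N')" by (simp add: nproj_ge[OF nd(2)])
    then have "hproj N N' \<beta> i m = hproj N N' \<beta> i (natoms N')" by (simp add: hproj_def)
    then show ?thesis using that by (auto simp: S_def)
  qed
  have S: "s \<in> corner ?e \<and> adj s = s \<and> s * s = s \<and> s * g = g * s" if sS: "s \<in> S" for s
  proof -
    obtain i m where s: "s = hproj N N' \<beta> i m" and i: "i < natoms N" using sS by (auto simp: S_def)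
    note u = unit_vec_simps[OF avec(1)[OF nd(1) i]]
    have 1: "adj s = s" using hproj_adj[OF nd(2)] s by simp
    have 2: "s * s = s"
      unfolding s hproj_def using compressed_central_idem[OF nd h i centralizes_nproj] nproj_mult[OF nd(2)] by simp
    have 3: "\<beta> (avec N i) * g = \<beta> (avec N i)"
      using hs(4)[OF u(7) m00] u by (simp add: g_def)
    have 4: "s * g = s" using 3 unfolding s hproj_def by (simp add: mult.assoc)
    have "g * s = s" by (metis adj_mult 1 4 g(2))
    then show ?thesis using 1 2 4 s u nd by (simp add: hproj_def hs)
  qed
  have commS: "s * t = t * s" if "s \<in> S" "t \<in> S" for s t using that comm by (auto simp: S_def)
  have finS: "finite S" by (simp add: S_def)
  obtain r :: nat and \<eta> where \<eta>: "\<And>k. k < r \<Longrightarrow> unit_vec_in ?e (\<eta> k) \<and> g * \<eta> k = \<eta> k \<and> (\<forall>s\<in>S. s * \<eta> k = 0 \<or> s * \<eta> k = \<eta> k)"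
    "\<And>j k. j < r \<Longrightarrow> k < r \<Longrightarrow> j \<noteq> k \<Longrightarrow> adj (\<eta> j) * \<eta> k = 0" "g = (\<Sum>k<r. \<eta> k * adj (\<eta> k))"
    using adapted_orthonormal_basis[OF finS g S commS] by blast
  define R where "R = (\<lambda>k. amplify ?d \<beta> (\<eta> k * adj (\<eta> k)))"
  have gr: "\<beta> (munit 0 0) * (\<eta> k * adj (\<eta> k)) = \<eta> k * adj (\<eta> k)" "\<eta> k * adj (\<eta> k) * \<beta> (munit 0 0) = \<eta> k * adj (\<eta> k)"
    if "k < r" for k
  proof -
    have 1: "g * \<eta> k = \<eta> k" using \<eta>(1)[OF that] by simp
    then have 2: "adj (\<eta> k) * g = adj (\<eta> k)" by (metis adj_mult 1 g(2))
    show "\<beta> (munit 0 0) * (\<eta> k * adj (\<eta> k)) = \<eta> k * adj (\<eta> k)" using 1 by (simp add: g_def mult.assoc[symmetric])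
    show "\<eta> k * adj (\<eta> k) * \<beta> (munit 0 0) = \<eta> k * adj (\<eta> k)" using 2 by (simp add: g_def mult.assoc)
  qed
  have RR: "R j * R k = (if j = k then R k else 0)" if "j < r" "k < r" for j k
  proof -
    have "R j * R k = amplify ?d \<beta> (\<eta> j * (adj (\<eta> j) * \<eta> k) * adj (\<eta> k))"
      unfolding R_def amplify_mult[OF ch gr[OF that(1)] gr[OF that(2)]] by (simp add: mult.assoc)
    moreover have "\<eta> k * (adj (\<eta> k) * \<eta> k) * adj (\<eta> k) = \<eta> k * adj (\<eta> k)"
      using \<eta>(1)[OF that(2)] unit_vec_simps[of ?e "\<eta> k"] by (simp add: mult.assoc)
    ultimately show ?thesis using \<eta>(2)[OF that] by (auto simp: R_def amplify_def)
  qed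
  have "R k \<in> dia N'" if "k < r" for k
    unfolding R_def using \<eta>(1)[OF that] hS by (intro amplify_dia[OF nd h]) (auto simp: g_def)
  moreover have "adj (R k) = R k" for k unfolding R_def using amplify_adj[OF ch d] by simp
  moreover have c: "\<beta> y * R k = R k * \<beta> y" if "k < r" "y \<in> ncorner N" for k y
    unfolding R_def by (rule amplify_commute[OF ch gr[OF that(1)] that(2)])
  moreover have "\<exists>\<zeta>. unit_vec_in ?e \<zeta> \<and> \<beta> (y * adj y) * R k = \<zeta> * adj \<zeta>" if k: "k < r" and y: "unit_vec_in ?d y" for k y
  proof -
    note u = unit_vec_simps[OF y]
    note e = \<eta>(1)[OF k]
    note ue = unit_vec_simps[OF conjunct1[OF e]]
    \<comment> \<open>Cutting \<open>\<beta> (y * adj y)\<close> by \<open>R k\<close> leaves the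
      rank one projection of this vector.\<close>
    define \<zeta> where "\<zeta> = \<beta> y * \<eta> k"
    have b: "\<beta> y * \<beta> (munit 0 0) = \<beta> y" "\<beta> (munit 0 0) * \<beta> (adj y) = \<beta> (adj y)" "adj (\<beta> y) * \<beta> y = g"
      using hs(4)[OF u(7) m00] hs(4)[of "munit 0 0" "adj y"] hs(4)[of "adj y" y] u m00 by (simp_all add: hs g_def)
    have r: "\<beta> (munit 0 0) * R k * \<beta> (munit 0 0) = \<eta> k * adj (\<eta> k)"
      using amplify_unit(1)[OF ch d d gr[OF k]] gr[OF k] by (simp add: R_def mult.assoc)
    have "\<beta> (y * adj y) * R k = \<beta> y * (\<beta> (adj y) * R k)" using u by (simp add: hs mult.assoc)
    also have "\<dots> = \<beta> y * R k * \<beta> (adj y)" using c[OF k, of "adj y"] u by (simp add: mult.assoc)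
    also have "\<dots> = \<beta> y * \<beta> (munit 0 0) * R k * (\<beta> (munit 0 0) * \<beta> (adj y))" unfolding b ..
    also have "\<dots> = \<beta> y * (\<beta> (munit 0 0) * R k * \<beta> (munit 0 0)) * \<beta> (adj y)" by (simp add: mult.assoc)
    also have "\<dots> = \<zeta> * adj \<zeta>" unfolding r \<zeta>_def using u by (simp add: hs mult.assoc)
    finally have "\<beta> (y * adj y) * R k = \<zeta> * adj \<zeta>" .
    moreover have "adj \<zeta> * \<zeta> = munit 0 0"
    proof -
      have "adj \<zeta> * \<zeta> = adj (\<eta> k) * ((adj (\<beta> y) * \<beta> y) * \<eta> k)" by (simp add: \<zeta>_def mult.assoc)
      then show ?thesis using b(3) e ue by simp
    qed
    moreover have "\<zeta> \<in> corner ?e" using hs(1)[OF u(7)] ue by (simp add: \<zeta>_def)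
    ultimately show ?thesis unfolding unit_vec_in_def by blast
  qed
  moreover have "\<beta> (idm ?d) = (\<Sum>k<r. R k)"
    unfolding R_def amplify_sum[symmetric] \<eta>(3)[symmetric] unfolding g_def by (rule amplify_unit_proj[OF ch d, symmetric])
  ultimately show ?thesis using RR by (intro exI[of _ r] exI[of _ R]) auto
qed

section \<open>Regular embeddings\<close>

lemma rank_le_1_minors:
  fixes A :: "complex mat"
  assumes A: "A \<in> carrier_mat n nc" and rk: "vec_space.rank n A \<le> 1"
    and lt: "i < n" "k < n" "j < nc" "l < nc"
  shows "A $$ (i, j) * A $$ (k, l) = A $$ (i, l) * A $$ (k, j)"
proof (rule ccontr)
  assume ne: "A $$ (i, j) * A $$ (k, l) \<noteq> A $$ (i, l) * A $$ (k, j)"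
  interpret vec_space "TYPE(complex)" n .
  let ?u = "col A j" and ?v = "col A l"
  have e: "?u $ i = A $$ (i, j)" "?u $ k = A $$ (k, j)" "?v $ i = A $$ (i, l)" "?v $ k = A $$ (k, l)"
    using A lt by auto
  have uv: "?u \<noteq> ?v" using ne e by (metis mult.commute)
  have sub: "{?u, ?v} \<subseteq> carrier_vec n" using A lt by auto
  have "lin_indpt {?u, ?v}"
  proof (rule finite_lin_indpt2[OF _ sub])
    fix a assume "lincomb a {?u, ?v} = 0\<^sub>v n"
    then have z: "(\<Sum>x\<in>{?u, ?v}. a x * x $ r) = 0" if "r < n" for r
      using lincomb_index[OF that sub, of a] that by simp
    have 1: "a ?u * A $$ (i, j) + a ?v * A $$ (i, l) = 0" "a ?u * A $$ (k, j) + a ?v * A $$ (k, l) = 0"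
      using z[OF lt(1)] z[OF lt(2)] uv e by auto
    let ?D = "A $$ (i, j) * A $$ (k, l) - A $$ (i, l) * A $$ (k, j)"
    \<comment> \<open>Cramer's rule: a nonzero minor makes the two columns independent.\<close>
    have "a ?u * ?D = (a ?u * A $$ (i, j) + a ?v * A $$ (i, l)) * A $$ (k, l) - (a ?u * A $$ (k, j) + a ?v * A $$ (k, l)) * A $$ (i, l)"
      "a ?v * ?D = (a ?u * A $$ (k, j) + a ?v * A $$ (k, l)) * A $$ (i, j) - (a ?u * A $$ (i, j) + a ?v * A $$ (i, l)) * A $$ (k, j)"
      by (simp_all add: algebra_simps)
    then have "a ?u * ?D = 0" "a ?v * ?D = 0" unfolding 1 by simp_all
    then show "\<forall>v\<in>{?u, ?v}. a v = 0" using ne by auto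
  qed auto
  moreover have "{?u, ?v} \<subseteq> set (cols A)"
    using A lt by (metis cols_length cols_nth carrier_matD(2) insert_subset empty_subsetI nth_mem)
  ultimately have "card {?u, ?v} \<le> rank A" by (intro rank_ge_card_indpt[OF A])
  then show False using rk uv by simp
qed

lemma rank_ge_1:
  fixes A :: "complex mat"
  assumes A: "A \<in> carrier_mat n nc" and nz: "A \<noteq> 0\<^sub>m n nc"
  shows "1 \<le> vec_space.rank n A"
proof -
  interpret vec_space "TYPE(complex)" n .
  obtain i j where ij: "i < n" "j < nc" "A $$ (i, j) \<noteq> 0" using A nz by (metis carrier_matD eq_matI index_zero_mat)
  let ?u = "col A j"
  have u: "?u $ i \<noteq> 0" using A ij by simp
  have sub: "{?u} \<subseteq> carrier_vec n" using A ij by auto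
  have "lin_indpt {?u}"
  proof (rule finite_lin_indpt2[OF _ sub])
    fix a assume "lincomb a {?u} = 0\<^sub>v n"
    then show "\<forall>v\<in>{?u}. a v = 0"
      using lincomb_index[OF ij(1) sub, of a] ij(1) u by simp
  qed auto
  moreover have "{?u} \<subseteq> set (cols A)"
    using A ij by (metis cols_length cols_nth carrier_matD(2) insert_subset empty_subsetI nth_mem)
  ultimately have "card {?u} \<le> rank A" by (intro rank_ge_card_indpt[OF A])
  then show ?thesis by simp
qed

lemma projection_iff_fm:
  assumes "p \<in> carrier_mat n n"
  shows "projection n p \<longleftrightarrow> adj (fm_of p) = fm_of p \<and> fm_of p * fm_of p = fm_of p"
proof -
  have "mat_adjoint p = p \<longleftrightarrow> adj (fm_of p) = fm_of p"
    using assms fm_of_inj[of "mat_adjoint p" n p] by (simp add: fm_of_adjoint)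
  moreover have "p * p = p \<longleftrightarrow> fm_of p * fm_of p = fm_of p"
    using assms fm_of_inj[of "p * p" n p] fm_of_mult[OF assms assms] by auto
  ultimately show ?thesis using assms by (simp add: projection_def)
qed

text \<open>Vanishing minors allow the outer indices to be exchanged under the sum, which leaves the
  trace of \<open>s * x\<close> as the scalar.\<close>

lemma minors_sandwich:
  assumes x: "x \<in> corner n" and s: "s \<in> corner n"
    and minors: "\<And>i j k l. ent x i j * ent x k l = ent x i l * ent x k j"
  shows "\<exists>c. x * s * x = scl c x"
proof (intro exI fmat_eqI)
  fix i l
  have b: "ent x i j \<noteq> 0 \<Longrightarrow> i < n \<and> j < n" "ent s i j \<noteq> 0 \<Longrightarrow> i < n \<and> j < n" for i j
    using x s by (auto simp: corner_def)
  have xs: "x * s \<in> corner n" using x s by simp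
  have "ent (x * s * x) i l = (\<Sum>k<n. ent (x * s) i k * ent x k l)"
    by (rule ent_times) (use b in blast)
  also have "\<dots> = (\<Sum>k<n. (\<Sum>j<n. ent x i j * ent s j k) * ent x k l)"
    by (intro sum.cong refl arg_cong2[where f = "(*)"] ent_times) (use b in blast)
  also have "\<dots> = (\<Sum>k<n. \<Sum>j<n. ent s j k * (ent x i j * ent x k l))"
    by (simp add: sum_distrib_left sum_distrib_right mult_ac)
  also have "\<dots> = (\<Sum>k<n. \<Sum>j<n. ent s j k * ent x k j) * ent x i l"
    unfolding minors[of i _ _ l] by (simp add: sum_distrib_left sum_distrib_right mult_ac)
  finally show "ent (x * s * x) i l = ent (scl (\<Sum>k<n. \<Sum>j<n. ent s j k * ent x k j) x) i l" by simp
qed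

lemma rank_one_projection_iff:
  "rank_one_projection n p \<longleftrightarrow> p \<in> carrier_mat n n \<and> (\<exists>y. unit_vec_in n y \<and> fm_of p = y * adj y)"
proof
  assume r: "rank_one_projection n p"
  then have pc: "p \<in> carrier_mat n n" and pr: "projection n p" and rk: "vec_space.rank n p = 1"
    by (auto simp: rank_one_projection_def projection_def)
  let ?x = "fm_of p"
  note px = pr[unfolded projection_iff_fm[OF pc]]
  have nz: "?x \<noteq> 0"
  proof
    assume "?x = 0"
    then have "p = 0\<^sub>m n n" using fm_of_inj[OF pc, of "0\<^sub>m n n"] by simp
    moreover have "vec_space.rank n (0\<^sub>m n n :: complex mat) = 0" by (rule vec_space.rank_0I)
    ultimately show False using rk by simp
  qed
  have minors: "ent ?x i j * ent ?x k l = ent ?x i l * ent ?x k j" for i j k l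
    using rank_le_1_minors[OF pc, of i k j l] rk pc by (auto simp: ent_fm_of)
  have xc: "?x \<in> corner n" using pc by simp
  obtain t where t: "t \<in> corner n" "unit_vec_in n (?x * t)" using range_unit_vec[OF xc nz] .
  define y where "y = ?x * t"
  have y: "unit_vec_in n y" using t by (simp add: y_def)
  note u = unit_vec_simps[OF y]
  have xy: "?x * y = y" using px by (simp add: y_def mult.assoc[symmetric])
  have yx: "adj y * ?x = adj y" by (metis adj_mult xy px)
  \<comment> \<open>\<open>y * adj y\<close> lies under the projection and is therefore a scalar
    multiple of it; both are nonzero idempotents, so the scalar is 1.\<close>
  obtain c where c: "?x * (y * adj y) * ?x = scl c ?x" using minors_sandwich[OF xc _ minors, of "y * adj y"] u by auto
  then have yc: "y * adj y = scl c ?x" using xy yx by (metis mult.assoc)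
  have "(y * adj y) * (y * adj y) = y * adj y" using u by (simp add: mult.assoc)
  then have "scl (c * c) ?x = scl c ?x" unfolding yc using px by simp
  then have "scl (c * c - c) ?x = 0"
    by (metis (no_types, opaque_lifting) add.right_inverse diff_conv_add_uminus ent_scl ent_zero fmat_eqI
        left_diff_distrib right_minus_eq)
  then have "c * (c - 1) = 0" using nz by (simp add: algebra_simps)
  moreover have "c \<noteq> 0" using yc rank_one_nonzero[OF y y] by auto
  ultimately have "c = 1" by simp
  then show "p \<in> carrier_mat n n \<and> (\<exists>y. unit_vec_in n y \<and> fm_of p = y * adj y)" using pc y yc by auto
next
  assume "p \<in> carrier_mat n n \<and> (\<exists>y. unit_vec_in n y \<and> fm_of p = y * adj y)"
  then obtain y where pc: "p \<in> carrier_mat n n" and y: "unit_vec_in n y" and py: "fm_of p = y * adj y" by blast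
  note u = unit_vec_simps[OF y]
  have pr: "projection n p" unfolding projection_iff_fm[OF pc] py using u by (simp add: mult.assoc)
  have "p \<noteq> 0\<^sub>m n n" using rank_one_nonzero[OF y y] py by auto
  then have ge: "1 \<le> vec_space.rank n p" by (rule rank_ge_1[OF pc])
  have col: "ent y i k = 0" if "k \<noteq> 0" for i k
    using unit_vec_col[OF y] ent_mult_munit[of y 0 0 i k] that by simp
  have "p $$ (i, j) = ent y i 0 * cnj (ent y j 0)" if "i < dim_row p" "j < dim_col p" for i j
  proof -
    have "p $$ (i, j) = ent (y * adj y) i j" using that by (simp add: py[symmetric] ent_fm_of)
    also have "\<dots> = (\<Sum>k<1. ent y i k * ent (adj y) k j)"
      by (rule ent_times) (use col in \<open>metis less_one\<close>)
    finally show ?thesis by simp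
  qed
  then have "vec_space.rank n p \<le> 1"
    by (rule vec_space.rank_le_1_product_entries[OF pc])
  then show "rank_one_projection n p" using pr ge by (simp add: rank_one_projection_def)
qed

definition fm_hom :: "nat \<Rightarrow> (complex mat \<Rightarrow> complex mat) \<Rightarrow> fmat \<Rightarrow> fmat" where
  "fm_hom d \<pi> x = fm_of (\<pi> (mat_of d x))"

lemma star_homD:
  assumes "star_hom d e \<pi>"
  shows "a \<in> carrier_mat d d \<Longrightarrow> \<pi> a \<in> carrier_mat e e"
    "a \<in> carrier_mat d d \<Longrightarrow> b \<in> carrier_mat d d \<Longrightarrow> \<pi> (a + b) = \<pi> a + \<pi> b"
    "a \<in> carrier_mat d d \<Longrightarrow> \<pi> (c \<cdot>\<^sub>m a) = c \<cdot>\<^sub>m \<pi> a"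
    "a \<in> carrier_mat d d \<Longrightarrow> b \<in> carrier_mat d d \<Longrightarrow> \<pi> (a * b) = \<pi> a * \<pi> b"
    "a \<in> carrier_mat d d \<Longrightarrow> \<pi> (mat_adjoint a) = mat_adjoint (\<pi> a)"
  using assms unfolding star_hom_def by blast+

lemma mat_of_add: "mat_of d (x + y) = mat_of d x + mat_of d y"
  by (rule eq_matI) (auto simp: mat_of_def)

lemma mat_of_scl: "mat_of d (scl c x) = c \<cdot>\<^sub>m mat_of d x"
  by (rule eq_matI) (auto simp: mat_of_def)

lemma mat_of_adj: "mat_of d (adj x) = mat_adjoint (mat_of d x)"
  by (rule eq_matI) (auto simp: mat_of_def mat_adjoint_def mat_of_rows_def)

lemma mat_of_mult:
  assumes "x \<in> corner d" "y \<in> corner d"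
  shows "mat_of d (x * y) = mat_of d x * mat_of d y"
proof -
  have "mat_of d (fm_of (mat_of d x * mat_of d y)) = mat_of d x * mat_of d y"
    by (rule mat_of_fm_of) (rule mult_carrier_mat[OF mat_of_carrier mat_of_carrier])
  then show ?thesis using assms fm_of_mult[OF mat_of_carrier mat_of_carrier, of d x y] by simp
qed

lemma fm_hom_corner_hom:
  assumes "star_hom d e \<pi>"
  shows "corner_hom d e (fm_hom d \<pi>)"
proof -
  note s = star_homD[OF assms]
  have c: "\<pi> (mat_of d x) \<in> carrier_mat e e" for x by (rule s(1)) simp
  show ?thesis
    unfolding corner_hom_def fm_hom_def
    using fm_of_add[OF c c] fm_of_mult[OF c c] c
    by (simp add: mat_of_add mat_of_scl mat_of_adj mat_of_mult s fm_of_smult fm_of_adjoint)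
qed

lemma fm_hom_fm_of: "a \<in> carrier_mat d d \<Longrightarrow> fm_hom d \<pi> (fm_of a) = fm_of (\<pi> a)"
  by (simp add: fm_hom_def)

lemma fm_hom_nest_hom:
  assumes "nest_data N" "nest_data N'" "star_hom (ndim N) (ndim N') \<pi>" "\<And>a. a \<in> nest_alg N \<Longrightarrow> \<pi> a \<in> nest_alg N'"
  shows "nest_hom N N' (fm_hom (ndim N) \<pi>)"
  unfolding nest_hom_def
proof (intro conjI ballI)
  fix x assume x: "x \<in> tri N"
  then have "mat_of (ndim N) x \<in> nest_alg N" using nest_alg_iff[OF assms(1)] tri_corner[OF x] by simp
  then show "fm_hom (ndim N) \<pi> x \<in> tri N'" using assms(4) nest_alg_iff[OF assms(2)] by (simp add: fm_hom_def)
qed (rule fm_hom_corner_hom[OF assms(3)])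

text \<open>Rank one operators between two atoms are order preserving, and comparability of their
  images makes any two chain projections comparable, hence commuting. That \<open>OP\<close> is
  mapped into \<open>OC\<close> follows from either kind of order condition.\<close>

lemma hproj_comm_of_OC:
  assumes nd: "nest_data N" "nest_data N'" and h: "nest_hom N N' \<beta>"
    and oc: "\<And>v. OP N v \<Longrightarrow> OC N' (\<beta> v)" and ij: "i < natoms N" "j < natoms N"
  shows "hproj N N' \<beta> i m * hproj N N' \<beta> j n = hproj N N' \<beta> j n * hproj N N' \<beta> i m"
proof -
  have le: "hproj N N' \<beta> i m * hproj N N' \<beta> j n = hproj N N' \<beta> j n * hproj N N' \<beta> i m"
    if ij: "i < natoms N" "j < natoms N" "i \<le> j" for i j m n
  proof -
    let ?v = "avec N i * adj (avec N j)"
    note a = avec[OF nd(1) ij(1)] avec[OF nd(1) ij(2)]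
    note b = atom_rank_one_block[OF nd(1) ij(1,2)]
    have "OC N' (\<beta> ?v)" by (intro oc single_block_OP[OF nd(1) a(1,3,2,4) ij(3)])
    then have "nproj N' m * \<beta> ?v * nproj N' n = nproj N' m * \<beta> ?v \<or> nproj N' m * \<beta> ?v * nproj N' n = \<beta> ?v * nproj N' n"
      unfolding OC_def by blast
    moreover have nz: "blk N ?v i j \<noteq> 0" using b by simp
    ultimately consider "ple N N' \<beta> i m j n" | "ple N N' \<beta> j n i m"
      using ple_rowsI[OF nd h b(3) nz] ple_colsI[OF nd h b(3) nz] by blast
    then show ?thesis
    proof cases
      case 1
      note e = hproj_mult[OF nd h ij(1,2) 1]
      then show ?thesis by (metis adj_mult hproj_adj[OF nd(2)])
    next
      case 2
      note e = hproj_mult[OF nd h ij(2,1) 2]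
      then show ?thesis by (metis adj_mult hproj_adj[OF nd(2)])
    qed
  qed
  show ?thesis using le[OF ij] le[OF ij(2,1)] by (metis nle_le)
qed

text \<open>The summands are \<open>a \<mapsto> \<pi> a * R k\<close> for the projections of
  \<open>regular_decomposition\<close>: lying in the commutant makes them star homomorphisms, and
  block diagonality keeps them in the nest algebra.\<close>

lemma regular_embeddingI:
  assumes nd: "nest_data N" "nest_data N'" and em: "star_ext_embedding N N' \<pi>"
    and sh: "star_hom (ndim N) (ndim N') \<pi>" and oc: "\<pi> ` Pisom_op N \<subseteq> Pisom_oc N'"
  shows "regular_embedding N N' \<pi>"
proof -
  let ?d = "ndim N" and ?e = "ndim N'"
  define \<beta> where "\<beta> = fm_hom ?d \<pi>"
  note s = star_homD[OF sh]
  have na: "\<pi> a \<in> nest_alg N'" if "a \<in> nest_alg N" for a using em that by (simp add: star_ext_embedding_def)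
  have h: "nest_hom N N' \<beta>" unfolding \<beta>_def by (rule fm_hom_nest_hom[OF nd sh na])
  note hs = corner_homD[OF nest_hom_corner[OF h]]
  have \<beta>: "\<beta> (fm_of a) = fm_of (\<pi> a)" if "a \<in> full_alg N" for a using fm_hom_fm_of[OF that] by (simp add: \<beta>_def)
  have oc\<beta>: "OC N' (\<beta> v)" if v: "OP N v" for v
  proof -
    have vc: "v \<in> ncorner N" using v tri_corner by (auto simp: OP_def)
    have "mat_of ?d v \<in> Pisom_op N" using v vc by (simp add: Pisom_op_iff[OF nd(1)])
    then have "\<pi> (mat_of ?d v) \<in> Pisom_oc N'" using oc by blast
    then show ?thesis by (simp add: Pisom_oc_iff[OF nd(2)] \<beta>_def fm_hom_def)
  qed
  have hcomm: "\<forall>i<natoms N. \<forall>j<natoms N. \<forall>m n.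
      hproj N N' \<beta> i m * hproj N N' \<beta> j n = hproj N N' \<beta> j n * hproj N N' \<beta> i m"
    using hproj_comm_of_OC[OF nd h oc\<beta>] by blast
  obtain r :: nat and R where
      R1: "\<forall>k<r. R k \<in> dia N' \<and> adj (R k) = R k \<and> R k * R k = R k \<and>
        (\<forall>y\<in>ncorner N. \<beta> y * R k = R k * \<beta> y) \<and>
        (\<forall>y. unit_vec_in ?d y \<longrightarrow> (\<exists>\<eta>. unit_vec_in ?e \<eta> \<and> \<beta> (y * adj y) * R k = \<eta> * adj \<eta>))"
      and R2: "\<forall>j<r. \<forall>k<r. j \<noteq> k \<longrightarrow> R j * R k = 0" and R3: "\<beta> (idm ?d) = (\<Sum>k<r. R k)"
    using regular_decomposition[OF nd h hcomm] by (elim exE conjE)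
  have R: "\<And>k. k < r \<Longrightarrow> R k \<in> dia N'" "\<And>k. k < r \<Longrightarrow> adj (R k) = R k"
      "\<And>k. k < r \<Longrightarrow> R k * R k = R k" "\<And>k y. k < r \<Longrightarrow> y \<in> ncorner N \<Longrightarrow> \<beta> y * R k = R k * \<beta> y"
      "\<And>k y. k < r \<Longrightarrow> unit_vec_in ?d y \<Longrightarrow> \<exists>\<eta>. unit_vec_in ?e \<eta> \<and> \<beta> (y * adj y) * R k = \<eta> * adj \<eta>"
      "\<And>j k. j < r \<Longrightarrow> k < r \<Longrightarrow> j \<noteq> k \<Longrightarrow> R j * R k = 0" "\<beta> (idm ?d) = (\<Sum>k<r. R k)"
    using R1 R2 R3 by blast+
  define \<phi> where "\<phi> = (\<lambda>k a. \<pi> a * mat_of ?e (R k))"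
  have Rc: "R k \<in> corner ?e" if "k < r" for k using R(1)[OF that] dia_corner by blast
  have \<phi>c: "\<phi> k a \<in> full_alg N'" if "a \<in> full_alg N" for k a
    unfolding \<phi>_def by (rule mult_carrier_mat[OF s(1)[OF that] mat_of_carrier])
  have f\<phi>: "fm_of (\<phi> k a) = \<beta> (fm_of a) * R k" if "k < r" "a \<in> full_alg N" for k a
    using fm_of_mult[OF s(1)[OF that(2)] mat_of_carrier] Rc[OF that(1)] \<beta>[OF that(2)] by (simp add: \<phi>_def)
  have full: "a \<in> full_alg N" if "a \<in> nest_alg N" for a using that nest_alg_iff[OF nd(1)] by blast
  have pos: "0 < ?d" using nd(1) by (simp add: nest_data_def)
  have m00: "munit 0 0 \<in> corner ?d" using pos by simp
  have u00: "unit_vec_in ?d (munit 0 0)" using m00 by (simp add: unit_vec_in_def)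
  have eqI: "a = b" if "a \<in> full_alg N'" "b \<in> full_alg N'" "fm_of a = fm_of b" for a b
    using fm_of_inj[OF that(1,2)] that(3) by blast
  have sh\<phi>: "star_hom ?d ?e (\<phi> k)" if k: "k < r" for k
    unfolding star_hom_def
  proof (intro conjI ballI allI)
    fix a assume a: "a \<in> full_alg N"
    show "\<phi> k a \<in> full_alg N'" using \<phi>c[OF a] .
    show "\<phi> k (c \<cdot>\<^sub>m a) = c \<cdot>\<^sub>m \<phi> k a" for c
      by (rule eqI) (use a \<phi>c k in \<open>simp_all add: f\<phi> fm_of_smult hs\<close>)
    show "\<phi> k (mat_adjoint a) = mat_adjoint (\<phi> k a)"
      by (rule eqI) (use a \<phi>c k R(2)[OF k] R(4)[OF k] in \<open>simp_all add: f\<phi> fm_of_adjoint hs\<close>)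
    fix b assume b: "b \<in> full_alg N"
    have ab: "a + b \<in> full_alg N" "a * b \<in> full_alg N" using a b by (auto intro: mult_carrier_mat[OF a b])
    show "\<phi> k (a + b) = \<phi> k a + \<phi> k b"
      by (rule eqI) (use a b ab \<phi>c k in \<open>simp_all add: f\<phi> fm_of_add[of _ ?d ?d] fm_of_add[of _ ?e ?e] hs distrib_right\<close>)
    have "\<beta> (fm_of a) * \<beta> (fm_of b) * R k = \<beta> (fm_of a) * R k * (\<beta> (fm_of b) * R k)"
    proof -
      have "\<beta> (fm_of a) * R k * (\<beta> (fm_of b) * R k) = \<beta> (fm_of a) * (R k * \<beta> (fm_of b)) * R k" by (simp add: mult.assoc)
      also have "\<dots> = \<beta> (fm_of a) * (\<beta> (fm_of b) * R k) * R k" using R(4)[OF k, of "fm_of b"] b by simp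
      finally show ?thesis using R(3)[OF k] by (simp add: mult.assoc)
    qed
    then have "fm_of (\<phi> k (a * b)) = fm_of (\<phi> k a * \<phi> k b)"
      using a b ab k fm_of_mult[OF a b] fm_of_mult[OF \<phi>c[OF a] \<phi>c[OF b], of k k] by (simp add: f\<phi> hs)
    then show "\<phi> k (a * b) = \<phi> k a * \<phi> k b"
      using fm_of_inj[OF \<phi>c[OF ab(2)] mult_carrier_mat[OF \<phi>c[OF a] \<phi>c[OF b]]] by blast
  qed
  have "mult_one_embedding N N' (\<phi> k)" if k: "k < r" for k
  proof -
    have ext: "star_extends N N' (\<phi> k) (\<phi> k)" using sh\<phi>[OF k] by (simp add: star_extends_def)
    have "\<phi> k a \<in> nest_alg N'" if a: "a \<in> nest_alg N" for a
      using nest_alg_iff[OF nd(2)] \<phi>c[OF full[OF a]] f\<phi>[OF k full[OF a]] na[OF a] \<beta>[OF full[OF a]]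
        tri_mult[OF _ dia_tri[OF nd(2) R(1)[OF k]]] by simp
    moreover have "inj_on (\<phi> k) (nest_alg N)"
    proof (rule inj_onI)
      fix a b assume ab: "a \<in> nest_alg N" "b \<in> nest_alg N" "\<phi> k a = \<phi> k b"
      let ?c = "fm_of a - fm_of b"
      have c: "?c \<in> corner ?d" using full ab by simp
      have bd: "\<beta> (x - y) = \<beta> x - \<beta> y" if "x \<in> corner ?d" "y \<in> corner ?d" for x y
      proof -
        have "\<beta> x = \<beta> (x - y) + \<beta> y" using hs(2)[of "x - y" y] that by simp
        then show ?thesis by simp
      qed
      have cR: "\<beta> ?c * R k = 0"
        using f\<phi>[OF k full[OF ab(1)]] f\<phi>[OF k full[OF ab(2)]] ab full by (simp add: bd left_diff_distrib)
      have "?c = 0"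
      proof (rule ccontr)
        assume nz: "?c \<noteq> 0"
        \<comment> \<open>The elements killed by the map cut down to \<open>R k\<close> form a
          two-sided ideal; a nonzero one would put \<open>munit 0 0\<close> into it, whose image has
          rank one.\<close>
        have "munit 0 0 \<in> corner ?d \<and> \<beta> (munit 0 0) * R k = 0"
        proof (rule corner_ideal_induct[OF c nz m00, where K = "\<lambda>y. y \<in> corner ?d \<and> \<beta> y * R k = 0"])
          show "0 \<in> corner ?d \<and> \<beta> 0 * R k = 0" using corner_hom_zero[OF nest_hom_corner[OF h]] by simp
        next
          fix x y assume "x \<in> corner ?d \<and> \<beta> x * R k = 0" "y \<in> corner ?d \<and> \<beta> y * R k = 0"
          then show "x + y \<in> corner ?d \<and> \<beta> (x + y) * R k = 0" by (simp add: hs distrib_right)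
        next
          fix x y assume xy: "x \<in> corner ?d" "y \<in> corner ?d"
          have "\<beta> (x * ?c * y) * R k = \<beta> x * \<beta> ?c * (\<beta> y * R k)" using xy c by (simp add: hs mult.assoc)
          also have "\<dots> = \<beta> x * (\<beta> ?c * R k) * \<beta> y" using R(4)[OF k xy(2)] by (simp add: mult.assoc)
          finally show "x * ?c * y \<in> corner ?d \<and> \<beta> (x * ?c * y) * R k = 0" using cR xy c by simp
        qed
        moreover obtain \<eta> where "unit_vec_in ?e \<eta>" "\<beta> (munit 0 0 * adj (munit 0 0)) * R k = \<eta> * adj \<eta>"
          using R(5)[OF k u00] by blast
        ultimately show False using rank_one_nonzero[of ?e \<eta> ?e \<eta>] by simp
      qed
      then show "a = b" using fm_of_inj[OF full full] ab by simp
    qed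
    ultimately have "star_ext_embedding N N' (\<phi> k)" using ext by (auto simp: star_ext_embedding_def)
    moreover have "rank_one_projection ?e (\<phi> k p)" if p: "rank_one_projection ?d p" for p
    proof -
      obtain y where pc: "p \<in> full_alg N" and y: "unit_vec_in ?d y" "fm_of p = y * adj y"
        using p unfolding rank_one_projection_iff by blast
      then show ?thesis unfolding rank_one_projection_iff using \<phi>c[OF pc] R(5)[OF k y(1)] f\<phi>[OF k pc] by simp
    qed
    ultimately show ?thesis unfolding mult_one_embedding_def using ext by blast
  qed
  moreover have "\<phi> i (1\<^sub>m ?d) * \<phi> j (1\<^sub>m ?d) = 0\<^sub>m ?e ?e" if "i < r" "j < r" "i \<noteq> j" for i j
  proof -
    have o: "1\<^sub>m ?d \<in> full_alg N" by simp
    have "fm_of (\<phi> i (1\<^sub>m ?d) * \<phi> j (1\<^sub>m ?d)) = \<beta> (idm ?d) * R i * (\<beta> (idm ?d) * R j)"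
      using fm_of_mult[OF \<phi>c[OF o] \<phi>c[OF o]] that f\<phi>[OF _ o] by simp
    also have "\<dots> = \<beta> (idm ?d) * (R i * (\<beta> (idm ?d) * R j))" by (simp add: mult.assoc)
    also have "R i * (\<beta> (idm ?d) * R j) = R i * R j * \<beta> (idm ?d)" using R(4)[OF that(2), of "idm ?d"] by (simp add: mult.assoc)
    finally have "fm_of (\<phi> i (1\<^sub>m ?d) * \<phi> j (1\<^sub>m ?d)) = fm_of (0\<^sub>m ?e ?e)" using R(6)[OF that] by simp
    then show ?thesis using fm_of_inj[OF mult_carrier_mat[OF \<phi>c[OF o] \<phi>c[OF o]], of "0\<^sub>m ?e ?e"] by simp
  qed
  moreover have "\<pi> a = mat_sum ?e {..<r} (\<lambda>i. \<phi> i a)" if a: "a \<in> nest_alg N" for a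
  proof -
    note ac = full[OF a]
    have "fm_of (mat_sum ?e {..<r} (\<lambda>i. \<phi> i a)) = (\<Sum>k<r. \<beta> (fm_of a) * R k)"
      using fm_of_mat_sum[of "{..<r}" "\<lambda>i. \<phi> i a" ?e] \<phi>c[OF ac] f\<phi>[OF _ ac] by simp
    also have "\<dots> = \<beta> (fm_of a) * \<beta> (idm ?d)" unfolding R(7) sum_distrib_left ..
    also have "\<dots> = fm_of (\<pi> a)" using \<beta>[OF ac] hs(4)[of "fm_of a" "idm ?d"] ac by simp
    finally have e: "fm_of (mat_sum ?e {..<r} (\<lambda>i. \<phi> i a)) = fm_of (\<pi> a)" .
    show ?thesis by (rule eqI[OF s(1)[OF ac] mat_sum_carrier e[symmetric]])
  qed
  ultimately show ?thesis unfolding regular_embedding_def using em by blast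
qed

section \<open>Operator norms\<close>

text \<open>The Euclidean length of column 0, where the vectors live.\<close>

definition cnorm :: "fmat \<Rightarrow> real" where
  "cnorm x = sqrt (Re (ent (adj x * x) 0 0))"

lemma cnorm_L2:
  assumes "\<And>k. ent x k 0 \<noteq> 0 \<Longrightarrow> k < n"
  shows "cnorm x = L2_set (\<lambda>k. cmod (ent x k 0)) {..<n}"
  using ent_adj_mult_diag[of x 0 n] assms by (simp add: cnorm_def L2_set_def)

lemma cnorm_sq: "(cnorm x)\<^sup>2 = Re (ent (adj x * x) 0 0)" and cnorm_ent: "ent (adj x * x) 0 0 = of_real ((cnorm x)\<^sup>2)"
  and cnorm_nonneg [simp]: "0 \<le> cnorm x"
proof -
  obtain n where n: "\<And>i j. ent x i j \<noteq> 0 \<Longrightarrow> i < n \<and> j < n" using ent_bound2 by metis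
  have e: "ent (adj x * x) 0 0 = of_real (\<Sum>k<n. (cmod (ent x k 0))\<^sup>2)"
    by (rule ent_adj_mult_diag) (use n in blast)
  have nn: "0 \<le> (\<Sum>k<n. (cmod (ent x k 0))\<^sup>2)" by (rule sum_nonneg) simp
  show "(cnorm x)\<^sup>2 = Re (ent (adj x * x) 0 0)" using e nn by (simp add: cnorm_def)
  show "ent (adj x * x) 0 0 = of_real ((cnorm x)\<^sup>2)" using e nn by (simp add: cnorm_def)
  show "0 \<le> cnorm x" using e nn by (simp add: cnorm_def)
qed

lemma cnorm_zero [simp]: "cnorm 0 = 0" by (simp add: cnorm_def)

lemma cnorm_triangle: "cnorm (x + y) \<le> cnorm x + cnorm y"
proof -
  obtain n where n: "\<And>i j. ent x i j \<noteq> 0 \<Longrightarrow> i < n \<and> j < n" "\<And>i j. ent y i j \<noteq> 0 \<Longrightarrow> i < n \<and> j < n"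
    using ent_bound2 by blast
  have "cnorm (x + y) = L2_set (\<lambda>k. cmod (ent (x + y) k 0)) {..<n}"
    by (rule cnorm_L2) (use n in \<open>metis add_cancel_right_right ent_plus\<close>)
  also have "\<dots> \<le> L2_set (\<lambda>k. cmod (ent x k 0) + cmod (ent y k 0)) {..<n}"
    by (rule L2_set_mono) (auto intro: norm_triangle_ineq)
  also have "\<dots> \<le> L2_set (\<lambda>k. cmod (ent x k 0)) {..<n} + L2_set (\<lambda>k. cmod (ent y k 0)) {..<n}"
    by (rule L2_set_triangle_ineq)
  also have "\<dots> = cnorm x + cnorm y"
  proof -
    have "cnorm x = L2_set (\<lambda>k. cmod (ent x k 0)) {..<n}" by (rule cnorm_L2) (use n in blast)
    moreover have "cnorm y = L2_set (\<lambda>k. cmod (ent y k 0)) {..<n}" by (rule cnorm_L2) (use n in blast)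
    ultimately show ?thesis by simp
  qed
  finally show ?thesis .
qed

lemma cnorm_scl: "cnorm (scl c x) = cmod c * cnorm x"
proof -
  have "ent (adj (scl c x) * scl c x) 0 0 = (cnj c * c) * ent (adj x * x) 0 0" by (simp add: mult.assoc)
  also have "\<dots> = of_real ((cmod c * cnorm x)\<^sup>2)"
    using complex_norm_square[of c] cnorm_ent[of x] by (simp add: power_mult_distrib mult.commute)
  finally have "ent (adj (scl c x) * scl c x) 0 0 = of_real ((cmod c * cnorm x)\<^sup>2)" .
  then have "(cnorm (scl c x))\<^sup>2 = (cmod c * cnorm x)\<^sup>2" unfolding cnorm_sq by (simp only: Re_complex_of_real)
  then show ?thesis by (rule power2_eq_imp_eq) simp_all
qed

lemma cnorm_Cauchy_Schwarz: "cmod (ent (adj x * y) 0 0) \<le> cnorm x * cnorm y"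
proof -
  obtain n where n: "\<And>i j. ent x i j \<noteq> 0 \<Longrightarrow> i < n \<and> j < n" "\<And>i j. ent y i j \<noteq> 0 \<Longrightarrow> i < n \<and> j < n"
    using ent_bound2 by blast
  have "ent (adj x * y) 0 0 = (\<Sum>k<n. ent (adj x) 0 k * ent y k 0)" by (rule ent_times) (use n in blast)
  then have "cmod (ent (adj x * y) 0 0) \<le> (\<Sum>k<n. cmod (ent x k 0) * cmod (ent y k 0))"
    by (simp add: sum_norm_le norm_mult)
  also have "\<dots> \<le> L2_set (\<lambda>k. cmod (ent x k 0)) {..<n} * L2_set (\<lambda>k. cmod (ent y k 0)) {..<n}"
    using L2_set_mult_ineq[of "\<lambda>k. cmod (ent x k 0)" "\<lambda>k. cmod (ent y k 0)" "{..<n}"] by simp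
  also have "\<dots> = cnorm x * cnorm y"
  proof -
    have "cnorm x = L2_set (\<lambda>k. cmod (ent x k 0)) {..<n}" by (rule cnorm_L2) (use n in blast)
    moreover have "cnorm y = L2_set (\<lambda>k. cmod (ent y k 0)) {..<n}" by (rule cnorm_L2) (use n in blast)
    ultimately show ?thesis by simp
  qed
  finally show ?thesis .
qed

lemma cnorm_proj_le:
  assumes "adj p = p" "p * p = p"
  shows "cnorm (p * y) \<le> cnorm y"
proof -
  have pp: "p * (p * z) = p * z" for z using assms by (simp add: mult.assoc[symmetric])
  have e1: "adj (p * y) * (p * y) = adj y * (p * y)" using assms pp by (simp add: mult.assoc)
  have "adj (y - p * y) * (y - p * y) = (adj y - adj y * p) * (y - p * y)"
    using assms by simp
  also have "\<dots> = adj y * y - adj y * (p * y)"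
    using assms pp by (simp add: algebra_simps)
  finally have e2: "adj (y - p * y) * (y - p * y) = adj y * y - adj y * (p * y)" .
  have "(cnorm (p * y))\<^sup>2 = (cnorm y)\<^sup>2 - (cnorm (y - p * y))\<^sup>2"
    unfolding cnorm_sq e1 e2 by simp
  then have "(cnorm (p * y))\<^sup>2 \<le> (cnorm y)\<^sup>2" by simp
  then show ?thesis by (rule power2_le_imp_le) simp
qed

text \<open>An operator norm bound as a predicate, free of suprema and of sizes;
  \<open>opnorm_le_iff_fbound\<close> ties it to \<open>opnorm\<close>.\<close>

definition fbound :: "fmat \<Rightarrow> real \<Rightarrow> bool" where
  "fbound x C \<longleftrightarrow> 0 \<le> C \<and> (\<forall>y. cnorm (x * y) \<le> C * cnorm y)"

lemma fbound_add: "fbound x C \<Longrightarrow> fbound y D \<Longrightarrow> fbound (x + y) (C + D)"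
  unfolding fbound_def
proof (intro conjI allI)
  fix z assume *: "0 \<le> C \<and> (\<forall>y. cnorm (x * y) \<le> C * cnorm y)" "0 \<le> D \<and> (\<forall>z. cnorm (y * z) \<le> D * cnorm z)"
  have "cnorm ((x + y) * z) \<le> cnorm (x * z) + cnorm (y * z)" unfolding distrib_right by (rule cnorm_triangle)
  also have "\<dots> \<le> C * cnorm z + D * cnorm z" using * by (intro add_mono) auto
  finally show "cnorm ((x + y) * z) \<le> (C + D) * cnorm z" by (simp add: distrib_right)
qed simp

lemma fbound_mult: "fbound x C \<Longrightarrow> fbound y D \<Longrightarrow> fbound (x * y) (C * D)"
  unfolding fbound_def
proof (intro conjI allI)
  fix z assume *: "0 \<le> C \<and> (\<forall>y. cnorm (x * y) \<le> C * cnorm y)" "0 \<le> D \<and> (\<forall>z. cnorm (y * z) \<le> D * cnorm z)"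
  have "cnorm (x * y * z) \<le> C * cnorm (y * z)" using * by (simp add: mult.assoc)
  also have "\<dots> \<le> C * (D * cnorm z)" using * by (intro mult_left_mono) auto
  finally show "cnorm (x * y * z) \<le> C * D * cnorm z" by (simp add: mult.assoc)
qed simp

lemma fbound_scl: "fbound x C \<Longrightarrow> fbound (scl c x) (cmod c * C)"
  unfolding fbound_def by (simp add: cnorm_scl mult.assoc mult_left_mono)

text \<open>For \<open>t = cnorm (adj x * y)\<close> the Cauchy-Schwarz inequality gives
  \<open>t * t \<le> cnorm y * (C * t)\<close>, and \<open>t\<close> cancels.\<close>

lemma fbound_adj:
  assumes "fbound x C"
  shows "fbound (adj x) C"
  unfolding fbound_def
proof (intro conjI allI)
  show C: "0 \<le> C" using assms by (simp add: fbound_def)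
  fix y
  let ?t = "cnorm (adj x * y)"
  have "?t\<^sup>2 = Re (ent (adj y * (x * (adj x * y))) 0 0)" unfolding cnorm_sq by (simp add: mult.assoc)
  also have "\<dots> \<le> cnorm y * cnorm (x * (adj x * y))"
    using cnorm_Cauchy_Schwarz[of y "x * (adj x * y)"] complex_Re_le_cmod order_trans by blast
  also have "\<dots> \<le> cnorm y * (C * ?t)" using assms by (intro mult_left_mono) (auto simp: fbound_def)
  finally have "?t * ?t \<le> (C * cnorm y) * ?t" by (simp add: power2_eq_square mult_ac)
  then show "?t \<le> C * cnorm y"
    using C by (cases "?t = 0") (auto simp: mult_le_cancel_right less_le)
qed

lemma ent_quadratic:
  assumes "m \<in> corner d"
  shows "ent (adj w * m * w) 0 0 = (\<Sum>i<d. \<Sum>j<d. cnj (ent w i 0) * ent m i j * ent w j 0)"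
proof -
  have b: "ent m i j \<noteq> 0 \<Longrightarrow> i < d \<and> j < d" for i j using assms by (auto simp: corner_def)
  have 1: "ent (adj w * m) 0 j = (\<Sum>i<d. cnj (ent w i 0) * ent m i j)" for j
    using ent_times[of "adj w" 0 m j d] b by simp
  have "j < d" if nz: "ent (adj w * m) 0 j \<noteq> 0" for j
  proof -
    obtain i where "cnj (ent w i 0) * ent m i j \<noteq> 0"
      using nz unfolding 1 by (rule sum.not_neutral_contains_not_neutral)
    then show ?thesis using b by auto
  qed
  then have "ent (adj w * m * w) 0 0 = (\<Sum>j<d. ent (adj w * m) 0 j * ent w j 0)"
    by (intro ent_times) blast
  also have "\<dots> = (\<Sum>i<d. \<Sum>j<d. cnj (ent w i 0) * ent m i j * ent w j 0)"
    unfolding 1 sum_distrib_right by (rule sum.swap)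
  finally show ?thesis .
qed

text \<open>Star homomorphisms are contractive: writing \<open>\<eta>\<^sub>r\<close> for the vector of the \<open>r\<close>-th coordinates of
  \<open>\<beta> (e\<^sub>0\<^sub>j) y\<close>, the square of the length of \<open>\<beta> x * y\<close> is the sum of those of the \<open>x * \<eta>\<^sub>r\<close>.\<close>

lemma fbound_hom:
  assumes h: "corner_hom d e \<beta>" and x: "x \<in> corner d" and b: "fbound x C"
  shows "fbound (\<beta> x) C"
  unfolding fbound_def
proof (intro conjI allI)
  show C: "0 \<le> C" using b by (simp add: fbound_def)
  fix y
  note hs = corner_homD[OF h]
  show "cnorm (\<beta> x * y) \<le> C * cnorm y"
  proof (cases "d = 0")
    case True
    then have "x = 0" using x by (intro fmat_eqI) (auto simp: corner_def)
    then show ?thesis using C by (simp add: corner_hom_zero[OF h])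
  next
    case False
    then have d: "0 < d" by simp
    define z where "z j = \<beta> (munit 0 j) * y" for j
    obtain M where M: "\<And>i j. ent y i j \<noteq> 0 \<Longrightarrow> i < M \<and> j < M" using ent_bound2 by metis
    define n where "n = max e M"
    have zb: "ent (z j) k 0 \<noteq> 0 \<Longrightarrow> k < n" if "j < d" for j k
    proof -
      assume nz: "ent (z j) k 0 \<noteq> 0"
      have "\<beta> (munit 0 j) \<in> corner e" using hs(1) that d by simp
      then have "idm e * z j = z j" by (simp add: z_def mult.assoc[symmetric])
      then have "ent (idm e * z j) k 0 \<noteq> 0" using nz by simp
      moreover have "ent (idm e * z j) k 0 = (\<Sum>l<e. ent (idm e) k l * ent (z j) l 0)"
        by (rule ent_times) (auto split: if_splits)
      ultimately obtain l where "l < e" "ent (idm e) k l * ent (z j) l 0 \<noteq> 0"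
        by (metis (no_types, lifting) lessThan_iff sum.not_neutral_contains_not_neutral)
      then have "k < e" by (auto split: if_splits)
      then show ?thesis by (simp add: n_def)
    qed
    \<comment> \<open>These are the vectors called \<eta> above: the \<open>r\<close>-th coordinates
      of all \<open>z j\<close>, collected into one vector of the source.\<close>
    define w where "w r = (\<Sum>j<d. scl (ent (z j) r 0) (munit j 0))" for r
    have we: "ent (w r) j 0 = (if j < d then ent (z j) r 0 else 0)" for r j
    proof -
      have "ent (w r) j 0 = (\<Sum>i<d. if i = j then ent (z i) r 0 else 0)"
        unfolding w_def ent_sum by (intro sum.cong refl) auto
      then show ?thesis by simp
    qed
    define m where "m = adj x * x"
    have mc: "m \<in> corner d" using x by (simp add: m_def)
    have zz: "ent (adj (z i) * z j) 0 0 = (\<Sum>r<n. cnj (ent (w r) i 0) * ent (w r) j 0)" if "i < d" "j < d" for i j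
    proof -
      have "ent (adj (z i) * z j) 0 0 = (\<Sum>r<n. ent (adj (z i)) 0 r * ent (z j) r 0)"
        by (rule ent_times) (use zb that in blast)
      then show ?thesis using that by (simp add: we)
    qed
    have \<beta>m: "adj y * \<beta> m * y = (\<Sum>i<d. \<Sum>j<d. scl (ent m i j) (adj (z i) * z j))"
    proof -
      have "adj (z i) * z j = adj y * \<beta> (munit i j) * y" if "i < d" "j < d" for i j
        using that d hs(4)[of "munit i 0" "munit 0 j"] hs(5)[of "munit 0 i"]
        by (simp add: z_def mult.assoc[symmetric])
      then show ?thesis
        unfolding hom_expand_units[OF h mc] sum_distrib_left sum_distrib_right by simp
    qed
    have "(cnorm (\<beta> x * y))\<^sup>2 = Re (ent (adj y * \<beta> m * y) 0 0)"
      unfolding cnorm_sq m_def using x by (simp add: hs mult.assoc)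
    also have "ent (adj y * \<beta> m * y) 0 0 = (\<Sum>i<d. \<Sum>j<d. ent m i j * (\<Sum>r<n. cnj (ent (w r) i 0) * ent (w r) j 0))"
      unfolding \<beta>m ent_sum by (intro sum.cong refl) (simp add: zz)
    also have "\<dots> = (\<Sum>i<d. \<Sum>j<d. \<Sum>r<n. cnj (ent (w r) i 0) * ent m i j * ent (w r) j 0)"
      by (simp add: sum_distrib_left mult_ac)
    also have "\<dots> = (\<Sum>i<d. \<Sum>r<n. \<Sum>j<d. cnj (ent (w r) i 0) * ent m i j * ent (w r) j 0)"
      by (rule sum.cong[OF refl], rule sum.swap)
    also have "\<dots> = (\<Sum>r<n. \<Sum>i<d. \<Sum>j<d. cnj (ent (w r) i 0) * ent m i j * ent (w r) j 0)"
      by (rule sum.swap)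
    also have "\<dots> = (\<Sum>r<n. ent (adj (w r) * m * w r) 0 0)"
      by (simp add: ent_quadratic[OF mc])
    also have "Re \<dots> = (\<Sum>r<n. (cnorm (x * w r))\<^sup>2)"
      unfolding cnorm_sq m_def by (simp add: mult.assoc)
    also have "\<dots> \<le> (\<Sum>r<n. C\<^sup>2 * (cnorm (w r))\<^sup>2)"
    proof (rule sum_mono)
      fix r
      have "cnorm (x * w r) \<le> C * cnorm (w r)" using b by (simp add: fbound_def)
      then show "(cnorm (x * w r))\<^sup>2 \<le> C\<^sup>2 * (cnorm (w r))\<^sup>2"
        unfolding power_mult_distrib[symmetric] by (rule power_mono) simp
    qed
    also have "\<dots> = C\<^sup>2 * (\<Sum>j<d. (cnorm (z j))\<^sup>2)"
    proof -
      have "(cnorm (w r))\<^sup>2 = (\<Sum>j<d. (cmod (ent (z j) r 0))\<^sup>2)" for r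
      proof -
        have "ent (adj (w r) * w r) 0 0 = of_real (\<Sum>j<d. (cmod (ent (w r) j 0))\<^sup>2)"
          by (rule ent_adj_mult_diag) (metis we)
        then show ?thesis unfolding cnorm_sq by (simp add: we)
      qed
      moreover have "(cnorm (z j))\<^sup>2 = (\<Sum>r<n. (cmod (ent (z j) r 0))\<^sup>2)" if "j < d" for j
        unfolding cnorm_sq using ent_adj_mult_diag[of "z j" 0 n] zb[OF that] by simp
      ultimately show ?thesis
        unfolding sum_distrib_left[symmetric] by (simp add: sum.swap[of _ "{..<n}"])
    qed
    \<comment> \<open>The \<open>z j\<close> are the coordinates of the part of \<open>y\<close> in
      the range of the projection \<open>\<beta> (idm d)\<close>, so their total length is at most
      that of \<open>y\<close>.\<close>
    also have "(\<Sum>j<d. (cnorm (z j))\<^sup>2) = (cnorm (\<beta> (idm d) * y))\<^sup>2"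
    proof -
      have "adj (\<beta> (idm d) * y) * (\<beta> (idm d) * y) = (\<Sum>j<d. adj (z j) * z j)"
      proof -
        have "adj (\<beta> (idm d) * y) * (\<beta> (idm d) * y) = adj y * \<beta> (idm d) * y"
          using hs(4)[of "idm d" "idm d"] hs(5)[of "idm d"] corner_idm_mult(1)[OF corner_idm, of d]
          by (simp add: mult.assoc) (simp add: mult.assoc[symmetric])
        also have "\<dots> = adj y * (\<Sum>j<d. \<beta> (munit j j)) * y"
          unfolding idm_eq_sum using d by (subst corner_hom_sum[OF h]) auto
        also have "\<dots> = (\<Sum>j<d. adj (z j) * z j)"
          unfolding sum_distrib_left sum_distrib_right
        proof (intro sum.cong refl)
          fix j assume "j \<in> {..<d}"
          then show "adj y * \<beta> (munit j j) * y = adj (z j) * z j"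
            using d hs(4)[of "munit j 0" "munit 0 j"] hs(5)[of "munit 0 j"]
            by (simp add: z_def mult.assoc[symmetric])
        qed
        finally show ?thesis .
      qed
      then show ?thesis unfolding cnorm_sq by (simp add: ent_sum)
    qed
    also have "C\<^sup>2 * (cnorm (\<beta> (idm d) * y))\<^sup>2 \<le> C\<^sup>2 * (cnorm y)\<^sup>2"
    proof (intro mult_left_mono power_mono cnorm_proj_le)
      show "adj (\<beta> (idm d)) = \<beta> (idm d)" using hs(5)[of "idm d"] by simp
      show "\<beta> (idm d) * \<beta> (idm d) = \<beta> (idm d)"
        using hs(4)[of "idm d" "idm d"] corner_idm_mult(1)[OF corner_idm, of d] by simp
    qed simp_all
    finally have "(cnorm (\<beta> x * y))\<^sup>2 \<le> (C * cnorm y)\<^sup>2" by (simp add: power_mult_distrib)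
    then show ?thesis by (rule power2_le_imp_le) (simp add: C)
  qed
qed

text \<open>Applied to a unit vector in the range of \<open>\<beta> (munit 0 0)\<close>, images of
  matrix units around \<open>\<beta> x\<close> isolate the entry. This lower bound takes the place
  of the isometry of injective star homomorphisms; entries are enough to detect zero in a
  limit.\<close>

lemma entry_le_hom_bound:
  assumes h: "corner_hom d e \<beta>" and x: "x \<in> corner d" and nz: "\<beta> (munit 0 0) \<noteq> 0"
    and b: "fbound (\<beta> x) C" and ij: "i < d" "j < d"
  shows "cmod (ent x i j) \<le> C"
proof -
  note hs = corner_homD[OF h]
  have d: "0 < d" using ij by simp
  have u: "\<beta> (munit a b) * \<beta> (munit b c) = \<beta> (munit a c)" if "a < d" "b < d" "c < d" for a b c
    using hs(4)[of "munit a b" "munit b c"] that by simp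
  have ua: "adj (\<beta> (munit a b)) = \<beta> (munit b a)" if "a < d" "b < d" for a b
    using hs(5)[of "munit a b"] that by simp
  have g: "\<beta> (munit 0 0) \<in> corner e" using hs(1) d by simp
  obtain t where t: "t \<in> corner e" "unit_vec_in e (\<beta> (munit 0 0) * t)" using range_unit_vec[OF g nz] .
  define \<zeta> where "\<zeta> = \<beta> (munit 0 0) * t"
  have \<zeta>: "adj \<zeta> * \<zeta> = munit 0 0" using t(2) by (simp add: \<zeta>_def unit_vec_in_def)
  have g\<zeta>: "\<beta> (munit 0 0) * \<zeta> = \<zeta>" using u[of 0 0 0] d by (simp add: \<zeta>_def mult.assoc[symmetric])
  have n1: "cnorm \<zeta> = 1" by (simp add: cnorm_def \<zeta>)
  define y where "y = \<beta> (munit j 0) * \<zeta>"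
  have "adj y * y = adj \<zeta> * ((\<beta> (munit 0 j) * \<beta> (munit j 0)) * \<zeta>)"
    using ua[of j 0] d ij by (simp add: y_def mult.assoc)
  then have y1: "cnorm y = 1" using u[of 0 j 0] d ij g\<zeta> \<zeta> by (simp add: cnorm_def)
  have "\<beta> (munit 0 i) * (\<beta> x * y) = \<beta> (munit 0 i * x * munit j 0) * \<zeta>"
    using x d ij by (simp add: y_def hs mult.assoc)
  also have "\<dots> = scl (ent x i j) \<zeta>" using g\<zeta> d by (simp add: munit_mult_munit hs)
  finally have e: "\<beta> (munit 0 i) * (\<beta> x * y) = scl (ent x i j) \<zeta>" .
  have "cmod (ent x i j) = cnorm (\<beta> (munit 0 i) * (\<beta> x * y))" unfolding e cnorm_scl n1 by simp
  also have "\<dots> = cnorm (\<beta> (munit i i) * (\<beta> x * y))"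
  proof -
    have "adj (\<beta> (munit 0 i) * z) * (\<beta> (munit 0 i) * z) = adj (\<beta> (munit i i) * z) * (\<beta> (munit i i) * z)" for z
    proof -
      have "adj (\<beta> (munit 0 i) * z) * (\<beta> (munit 0 i) * z) = adj z * ((\<beta> (munit i 0) * \<beta> (munit 0 i)) * z)"
        using ua[of 0 i] d ij by (simp add: mult.assoc)
      also have "\<dots> = adj z * ((\<beta> (munit i i) * \<beta> (munit i i)) * z)" using u[of i 0 i] u[of i i i] d ij by simp
      also have "\<dots> = adj (\<beta> (munit i i) * z) * (\<beta> (munit i i) * z)" using ua[of i i] ij by (simp add: mult.assoc)
      finally show ?thesis .
    qed
    then show ?thesis unfolding cnorm_def by (simp only:)
  qed
  also have "\<dots> \<le> cnorm (\<beta> x * y)" by (rule cnorm_proj_le) (use ua[of i i] u[of i i i] ij in auto)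
  also have "\<dots> \<le> C * cnorm y" using b by (simp add: fbound_def)
  finally show ?thesis using y1 by simp
qed

lift_definition fm_of_vec :: "complex vec \<Rightarrow> fmat" is
  "\<lambda>v i j. if i < dim_vec v \<and> j = 0 then v $ i else 0"
proof -
  fix v :: "complex vec"
  show "\<exists>n. \<forall>i j. (if i < dim_vec v \<and> j = 0 then v $ i else 0) \<noteq> 0 \<longrightarrow> i < n \<and> j < n"
    by (rule exI[of _ "Suc (dim_vec v)"]) auto
qed

lemma ent_fm_of_vec: "ent (fm_of_vec v) i j = (if i < dim_vec v \<and> j = 0 then v $ i else 0)"
  by (simp add: fm_of_vec.rep_eq)

lemma vnorm_L2:
  assumes "v \<in> carrier_vec n"
  shows "vnorm v = L2_set (\<lambda>i. cmod (v $ i)) {..<n}"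
proof -
  have "v \<bullet>c v = (\<Sum>i<n. v $ i * cnj (v $ i))"
    using assms by (auto simp: scalar_prod_def lessThan_atLeast0)
  also have "\<dots> = of_real (\<Sum>i<n. (cmod (v $ i))\<^sup>2)"
    unfolding of_real_sum by (intro sum.cong refl) (rule complex_norm_square[symmetric])
  finally show ?thesis by (simp add: vnorm_def L2_set_def)
qed

lemma vnorm_cnorm:
  assumes "v \<in> carrier_vec n"
  shows "vnorm v = cnorm (fm_of_vec v)"
proof -
  have "cnorm (fm_of_vec v) = L2_set (\<lambda>k. cmod (ent (fm_of_vec v) k 0)) {..<n}"
    by (rule cnorm_L2) (use assms in \<open>auto simp: ent_fm_of_vec split: if_splits\<close>)
  also have "\<dots> = L2_set (\<lambda>i. cmod (v $ i)) {..<n}"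
    by (rule L2_set_cong) (use assms in \<open>auto simp: ent_fm_of_vec\<close>)
  finally show ?thesis using vnorm_L2[OF assms] by simp
qed

lemma fm_of_mult_vec:
  assumes "a \<in> carrier_mat n n" "v \<in> carrier_vec n"
  shows "fm_of_vec (a *\<^sub>v v) = fm_of a * fm_of_vec v"
proof (rule fmat_eqI)
  fix i j
  have "ent (fm_of a * fm_of_vec v) i j = (\<Sum>k<n. ent (fm_of a) i k * ent (fm_of_vec v) k j)"
    by (rule ent_times) (use assms in \<open>auto simp: ent_fm_of split: if_splits\<close>)
  also have "\<dots> = ent (fm_of_vec (a *\<^sub>v v)) i j"
    using assms by (auto simp: ent_fm_of ent_fm_of_vec scalar_prod_def lessThan_atLeast0)
  finally show "ent (fm_of_vec (a *\<^sub>v v)) i j = ent (fm_of a * fm_of_vec v) i j" by simp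
qed

lemma vnorm_nonneg [simp]: "v \<in> carrier_vec n \<Longrightarrow> 0 \<le> vnorm v"
  by (simp add: vnorm_cnorm)

lemma vnorm_smult: "v \<in> carrier_vec n \<Longrightarrow> vnorm (c \<cdot>\<^sub>v v) = cmod c * vnorm v"
proof -
  assume v: "v \<in> carrier_vec n"
  have "fm_of_vec (c \<cdot>\<^sub>v v) = scl c (fm_of_vec v)" by (rule fmat_eqI) (auto simp: ent_fm_of_vec)
  then show ?thesis using v vnorm_cnorm[of "c \<cdot>\<^sub>v v" n] vnorm_cnorm[OF v] by (simp add: cnorm_scl)
qed

text \<open>The supremum in \<open>opnorm\<close> is meaningful only over a bounded set; the sum of
  the moduli of all entries is a crude bound.\<close>

lemma vnorm_mult_bdd:
  assumes a: "a \<in> carrier_mat n n"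
  shows "bdd_above ((\<lambda>v. vnorm (a *\<^sub>v v)) ` {v \<in> carrier_vec n. vnorm v \<le> 1})"
proof (rule bdd_aboveI2)
  fix v assume "v \<in> {v \<in> carrier_vec n. vnorm v \<le> 1}"
  then have v: "v \<in> carrier_vec n" "vnorm v \<le> 1" by auto
  have le: "cmod (v $ j) \<le> 1" if "j < n" for j
  proof -
    have "cmod (v $ j) \<le> L2_set (\<lambda>i. cmod (v $ i)) {..<n}"
      using that by (intro member_le_L2_set) auto
    then show ?thesis using v vnorm_L2[OF v(1)] by simp
  qed
  have av: "a *\<^sub>v v \<in> carrier_vec n" using a v by simp
  have "vnorm (a *\<^sub>v v) \<le> (\<Sum>i<n. cmod ((a *\<^sub>v v) $ i))"
    unfolding vnorm_L2[OF av] by (rule L2_set_le_sum) simp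
  also have "\<dots> \<le> (\<Sum>i<n. \<Sum>j<n. cmod (a $$ (i, j)))"
  proof (rule sum_mono)
    fix i assume i: "i \<in> {..<n}"
    have "(a *\<^sub>v v) $ i = (\<Sum>j<n. a $$ (i, j) * v $ j)"
      using a v i by (auto simp: scalar_prod_def lessThan_atLeast0)
    then have "cmod ((a *\<^sub>v v) $ i) \<le> (\<Sum>j<n. cmod (a $$ (i, j) * v $ j))" by (simp add: norm_sum)
    also have "\<dots> \<le> (\<Sum>j<n. cmod (a $$ (i, j)))"
      by (rule sum_mono) (use le in \<open>auto simp: norm_mult intro: mult_left_le\<close>)
    finally show "cmod ((a *\<^sub>v v) $ i) \<le> (\<Sum>j<n. cmod (a $$ (i, j)))" .
  qed
  finally show "vnorm (a *\<^sub>v v) \<le> (\<Sum>i<n. \<Sum>j<n. cmod (a $$ (i, j)))" .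
qed

lemma opnorm_bound:
  assumes a: "a \<in> carrier_mat n n" and v: "v \<in> carrier_vec n"
  shows "vnorm (a *\<^sub>v v) \<le> opnorm a * vnorm v"
proof -
  have le: "vnorm (a *\<^sub>v u) \<le> opnorm a" if "u \<in> carrier_vec n" "vnorm u \<le> 1" for u
    unfolding opnorm_def using a that by (intro cSUP_upper) (use vnorm_mult_bdd[OF a] in auto)
  show ?thesis
  proof (cases "vnorm v = 0")
    case True
    have "vnorm (a *\<^sub>v v) = 0"
    proof -
      have "v $ i = 0" if "i < n" for i
      proof -
        have "cmod (v $ i) \<le> L2_set (\<lambda>i. cmod (v $ i)) {..<n}"
          using that by (intro member_le_L2_set) auto
        then show ?thesis using True vnorm_L2[OF v] by simp
      qed
      then have "v = 0\<^sub>v n" using v by (intro eq_vecI) auto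
      then have "a *\<^sub>v v = 0\<^sub>v n" using a by auto
      then show ?thesis using vnorm_L2[of "0\<^sub>v n" n] by (simp add: L2_set_def)
    qed
    then show ?thesis using True by simp
  next
    case False
    then have pos: "0 < vnorm v" using vnorm_nonneg[OF v] by simp
    let ?c = "complex_of_real (1 / vnorm v)"
    have "vnorm (?c \<cdot>\<^sub>v v) = 1" using pos vnorm_smult[OF v, of ?c] by (simp add: norm_divide)
    then have "vnorm (a *\<^sub>v (?c \<cdot>\<^sub>v v)) \<le> opnorm a" using v by (intro le) auto
    moreover have "a *\<^sub>v (?c \<cdot>\<^sub>v v) = ?c \<cdot>\<^sub>v (a *\<^sub>v v)" by (rule mult_mat_vec[OF a v])
    moreover have "vnorm (?c \<cdot>\<^sub>v (a *\<^sub>v v)) = vnorm (a *\<^sub>v v) / vnorm v"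
      using vnorm_smult[of "a *\<^sub>v v" n ?c] a v pos by (simp add: norm_divide)
    ultimately show ?thesis using pos by (simp add: divide_le_eq)
  qed
qed

lemma opnorm_le_iff_fbound:
  assumes a: "a \<in> carrier_mat n n"
  shows "opnorm a \<le> C \<longleftrightarrow> fbound (fm_of a) C"
proof
  assume C: "opnorm a \<le> C"
  have z: "vnorm (0\<^sub>v n) = 0" using vnorm_L2[of "0\<^sub>v n" n] by (simp add: L2_set_def)
  have "a *\<^sub>v 0\<^sub>v n = 0\<^sub>v n" using a by auto
  then have "0 \<le> opnorm a" unfolding opnorm_def
    using a z by (intro cSUP_upper2[where x = "0\<^sub>v n"]) (use vnorm_mult_bdd[OF a] in auto)
  then have C0: "0 \<le> C" using C by simp
  have "cnorm (fm_of a * y) \<le> C * cnorm y" for y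
  proof -
    \<comment> \<open>Only the first \<open>n\<close> coordinates of column 0 of \<open>y\<close>
      matter for the product, and cutting off the others does not increase the length.\<close>
    define v where "v = vec n (\<lambda>i. ent y i 0)"
    have v: "v \<in> carrier_vec n" by (simp add: v_def)
    have yb: "ent (fm_of a * z) i j = (\<Sum>k<n. ent (fm_of a) i k * ent z k j)" for i j z
      by (rule ent_times) (use a in \<open>auto simp: ent_fm_of split: if_splits\<close>)
    have ab: "ent (fm_of a * z) k 0 \<noteq> 0 \<Longrightarrow> k < n" for k z
      unfolding yb using a by (auto simp: ent_fm_of elim!: sum.not_neutral_contains_not_neutral split: if_splits)
    have e: "ent (fm_of a * y) i 0 = ent (fm_of a * fm_of_vec v) i 0" for i
      unfolding yb by (intro sum.cong refl) (simp add: ent_fm_of_vec v_def)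
    have "cnorm (fm_of a * y) = cnorm (fm_of a * fm_of_vec v)"
      using cnorm_L2[of "fm_of a * y" n] cnorm_L2[of "fm_of a * fm_of_vec v" n] ab e by simp
    also have "\<dots> = vnorm (a *\<^sub>v v)" using fm_of_mult_vec[OF a v] vnorm_cnorm[of "a *\<^sub>v v" n] a v by simp
    also have "\<dots> \<le> opnorm a * vnorm v" by (rule opnorm_bound[OF a v])
    also have "\<dots> \<le> C * vnorm v" using C v by (intro mult_right_mono) auto
    also have "\<dots> \<le> C * cnorm y"
    proof (rule mult_left_mono[OF _ C0])
      obtain M where M: "\<And>i j. ent y i j \<noteq> 0 \<Longrightarrow> i < M \<and> j < M" using ent_bound2 by metis
      have "cnorm y = L2_set (\<lambda>k. cmod (ent y k 0)) {..<max n M}"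
        by (rule cnorm_L2) (use M in \<open>meson less_max_iff_disj\<close>)
      moreover have "vnorm v = L2_set (\<lambda>k. cmod (ent y k 0)) {..<n}"
        unfolding vnorm_L2[OF v] by (rule L2_set_cong) (auto simp: v_def)
      moreover have "L2_set (\<lambda>k. cmod (ent y k 0)) {..<n} \<le> L2_set (\<lambda>k. cmod (ent y k 0)) {..<max n M}"
        unfolding L2_set_def by (intro real_sqrt_le_mono sum_mono2) auto
      ultimately show "vnorm v \<le> cnorm y" by simp
    qed
    finally show ?thesis .
  qed
  then show "fbound (fm_of a) C" using C0 by (simp add: fbound_def)
next
  assume b: "fbound (fm_of a) C"
  show "opnorm a \<le> C" unfolding opnorm_def
  proof (rule cSUP_least)
    have "vnorm (0\<^sub>v n) = 0" using vnorm_L2[of "0\<^sub>v n" n] by (simp add: L2_set_def)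
    then have "0\<^sub>v n \<in> {v \<in> carrier_vec (dim_col a). vnorm v \<le> 1}" using a by simp
    then show "{v \<in> carrier_vec (dim_col a). vnorm v \<le> 1} \<noteq> {}" by blast
    fix v assume "v \<in> {v \<in> carrier_vec (dim_col a). vnorm v \<le> 1}"
    then have v: "v \<in> carrier_vec n" "vnorm v \<le> 1" using a by auto
    have "vnorm (a *\<^sub>v v) = cnorm (fm_of a * fm_of_vec v)"
      using fm_of_mult_vec[OF a v(1)] vnorm_cnorm[of "a *\<^sub>v v" n] a v by simp
    also have "\<dots> \<le> C * vnorm v" using b vnorm_cnorm[OF v(1)] by (simp add: fbound_def)
    also have "\<dots> \<le> C" using v b by (intro mult_left_le) (auto simp: fbound_def)
    finally show "vnorm (a *\<^sub>v v) \<le> C" .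
  qed
qed

lemma opnorm_fbound: "a \<in> carrier_mat n n \<Longrightarrow> fbound (fm_of a) (opnorm a)"
  using opnorm_le_iff_fbound[of a n "opnorm a"] by simp

lemma opnorm_nonneg: "a \<in> carrier_mat n n \<Longrightarrow> 0 \<le> opnorm a"
  using opnorm_fbound by (auto simp: fbound_def)

lemma opnorm_add: "a \<in> carrier_mat n n \<Longrightarrow> b \<in> carrier_mat n n \<Longrightarrow> opnorm (a + b) \<le> opnorm a + opnorm b"
  using fbound_add[OF opnorm_fbound opnorm_fbound, of a n b n] fm_of_add[of a n n b]
  by (simp add: opnorm_le_iff_fbound[of "a + b" n])

lemma opnorm_mult:
  assumes "a \<in> carrier_mat n n" "b \<in> carrier_mat n n"
  shows "opnorm (a * b) \<le> opnorm a * opnorm b"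
  using fbound_mult[OF opnorm_fbound[OF assms(1)] opnorm_fbound[OF assms(2)]] fm_of_mult[OF assms]
  by (simp add: opnorm_le_iff_fbound[OF mult_carrier_mat[OF assms]])

lemma opnorm_smult: "a \<in> carrier_mat n n \<Longrightarrow> opnorm (c \<cdot>\<^sub>m a) \<le> cmod c * opnorm a"
  using fbound_scl[OF opnorm_fbound, of a n c] by (simp add: opnorm_le_iff_fbound[of "c \<cdot>\<^sub>m a" n] fm_of_smult)

lemma opnorm_adjoint: "a \<in> carrier_mat n n \<Longrightarrow> opnorm (mat_adjoint a) \<le> opnorm a"
  using fbound_adj[OF opnorm_fbound, of a n] by (simp add: opnorm_le_iff_fbound[of "mat_adjoint a" n] fm_of_adjoint)

lemma opnorm_zero: "opnorm (0\<^sub>m n n) = 0"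
proof -
  have "opnorm (0\<^sub>m n n) \<le> 0" by (simp add: opnorm_le_iff_fbound[of _ n] fbound_def cnorm_def)
  then show ?thesis using opnorm_nonneg[of "0\<^sub>m n n" n] by simp
qed

lemma minus_mat_eq:
  fixes a b :: "complex mat"
  shows "a \<in> carrier_mat n n \<Longrightarrow> b \<in> carrier_mat n n \<Longrightarrow> a - b = a + (- 1) \<cdot>\<^sub>m b"
  by (rule eq_matI) auto

lemma opnorm_minus_commute:
  assumes a: "a \<in> carrier_mat n n" and b: "b \<in> carrier_mat n n"
  shows "opnorm (a - b) = opnorm (b - a)"
proof -
  have "opnorm (x - y) \<le> opnorm (y - x)" if "x \<in> carrier_mat n n" "y \<in> carrier_mat n n" for x y
  proof -
    have "x - y = (- 1) \<cdot>\<^sub>m (y - x)" using that by (intro eq_matI) auto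
    then show ?thesis using opnorm_smult[of "y - x" n "- 1"] minus_carrier_mat[OF that(1), of y] by simp
  qed
  then show ?thesis using a b by (meson order_antisym)
qed

lemma opnorm_triangle:
  assumes "a \<in> carrier_mat n n" "b \<in> carrier_mat n n" "c \<in> carrier_mat n n"
  shows "opnorm (a - c) \<le> opnorm (a - b) + opnorm (b - c)"
proof -
  have "a - c = (a - b) + (b - c)" using assms by (intro eq_matI) auto
  then show ?thesis using opnorm_add[OF minus_carrier_mat[OF assms(2)] minus_carrier_mat[OF assms(3)], of a b] by simp
qed

lemma opnorm_star_hom:
  assumes "star_hom d e \<pi>" "a \<in> carrier_mat d d"
  shows "opnorm (\<pi> a) \<le> opnorm a"
proof -
  have "fbound (fm_hom d \<pi> (fm_of a)) (opnorm a)"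
    using assms by (intro fbound_hom[OF fm_hom_corner_hom] opnorm_fbound) auto
  then show ?thesis
    using assms by (simp add: fm_hom_fm_of opnorm_le_iff_fbound[OF star_homD(1)[OF assms]])
qed

lemma entry_le_opnorm:
  assumes sh: "star_hom d e \<pi>" and a: "a \<in> carrier_mat d d" and inj: "inj_on \<pi> (carrier_mat d d)"
    and ij: "i < d" "j < d"
  shows "cmod (a $$ (i, j)) \<le> opnorm (\<pi> a)"
proof -
  note h = fm_hom_corner_hom[OF sh]
  have z: "\<pi> (0\<^sub>m d d) = 0\<^sub>m e e"
  proof -
    have "\<pi> (0 \<cdot>\<^sub>m 0\<^sub>m d d) = 0 \<cdot>\<^sub>m \<pi> (0\<^sub>m d d)" by (rule star_homD(3)[OF sh]) simp
    moreover have "0 \<cdot>\<^sub>m 0\<^sub>m d d = (0\<^sub>m d d :: complex mat)" by (rule eq_matI) auto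
    moreover have "0 \<cdot>\<^sub>m \<pi> (0\<^sub>m d d) = 0\<^sub>m e e" using star_homD(1)[OF sh, of "0\<^sub>m d d"] by (intro eq_matI) auto
    ultimately show ?thesis by simp
  qed
  have m: "munit 0 0 \<in> corner d" using ij by simp
  have "fm_hom d \<pi> (munit 0 0) \<noteq> 0"
  proof
    assume "fm_hom d \<pi> (munit 0 0) = 0"
    then have "\<pi> (mat_of d (munit 0 0)) = \<pi> (0\<^sub>m d d)"
      unfolding z fm_hom_def using fm_of_inj[OF star_homD(1)[OF sh mat_of_carrier], of "0\<^sub>m e e"] by simp
    then have "mat_of d (munit 0 0) = 0\<^sub>m d d" using inj by (simp add: inj_on_eq_iff)
    then have "fm_of (mat_of d (munit 0 0)) = 0" by simp
    then show False using m by simp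
  qed
  moreover have "fbound (fm_hom d \<pi> (fm_of a)) (opnorm (\<pi> a))"
    unfolding fm_hom_fm_of[OF a] by (rule opnorm_fbound[OF star_homD(1)[OF sh a]])
  ultimately have "cmod (ent (fm_of a) i j) \<le> opnorm (\<pi> a)"
    using a ij by (intro entry_le_hom_bound[OF h]) auto
  then show ?thesis using a ij by (simp add: ent_fm_of)
qed

section \<open>Direct systems and their C*-limits\<close>

lemma sysmap_refl [simp]: "sysmap f i i = id" by (simp add: sysmap_def)

lemma sysmap_Suc: "i \<le> j \<Longrightarrow> sysmap f i (Suc j) a = f j (sysmap f i j a)"
  by (simp add: sysmap_def)

lemma sysmap_trans: "i \<le> j \<Longrightarrow> j \<le> k \<Longrightarrow> sysmap f j k (sysmap f i j a) = sysmap f i k a"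
proof (induction k)
  case (Suc k)
  show ?case
  proof (cases "j \<le> k")
    case True
    then show ?thesis using Suc by (simp add: sysmap_Suc)
  next
    case False
    then have "j = Suc k" using Suc by simp
    then show ?thesis by simp
  qed
qed simp

lemma star_hom_id: "star_hom d d (\<lambda>a. a)" by (simp add: star_hom_def)

lemma star_hom_comp: "star_hom d e \<pi> \<Longrightarrow> star_hom e f \<rho> \<Longrightarrow> star_hom d f (\<lambda>a. \<rho> (\<pi> a))"
  by (simp add: star_hom_def)

lemma star_hom_zero:
  assumes sh: "star_hom d e \<pi>"
  shows "\<pi> (0\<^sub>m d d) = 0\<^sub>m e e"
proof -
  have "\<pi> (0 \<cdot>\<^sub>m 0\<^sub>m d d) = 0 \<cdot>\<^sub>m \<pi> (0\<^sub>m d d)" by (rule star_homD(3)[OF sh]) simp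
  moreover have "0 \<cdot>\<^sub>m 0\<^sub>m d d = (0\<^sub>m d d :: complex mat)" by (rule eq_matI) auto
  moreover have "0 \<cdot>\<^sub>m \<pi> (0\<^sub>m d d) = 0\<^sub>m e e" using star_homD(1)[OF sh, of "0\<^sub>m d d"] by (intro eq_matI) auto
  ultimately show ?thesis by simp
qed

lemma star_hom_minus:
  assumes sh: "star_hom d e \<pi>" and "a \<in> carrier_mat d d" "b \<in> carrier_mat d d"
  shows "\<pi> (a - b) = \<pi> a - \<pi> b"
  using assms star_homD(1,2,3)[OF sh] by (simp add: minus_mat_eq[of _ d] minus_mat_eq[of _ e])

lemma one_in_nest_alg: "nest_data N \<Longrightarrow> 1\<^sub>m (ndim N) \<in> nest_alg N"
  by (simp add: nest_alg_iff tri_def nproj_mult)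

lemma zero_in_nest_alg: "nest_data N \<Longrightarrow> 0\<^sub>m (ndim N) (ndim N) \<in> nest_alg N"
  by (simp add: nest_alg_iff tri_zero)

lemma nest_alg_full: "a \<in> nest_alg N \<Longrightarrow> a \<in> full_alg N" by (simp add: nest_alg_def)

lemma nest_alg_closed:
  assumes nd: "nest_data N" and a: "a \<in> nest_alg N" "b \<in> nest_alg N"
  shows "a + b \<in> nest_alg N" "a * b \<in> nest_alg N" "c \<cdot>\<^sub>m a \<in> nest_alg N"
proof -
  note ac = nest_alg_full[OF a(1)] nest_alg_full[OF a(2)]
  show "a + b \<in> nest_alg N" "c \<cdot>\<^sub>m a \<in> nest_alg N"
    using a fm_of_add[OF ac] by (simp_all add: nest_alg_iff[OF nd] tri_add tri_scl fm_of_smult)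
  show "a * b \<in> nest_alg N"
    using a fm_of_mult[OF ac] mult_carrier_mat[OF ac] by (simp add: nest_alg_iff[OF nd] tri_mult)
qed

lemma full_alg_split:
  assumes nd: "nest_data N" and a: "a \<in> full_alg N"
  obtains b c where "b \<in> nest_alg N" "c \<in> nest_alg N" "a = b + mat_adjoint c"
proof -
  obtain y z where yz: "y \<in> tri N" "z \<in> tri N" "fm_of a = y + adj z"
    using corner_split_tri[OF nd fm_of_corner[OF a]] .
  have m: "mat_of (ndim N) y \<in> nest_alg N" "mat_of (ndim N) z \<in> nest_alg N"
    using yz tri_corner by (simp_all add: nest_alg_iff[OF nd])
  have "a = mat_of (ndim N) (y + adj z)" using a mat_of_fm_of[OF a] yz(3) by simp
  then have "a = mat_of (ndim N) y + mat_adjoint (mat_of (ndim N) z)" by (simp add: mat_of_add mat_of_adj)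
  then show ?thesis using that m by blast
qed

text \<open>A nonzero kernel element generates the whole matrix algebra and so puts the identity
  into the kernel; but the identity lies in the nest algebra, where the map is injective.\<close>

lemma star_hom_inj_full:
  assumes nd: "nest_data N" and sh: "star_hom (ndim N) e \<pi>" and inj: "inj_on \<pi> (nest_alg N)"
  shows "inj_on \<pi> (full_alg N)"
proof (rule inj_onI, rule ccontr)
  fix a b assume ab: "a \<in> full_alg N" "b \<in> full_alg N" "\<pi> a = \<pi> b" "a \<noteq> b"
  let ?d = "ndim N" and ?\<beta> = "fm_hom (ndim N) \<pi>"
  note h = fm_hom_corner_hom[OF sh]
  note hs = corner_homD[OF h]
  let ?c = "fm_of a - fm_of b"
  have c: "?c \<in> corner ?d" "?c \<noteq> 0" using ab fm_of_inj[OF ab(1,2)] by auto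
  have "?\<beta> (fm_of a) = ?\<beta> ?c + ?\<beta> (fm_of b)" using hs(2)[of ?c "fm_of b"] c ab by simp
  then have z: "?\<beta> ?c = 0" using ab by (simp add: fm_hom_fm_of)
  have "idm ?d \<in> corner ?d \<and> ?\<beta> (idm ?d) = 0"
  proof (rule corner_ideal_induct[OF c corner_idm, where K = "\<lambda>y. y \<in> corner ?d \<and> ?\<beta> y = 0"])
    show "0 \<in> corner ?d \<and> ?\<beta> 0 = 0" using corner_hom_zero[OF h] by simp
  qed (use z c in \<open>auto simp: hs\<close>)
  then have "fm_of (\<pi> (1\<^sub>m ?d)) = 0" using fm_hom_fm_of[of "1\<^sub>m ?d" ?d \<pi>] by simp
  then have "\<pi> (1\<^sub>m ?d) = \<pi> (0\<^sub>m ?d ?d)"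
    using fm_of_inj[OF star_homD(1)[OF sh one_carrier_mat], of "0\<^sub>m e e"] star_hom_zero[OF sh] by simp
  then have "1\<^sub>m ?d = (0\<^sub>m ?d ?d :: complex mat)"
    using inj one_in_nest_alg[OF nd] zero_in_nest_alg[OF nd] by (simp add: inj_on_eq_iff)
  then have "(1\<^sub>m ?d :: complex mat) $$ (0, 0) = 0\<^sub>m ?d ?d $$ (0, 0)" by simp
  then show False using nd by (simp add: nest_data_def)
qed

definition lmap :: "(nat \<Rightarrow> nest) \<Rightarrow> (nat \<Rightarrow> complex mat \<Rightarrow> complex mat) \<Rightarrow> nat \<Rightarrow> nat \<Rightarrow> complex mat \<Rightarrow> complex mat" where
  "lmap N \<alpha> = sysmap (ext_maps N \<alpha>)"

definition lcls :: "(nat \<Rightarrow> nest) \<Rightarrow> (nat \<Rightarrow> complex mat \<Rightarrow> complex mat) \<Rightarrow> (nat \<Rightarrow> complex mat) \<Rightarrow> (nat \<Rightarrow> complex mat) set" where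
  "lcls N \<alpha> x = null_rel N \<alpha> `` {x}"

definition lin :: "(nat \<Rightarrow> nest) \<Rightarrow> (nat \<Rightarrow> complex mat \<Rightarrow> complex mat) \<Rightarrow> nat \<Rightarrow> complex mat \<Rightarrow> (nat \<Rightarrow> complex mat) set" where
  "lin N \<alpha> k a = lcls N \<alpha> (thread N \<alpha> k a)"

section \<open>Star extended system maps and limit sequences\<close>

locale dsys =
  fixes N :: "nat \<Rightarrow> nest" and \<alpha> :: "nat \<Rightarrow> complex mat \<Rightarrow> complex mat"
  assumes ds: "direct_system N \<alpha>"
begin

lemma nd [simp]: "nest_data (N k)" using ds by (simp add: direct_system_def)

lemma emb: "star_ext_embedding (N k) (N (Suc k)) (\<alpha> k)" using ds by (simp add: direct_system_def)

lemma ext_maps: "star_hom (ndim (N k)) (ndim (N (Suc k))) (ext_maps N \<alpha> k)"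
  "a \<in> nest_alg (N k) \<Longrightarrow> ext_maps N \<alpha> k a = \<alpha> k a"
proof -
  have "\<exists>\<pi>. star_extends (N k) (N (Suc k)) (\<alpha> k) \<pi>" using emb by (simp add: star_ext_embedding_def)
  then have "star_extends (N k) (N (Suc k)) (\<alpha> k) (ext_maps N \<alpha> k)"
    unfolding ext_maps_def star_extension_def by (rule someI_ex)
  then show "star_hom (ndim (N k)) (ndim (N (Suc k))) (ext_maps N \<alpha> k)"
    "a \<in> nest_alg (N k) \<Longrightarrow> ext_maps N \<alpha> k a = \<alpha> k a" by (auto simp: star_extends_def)
qed

lemma ext_maps_inj: "inj_on (ext_maps N \<alpha> k) (full_alg (N k))"
proof (rule star_hom_inj_full[OF nd ext_maps(1)])
  have "inj_on (\<alpha> k) (nest_alg (N k))" using emb by (simp add: star_ext_embedding_def)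
  then show "inj_on (ext_maps N \<alpha> k) (nest_alg (N k))" by (simp add: inj_on_def ext_maps(2))
qed

lemma lmap_refl [simp]: "lmap N \<alpha> k k a = a" by (simp add: lmap_def)

lemma lmap_trans: "i \<le> j \<Longrightarrow> j \<le> k \<Longrightarrow> lmap N \<alpha> j k (lmap N \<alpha> i j a) = lmap N \<alpha> i k a"
  by (simp add: lmap_def sysmap_trans)

lemma lmap_hom: "i \<le> j \<Longrightarrow> star_hom (ndim (N i)) (ndim (N j)) (lmap N \<alpha> i j)"
proof (induction j)
  case 0
  then show ?case using star_hom_id by (simp add: lmap_def id_def)
next
  case (Suc j)
  show ?case
  proof (cases "i \<le> j")
    case True
    then have "lmap N \<alpha> i (Suc j) = (\<lambda>a. ext_maps N \<alpha> j (lmap N \<alpha> i j a))" by (simp add: lmap_def sysmap_Suc fun_eq_iff)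
    then show ?thesis using star_hom_comp[OF Suc.IH[OF True] ext_maps(1)] by simp
  next
    case False
    then have "i = Suc j" using Suc by simp
    then show ?thesis using star_hom_id by (simp add: lmap_def id_def)
  qed
qed

lemma lmap_nest: "i \<le> j \<Longrightarrow> a \<in> nest_alg (N i) \<Longrightarrow> lmap N \<alpha> i j a = sysmap \<alpha> i j a \<and> sysmap \<alpha> i j a \<in> nest_alg (N j)"
proof (induction j)
  case (Suc j)
  show ?case
  proof (cases "i \<le> j")
    case True
    then show ?thesis using Suc ext_maps(2) emb[of j] by (auto simp: lmap_def sysmap_Suc star_ext_embedding_def)
  next
    case False
    then have "i = Suc j" using Suc by simp
    then show ?thesis using Suc by (simp add: lmap_def)
  qed
qed (simp add: lmap_def)

lemma lmap_inj: "i \<le> j \<Longrightarrow> inj_on (lmap N \<alpha> i j) (full_alg (N i))"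
proof (induction j)
  case (Suc j)
  show ?case
  proof (cases "i \<le> j")
    case True
    show ?thesis
    proof (rule inj_onI)
      fix a b assume ab: "a \<in> full_alg (N i)" "b \<in> full_alg (N i)" "lmap N \<alpha> i (Suc j) a = lmap N \<alpha> i (Suc j) b"
      have "ext_maps N \<alpha> j (lmap N \<alpha> i j a) = ext_maps N \<alpha> j (lmap N \<alpha> i j b)"
        using ab(3) True by (simp add: lmap_def sysmap_Suc)
      then have "lmap N \<alpha> i j a = lmap N \<alpha> i j b"
        using ext_maps_inj[of j] star_homD(1)[OF lmap_hom[OF True]] ab by (auto simp: inj_on_def)
      then show "a = b" using Suc.IH[OF True] ab by (auto simp: inj_on_def)
    qed
  next
    case False
    then have "i = Suc j" using Suc by simp
    then show ?thesis by (simp add: lmap_def)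
  qed
qed (simp add: lmap_def)

lemma lmap_carrier: "i \<le> j \<Longrightarrow> a \<in> full_alg (N i) \<Longrightarrow> lmap N \<alpha> i j a \<in> full_alg (N j)"
  using star_homD(1)[OF lmap_hom] by blast

lemma thread_eq: "thread N \<alpha> k a j = (if k \<le> j then lmap N \<alpha> k j a else 0\<^sub>m (ndim (N j)) (ndim (N j)))"
  by (simp add: thread_def lmap_def)

lemma thread_carrier: "a \<in> full_alg (N k) \<Longrightarrow> thread N \<alpha> k a j \<in> full_alg (N j)"
  by (simp add: thread_eq lmap_carrier)

lemma thread_shift: "k \<le> l \<Longrightarrow> l \<le> j \<Longrightarrow> thread N \<alpha> l (lmap N \<alpha> k l a) j = thread N \<alpha> k a j"
  by (simp add: thread_eq lmap_trans)

lemma thread_ops: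
  assumes "a \<in> full_alg (N k)" "b \<in> full_alg (N k)"
  shows "thread N \<alpha> k (a + b) j = thread N \<alpha> k a j + thread N \<alpha> k b j"
    "thread N \<alpha> k (a - b) j = thread N \<alpha> k a j - thread N \<alpha> k b j"
    "thread N \<alpha> k (a * b) j = thread N \<alpha> k a j * thread N \<alpha> k b j"
    "thread N \<alpha> k (c \<cdot>\<^sub>m a) j = c \<cdot>\<^sub>m thread N \<alpha> k a j"
    "thread N \<alpha> k (mat_adjoint a) j = mat_adjoint (thread N \<alpha> k a j)"
proof -
  have z: "0\<^sub>m d d + 0\<^sub>m d d = (0\<^sub>m d d :: complex mat)" "0\<^sub>m d d - 0\<^sub>m d d = (0\<^sub>m d d :: complex mat)"
    "0\<^sub>m d d * 0\<^sub>m d d = (0\<^sub>m d d :: complex mat)" "c \<cdot>\<^sub>m 0\<^sub>m d d = (0\<^sub>m d d :: complex mat)"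
    "mat_adjoint (0\<^sub>m d d) = (0\<^sub>m d d :: complex mat)" for d
    by (rule eq_matI; simp add: mat_adjoint_def mat_of_rows_def)+
  show "thread N \<alpha> k (a + b) j = thread N \<alpha> k a j + thread N \<alpha> k b j"
    "thread N \<alpha> k (a - b) j = thread N \<alpha> k a j - thread N \<alpha> k b j"
    "thread N \<alpha> k (a * b) j = thread N \<alpha> k a j * thread N \<alpha> k b j"
    "thread N \<alpha> k (c \<cdot>\<^sub>m a) j = c \<cdot>\<^sub>m thread N \<alpha> k a j"
    "thread N \<alpha> k (mat_adjoint a) j = mat_adjoint (thread N \<alpha> k a j)"
    using assms by (auto simp: thread_eq z star_homD[OF lmap_hom] star_hom_minus[OF lmap_hom])
qed

lemma lim_seqsD: "x \<in> lim_seqs N \<alpha> \<Longrightarrow> x j \<in> full_alg (N j)"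
  by (simp add: lim_seqs_def)

lemma lim_seqs_iff:
  "x \<in> lim_seqs N \<alpha> \<longleftrightarrow> (\<forall>j. x j \<in> full_alg (N j)) \<and>
     (\<forall>\<epsilon>>0. \<exists>k. \<exists>a\<in>full_alg (N k). \<forall>\<^sub>F j in sequentially. opnorm (x j - thread N \<alpha> k a j) < \<epsilon>)"
  by (simp add: lim_seqs_def eventually_sequentially)

lemma thread_lim: "a \<in> full_alg (N k) \<Longrightarrow> thread N \<alpha> k a \<in> lim_seqs N \<alpha>"
proof -
  assume a: "a \<in> full_alg (N k)"
  have "thread N \<alpha> k a j - thread N \<alpha> k a j = 0\<^sub>m (ndim (N j)) (ndim (N j))" for j
    using thread_carrier[OF a, of j] by (intro eq_matI) auto
  then have "opnorm (thread N \<alpha> k a j - thread N \<alpha> k a j) = 0" for j using opnorm_zero by simp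
  then show ?thesis using a thread_carrier[OF a] by (auto simp: lim_seqs_iff intro!: exI[of _ k] bexI[of _ a])
qed

lemma thread_bounded: "a \<in> full_alg (N k) \<Longrightarrow> opnorm (thread N \<alpha> k a j) \<le> opnorm a"
  using opnorm_star_hom[OF lmap_hom] opnorm_nonneg[of a "ndim (N k)"] by (simp add: thread_eq opnorm_zero)

lemma lim_seqs_approx2:
  assumes x: "x \<in> lim_seqs N \<alpha>" and y: "y \<in> lim_seqs N \<alpha>" and e: "0 < \<epsilon>"
  obtains k a b where "a \<in> full_alg (N k)" "b \<in> full_alg (N k)"
    "\<forall>\<^sub>F j in sequentially. opnorm (x j - thread N \<alpha> k a j) < \<epsilon>"
    "\<forall>\<^sub>F j in sequentially. opnorm (y j - thread N \<alpha> k b j) < \<epsilon>"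
proof -
  obtain k a where a: "a \<in> full_alg (N k)" "\<forall>\<^sub>F j in sequentially. opnorm (x j - thread N \<alpha> k a j) < \<epsilon>"
    using x e unfolding lim_seqs_iff by blast
  obtain l b where b: "b \<in> full_alg (N l)" "\<forall>\<^sub>F j in sequentially. opnorm (y j - thread N \<alpha> l b j) < \<epsilon>"
    using y e unfolding lim_seqs_iff by blast
  let ?m = "max k l"
  have "\<forall>\<^sub>F j in sequentially. opnorm (x j - thread N \<alpha> ?m (lmap N \<alpha> k ?m a) j) < \<epsilon>"
    using a(2) eventually_ge_at_top[of ?m] by eventually_elim (simp add: thread_shift)
  moreover have "\<forall>\<^sub>F j in sequentially. opnorm (y j - thread N \<alpha> ?m (lmap N \<alpha> l ?m b) j) < \<epsilon>"
    using b(2) eventually_ge_at_top[of ?m] by eventually_elim (simp add: thread_shift)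
  ultimately show ?thesis using that lmap_carrier[of k ?m a] lmap_carrier[of l ?m b] a b by simp
qed

lemma lim_seqs_bounded:
  assumes x: "x \<in> lim_seqs N \<alpha>"
  obtains C where "0 < C" "\<forall>\<^sub>F j in sequentially. opnorm (x j) \<le> C"
proof -
  have one: "0 < (1 :: real)" by simp
  obtain k a where a: "a \<in> full_alg (N k)" "\<forall>\<^sub>F j in sequentially. opnorm (x j - thread N \<alpha> k a j) < 1"
    using x one unfolding lim_seqs_iff by blast
  have "\<forall>\<^sub>F j in sequentially. opnorm (x j) \<le> 1 + opnorm a"
    using a(2)
  proof eventually_elim
    case (elim j)
    note xc = lim_seqsD[OF x, of j] and tc = thread_carrier[OF a(1), of j]
    have "x j = (x j - thread N \<alpha> k a j) + thread N \<alpha> k a j" using xc tc by (intro eq_matI) auto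
    then have "opnorm (x j) \<le> opnorm (x j - thread N \<alpha> k a j) + opnorm (thread N \<alpha> k a j)"
      using opnorm_add[OF minus_carrier_mat[OF tc] tc, of "x j"] by simp
    then show ?case using elim thread_bounded[OF a(1), of j] by simp
  qed
  then show ?thesis using that[of "1 + opnorm a"] opnorm_nonneg[OF a(1)] by simp
qed

lemma diff_mult_bound:
  assumes "a \<in> carrier_mat n n" "b \<in> carrier_mat n n" "c \<in> carrier_mat n n" "d \<in> carrier_mat n n"
  shows "opnorm (a * b - c * d) \<le> opnorm (a - c) * opnorm b + opnorm c * opnorm (b - d)"
proof -
  have ac: "a - c \<in> carrier_mat n n" and bd: "b - d \<in> carrier_mat n n" using assms by (auto intro: minus_carrier_mat)
  have 1: "(a - c) * b \<in> carrier_mat n n" and 2: "c * (b - d) \<in> carrier_mat n n"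
    using ac bd assms by (auto intro: mult_carrier_mat)
  have "a * b - c * d = (a - c) * b + c * (b - d)"
  proof -
    have ab: "a * b \<in> carrier_mat n n" "c * d \<in> carrier_mat n n" "c * b \<in> carrier_mat n n"
      using assms by (auto intro: mult_carrier_mat)
    have 3: "(a - c) * b = a * b - c * b" using assms by (intro minus_mult_distrib_mat) auto
    have 4: "c * (b - d) = c * b - c * d" using assms by (intro mult_minus_distrib_mat) auto
    have split: "P - Q = (P - R) + (R - Q)"
      if "P \<in> carrier_mat n n" "Q \<in> carrier_mat n n" "R \<in> carrier_mat n n" for P Q R :: "complex mat"
      using that by (intro eq_matI) auto
    show ?thesis unfolding 3 4 by (rule split[OF ab])
  qed
  then have "opnorm (a * b - c * d) \<le> opnorm ((a - c) * b) + opnorm (c * (b - d))"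
    using opnorm_add[OF 1 2] by simp
  also have "\<dots> \<le> opnorm (a - c) * opnorm b + opnorm c * opnorm (b - d)"
    using opnorm_mult[OF ac assms(2)] opnorm_mult[OF assms(3) bd] by simp
  finally show ?thesis .
qed

lemma add_diff_bound:
  assumes "a \<in> carrier_mat n n" "b \<in> carrier_mat n n" "c \<in> carrier_mat n n" "d \<in> carrier_mat n n"
  shows "opnorm ((a + b) - (c + d)) \<le> opnorm (a - c) + opnorm (b - d)"
proof -
  have "(a + b) - (c + d) = (a - c) + (b - d)" using assms by (intro eq_matI) auto
  then show ?thesis
    using opnorm_add[OF minus_carrier_mat[OF assms(3)] minus_carrier_mat[OF assms(4)], of a b] by simp
qed

lemma smult_diff_bound:
  assumes "a \<in> carrier_mat n n" "b \<in> carrier_mat n n"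
  shows "opnorm (c \<cdot>\<^sub>m a - c \<cdot>\<^sub>m b) \<le> cmod c * opnorm (a - b)"
proof -
  have "c \<cdot>\<^sub>m a - c \<cdot>\<^sub>m b = c \<cdot>\<^sub>m (a - b)" using assms by (intro eq_matI) (auto simp: right_diff_distrib)
  then show ?thesis using opnorm_smult[OF minus_carrier_mat[OF assms(2)], of c a] by simp
qed

lemma adjoint_diff_bound:
  assumes "a \<in> carrier_mat n n" "b \<in> carrier_mat n n"
  shows "opnorm (mat_adjoint a - mat_adjoint b) \<le> opnorm (a - b)"
proof -
  have "mat_adjoint a - mat_adjoint b = mat_adjoint (a - b)"
    using assms by (intro eq_matI) (auto simp: mat_adjoint_def mat_of_rows_def)
  then show ?thesis using opnorm_adjoint[OF minus_carrier_mat[OF assms(2)], of a] by simp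
qed

lemma lim_add:
  assumes x: "x \<in> lim_seqs N \<alpha>" and y: "y \<in> lim_seqs N \<alpha>"
  shows "(\<lambda>j. x j + y j) \<in> lim_seqs N \<alpha>"
  unfolding lim_seqs_iff
proof (intro conjI allI impI)
  fix \<epsilon> :: real assume "0 < \<epsilon>"
  then have e: "0 < \<epsilon> / 2" by simp
  obtain k a b where ab: "a \<in> full_alg (N k)" "b \<in> full_alg (N k)"
    "\<forall>\<^sub>F j in sequentially. opnorm (x j - thread N \<alpha> k a j) < \<epsilon> / 2"
    "\<forall>\<^sub>F j in sequentially. opnorm (y j - thread N \<alpha> k b j) < \<epsilon> / 2"
    using lim_seqs_approx2[OF x y e] .
  have "\<forall>\<^sub>F j in sequentially. opnorm (x j + y j - thread N \<alpha> k (a + b) j) < \<epsilon>"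
    using ab(3,4)
  proof eventually_elim
    case (elim j)
    then show ?case unfolding thread_ops(1)[OF ab(1,2)]
      using add_diff_bound[OF lim_seqsD[OF x] lim_seqsD[OF y] thread_carrier[OF ab(1)] thread_carrier[OF ab(2)], of j] by simp
  qed
  then show "\<exists>k. \<exists>a\<in>full_alg (N k). \<forall>\<^sub>F j in sequentially. opnorm (x j + y j - thread N \<alpha> k a j) < \<epsilon>"
    using ab by (intro exI[of _ k] bexI[of _ "a + b"]) auto
qed (use lim_seqsD[OF x] lim_seqsD[OF y] in auto)

lemma lim_smult:
  assumes x: "x \<in> lim_seqs N \<alpha>"
  shows "(\<lambda>j. c \<cdot>\<^sub>m x j) \<in> lim_seqs N \<alpha>"
  unfolding lim_seqs_iff
proof (intro conjI allI impI)
  fix \<epsilon> :: real assume e: "0 < \<epsilon>"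
  \<comment> \<open>The added 1 keeps the denominator positive for \<open>c = 0\<close>.\<close>
  define \<delta> where "\<delta> = \<epsilon> / (cmod c + 1)"
  have p: "0 < cmod c + 1" by (simp add: add_nonneg_pos)
  then have d: "0 < \<delta>" using e by (simp add: \<delta>_def)
  obtain k a where a: "a \<in> full_alg (N k)" "\<forall>\<^sub>F j in sequentially. opnorm (x j - thread N \<alpha> k a j) < \<delta>"
    using x d unfolding lim_seqs_iff by blast
  have "\<forall>\<^sub>F j in sequentially. opnorm (c \<cdot>\<^sub>m x j - thread N \<alpha> k (c \<cdot>\<^sub>m a) j) < \<epsilon>"
    using a(2)
  proof eventually_elim
    case (elim j)
    have "opnorm (c \<cdot>\<^sub>m x j - thread N \<alpha> k (c \<cdot>\<^sub>m a) j) \<le> cmod c * opnorm (x j - thread N \<alpha> k a j)"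
      unfolding thread_ops(4)[OF a(1) a(1)] by (rule smult_diff_bound[OF lim_seqsD[OF x] thread_carrier[OF a(1)]])
    also have "\<dots> \<le> cmod c * \<delta>" using elim by (intro mult_left_mono) auto
    also have "\<dots> < (cmod c + 1) * \<delta>" using d by simp
    also have "\<dots> = \<epsilon>" using p by (simp add: \<delta>_def)
    finally show ?case .
  qed
  then show "\<exists>k. \<exists>a\<in>full_alg (N k). \<forall>\<^sub>F j in sequentially. opnorm (c \<cdot>\<^sub>m x j - thread N \<alpha> k a j) < \<epsilon>"
    using a by (intro exI[of _ k] bexI[of _ "c \<cdot>\<^sub>m a"]) auto
qed (use lim_seqsD[OF x] in auto)

lemma lim_adjoint:
  assumes x: "x \<in> lim_seqs N \<alpha>"
  shows "(\<lambda>j. mat_adjoint (x j)) \<in> lim_seqs N \<alpha>"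
  unfolding lim_seqs_iff
proof (intro conjI allI impI)
  fix \<epsilon> :: real assume e: "0 < \<epsilon>"
  obtain k a where a: "a \<in> full_alg (N k)" "\<forall>\<^sub>F j in sequentially. opnorm (x j - thread N \<alpha> k a j) < \<epsilon>"
    using x e unfolding lim_seqs_iff by blast
  have "\<forall>\<^sub>F j in sequentially. opnorm (mat_adjoint (x j) - thread N \<alpha> k (mat_adjoint a) j) < \<epsilon>"
    using a(2)
  proof eventually_elim
    case (elim j)
    then show ?case unfolding thread_ops(5)[OF a(1) a(1)]
      using adjoint_diff_bound[OF lim_seqsD[OF x] thread_carrier[OF a(1)], of j] by simp
  qed
  then show "\<exists>k. \<exists>a\<in>full_alg (N k). \<forall>\<^sub>F j in sequentially. opnorm (mat_adjoint (x j) - thread N \<alpha> k a j) < \<epsilon>"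
    using a by (intro exI[of _ k] bexI[of _ "mat_adjoint a"]) auto
qed (use lim_seqsD[OF x] in auto)

lemma lim_mult:
  assumes x: "x \<in> lim_seqs N \<alpha>" and y: "y \<in> lim_seqs N \<alpha>"
  shows "(\<lambda>j. x j * y j) \<in> lim_seqs N \<alpha>"
  unfolding lim_seqs_iff
proof (intro conjI allI impI)
  fix \<epsilon> :: real assume e: "0 < \<epsilon>"
  obtain C where C: "0 < C" "\<forall>\<^sub>F j in sequentially. opnorm (x j) \<le> C" using lim_seqs_bounded[OF x] .
  obtain D where D: "0 < D" "\<forall>\<^sub>F j in sequentially. opnorm (y j) \<le> D" using lim_seqs_bounded[OF y] .
  \<comment> \<open>The estimate below ends in \<open>\<delta> * D + (C + 1) * \<delta>\<close>; the
    bound by 1 keeps the norms of the approximants below \<open>C + 1\<close>.\<close>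
  define \<delta> where "\<delta> = min 1 (\<epsilon> / (D + C + 1))"
  have d: "0 < \<delta>" "\<delta> \<le> 1" using e C D by (auto simp: \<delta>_def)
  obtain k a b where ab: "a \<in> full_alg (N k)" "b \<in> full_alg (N k)"
    "\<forall>\<^sub>F j in sequentially. opnorm (x j - thread N \<alpha> k a j) < \<delta>"
    "\<forall>\<^sub>F j in sequentially. opnorm (y j - thread N \<alpha> k b j) < \<delta>"
    using lim_seqs_approx2[OF x y d(1)] .
  have "\<forall>\<^sub>F j in sequentially. opnorm (x j * y j - thread N \<alpha> k (a * b) j) < \<epsilon>"
    using ab(3,4) C(2) D(2)
  proof eventually_elim
    case (elim j)
    let ?a = "thread N \<alpha> k a j" and ?b = "thread N \<alpha> k b j"
    note c = lim_seqsD[OF x, of j] lim_seqsD[OF y, of j] thread_carrier[OF ab(1), of j] thread_carrier[OF ab(2), of j]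
    have dc: "?a - x j \<in> full_alg (N j)" using c by (auto intro: minus_carrier_mat)
    have "?a = (?a - x j) + x j" using c by (intro eq_matI) auto
    then have "opnorm ?a \<le> opnorm (?a - x j) + opnorm (x j)" using opnorm_add[OF dc c(1)] by simp
    then have an: "opnorm ?a \<le> C + 1" using elim d opnorm_minus_commute[OF c(1,3)] by simp
    have "opnorm (x j * y j - ?a * ?b) \<le> opnorm (x j - ?a) * opnorm (y j) + opnorm ?a * opnorm (y j - ?b)"
      by (rule diff_mult_bound[OF c(1,2,3,4)])
    also have "\<dots> \<le> opnorm (x j - ?a) * D + (C + 1) * opnorm (y j - ?b)"
      using elim an C opnorm_nonneg[OF minus_carrier_mat[OF c(3)], of "x j"] opnorm_nonneg[OF minus_carrier_mat[OF c(4)], of "y j"]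
      by (intro add_mono mult_left_mono mult_right_mono) auto
    also have "\<dots> < \<delta> * D + (C + 1) * \<delta>"
      using elim C D by (intro add_strict_mono mult_strict_right_mono mult_strict_left_mono) auto
    also have "\<dots> = (D + C + 1) * \<delta>" by (simp add: algebra_simps)
    also have "\<dots> \<le> (D + C + 1) * (\<epsilon> / (D + C + 1))" using C D by (intro mult_left_mono) (auto simp: \<delta>_def)
    also have "\<dots> = \<epsilon>" using C D by simp
    finally show ?case unfolding thread_ops(3)[OF ab(1,2)] .
  qed
  then show "\<exists>k. \<exists>a\<in>full_alg (N k). \<forall>\<^sub>F j in sequentially. opnorm (x j * y j - thread N \<alpha> k a j) < \<epsilon>"
    using mult_carrier_mat[OF ab(1,2)] by blast
qed (use lim_seqsD[OF x] lim_seqsD[OF y] mult_carrier_mat in blast)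

section \<open>The quotient by null sequences\<close>

lemma null_relI:
  assumes "x \<in> lim_seqs N \<alpha>" "y \<in> lim_seqs N \<alpha>" and f: "f \<longlonglongrightarrow> 0"
    and le: "\<forall>\<^sub>F j in sequentially. opnorm (x j - y j) \<le> f j"
  shows "(x, y) \<in> null_rel N \<alpha>"
proof -
  have "(\<lambda>j. opnorm (x j - y j)) \<longlonglongrightarrow> 0"
  proof (rule tendsto_sandwich[OF _ le tendsto_const f])
    show "\<forall>\<^sub>F j in sequentially. 0 \<le> opnorm (x j - y j)"
      using opnorm_nonneg[OF minus_carrier_mat[OF lim_seqsD[OF assms(2)]]] by simp
  qed
  then show ?thesis using assms by (simp add: null_rel_def)
qed

lemma null_rel_eventually_eq:
  assumes "x \<in> lim_seqs N \<alpha>" "y \<in> lim_seqs N \<alpha>" "\<forall>\<^sub>F j in sequentially. x j = y j"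
  shows "(x, y) \<in> null_rel N \<alpha>"
proof (rule null_relI[OF assms(1,2) tendsto_const])
  show "\<forall>\<^sub>F j in sequentially. opnorm (x j - y j) \<le> 0"
    using assms(3)
  proof eventually_elim
    case (elim j)
    have "x j - y j = 0\<^sub>m (ndim (N j)) (ndim (N j))" using elim lim_seqsD[OF assms(2), of j] by (intro eq_matI) auto
    then show ?case by (simp add: opnorm_zero)
  qed
qed

lemma null_rel_equiv: "equiv (lim_seqs N \<alpha>) (null_rel N \<alpha>)"
proof (rule equivI)
  show "null_rel N \<alpha> \<subseteq> lim_seqs N \<alpha> \<times> lim_seqs N \<alpha>" by (auto simp: null_rel_def)
  show "refl_on (lim_seqs N \<alpha>) (null_rel N \<alpha>)"
    by (auto simp: refl_on_def null_rel_eventually_eq)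
  show "sym (null_rel N \<alpha>)"
  proof (rule symI)
    fix x y assume *: "(x, y) \<in> null_rel N \<alpha>"
    then have c: "x \<in> lim_seqs N \<alpha>" "y \<in> lim_seqs N \<alpha>" by (auto simp: null_rel_def)
    have "opnorm (y j - x j) = opnorm (x j - y j)" for j
      using opnorm_minus_commute[OF lim_seqsD[OF c(2)] lim_seqsD[OF c(1)]] by blast
    then show "(y, x) \<in> null_rel N \<alpha>" using * by (simp add: null_rel_def)
  qed
  show "trans (null_rel N \<alpha>)"
  proof (rule transI)
    fix x y z assume *: "(x, y) \<in> null_rel N \<alpha>" "(y, z) \<in> null_rel N \<alpha>"
    then have c: "x \<in> lim_seqs N \<alpha>" "y \<in> lim_seqs N \<alpha>" "z \<in> lim_seqs N \<alpha>"
      and l: "(\<lambda>j. opnorm (x j - y j)) \<longlonglongrightarrow> 0" "(\<lambda>j. opnorm (y j - z j)) \<longlonglongrightarrow> 0" by (auto simp: null_rel_def)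
    show "(x, z) \<in> null_rel N \<alpha>"
    proof (rule null_relI[OF c(1,3) tendsto_add_zero[OF l]])
      show "\<forall>\<^sub>F j in sequentially. opnorm (x j - z j) \<le> opnorm (x j - y j) + opnorm (y j - z j)"
        using opnorm_triangle[OF lim_seqsD[OF c(1)] lim_seqsD[OF c(2)] lim_seqsD[OF c(3)]] by simp
    qed
  qed
qed

lemma lcls_eq_iff: "x \<in> lim_seqs N \<alpha> \<Longrightarrow> y \<in> lim_seqs N \<alpha> \<Longrightarrow> lcls N \<alpha> x = lcls N \<alpha> y \<longleftrightarrow> (x, y) \<in> null_rel N \<alpha>"
  unfolding lcls_def by (rule eq_equiv_class_iff[OF null_rel_equiv])

lemma in_lclsD: "y \<in> lcls N \<alpha> x \<Longrightarrow> (x, y) \<in> null_rel N \<alpha>" "y \<in> lcls N \<alpha> x \<Longrightarrow> y \<in> lim_seqs N \<alpha>"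
  by (auto simp: lcls_def null_rel_def)

lemma in_lcls_self: "x \<in> lim_seqs N \<alpha> \<Longrightarrow> x \<in> lcls N \<alpha> x"
  using null_rel_equiv by (simp add: lcls_def equiv_def refl_on_def)

lemma cstar_carrier: "acarrier (cstar_limit N \<alpha>) = lcls N \<alpha> ` lim_seqs N \<alpha>"
  by (auto simp: cstar_limit_def quotient_def lcls_def)

lemma null_add:
  assumes "(x, x') \<in> null_rel N \<alpha>" "(y, y') \<in> null_rel N \<alpha>"
  shows "((\<lambda>j. x j + y j), (\<lambda>j. x' j + y' j)) \<in> null_rel N \<alpha>"
proof -
  have c: "x \<in> lim_seqs N \<alpha>" "x' \<in> lim_seqs N \<alpha>" "y \<in> lim_seqs N \<alpha>" "y' \<in> lim_seqs N \<alpha>"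
    and l: "(\<lambda>j. opnorm (x j - x' j)) \<longlonglongrightarrow> 0" "(\<lambda>j. opnorm (y j - y' j)) \<longlonglongrightarrow> 0"
    using assms by (auto simp: null_rel_def)
  show ?thesis
    by (rule null_relI[OF lim_add[OF c(1,3)] lim_add[OF c(2,4)] tendsto_add_zero[OF l]])
      (use add_diff_bound[OF lim_seqsD[OF c(1)] lim_seqsD[OF c(3)] lim_seqsD[OF c(2)] lim_seqsD[OF c(4)]] in simp)
qed

lemma null_smult:
  assumes "(x, x') \<in> null_rel N \<alpha>"
  shows "((\<lambda>j. c \<cdot>\<^sub>m x j), (\<lambda>j. c \<cdot>\<^sub>m x' j)) \<in> null_rel N \<alpha>"
proof -
  have c: "x \<in> lim_seqs N \<alpha>" "x' \<in> lim_seqs N \<alpha>" and l: "(\<lambda>j. opnorm (x j - x' j)) \<longlonglongrightarrow> 0"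
    using assms by (auto simp: null_rel_def)
  show ?thesis
    by (rule null_relI[OF lim_smult[OF c(1)] lim_smult[OF c(2)] tendsto_mult_right_zero[OF l, of "cmod c"]])
      (use smult_diff_bound[OF lim_seqsD[OF c(1)] lim_seqsD[OF c(2)]] in simp)
qed

lemma null_adjoint:
  assumes "(x, x') \<in> null_rel N \<alpha>"
  shows "((\<lambda>j. mat_adjoint (x j)), (\<lambda>j. mat_adjoint (x' j))) \<in> null_rel N \<alpha>"
proof -
  have c: "x \<in> lim_seqs N \<alpha>" "x' \<in> lim_seqs N \<alpha>" and l: "(\<lambda>j. opnorm (x j - x' j)) \<longlonglongrightarrow> 0"
    using assms by (auto simp: null_rel_def)
  show ?thesis
    by (rule null_relI[OF lim_adjoint[OF c(1)] lim_adjoint[OF c(2)] l])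
      (use adjoint_diff_bound[OF lim_seqsD[OF c(1)] lim_seqsD[OF c(2)]] in simp)
qed

lemma null_mult:
  assumes "(x, x') \<in> null_rel N \<alpha>" "(y, y') \<in> null_rel N \<alpha>"
  shows "((\<lambda>j. x j * y j), (\<lambda>j. x' j * y' j)) \<in> null_rel N \<alpha>"
proof -
  have c: "x \<in> lim_seqs N \<alpha>" "x' \<in> lim_seqs N \<alpha>" "y \<in> lim_seqs N \<alpha>" "y' \<in> lim_seqs N \<alpha>"
    and l: "(\<lambda>j. opnorm (x j - x' j)) \<longlonglongrightarrow> 0" "(\<lambda>j. opnorm (y j - y' j)) \<longlonglongrightarrow> 0"
    using assms by (auto simp: null_rel_def)
  obtain C where C: "0 < C" "\<forall>\<^sub>F j in sequentially. opnorm (x' j) \<le> C" using lim_seqs_bounded[OF c(2)] .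
  obtain D where D: "0 < D" "\<forall>\<^sub>F j in sequentially. opnorm (y j) \<le> D" using lim_seqs_bounded[OF c(3)] .
  have l': "(\<lambda>j. opnorm (x j - x' j) * D + C * opnorm (y j - y' j)) \<longlonglongrightarrow> 0"
    by (intro tendsto_add_zero tendsto_mult_left_zero tendsto_mult_right_zero l)
  show ?thesis
  proof (rule null_relI[OF lim_mult[OF c(1,3)] lim_mult[OF c(2,4)] l'])
    show "\<forall>\<^sub>F j in sequentially. opnorm (x j * y j - x' j * y' j) \<le> opnorm (x j - x' j) * D + C * opnorm (y j - y' j)"
      using C(2) D(2)
    proof eventually_elim
      case (elim j)
      note cj = lim_seqsD[OF c(1), of j] lim_seqsD[OF c(2), of j] lim_seqsD[OF c(3), of j] lim_seqsD[OF c(4), of j]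
      have "opnorm (x j * y j - x' j * y' j) \<le> opnorm (x j - x' j) * opnorm (y j) + opnorm (x' j) * opnorm (y j - y' j)"
        by (rule diff_mult_bound[OF cj(1,3,2,4)])
      also have "\<dots> \<le> opnorm (x j - x' j) * D + C * opnorm (y j - y' j)"
        using elim opnorm_nonneg[OF minus_carrier_mat[OF cj(2)], of "x j"] opnorm_nonneg[OF minus_carrier_mat[OF cj(4)], of "y j"]
        by (intro add_mono mult_left_mono mult_right_mono) auto
      finally show ?case .
    qed
  qed
qed

text \<open>Each operation respects \<open>null_rel\<close>, so the union in its definition runs
  over copies of a single class. The facts \<open>c2\<close> and \<open>c1\<close> treat the
  operations with two and with one class as argument.\<close>

lemma lcls_ops:
  assumes x: "x \<in> lim_seqs N \<alpha>" and y: "y \<in> lim_seqs N \<alpha>"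
  shows "aadd (cstar_limit N \<alpha>) (lcls N \<alpha> x) (lcls N \<alpha> y) = lcls N \<alpha> (\<lambda>j. x j + y j)"
    "amult (cstar_limit N \<alpha>) (lcls N \<alpha> x) (lcls N \<alpha> y) = lcls N \<alpha> (\<lambda>j. x j * y j)"
    "ascale (cstar_limit N \<alpha>) c (lcls N \<alpha> x) = lcls N \<alpha> (\<lambda>j. c \<cdot>\<^sub>m x j)"
    "astar (cstar_limit N \<alpha>) (lcls N \<alpha> x) = lcls N \<alpha> (\<lambda>j. mat_adjoint (x j))"
proof -
  have c2: "\<Union>{null_rel N \<alpha> `` {F x' y'} |x' y'. x' \<in> lcls N \<alpha> x \<and> y' \<in> lcls N \<alpha> y} = lcls N \<alpha> (F x y)"
    if F: "\<And>x x' y y'. (x, x') \<in> null_rel N \<alpha> \<Longrightarrow> (y, y') \<in> null_rel N \<alpha> \<Longrightarrow> (F x y, F x' y') \<in> null_rel N \<alpha>" for F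
  proof -
    have "null_rel N \<alpha> `` {F x' y'} = lcls N \<alpha> (F x y)" if "x' \<in> lcls N \<alpha> x" "y' \<in> lcls N \<alpha> y" for x' y'
      using equiv_class_eq[OF null_rel_equiv F[OF in_lclsD(1)[OF that(1)] in_lclsD(1)[OF that(2)]]] by (simp add: lcls_def)
    then have "{null_rel N \<alpha> `` {F x' y'} |x' y'. x' \<in> lcls N \<alpha> x \<and> y' \<in> lcls N \<alpha> y} = {lcls N \<alpha> (F x y)}"
      using in_lcls_self[OF x] in_lcls_self[OF y] by blast
    then show ?thesis by simp
  qed
  have c1: "\<Union>{null_rel N \<alpha> `` {F x'} |x'. x' \<in> lcls N \<alpha> x} = lcls N \<alpha> (F x)"
    if F: "\<And>x x'. (x, x') \<in> null_rel N \<alpha> \<Longrightarrow> (F x, F x') \<in> null_rel N \<alpha>" for F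
  proof -
    have "null_rel N \<alpha> `` {F x'} = lcls N \<alpha> (F x)" if "x' \<in> lcls N \<alpha> x" for x'
      using equiv_class_eq[OF null_rel_equiv F[OF in_lclsD(1)[OF that(1)]]] by (simp add: lcls_def)
    then have "{null_rel N \<alpha> `` {F x'} |x'. x' \<in> lcls N \<alpha> x} = {lcls N \<alpha> (F x)}"
      using in_lcls_self[OF x] by blast
    then show ?thesis by simp
  qed
  show "aadd (cstar_limit N \<alpha>) (lcls N \<alpha> x) (lcls N \<alpha> y) = lcls N \<alpha> (\<lambda>j. x j + y j)"
    unfolding cstar_limit_def alg_struct.select_convs star_alg_struct.select_convs
    by (rule c2[where F = "\<lambda>x y j. x j + y j"]) (rule null_add)
  show "amult (cstar_limit N \<alpha>) (lcls N \<alpha> x) (lcls N \<alpha> y) = lcls N \<alpha> (\<lambda>j. x j * y j)"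
    unfolding cstar_limit_def alg_struct.select_convs star_alg_struct.select_convs
    by (rule c2[where F = "\<lambda>x y j. x j * y j"]) (rule null_mult)
  show "ascale (cstar_limit N \<alpha>) c (lcls N \<alpha> x) = lcls N \<alpha> (\<lambda>j. c \<cdot>\<^sub>m x j)"
    unfolding cstar_limit_def alg_struct.select_convs star_alg_struct.select_convs
    by (rule c1[where F = "\<lambda>x j. c \<cdot>\<^sub>m x j"]) (rule null_smult)
  show "astar (cstar_limit N \<alpha>) (lcls N \<alpha> x) = lcls N \<alpha> (\<lambda>j. mat_adjoint (x j))"
    unfolding cstar_limit_def alg_struct.select_convs star_alg_struct.select_convs
    by (rule c1[where F = "\<lambda>x j. mat_adjoint (x j)"]) (rule null_adjoint)
qed

lemma lin_carrier: "a \<in> full_alg (N k) \<Longrightarrow> lin N \<alpha> k a \<in> acarrier (cstar_limit N \<alpha>)"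
  by (simp add: lin_def cstar_carrier thread_lim)

lemma lin_ops:
  assumes "a \<in> full_alg (N k)" "b \<in> full_alg (N k)"
  shows "aadd (cstar_limit N \<alpha>) (lin N \<alpha> k a) (lin N \<alpha> k b) = lin N \<alpha> k (a + b)"
    "amult (cstar_limit N \<alpha>) (lin N \<alpha> k a) (lin N \<alpha> k b) = lin N \<alpha> k (a * b)"
    "ascale (cstar_limit N \<alpha>) c (lin N \<alpha> k a) = lin N \<alpha> k (c \<cdot>\<^sub>m a)"
    "astar (cstar_limit N \<alpha>) (lin N \<alpha> k a) = lin N \<alpha> k (mat_adjoint a)"
  unfolding lin_def lcls_ops[OF thread_lim[OF assms(1)] thread_lim[OF assms(2)]] thread_ops[OF assms, abs_def]
  by (rule refl)+

lemma lin_shift: "k \<le> l \<Longrightarrow> a \<in> full_alg (N k) \<Longrightarrow> lin N \<alpha> l (lmap N \<alpha> k l a) = lin N \<alpha> k a"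
  unfolding lin_def
  by (subst lcls_eq_iff)
    (auto intro!: null_rel_eventually_eq thread_lim lmap_carrier eventually_sequentiallyI[of l] simp: thread_shift)

text \<open>The system maps are injective, so at every later level each entry of
  \<open>a - b\<close> is bounded by the norm of the difference of the threads; these norms tend to
  0.\<close>

lemma lin_inj:
  assumes a: "a \<in> full_alg (N k)" and b: "b \<in> full_alg (N k)" and eq: "lin N \<alpha> k a = lin N \<alpha> k b"
  shows "a = b"
proof -
  have "(thread N \<alpha> k a, thread N \<alpha> k b) \<in> null_rel N \<alpha>"
    using eq lcls_eq_iff[OF thread_lim[OF a] thread_lim[OF b]] by (simp add: lin_def)
  then have l: "(\<lambda>j. opnorm (thread N \<alpha> k a j - thread N \<alpha> k b j)) \<longlonglongrightarrow> 0" by (simp add: null_rel_def)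
  have c: "a - b \<in> full_alg (N k)" by (rule minus_carrier_mat[OF b])
  have "(a - b) $$ (p, q) = 0" if pq: "p < ndim (N k)" "q < ndim (N k)" for p q
  proof -
    have "cmod ((a - b) $$ (p, q)) \<le> 0"
    proof (rule tendsto_le[OF _ l tendsto_const])
      show "\<forall>\<^sub>F j in sequentially. cmod ((a - b) $$ (p, q)) \<le> opnorm (thread N \<alpha> k a j - thread N \<alpha> k b j)"
        using eventually_ge_at_top[of k]
      proof eventually_elim
        case (elim j)
        have "thread N \<alpha> k a j - thread N \<alpha> k b j = lmap N \<alpha> k j (a - b)"
          using thread_ops(2)[OF a b, of j] elim by (simp add: thread_eq)
        then show ?case using entry_le_opnorm[OF lmap_hom[OF elim] c lmap_inj[OF elim] pq] by simp
      qed
    qed simp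
    then show ?thesis by simp
  qed
  then have "a $$ (p, q) = b $$ (p, q)" if "p < ndim (N k)" "q < ndim (N k)" for p q
    using that a b by fastforce
  then show ?thesis using a b by (intro eq_matI) auto
qed

lemma lin_eq_lmap:
  assumes a: "a \<in> full_alg (N k)" and b: "b \<in> full_alg (N l)" and eq: "lin N \<alpha> k a = lin N \<alpha> l b"
    and j: "k \<le> j" "l \<le> j"
  shows "lmap N \<alpha> k j a = lmap N \<alpha> l j b"
  using lin_inj[OF lmap_carrier[OF j(1) a] lmap_carrier[OF j(2) b]] lin_shift[OF j(1) a] lin_shift[OF j(2) b] eq by simp

text \<open>Injectivity of \<open>lin\<close> at a common level replaces agreement at some later
  level by equality in the C*-limit. From here on the algebraic limit is handled inside the
  C*-limit.\<close>

lemma germ_rel_iff: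
  "((k, a), (l, b)) \<in> germ_rel N \<alpha> \<longleftrightarrow> a \<in> nest_alg (N k) \<and> b \<in> nest_alg (N l) \<and> lin N \<alpha> k a = lin N \<alpha> l b"
proof
  assume "((k, a), (l, b)) \<in> germ_rel N \<alpha>"
  then obtain j where a: "a \<in> nest_alg (N k)" "b \<in> nest_alg (N l)" and j: "k \<le> j" "l \<le> j" "sysmap \<alpha> k j a = sysmap \<alpha> l j b"
    by (auto simp: germ_rel_def)
  have "lmap N \<alpha> k j a = lmap N \<alpha> l j b" using lmap_nest[OF j(1) a(1)] lmap_nest[OF j(2) a(2)] j(3) by simp
  then show "a \<in> nest_alg (N k) \<and> b \<in> nest_alg (N l) \<and> lin N \<alpha> k a = lin N \<alpha> l b"
    using lin_shift[OF j(1) nest_alg_full[OF a(1)]] lin_shift[OF j(2) nest_alg_full[OF a(2)]] a by simp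
next
  assume *: "a \<in> nest_alg (N k) \<and> b \<in> nest_alg (N l) \<and> lin N \<alpha> k a = lin N \<alpha> l b"
  let ?j = "max k l"
  have "lmap N \<alpha> k ?j a = lmap N \<alpha> l ?j b" using * by (intro lin_eq_lmap nest_alg_full) auto
  then have "sysmap \<alpha> k ?j a = sysmap \<alpha> l ?j b"
    using * lmap_nest[of k ?j a] lmap_nest[of l ?j b] by simp
  then show "((k, a), (l, b)) \<in> germ_rel N \<alpha>"
    using * unfolding germ_rel_def by (auto intro!: exI[of _ ?j])
qed

lemma germ_eq: "germ N \<alpha> k a = {(l, b). a \<in> nest_alg (N k) \<and> b \<in> nest_alg (N l) \<and> lin N \<alpha> k a = lin N \<alpha> l b}"
  by (auto simp: germ_def germ_rel_iff)

lemma germ_eq_iff: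
  assumes "a \<in> nest_alg (N k)" "b \<in> nest_alg (N l)"
  shows "germ N \<alpha> k a = germ N \<alpha> l b \<longleftrightarrow> lin N \<alpha> k a = lin N \<alpha> l b"
proof
  assume "germ N \<alpha> k a = germ N \<alpha> l b"
  moreover have "(k, a) \<in> germ N \<alpha> k a" using assms by (simp add: germ_eq)
  ultimately show "lin N \<alpha> k a = lin N \<alpha> l b" by (simp add: germ_eq)
qed (use assms in \<open>simp add: germ_eq\<close>)

lemma limit_carrier: "acarrier (limit_alg N \<alpha>) = {germ N \<alpha> k a | k a. a \<in> nest_alg (N k)}"
  by (auto simp: limit_alg_def quotient_def germ_def)

lemma limit_incl_germ:
  assumes "a \<in> nest_alg (N k)"
  shows "limit_incl N \<alpha> (germ N \<alpha> k a) = lin N \<alpha> k a"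
proof -
  have "{null_rel N \<alpha> `` {thread N \<alpha> l b} | l b. (l, b) \<in> germ N \<alpha> k a} = {lin N \<alpha> k a}"
    using assms by (auto simp: germ_eq lin_def lcls_def)
  then show ?thesis by (simp add: limit_incl_def)
qed

lemma common_level:
  assumes "X \<in> acarrier (limit_alg N \<alpha>)" "Y \<in> acarrier (limit_alg N \<alpha>)"
  obtains k a b where "a \<in> nest_alg (N k)" "b \<in> nest_alg (N k)" "X = germ N \<alpha> k a" "Y = germ N \<alpha> k b"
proof -
  obtain k a where a: "a \<in> nest_alg (N k)" "X = germ N \<alpha> k a" using assms by (auto simp: limit_carrier)
  obtain l b where b: "b \<in> nest_alg (N l)" "Y = germ N \<alpha> l b" using assms by (auto simp: limit_carrier)
  let ?m = "max k l"
  have a': "lmap N \<alpha> k ?m a \<in> nest_alg (N ?m)" using lmap_nest[of k ?m a] a by simp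
  have b': "lmap N \<alpha> l ?m b \<in> nest_alg (N ?m)" using lmap_nest[of l ?m b] b by simp
  have "X = germ N \<alpha> ?m (lmap N \<alpha> k ?m a)" unfolding a(2) germ_eq_iff[OF a(1) a'] using a nest_alg_full by (simp add: lin_shift)
  moreover have "Y = germ N \<alpha> ?m (lmap N \<alpha> l ?m b)" unfolding b(2) germ_eq_iff[OF b(1) b'] using b nest_alg_full by (simp add: lin_shift)
  ultimately show ?thesis using that a' b' by blast
qed

lemma germ_ops:
  assumes ab: "a \<in> nest_alg (N k)" "b \<in> nest_alg (N k)"
  shows "aadd (limit_alg N \<alpha>) (germ N \<alpha> k a) (germ N \<alpha> k b) = germ N \<alpha> k (a + b)"
    "amult (limit_alg N \<alpha>) (germ N \<alpha> k a) (germ N \<alpha> k b) = germ N \<alpha> k (a * b)"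
    "ascale (limit_alg N \<alpha>) c (germ N \<alpha> k a) = germ N \<alpha> k (c \<cdot>\<^sub>m a)"
proof -
  have self: "(k, a) \<in> germ N \<alpha> k a" "(k, b) \<in> germ N \<alpha> k b" using ab by (simp_all add: germ_eq)
  have "{germ N \<alpha> l (a' + b') | l a' b'. (l, a') \<in> germ N \<alpha> k a \<and> (l, b') \<in> germ N \<alpha> k b} = {germ N \<alpha> k (a + b)}" (is "?S = _")
  proof -
    have "germ N \<alpha> l (a' + b') = germ N \<alpha> k (a + b)" if h: "(l, a') \<in> germ N \<alpha> k a" "(l, b') \<in> germ N \<alpha> k b" for l a' b'
    proof -
      have h': "a' \<in> nest_alg (N l)" "b' \<in> nest_alg (N l)" "lin N \<alpha> k a = lin N \<alpha> l a'" "lin N \<alpha> k b = lin N \<alpha> l b'"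
        using h by (auto simp: germ_eq)
      show ?thesis
        unfolding germ_eq_iff[OF nest_alg_closed(1)[OF nd h'(1,2)] nest_alg_closed(1)[OF nd ab]]
        using lin_ops(1)[OF nest_alg_full[OF h'(1)] nest_alg_full[OF h'(2)]] lin_ops(1)[OF nest_alg_full[OF ab(1)] nest_alg_full[OF ab(2)]] h'(3,4) by simp
    qed
    then show ?thesis using self by blast
  qed
  then show "aadd (limit_alg N \<alpha>) (germ N \<alpha> k a) (germ N \<alpha> k b) = germ N \<alpha> k (a + b)" by (simp add: limit_alg_def)
  have "{germ N \<alpha> l (a' * b') | l a' b'. (l, a') \<in> germ N \<alpha> k a \<and> (l, b') \<in> germ N \<alpha> k b} = {germ N \<alpha> k (a * b)}"
  proof -
    have "germ N \<alpha> l (a' * b') = germ N \<alpha> k (a * b)" if h: "(l, a') \<in> germ N \<alpha> k a" "(l, b') \<in> germ N \<alpha> k b" for l a' b'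
    proof -
      have h': "a' \<in> nest_alg (N l)" "b' \<in> nest_alg (N l)" "lin N \<alpha> k a = lin N \<alpha> l a'" "lin N \<alpha> k b = lin N \<alpha> l b'"
        using h by (auto simp: germ_eq)
      show ?thesis
        unfolding germ_eq_iff[OF nest_alg_closed(2)[OF nd h'(1,2)] nest_alg_closed(2)[OF nd ab]]
        using lin_ops(2)[OF nest_alg_full[OF h'(1)] nest_alg_full[OF h'(2)]] lin_ops(2)[OF nest_alg_full[OF ab(1)] nest_alg_full[OF ab(2)]] h'(3,4) by simp
    qed
    then show ?thesis using self by blast
  qed
  then show "amult (limit_alg N \<alpha>) (germ N \<alpha> k a) (germ N \<alpha> k b) = germ N \<alpha> k (a * b)" by (simp add: limit_alg_def)
  have "{germ N \<alpha> l (c \<cdot>\<^sub>m a') | l a'. (l, a') \<in> germ N \<alpha> k a} = {germ N \<alpha> k (c \<cdot>\<^sub>m a)}"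
  proof -
    have "germ N \<alpha> l (c \<cdot>\<^sub>m a') = germ N \<alpha> k (c \<cdot>\<^sub>m a)" if h: "(l, a') \<in> germ N \<alpha> k a" for l a'
    proof -
      have h': "a' \<in> nest_alg (N l)" "lin N \<alpha> k a = lin N \<alpha> l a'" using h by (auto simp: germ_eq)
      show ?thesis
        unfolding germ_eq_iff[OF nest_alg_closed(3)[OF nd h'(1) h'(1)] nest_alg_closed(3)[OF nd ab(1) ab(1)]]
        using lin_ops(3)[OF nest_alg_full[OF h'(1)] nest_alg_full[OF h'(1)], of c] lin_ops(3)[OF nest_alg_full[OF ab(1)] nest_alg_full[OF ab(1)], of c] h'(2) by simp
    qed
    then show ?thesis using self by blast
  qed
  then show "ascale (limit_alg N \<alpha>) c (germ N \<alpha> k a) = germ N \<alpha> k (c \<cdot>\<^sub>m a)" by (simp add: limit_alg_def)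
qed

end

section \<open>Maps of limits induced by commuting diagrams\<close>

text \<open>A ladder of star homomorphisms in one direction only. Both directions of a commuting
  diagram are instances, combined in \<open>inverse_on_threads\<close>.\<close>

locale sysmor = A: dsys N \<alpha> + B: dsys N' \<alpha>'
  for N \<alpha> N' \<alpha>' +
  fixes n m :: "nat \<Rightarrow> nat" and \<pi> :: "nat \<Rightarrow> complex mat \<Rightarrow> complex mat"
  assumes n: "strict_mono n" and m: "strict_mono m"
    and \<pi>: "star_hom (ndim (N (n k))) (ndim (N' (m k))) (\<pi> k)"
    and step: "a \<in> full_alg (N (n k)) \<Longrightarrow>
      \<pi> (Suc k) (lmap N \<alpha> (n k) (n (Suc k)) a) = lmap N' \<alpha>' (m k) (m (Suc k)) (\<pi> k a)"
begin

definition lev :: "nat \<Rightarrow> nat" where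
  "lev j = (GREATEST k. m k \<le> j)"

lemma lev: "m 0 \<le> j \<Longrightarrow> m (lev j) \<le> j" "m k \<le> j \<Longrightarrow> k \<le> lev j"
proof -
  have b: "\<forall>k. m k \<le> j \<longrightarrow> k \<le> j" using strict_mono_imp_increasing[OF m] order_trans by blast
  show "m 0 \<le> j \<Longrightarrow> m (lev j) \<le> j"
    unfolding lev_def by (rule GreatestI_nat[where P = "\<lambda>k. m k \<le> j" and b = j and k = 0]) (use b in auto)
  show "m k \<le> j \<Longrightarrow> k \<le> lev j"
    unfolding lev_def by (rule Greatest_le_nat[where P = "\<lambda>k. m k \<le> j" and b = j]) (use b in auto)
qed

lemma n_ge: "k \<le> n k" using strict_mono_imp_increasing[OF n] .

text \<open>A limit sequence has values at all levels, the ladder only has rungs at the levels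
  \<open>m k\<close>. So the value at \<open>j\<close> is computed on the last rung not above
  \<open>j\<close> and pushed on by the system map; the zeros before the first rung do not affect
  classes modulo null sequences.\<close>

definition T :: "(nat \<Rightarrow> complex mat) \<Rightarrow> nat \<Rightarrow> complex mat" where
  "T x j = (if m 0 \<le> j then lmap N' \<alpha>' (m (lev j)) j (\<pi> (lev j) (x (n (lev j)))) else 0\<^sub>m (ndim (N' j)) (ndim (N' j)))"

lemma hom_lev: "m 0 \<le> j \<Longrightarrow> star_hom (ndim (N (n (lev j)))) (ndim (N' j)) (\<lambda>a. lmap N' \<alpha>' (m (lev j)) j (\<pi> (lev j) a))"
  by (rule star_hom_comp[OF \<pi> B.lmap_hom]) (rule lev)

lemma T_carrier: "(\<And>j. x j \<in> full_alg (N j)) \<Longrightarrow> T x j \<in> full_alg (N' j)"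
  using star_homD(1)[OF hom_lev] by (simp add: T_def)

lemma T_ops:
  assumes x: "\<And>j. x j \<in> full_alg (N j)" and y: "\<And>j. y j \<in> full_alg (N j)"
  shows "T (\<lambda>j. x j + y j) j = T x j + T y j" "T (\<lambda>j. x j - y j) j = T x j - T y j"
    "T (\<lambda>j. x j * y j) j = T x j * T y j" "T (\<lambda>j. c \<cdot>\<^sub>m x j) j = c \<cdot>\<^sub>m T x j"
    "T (\<lambda>j. mat_adjoint (x j)) j = mat_adjoint (T x j)"
proof -
  have z: "0\<^sub>m d d + 0\<^sub>m d d = (0\<^sub>m d d :: complex mat)" "0\<^sub>m d d - 0\<^sub>m d d = (0\<^sub>m d d :: complex mat)"
    "0\<^sub>m d d * 0\<^sub>m d d = (0\<^sub>m d d :: complex mat)" "c \<cdot>\<^sub>m 0\<^sub>m d d = (0\<^sub>m d d :: complex mat)"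
    "mat_adjoint (0\<^sub>m d d) = (0\<^sub>m d d :: complex mat)" for d
    by (rule eq_matI; simp add: mat_adjoint_def mat_of_rows_def)+
  show "T (\<lambda>j. x j + y j) j = T x j + T y j" "T (\<lambda>j. x j - y j) j = T x j - T y j"
    "T (\<lambda>j. x j * y j) j = T x j * T y j" "T (\<lambda>j. c \<cdot>\<^sub>m x j) j = c \<cdot>\<^sub>m T x j"
    "T (\<lambda>j. mat_adjoint (x j)) j = mat_adjoint (T x j)"
    using x[of "n (lev j)"] y[of "n (lev j)"]
    by (auto simp: T_def z star_homD[OF hom_lev] star_hom_minus[OF hom_lev])
qed

lemma T_norm:
  assumes x: "\<And>j. x j \<in> full_alg (N j)" and j: "m 0 \<le> j"
  shows "opnorm (T x j) \<le> opnorm (x (n (lev j)))"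
  using opnorm_star_hom[OF hom_lev[OF j] x] j by (simp add: T_def)

lemma steps:
  assumes "i \<le> k" and a: "a \<in> full_alg (N (n i))"
  shows "\<pi> k (lmap N \<alpha> (n i) (n k) a) = lmap N' \<alpha>' (m i) (m k) (\<pi> i a)"
  using assms(1)
proof (induction k rule: dec_induct)
  case base
  then show ?case by simp
next
  case (step k)
  have le: "n i \<le> n k" "n k \<le> n (Suc k)" "m i \<le> m k" "m k \<le> m (Suc k)"
    using n m step(1) by (simp_all add: strict_mono_less_eq)
  have "\<pi> (Suc k) (lmap N \<alpha> (n i) (n (Suc k)) a) = \<pi> (Suc k) (lmap N \<alpha> (n k) (n (Suc k)) (lmap N \<alpha> (n i) (n k) a))"
    using le by (simp add: A.lmap_trans)
  also have "\<dots> = lmap N' \<alpha>' (m k) (m (Suc k)) (\<pi> k (lmap N \<alpha> (n i) (n k) a))"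
    using A.lmap_carrier[OF le(1) a] by (rule sysmor.step[OF sysmor_axioms])
  also have "\<dots> = lmap N' \<alpha>' (m i) (m (Suc k)) (\<pi> i a)" using step.IH le by (simp add: B.lmap_trans)
  finally show ?case .
qed

lemma T_thread:
  assumes a: "a \<in> full_alg (N (n i))" and j: "m i \<le> j"
  shows "T (thread N \<alpha> (n i) a) j = thread N' \<alpha>' (m i) (\<pi> i a) j"
proof -
  have m0: "m 0 \<le> j" using j m by (meson le0 order_trans strict_mono_less_eq)
  have i: "i \<le> lev j" using lev(2)[OF j] .
  then have le: "n i \<le> n (lev j)" "m i \<le> m (lev j)" using n m by (simp_all add: strict_mono_less_eq)
  have "T (thread N \<alpha> (n i) a) j = lmap N' \<alpha>' (m (lev j)) j (\<pi> (lev j) (lmap N \<alpha> (n i) (n (lev j)) a))"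
    using m0 le by (simp add: T_def A.thread_eq)
  also have "\<dots> = lmap N' \<alpha>' (m (lev j)) j (lmap N' \<alpha>' (m i) (m (lev j)) (\<pi> i a))" using steps[OF i a] by simp
  also have "\<dots> = lmap N' \<alpha>' (m i) j (\<pi> i a)" using le lev(1)[OF m0] by (simp add: B.lmap_trans)
  finally show ?thesis using j by (simp add: B.thread_eq)
qed

lemma lev_tends: "filterlim (\<lambda>j. n (lev j)) at_top sequentially"
  unfolding filterlim_at_top eventually_sequentially
proof (intro allI exI impI)
  fix K j assume "m K \<le> j"
  then show "K \<le> n (lev j)" using lev(2) n_ge order_trans by blast
qed

text \<open>\<open>T\<close> is contractive up to the reindexing by \<open>n (lev j)\<close>, which
  tends to infinity; an approximation of \<open>x\<close> by a thread is thus carried to one of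
  \<open>T x\<close>.\<close>

lemma T_lim:
  assumes x: "x \<in> lim_seqs N \<alpha>"
  shows "T x \<in> lim_seqs N' \<alpha>'"
  unfolding B.lim_seqs_iff
proof (intro conjI allI impI)
  note xc = A.lim_seqsD[OF x]
  fix j show "T x j \<in> full_alg (N' j)" using T_carrier[of x] xc by blast
next
  note xc = A.lim_seqsD[OF x]
  fix \<epsilon> :: real assume "0 < \<epsilon>"
  then obtain k a where a: "a \<in> full_alg (N k)" "\<forall>\<^sub>F j in sequentially. opnorm (x j - thread N \<alpha> k a j) < \<epsilon>"
    using x unfolding A.lim_seqs_iff by blast
  let ?a = "lmap N \<alpha> k (n k) a"
  have ac: "?a \<in> full_alg (N (n k))" using A.lmap_carrier[OF n_ge a(1)] .
  note tc = A.thread_carrier[OF ac]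
  have "\<forall>\<^sub>F j in sequentially. opnorm (x j - thread N \<alpha> (n k) ?a j) < \<epsilon>"
    using a(2) eventually_ge_at_top[of "n k"] by eventually_elim (simp add: A.thread_shift[OF n_ge])
  then have "\<forall>\<^sub>F j in sequentially. opnorm (x (n (lev j)) - thread N \<alpha> (n k) ?a (n (lev j))) < \<epsilon>"
    using lev_tends by (rule eventually_compose_filterlim)
  then have "\<forall>\<^sub>F j in sequentially. opnorm (T x j - thread N' \<alpha>' (m k) (\<pi> k ?a) j) < \<epsilon>"
    using eventually_ge_at_top[of "m k"]
  proof eventually_elim
    case (elim j)
    have m0: "m 0 \<le> j" using elim m by (meson le0 order_trans strict_mono_less_eq)
    have "T x j - thread N' \<alpha>' (m k) (\<pi> k ?a) j = T (\<lambda>j. x j - thread N \<alpha> (n k) ?a j) j"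
      using T_ops(2)[of x "thread N \<alpha> (n k) ?a"] xc tc T_thread[OF ac elim(2)] by simp
    then show ?case
      using T_norm[OF _ m0, of "\<lambda>j. x j - thread N \<alpha> (n k) ?a j"] minus_carrier_mat[OF tc] elim(1) by simp
  qed
  then show "\<exists>k. \<exists>a\<in>full_alg (N' k). \<forall>\<^sub>F j in sequentially. opnorm (T x j - thread N' \<alpha>' k a j) < \<epsilon>"
    using star_homD(1)[OF \<pi> ac] by blast
qed

lemma T_null:
  assumes "(x, y) \<in> null_rel N \<alpha>"
  shows "(T x, T y) \<in> null_rel N' \<alpha>'"
proof -
  have c: "x \<in> lim_seqs N \<alpha>" "y \<in> lim_seqs N \<alpha>" and l: "(\<lambda>j. opnorm (x j - y j)) \<longlonglongrightarrow> 0"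
    using assms by (auto simp: null_rel_def)
  note xc = A.lim_seqsD[OF c(1)] and yc = A.lim_seqsD[OF c(2)]
  have l': "(\<lambda>j. opnorm (x (n (lev j)) - y (n (lev j)))) \<longlonglongrightarrow> 0"
    using l lev_tends by (rule filterlim_compose)
  show ?thesis
  proof (rule B.null_relI[OF T_lim[OF c(1)] T_lim[OF c(2)] l'])
    show "\<forall>\<^sub>F j in sequentially. opnorm (T x j - T y j) \<le> opnorm (x (n (lev j)) - y (n (lev j)))"
      using eventually_ge_at_top[of "m 0"]
    proof eventually_elim
      case (elim j)
      show ?case
        using T_norm[OF _ elim, of "\<lambda>j. x j - y j"] minus_carrier_mat[OF yc] T_ops(2)[of x y j] xc yc by simp
    qed
  qed
qed

definition limmap :: "(nat \<Rightarrow> complex mat) set \<Rightarrow> (nat \<Rightarrow> complex mat) set" where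
  "limmap X = lcls N' \<alpha>' (T (SOME x. x \<in> X))"

lemma limmap_lcls:
  assumes x: "x \<in> lim_seqs N \<alpha>"
  shows "limmap (lcls N \<alpha> x) = lcls N' \<alpha>' (T x)"
proof -
  have "(SOME y. y \<in> lcls N \<alpha> x) \<in> lcls N \<alpha> x" 
    using someI[of "\<lambda>y. y \<in> lcls N \<alpha> x" x] A.in_lcls_self[OF x] by blast
  then have "(x, SOME y. y \<in> lcls N \<alpha> x) \<in> null_rel N \<alpha>" by (rule A.in_lclsD(1))
  then have "(T x, T (SOME y. y \<in> lcls N \<alpha> x)) \<in> null_rel N' \<alpha>'" by (rule T_null)
  moreover from this have "T (SOME y. y \<in> lcls N \<alpha> x) \<in> lim_seqs N' \<alpha>'" by (simp add: null_rel_def)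
  ultimately show ?thesis unfolding limmap_def using B.lcls_eq_iff T_lim[OF x] by blast
qed

lemma limmap_lin:
  assumes a: "a \<in> full_alg (N (n i))"
  shows "limmap (lin N \<alpha> (n i) a) = lin N' \<alpha>' (m i) (\<pi> i a)"
proof -
  note t = A.thread_lim[OF a] and t' = B.thread_lim[OF star_homD(1)[OF \<pi> a]]
  have "(T (thread N \<alpha> (n i) a), thread N' \<alpha>' (m i) (\<pi> i a)) \<in> null_rel N' \<alpha>'"
    by (rule B.null_rel_eventually_eq[OF T_lim[OF t] t']) (use T_thread[OF a] in \<open>auto simp: eventually_sequentially\<close>)
  then show ?thesis unfolding lin_def limmap_lcls[OF t] using B.lcls_eq_iff[OF T_lim[OF t] t'] by blast
qed

lemma limmap_ops:
  assumes "X \<in> acarrier (cstar_limit N \<alpha>)" "Y \<in> acarrier (cstar_limit N \<alpha>)"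
  shows "limmap X \<in> acarrier (cstar_limit N' \<alpha>')"
    "limmap (aadd (cstar_limit N \<alpha>) X Y) = aadd (cstar_limit N' \<alpha>') (limmap X) (limmap Y)"
    "limmap (amult (cstar_limit N \<alpha>) X Y) = amult (cstar_limit N' \<alpha>') (limmap X) (limmap Y)"
    "limmap (ascale (cstar_limit N \<alpha>) c X) = ascale (cstar_limit N' \<alpha>') c (limmap X)"
    "limmap (astar (cstar_limit N \<alpha>) X) = astar (cstar_limit N' \<alpha>') (limmap X)"
proof -
  obtain x where x: "x \<in> lim_seqs N \<alpha>" "X = lcls N \<alpha> x" using assms(1) unfolding A.cstar_carrier by blast
  obtain y where y: "y \<in> lim_seqs N \<alpha>" "Y = lcls N \<alpha> y" using assms(2) unfolding A.cstar_carrier by blast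
  note xc = A.lim_seqsD[OF x(1)] and yc = A.lim_seqsD[OF y(1)]
  note t = T_ops[of x y, OF xc yc, abs_def]
  have t': "T (\<lambda>j. x j + y j) = (\<lambda>j. T x j + T y j)" "T (\<lambda>j. x j * y j) = (\<lambda>j. T x j * T y j)"
    "T (\<lambda>j. c \<cdot>\<^sub>m x j) = (\<lambda>j. c \<cdot>\<^sub>m T x j)" "T (\<lambda>j. mat_adjoint (x j)) = (\<lambda>j. mat_adjoint (T x j))"
    using T_ops[of x y, OF xc yc] by (simp_all add: fun_eq_iff)
  note L = limmap_lcls A.lcls_ops[OF x(1) y(1)] B.lcls_ops[OF T_lim[OF x(1)] T_lim[OF y(1)]]
  show "limmap X \<in> acarrier (cstar_limit N' \<alpha>')" using x T_lim[OF x(1)] by (simp add: limmap_lcls B.cstar_carrier)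
  show "limmap (aadd (cstar_limit N \<alpha>) X Y) = aadd (cstar_limit N' \<alpha>') (limmap X) (limmap Y)"
    "limmap (amult (cstar_limit N \<alpha>) X Y) = amult (cstar_limit N' \<alpha>') (limmap X) (limmap Y)"
    "limmap (ascale (cstar_limit N \<alpha>) c X) = ascale (cstar_limit N' \<alpha>') c (limmap X)"
    "limmap (astar (cstar_limit N \<alpha>) X) = astar (cstar_limit N' \<alpha>') (limmap X)"
    using A.lim_add[OF x(1) y(1)] A.lim_mult[OF x(1) y(1)] A.lim_smult[OF x(1)] A.lim_adjoint[OF x(1)] x y
    by (simp_all add: L t')
qed

end

text \<open>A density argument: the composition fixes threads up to null sequences, limit sequences
  are approximated by threads, and both maps are contractive after reindexing. Three errors of size
  \<open>r / 3\<close> remain.\<close>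

lemma inverse_on_threads:
  assumes 1: "sysmor N \<alpha> N' \<alpha>' n m \<pi>" and 2: "sysmor N' \<alpha>' N \<alpha> n' m' \<rho>"
    and thr: "\<And>k a. a \<in> full_alg (N k) \<Longrightarrow>
      sysmor.limmap N \<alpha> n' m' \<rho> (sysmor.limmap N' \<alpha>' n m \<pi> (lin N \<alpha> k a)) = lin N \<alpha> k a"
    and X: "X \<in> acarrier (cstar_limit N \<alpha>)"
  shows "sysmor.limmap N \<alpha> n' m' \<rho> (sysmor.limmap N' \<alpha>' n m \<pi> X) = X"
proof -
  interpret F: sysmor N \<alpha> N' \<alpha>' n m \<pi> by (rule 1)
  interpret G: sysmor N' \<alpha>' N \<alpha> n' m' \<rho> by (rule 2)
  obtain x where x: "x \<in> lim_seqs N \<alpha>" "X = lcls N \<alpha> x" using X unfolding F.A.cstar_carrier by blast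
  note xc = F.A.lim_seqsD[OF x(1)]
  have e: "G.limmap (F.limmap (lcls N \<alpha> y)) = lcls N \<alpha> (G.T (F.T y))" if "y \<in> lim_seqs N \<alpha>" for y
    using that F.T_lim by (simp add: F.limmap_lcls G.limmap_lcls)
  have S: "G.T (F.T x) \<in> lim_seqs N \<alpha>" using F.T_lim G.T_lim x(1) by blast
  note Sc = F.A.lim_seqsD[OF S]
  have "(\<lambda>j. opnorm (G.T (F.T x) j - x j)) \<longlonglongrightarrow> 0"
  proof (rule LIMSEQ_I)
    fix r :: real assume "0 < r"
    then have r: "0 < r / 3" by simp
    obtain k a where a: "a \<in> full_alg (N k)" "\<forall>\<^sub>F j in sequentially. opnorm (x j - thread N \<alpha> k a j) < r / 3"
      using x(1) r unfolding F.A.lim_seqs_iff by blast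
    let ?t = "thread N \<alpha> k a"
    note t = F.A.thread_lim[OF a(1)] and tc = F.A.thread_carrier[OF a(1)]
    have St: "G.T (F.T ?t) \<in> lim_seqs N \<alpha>" using F.T_lim G.T_lim t by blast
    note Stc = F.A.lim_seqsD[OF St]
    have "lcls N \<alpha> (G.T (F.T ?t)) = lcls N \<alpha> ?t" using thr[OF a(1)] e[OF t] by (simp add: lin_def)
    then have "(G.T (F.T ?t), ?t) \<in> null_rel N \<alpha>" using F.A.lcls_eq_iff[OF St t] by blast
    then have "(\<lambda>j. opnorm (G.T (F.T ?t) j - ?t j)) \<longlonglongrightarrow> 0" by (simp add: null_rel_def)
    then have c1: "\<forall>\<^sub>F j in sequentially. opnorm (G.T (F.T ?t) j - ?t j) < r / 3"
      using r by (rule order_tendstoD(2))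
    \<comment> \<open>The value of the composition at level \<open>j\<close> depends on
      \<open>x\<close> at this index, which still tends to infinity.\<close>
    have "filterlim (\<lambda>j. n (F.lev (n' (G.lev j)))) at_top sequentially"
      by (rule filterlim_compose[OF F.lev_tends G.lev_tends])
    then have c2: "\<forall>\<^sub>F j in sequentially. opnorm (x (n (F.lev (n' (G.lev j)))) - ?t (n (F.lev (n' (G.lev j))))) < r / 3"
      by (rule eventually_compose_filterlim[OF a(2)])
    have c3: "\<forall>\<^sub>F j in sequentially. m 0 \<le> n' (G.lev j)"
      using G.lev_tends by (simp add: filterlim_at_top)
    have "\<forall>\<^sub>F j in sequentially. opnorm (G.T (F.T x) j - x j) < r"
      using c1 c2 c3 a(2) eventually_ge_at_top[of "m' 0"]
    proof eventually_elim
      case (elim j)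
      let ?d = "\<lambda>j. x j - ?t j"
      have dc: "?d j \<in> full_alg (N j)" for j by (rule minus_carrier_mat[OF tc])
      have Fd: "F.T ?d = (\<lambda>j. F.T x j - F.T ?t j)" using F.T_ops(2)[of x ?t] xc tc by (simp add: fun_eq_iff)
      have Fc: "F.T x j \<in> full_alg (N' j)" "F.T ?t j \<in> full_alg (N' j)" "F.T ?d j \<in> full_alg (N' j)" for j
        by (rule F.T_carrier, rule xc tc dc)+
      have "G.T (F.T x) j - G.T (F.T ?t) j = G.T (F.T ?d) j"
        unfolding Fd using G.T_ops(2)[of "F.T x" "F.T ?t"] Fc by simp
      then have "opnorm (G.T (F.T x) j - G.T (F.T ?t) j) \<le> opnorm (F.T ?d (n' (G.lev j)))"
        using G.T_norm[of "F.T ?d" j] Fc elim by simp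
      also have "\<dots> \<le> opnorm (?d (n (F.lev (n' (G.lev j)))))" by (rule F.T_norm[OF dc elim(3)])
      finally have b1: "opnorm (G.T (F.T x) j - G.T (F.T ?t) j) < r / 3" using elim by simp
      have b3: "opnorm (?t j - x j) < r / 3" using elim opnorm_minus_commute[OF xc tc, of j] by simp
      have "opnorm (G.T (F.T x) j - x j) \<le> opnorm (G.T (F.T x) j - G.T (F.T ?t) j) + opnorm (G.T (F.T ?t) j - x j)"
        by (rule opnorm_triangle[OF Sc Stc xc])
      also have "opnorm (G.T (F.T ?t) j - x j) \<le> opnorm (G.T (F.T ?t) j - ?t j) + opnorm (?t j - x j)"
        by (rule opnorm_triangle[OF Stc tc xc])
      finally show ?case using b1 b3 elim by simp
    qed
    then obtain j0 where "\<And>j. j0 \<le> j \<Longrightarrow> opnorm (G.T (F.T x) j - x j) < r" by (auto simp: eventually_sequentially)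
    then show "\<exists>no. \<forall>j\<ge>no. norm (opnorm (G.T (F.T x) j - x j) - 0) < r"
      using opnorm_nonneg[OF minus_carrier_mat[OF xc]] by (intro exI[of _ j0]) auto
  qed
  then have "(G.T (F.T x), x) \<in> null_rel N \<alpha>" using S x(1) by (simp add: null_rel_def)
  then show ?thesis using e[OF x(1)] F.A.lcls_eq_iff[OF S x(1)] x(2) by simp
qed

section \<open>Isomorphisms of limits\<close>

lemma star_hom_eq_full:
  assumes nd: "nest_data N" and h: "star_hom (ndim N) e \<pi>" "star_hom (ndim N) e \<rho>"
    and eq: "\<And>a. a \<in> nest_alg N \<Longrightarrow> \<pi> a = \<rho> a" and a: "a \<in> full_alg N"
  shows "\<pi> a = \<rho> a"
proof -
  obtain b c where bc: "b \<in> nest_alg N" "c \<in> nest_alg N" "a = b + mat_adjoint c" using full_alg_split[OF nd a] .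
  note f = nest_alg_full[OF bc(1)] nest_alg_full[OF bc(2)]
  show ?thesis
    using f eq[OF bc(1)] eq[OF bc(2)] star_homD(2,5)[OF h(1)] star_homD(2,5)[OF h(2)] by (simp add: bc(3))
qed

context dsys
begin

lemma incl_carrier: "X \<in> acarrier (limit_alg N \<alpha>) \<Longrightarrow> limit_incl N \<alpha> X \<in> acarrier (cstar_limit N \<alpha>)"
  by (auto simp: limit_carrier limit_incl_germ intro!: lin_carrier nest_alg_full)

lemma incl_inj: "inj_on (limit_incl N \<alpha>) (acarrier (limit_alg N \<alpha>))"
proof (rule inj_onI)
  fix X Y assume XY: "X \<in> acarrier (limit_alg N \<alpha>)" "Y \<in> acarrier (limit_alg N \<alpha>)" "limit_incl N \<alpha> X = limit_incl N \<alpha> Y"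
  obtain k a where a: "a \<in> nest_alg (N k)" "X = germ N \<alpha> k a" using XY(1) unfolding limit_carrier by blast
  obtain l b where b: "b \<in> nest_alg (N l)" "Y = germ N \<alpha> l b" using XY(2) unfolding limit_carrier by blast
  have "lin N \<alpha> k a = lin N \<alpha> l b" using XY(3) limit_incl_germ[OF a(1)] limit_incl_germ[OF b(1)] a(2) b(2) by simp
  then show "X = Y" using germ_eq_iff[OF a(1) b(1)] a(2) b(2) by simp
qed

lemma limit_alg_closed:
  assumes "X \<in> acarrier (limit_alg N \<alpha>)" "Y \<in> acarrier (limit_alg N \<alpha>)"
  shows "aadd (limit_alg N \<alpha>) X Y \<in> acarrier (limit_alg N \<alpha>)"
    "amult (limit_alg N \<alpha>) X Y \<in> acarrier (limit_alg N \<alpha>)"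
    "ascale (limit_alg N \<alpha>) c X \<in> acarrier (limit_alg N \<alpha>)"
    "limit_incl N \<alpha> (aadd (limit_alg N \<alpha>) X Y) = aadd (cstar_limit N \<alpha>) (limit_incl N \<alpha> X) (limit_incl N \<alpha> Y)"
    "limit_incl N \<alpha> (amult (limit_alg N \<alpha>) X Y) = amult (cstar_limit N \<alpha>) (limit_incl N \<alpha> X) (limit_incl N \<alpha> Y)"
    "limit_incl N \<alpha> (ascale (limit_alg N \<alpha>) c X) = ascale (cstar_limit N \<alpha>) c (limit_incl N \<alpha> X)"
proof -
  obtain k a b where ab: "a \<in> nest_alg (N k)" "b \<in> nest_alg (N k)" "X = germ N \<alpha> k a" "Y = germ N \<alpha> k b"
    using common_level[OF assms] .
  note cl = nest_alg_closed[OF nd ab(1,2)]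
  note f = nest_alg_full[OF ab(1)] nest_alg_full[OF ab(2)]
  note ops = germ_ops[OF ab(1,2)]
  show "aadd (limit_alg N \<alpha>) X Y \<in> acarrier (limit_alg N \<alpha>)"
    "amult (limit_alg N \<alpha>) X Y \<in> acarrier (limit_alg N \<alpha>)"
    "ascale (limit_alg N \<alpha>) c X \<in> acarrier (limit_alg N \<alpha>)"
    unfolding ab(3,4) ops limit_carrier using cl by blast+
  show "limit_incl N \<alpha> (aadd (limit_alg N \<alpha>) X Y) = aadd (cstar_limit N \<alpha>) (limit_incl N \<alpha> X) (limit_incl N \<alpha> Y)"
    "limit_incl N \<alpha> (amult (limit_alg N \<alpha>) X Y) = amult (cstar_limit N \<alpha>) (limit_incl N \<alpha> X) (limit_incl N \<alpha> Y)"
    "limit_incl N \<alpha> (ascale (limit_alg N \<alpha>) c X) = ascale (cstar_limit N \<alpha>) c (limit_incl N \<alpha> X)"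
    unfolding ab(3,4) ops using ab cl by (simp_all add: limit_incl_germ lin_ops[OF f])
qed

end

text \<open>The isomorphism of the algebraic limits is \<Psi> restricted to their images, pulled
  back along the injective inclusions; \<open>fwd\<close> and \<open>bwd\<close> say that these
  images correspond.\<close>

lemma star_ext_isoI:
  assumes d: "dsys N \<alpha>" "dsys N' \<alpha>'" and \<Psi>: "star_alg_iso (cstar_limit N \<alpha>) (cstar_limit N' \<alpha>') \<Psi>"
    and fwd: "\<And>X. X \<in> acarrier (limit_alg N \<alpha>) \<Longrightarrow> \<exists>Y\<in>acarrier (limit_alg N' \<alpha>'). limit_incl N' \<alpha>' Y = \<Psi> (limit_incl N \<alpha> X)"
    and bwd: "\<And>Y. Y \<in> acarrier (limit_alg N' \<alpha>') \<Longrightarrow> \<exists>X\<in>acarrier (limit_alg N \<alpha>). limit_incl N' \<alpha>' Y = \<Psi> (limit_incl N \<alpha> X)"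
  shows "\<exists>\<Phi>. star_ext_iso N \<alpha> N' \<alpha>' \<Phi>"
proof -
  interpret A: dsys N \<alpha> by (rule d(1))
  interpret B: dsys N' \<alpha>' by (rule d(2))
  let ?A = "acarrier (limit_alg N \<alpha>)" and ?B = "acarrier (limit_alg N' \<alpha>')"
  define \<Phi> where "\<Phi> = (\<lambda>X. SOME Y. Y \<in> ?B \<and> limit_incl N' \<alpha>' Y = \<Psi> (limit_incl N \<alpha> X))"
  have \<Phi>: "\<Phi> X \<in> ?B \<and> limit_incl N' \<alpha>' (\<Phi> X) = \<Psi> (limit_incl N \<alpha> X)" if "X \<in> ?A" for X
    unfolding \<Phi>_def by (rule someI_ex) (use fwd[OF that] in blast)
  have unique: "\<Phi> X = Y" if "X \<in> ?A" "Y \<in> ?B" "limit_incl N' \<alpha>' Y = \<Psi> (limit_incl N \<alpha> X)" for X Y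
    using \<Phi>[OF that(1)] that(2,3) B.incl_inj by (metis inj_on_def)
  have P: "\<Psi> (aadd (cstar_limit N \<alpha>) x y) = aadd (cstar_limit N' \<alpha>') (\<Psi> x) (\<Psi> y)"
    "\<Psi> (amult (cstar_limit N \<alpha>) x y) = amult (cstar_limit N' \<alpha>') (\<Psi> x) (\<Psi> y)"
    "\<Psi> (ascale (cstar_limit N \<alpha>) c x) = ascale (cstar_limit N' \<alpha>') c (\<Psi> x)"
    if "x \<in> acarrier (cstar_limit N \<alpha>)" "y \<in> acarrier (cstar_limit N \<alpha>)" for x y c
    using \<Psi> that by (auto simp: star_alg_iso_def alg_iso_def)
  have Pinj: "inj_on \<Psi> (acarrier (cstar_limit N \<alpha>))" using \<Psi> by (auto simp: star_alg_iso_def alg_iso_def bij_betw_def)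
  have "bij_betw \<Phi> ?A ?B"
    unfolding bij_betw_def
  proof
    show "inj_on \<Phi> ?A"
    proof (rule inj_onI)
      fix X Y assume XY: "X \<in> ?A" "Y \<in> ?A" "\<Phi> X = \<Phi> Y"
      then have "\<Psi> (limit_incl N \<alpha> X) = \<Psi> (limit_incl N \<alpha> Y)" using \<Phi> by metis
      then have "limit_incl N \<alpha> X = limit_incl N \<alpha> Y" using Pinj A.incl_carrier XY by (metis inj_on_def)
      then show "X = Y" using A.incl_inj XY by (metis inj_on_def)
    qed
    show "\<Phi> ` ?A = ?B"
    proof
      show "\<Phi> ` ?A \<subseteq> ?B" using \<Phi> by blast
      show "?B \<subseteq> \<Phi> ` ?A"
      proof
        fix Y assume Y: "Y \<in> ?B"
        then obtain X where X: "X \<in> ?A" "limit_incl N' \<alpha>' Y = \<Psi> (limit_incl N \<alpha> X)" using bwd by blast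
        then have "\<Phi> X = Y" using unique Y by blast
        then show "Y \<in> \<Phi> ` ?A" using X by blast
      qed
    qed
  qed
  moreover have "\<Phi> (aadd (limit_alg N \<alpha>) X Y) = aadd (limit_alg N' \<alpha>') (\<Phi> X) (\<Phi> Y)"
    "\<Phi> (amult (limit_alg N \<alpha>) X Y) = amult (limit_alg N' \<alpha>') (\<Phi> X) (\<Phi> Y)"
    "\<Phi> (ascale (limit_alg N \<alpha>) c X) = ascale (limit_alg N' \<alpha>') c (\<Phi> X)"
    if XY: "X \<in> ?A" "Y \<in> ?A" for X Y c
  proof -
    have \<Phi>': "\<Phi> X \<in> ?B" "\<Phi> Y \<in> ?B" using \<Phi> XY by blast+
    have e: "limit_incl N' \<alpha>' (\<Phi> X) = \<Psi> (limit_incl N \<alpha> X)" "limit_incl N' \<alpha>' (\<Phi> Y) = \<Psi> (limit_incl N \<alpha> Y)"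
      using \<Phi> XY by blast+
    note a = A.limit_alg_closed[OF XY] and b = B.limit_alg_closed[OF \<Phi>'] and ic = A.incl_carrier[OF XY(1)] A.incl_carrier[OF XY(2)]
    show "\<Phi> (aadd (limit_alg N \<alpha>) X Y) = aadd (limit_alg N' \<alpha>') (\<Phi> X) (\<Phi> Y)"
      by (rule unique[OF a(1) b(1)]) (simp add: a b e P ic)
    show "\<Phi> (amult (limit_alg N \<alpha>) X Y) = amult (limit_alg N' \<alpha>') (\<Phi> X) (\<Phi> Y)"
      by (rule unique[OF a(2) b(2)]) (simp add: a b e P ic)
    show "\<Phi> (ascale (limit_alg N \<alpha>) c X) = ascale (limit_alg N' \<alpha>') c (\<Phi> X)"
      by (rule unique[OF a(3) b(3)]) (simp add: a b e P(3)[OF ic])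
  qed
  ultimately have "alg_iso (limit_alg N \<alpha>) (limit_alg N' \<alpha>') \<Phi>" unfolding alg_iso_def by blast
  then have "star_ext_iso N \<alpha> N' \<alpha>' \<Phi>" unfolding star_ext_iso_def using \<Psi> \<Phi> by metis
  then show ?thesis by blast
qed

text \<open>The triangles commute on the nest algebras and hence on the full algebras, which these
  span together with their adjoints. The two ladders then give mutually inverse star isomorphisms of
  the C*-limits that match the algebraic limits.\<close>

lemma regular_system_iso_imp_star_ext_iso:
  assumes d: "dsys N \<alpha>" "dsys N' \<alpha>'" and iso: "regular_system_iso N \<alpha> N' \<alpha>' n m \<phi> \<psi>"
  shows "\<exists>\<Phi>. star_ext_iso N \<alpha> N' \<alpha>' \<Phi>"
proof -
  interpret A: dsys N \<alpha> by (rule d(1))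
  interpret B: dsys N' \<alpha>' by (rule d(2))
  have n: "strict_mono n" and m: "strict_mono m" using iso by (auto simp: regular_system_iso_def)
  have em: "star_ext_embedding (N (n k)) (N' (m k)) (\<phi> k)" "star_ext_embedding (N' (m k)) (N (n (Suc k))) (\<psi> k)" for k
    using iso by (auto simp: regular_system_iso_def regular_embedding_def)
  have comp: "a \<in> nest_alg (N (n k)) \<Longrightarrow> \<psi> k (\<phi> k a) = sysmap \<alpha> (n k) (n (Suc k)) a"
    "b \<in> nest_alg (N' (m k)) \<Longrightarrow> \<phi> (Suc k) (\<psi> k b) = sysmap \<alpha>' (m k) (m (Suc k)) b" for k a b
    using iso by (auto simp: regular_system_iso_def)
  obtain \<pi> where \<pi>: "\<And>k. star_extends (N (n k)) (N' (m k)) (\<phi> k) (\<pi> k)" using em(1) unfolding star_ext_embedding_def by metis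
  obtain \<rho> where \<rho>: "\<And>k. star_extends (N' (m k)) (N (n (Suc k))) (\<psi> k) (\<rho> k)" using em(2) unfolding star_ext_embedding_def by metis
  have h: "star_hom (ndim (N (n k))) (ndim (N' (m k))) (\<pi> k)" "star_hom (ndim (N' (m k))) (ndim (N (n (Suc k)))) (\<rho> k)" for k
    using \<pi> \<rho> by (auto simp: star_extends_def)
  have ext: "a \<in> nest_alg (N (n k)) \<Longrightarrow> \<pi> k a = \<phi> k a" "b \<in> nest_alg (N' (m k)) \<Longrightarrow> \<rho> k b = \<psi> k b" for k a b
    using \<pi> \<rho> by (auto simp: star_extends_def)
  have na: "a \<in> nest_alg (N (n k)) \<Longrightarrow> \<phi> k a \<in> nest_alg (N' (m k))" "b \<in> nest_alg (N' (m k)) \<Longrightarrow> \<psi> k b \<in> nest_alg (N (n (Suc k)))" for k a b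
    using em by (auto simp: star_ext_embedding_def)
  have le: "n k \<le> n (Suc k)" "m k \<le> m (Suc k)" for k using n m by (simp_all add: strict_mono_less_eq)
  have rp: "\<rho> k (\<pi> k a) = lmap N \<alpha> (n k) (n (Suc k)) a" if "a \<in> full_alg (N (n k))" for k a
    by (rule star_hom_eq_full[OF A.nd star_hom_comp[OF h(1) h(2)] A.lmap_hom[OF le(1)] _ that])
      (use A.lmap_nest[OF le(1)] in \<open>simp add: ext na comp\<close>)
  have pr: "\<pi> (Suc k) (\<rho> k b) = lmap N' \<alpha>' (m k) (m (Suc k)) b" if "b \<in> full_alg (N' (m k))" for k b
    by (rule star_hom_eq_full[OF B.nd star_hom_comp[OF h(2) h(1)] B.lmap_hom[OF le(2)] _ that])
      (use B.lmap_nest[OF le(2)] in \<open>simp add: ext na comp\<close>)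
  have F: "sysmor N \<alpha> N' \<alpha>' n m \<pi>"
  proof unfold_locales
    fix k a assume a: "a \<in> full_alg (N (n k))"
    show "\<pi> (Suc k) (lmap N \<alpha> (n k) (n (Suc k)) a) = lmap N' \<alpha>' (m k) (m (Suc k)) (\<pi> k a)"
      using rp[OF a] pr[OF star_homD(1)[OF h(1) a]] by simp
  qed (use n m h in auto)
  \<comment> \<open>The rungs of the backward ladder lead from \<open>m k\<close> to
    \<open>n (Suc k)\<close>, so its target indices are shifted by one.\<close>
  have G: "sysmor N' \<alpha>' N \<alpha> m (\<lambda>k. n (Suc k)) \<rho>"
  proof unfold_locales
    show "strict_mono (\<lambda>k. n (Suc k))" using n by (simp add: strict_mono_def)
    fix k b assume b: "b \<in> full_alg (N' (m k))"
    show "\<rho> (Suc k) (lmap N' \<alpha>' (m k) (m (Suc k)) b) = lmap N \<alpha> (n (Suc k)) (n (Suc (Suc k))) (\<rho> k b)"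
      using pr[OF b] rp[OF star_homD(1)[OF h(2) b]] by simp
  qed (use m h in auto)
  interpret F: sysmor N \<alpha> N' \<alpha>' n m \<pi> by (rule F)
  interpret G: sysmor N' \<alpha>' N \<alpha> m "\<lambda>k. n (Suc k)" \<rho> by (rule G)
  have FL: "F.limmap (lin N \<alpha> k a) = lin N' \<alpha>' (m k) (\<pi> k (lmap N \<alpha> k (n k) a))" if a: "a \<in> full_alg (N k)" for k a
    using F.limmap_lin[OF A.lmap_carrier[OF F.n_ge a]] A.lin_shift[OF F.n_ge a] by simp
  have GL: "G.limmap (lin N' \<alpha>' k b) = lin N \<alpha> (n (Suc k)) (\<rho> k (lmap N' \<alpha>' k (m k) b))" if b: "b \<in> full_alg (N' k)" for k b
    using G.limmap_lin[OF B.lmap_carrier[OF G.n_ge b]] B.lin_shift[OF G.n_ge b] by simp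
  have GF: "G.limmap (F.limmap X) = X" if X: "X \<in> acarrier (cstar_limit N \<alpha>)" for X
  proof (rule inverse_on_threads[OF F G _ X])
    fix k a assume a: "a \<in> full_alg (N k)"
    let ?a = "lmap N \<alpha> k (n k) a"
    have ac: "?a \<in> full_alg (N (n k))" using A.lmap_carrier[OF F.n_ge a] .
    have "G.limmap (F.limmap (lin N \<alpha> k a)) = lin N \<alpha> (n (Suc k)) (\<rho> k (\<pi> k ?a))"
      unfolding FL[OF a] by (rule G.limmap_lin[OF star_homD(1)[OF h(1) ac]])
    then show "G.limmap (F.limmap (lin N \<alpha> k a)) = lin N \<alpha> k a"
      using A.lin_shift[OF le(1) ac] A.lin_shift[OF F.n_ge a] rp[OF ac] by simp
  qed
  have FG: "F.limmap (G.limmap Y) = Y" if Y: "Y \<in> acarrier (cstar_limit N' \<alpha>')" for Y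
  proof (rule inverse_on_threads[OF G F _ Y])
    fix k b assume b: "b \<in> full_alg (N' k)"
    let ?b = "lmap N' \<alpha>' k (m k) b"
    have bc: "?b \<in> full_alg (N' (m k))" using B.lmap_carrier[OF G.n_ge b] .
    have "F.limmap (G.limmap (lin N' \<alpha>' k b)) = lin N' \<alpha>' (m (Suc k)) (\<pi> (Suc k) (\<rho> k ?b))"
      unfolding GL[OF b] by (rule F.limmap_lin[OF star_homD(1)[OF h(2) bc]])
    then show "F.limmap (G.limmap (lin N' \<alpha>' k b)) = lin N' \<alpha>' k b"
      using B.lin_shift[OF le(2) bc] B.lin_shift[OF G.n_ge b] pr[OF bc] by simp
  qed
  have "bij_betw F.limmap (acarrier (cstar_limit N \<alpha>)) (acarrier (cstar_limit N' \<alpha>'))"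
    by (rule bij_betw_byWitness[where f' = G.limmap]) (use GF FG F.limmap_ops(1) G.limmap_ops(1) in auto)
  then have iso: "star_alg_iso (cstar_limit N \<alpha>) (cstar_limit N' \<alpha>') F.limmap"
    unfolding star_alg_iso_def alg_iso_def using F.limmap_ops by blast
  show ?thesis
  proof (rule star_ext_isoI[OF d iso])
    fix X assume "X \<in> acarrier (limit_alg N \<alpha>)"
    then obtain k a where a: "a \<in> nest_alg (N k)" "X = germ N \<alpha> k a" unfolding A.limit_carrier by blast
    let ?a = "lmap N \<alpha> k (n k) a"
    have "\<pi> k ?a \<in> nest_alg (N' (m k))" using A.lmap_nest[OF F.n_ge a(1)] by (simp add: ext na)
    then show "\<exists>Y\<in>acarrier (limit_alg N' \<alpha>'). limit_incl N' \<alpha>' Y = F.limmap (limit_incl N \<alpha> X)"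
      unfolding B.limit_carrier a(2) A.limit_incl_germ[OF a(1)] FL[OF nest_alg_full[OF a(1)]]
      using B.limit_incl_germ by blast
  next
    fix Y assume "Y \<in> acarrier (limit_alg N' \<alpha>')"
    then obtain k b where b: "b \<in> nest_alg (N' k)" "Y = germ N' \<alpha>' k b" unfolding B.limit_carrier by blast
    let ?b = "lmap N' \<alpha>' k (m k) b"
    have c: "\<rho> k ?b \<in> nest_alg (N (n (Suc k)))" using B.lmap_nest[OF G.n_ge b(1)] by (simp add: ext na)
    have "F.limmap (lin N \<alpha> (n (Suc k)) (\<rho> k ?b)) = F.limmap (G.limmap (lin N' \<alpha>' k b))"
      using GL[OF nest_alg_full[OF b(1)]] by simp
    also have "\<dots> = lin N' \<alpha>' k b" using FG[OF B.lin_carrier[OF nest_alg_full[OF b(1)]]] .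
    finally have "limit_incl N' \<alpha>' Y = F.limmap (limit_incl N \<alpha> (germ N \<alpha> (n (Suc k)) (\<rho> k ?b)))"
      using A.limit_incl_germ[OF c] B.limit_incl_germ[OF b(1)] b(2) by simp
    then show "\<exists>X\<in>acarrier (limit_alg N \<alpha>). limit_incl N' \<alpha>' Y = F.limmap (limit_incl N \<alpha> X)"
      unfolding A.limit_carrier using c by blast
  qed
qed

section \<open>Restricting a limit isomorphism to finite levels\<close>

locale limiso = A: dsys N \<alpha> + B: dsys N' \<alpha>'
  for N \<alpha> N' \<alpha>' +
  fixes \<Psi>
  assumes iso: "star_alg_iso (cstar_limit N \<alpha>) (cstar_limit N' \<alpha>') \<Psi>"
    and lands: "a \<in> nest_alg (N k) \<Longrightarrow> \<exists>l. \<exists>b\<in>nest_alg (N' l). \<Psi> (lin N \<alpha> k a) = lin N' \<alpha>' l b"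
begin

definition into_level :: "nat \<Rightarrow> nat \<Rightarrow> complex mat \<Rightarrow> bool" where
  "into_level k m a \<longleftrightarrow> (\<exists>b\<in>nest_alg (N' m). \<Psi> (lin N \<alpha> k a) = lin N' \<alpha>' m b)"

lemma \<Psi>_ops:
  assumes "X \<in> acarrier (cstar_limit N \<alpha>)" "Y \<in> acarrier (cstar_limit N \<alpha>)"
  shows "\<Psi> (aadd (cstar_limit N \<alpha>) X Y) = aadd (cstar_limit N' \<alpha>') (\<Psi> X) (\<Psi> Y)"
    "\<Psi> (amult (cstar_limit N \<alpha>) X Y) = amult (cstar_limit N' \<alpha>') (\<Psi> X) (\<Psi> Y)"
    "\<Psi> (ascale (cstar_limit N \<alpha>) c X) = ascale (cstar_limit N' \<alpha>') c (\<Psi> X)"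
    "\<Psi> (astar (cstar_limit N \<alpha>) X) = astar (cstar_limit N' \<alpha>') (\<Psi> X)"
  using iso assms by (auto simp: star_alg_iso_def alg_iso_def)

lemma \<Psi>_inj: "inj_on \<Psi> (acarrier (cstar_limit N \<alpha>))"
  using iso by (auto simp: star_alg_iso_def alg_iso_def bij_betw_def)

lemma \<Psi>_lin:
  assumes "a \<in> full_alg (N k)" "b \<in> full_alg (N k)" "a' \<in> full_alg (N' m)" "b' \<in> full_alg (N' m)"
    and "\<Psi> (lin N \<alpha> k a) = lin N' \<alpha>' m a'" "\<Psi> (lin N \<alpha> k b) = lin N' \<alpha>' m b'"
  shows "\<Psi> (lin N \<alpha> k (a + b)) = lin N' \<alpha>' m (a' + b')"
    "\<Psi> (lin N \<alpha> k (a * b)) = lin N' \<alpha>' m (a' * b')"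
    "\<Psi> (lin N \<alpha> k (c \<cdot>\<^sub>m a)) = lin N' \<alpha>' m (c \<cdot>\<^sub>m a')"
    "\<Psi> (lin N \<alpha> k (mat_adjoint a)) = lin N' \<alpha>' m (mat_adjoint a')"
  using \<Psi>_ops[OF A.lin_carrier[OF assms(1)] A.lin_carrier[OF assms(2)]] A.lin_ops[OF assms(1,2)]
    B.lin_ops[OF assms(3,4)] assms(5,6) by simp_all

lemma into_level_mono:
  assumes "into_level k m a" "m \<le> m'"
  shows "into_level k m' a"
proof -
  obtain b where b: "b \<in> nest_alg (N' m)" "\<Psi> (lin N \<alpha> k a) = lin N' \<alpha>' m b" using assms by (auto simp: into_level_def)
  have "\<Psi> (lin N \<alpha> k a) = lin N' \<alpha>' m' (lmap N' \<alpha>' m m' b)" using B.lin_shift[OF assms(2) nest_alg_full[OF b(1)]] b by simp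
  moreover have "lmap N' \<alpha>' m m' b \<in> nest_alg (N' m')" using B.lmap_nest[OF assms(2) b(1)] by simp
  ultimately show ?thesis by (auto simp: into_level_def)
qed

lemma into_level_add:
  "a \<in> nest_alg (N k) \<Longrightarrow> b \<in> nest_alg (N k) \<Longrightarrow> into_level k m a \<Longrightarrow> into_level k m b \<Longrightarrow> into_level k m (a + b)"
  unfolding into_level_def using \<Psi>_lin(1) nest_alg_closed(1)[OF B.nd] nest_alg_full by meson

lemma into_level_smult:
  "a \<in> nest_alg (N k) \<Longrightarrow> into_level k m a \<Longrightarrow> into_level k m (c \<cdot>\<^sub>m a)"
  unfolding into_level_def using \<Psi>_lin(3) nest_alg_closed(3)[OF B.nd] nest_alg_full by meson

text \<open>The nest algebra has a finite spanning set, so it is mapped into a single level.\<close>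

lemma level_exists: "\<exists>m0. \<forall>m\<ge>m0. \<forall>a\<in>nest_alg (N k). into_level k m a"
proof -
  let ?d = "ndim (N k)" and ?l = "natoms (N k)"
  \<comment> \<open>The blocks of matrix units on and above the diagonal span the nest algebra;
    index pairs below the diagonal are filled with 0.\<close>
  define g where "g = (\<lambda>(i, j, p, q). if i \<le> j then blk (N k) (munit p q) i j else 0)"
  let ?S = "{..<?l} \<times> {..<?l} \<times> {..<?d} \<times> {..<?d}"
  have gt: "g s \<in> tri (N k)" if "s \<in> ?S" for s
    using that by (auto simp: g_def tri_zero blk_tri[OF A.nd])
  have "\<exists>m. into_level k m (mat_of ?d (g s))" if "s \<in> ?S" for s
    using lands[of "mat_of ?d (g s)" k] gt[OF that] tri_corner[OF gt[OF that]]
    by (auto simp: into_level_def nest_alg_iff[OF A.nd])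
  then obtain lv where lv: "\<And>s. s \<in> ?S \<Longrightarrow> into_level k (lv s) (mat_of ?d (g s))" by metis
  \<comment> \<open>The sum serves as a common upper bound of finitely many levels.\<close>
  define m0 where "m0 = (\<Sum>s\<in>?S. lv s)"
  have all: "into_level k m a" if m: "m0 \<le> m" and a: "a \<in> nest_alg (N k)" for m a
  proof -
    define V where "V = (\<lambda>x. x \<in> tri (N k) \<and> into_level k m (mat_of ?d x))"
    have n: "mat_of ?d x \<in> nest_alg (N k)" if "x \<in> tri (N k)" for x
      using that tri_corner[OF that] by (simp add: nest_alg_iff[OF A.nd])
    have Vadd: "V (x + y)" if "V x" "V y" for x y
      using that into_level_add[OF n n] by (auto simp: V_def tri_add mat_of_add)
    have Vscl: "V (scl c x)" if "V x" for c x
      using that into_level_smult[OF n] by (auto simp: V_def tri_scl mat_of_scl)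
    have Vg: "V (g s)" if "s \<in> ?S" for s
    proof -
      have "lv s \<le> m0" unfolding m0_def by (rule member_le_sum[OF that]) auto
      then show ?thesis using into_level_mono[OF lv[OF that]] m gt[OF that] by (auto simp: V_def)
    qed
    have x: "fm_of a \<in> tri (N k)" and xc: "fm_of a \<in> corner ?d" using a nest_alg_full[OF a] by (auto simp: nest_alg_iff[OF A.nd])
    have l: "0 < ?l" and d: "0 < ?d"
    proof -
      show d: "0 < ?d" using A.nd[of k] by (simp add: nest_data_def)
      show "0 < ?l"
      proof (rule ccontr)
        assume "\<not> 0 < ?l"
        then have "idm ?d = 0" using sum_natom[OF A.nd[of k]] by simp
        then have "ent (idm ?d) 0 0 = 0" by simp
        then show False using d by simp
      qed
    qed
    \<comment> \<open>Membership of 0 comes from the zero multiple of a generator, for which the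
      index set has to be nonempty.\<close>
    have V0: "V 0" using Vscl[OF Vg[of "(0, 0, 0, 0)"], of 0] l d by simp
    have Vsum: "V (\<Sum>s\<in>S. f s)" if "finite S" "\<And>s. s \<in> S \<Longrightarrow> V (f s)" for S :: "nat set" and f
      using that by (induction S rule: finite_induct) (auto intro: V0 Vadd)
    have "V (blk (N k) (fm_of a) i j)" if ij: "i < ?l" "j < ?l" for i j
    proof (cases "i \<le> j")
      case True
      have "blk (N k) (fm_of a) i j = blk (N k) (\<Sum>p<?d. \<Sum>q<?d. scl (ent (fm_of a) p q) (munit p q)) i j"
        using corner_expand[OF xc] by simp
      also have "\<dots> = (\<Sum>p<?d. \<Sum>q<?d. scl (ent (fm_of a) p q) (g (i, j, p, q)))"
        using True by (simp add: sum_distrib_left sum_distrib_right g_def)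
      finally show ?thesis using ij by (simp only:) (intro Vsum Vscl Vg, auto)
    next
      case False
      then have "blk (N k) (fm_of a) i j = 0" using x tri_iff_blocks[OF A.nd] by (meson not_le)
      then show ?thesis using V0 by simp
    qed
    then have "V (\<Sum>i<?l. \<Sum>j<?l. blk (N k) (fm_of a) i j)" by (intro Vsum) auto
    then have "V (fm_of a)" using corner_expand_blocks[OF A.nd xc] by simp
    then show ?thesis using nest_alg_full[OF a] by (simp add: V_def)
  qed
  then show ?thesis by blast
qed

text \<open>Chosen on the full algebra and not only on the nest algebra, so that the crossover map
  is its own star extension; \<open>lin_inj\<close> makes the choice unique.\<close>

definition cross :: "nat \<Rightarrow> nat \<Rightarrow> complex mat \<Rightarrow> complex mat" where
  "cross k m a = (SOME b. b \<in> full_alg (N' m) \<and> \<Psi> (lin N \<alpha> k a) = lin N' \<alpha>' m b)"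

definition level_ok :: "nat \<Rightarrow> nat \<Rightarrow> bool" where
  "level_ok k m \<longleftrightarrow> (\<forall>a\<in>nest_alg (N k). into_level k m a)"

lemma cross:
  assumes ok: "level_ok k m" and a: "a \<in> full_alg (N k)"
  shows "cross k m a \<in> full_alg (N' m)" "\<Psi> (lin N \<alpha> k a) = lin N' \<alpha>' m (cross k m a)"
proof -
  obtain b c where bc: "b \<in> nest_alg (N k)" "c \<in> nest_alg (N k)" "a = b + mat_adjoint c" using full_alg_split[OF A.nd a] .
  note f = nest_alg_full[OF bc(1)] nest_alg_full[OF bc(2)]
  obtain b' where b': "b' \<in> full_alg (N' m)" "\<Psi> (lin N \<alpha> k b) = lin N' \<alpha>' m b'"
    using ok bc(1) unfolding level_ok_def into_level_def by (meson nest_alg_full)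
  obtain c' where c': "c' \<in> full_alg (N' m)" "\<Psi> (lin N \<alpha> k c) = lin N' \<alpha>' m c'"
    using ok bc(2) unfolding level_ok_def into_level_def by (meson nest_alg_full)
  have "\<Psi> (lin N \<alpha> k (mat_adjoint c)) = lin N' \<alpha>' m (mat_adjoint c')"
    by (rule \<Psi>_lin(4)[OF f(2,2) c'(1,1,2,2)])
  then have "\<Psi> (lin N \<alpha> k a) = lin N' \<alpha>' m (b' + mat_adjoint c')"
    unfolding bc(3) using f b' c' by (intro \<Psi>_lin(1)) auto
  then have "\<exists>b. b \<in> full_alg (N' m) \<and> \<Psi> (lin N \<alpha> k a) = lin N' \<alpha>' m b" using b' c' by (intro exI[of _ "b' + mat_adjoint c'"]) auto
  then have "cross k m a \<in> full_alg (N' m) \<and> \<Psi> (lin N \<alpha> k a) = lin N' \<alpha>' m (cross k m a)"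
    unfolding cross_def by (rule someI_ex)
  then show "cross k m a \<in> full_alg (N' m)" "\<Psi> (lin N \<alpha> k a) = lin N' \<alpha>' m (cross k m a)" by auto
qed

lemma cross_unique:
  assumes "level_ok k m" "a \<in> full_alg (N k)" "b \<in> full_alg (N' m)" "\<Psi> (lin N \<alpha> k a) = lin N' \<alpha>' m b"
  shows "cross k m a = b"
  using B.lin_inj[OF cross(1)[OF assms(1,2)] assms(3)] cross(2)[OF assms(1,2)] assms(4) by simp

lemma cross_hom:
  assumes ok: "level_ok k m"
  shows "star_hom (ndim (N k)) (ndim (N' m)) (cross k m)"
  unfolding star_hom_def
proof (intro conjI ballI allI)
  fix a assume a: "a \<in> full_alg (N k)"
  note ca = cross[OF ok a]
  show "cross k m a \<in> full_alg (N' m)" by (rule ca)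
  show "cross k m (c \<cdot>\<^sub>m a) = c \<cdot>\<^sub>m cross k m a" for c
    by (rule cross_unique[OF ok]) (use a ca \<Psi>_lin(3)[OF a a ca(1,1,2,2)] in auto)
  show "cross k m (mat_adjoint a) = mat_adjoint (cross k m a)"
    by (rule cross_unique[OF ok]) (use a ca \<Psi>_lin(4)[OF a a ca(1,1,2,2)] in auto)
  fix b assume b: "b \<in> full_alg (N k)"
  note cb = cross[OF ok b]
  show "cross k m (a + b) = cross k m a + cross k m b"
    by (rule cross_unique[OF ok]) (use a b ca cb \<Psi>_lin(1)[OF a b ca(1) cb(1) ca(2) cb(2)] in auto)
  show "cross k m (a * b) = cross k m a * cross k m b"
    by (rule cross_unique[OF ok mult_carrier_mat[OF a b] mult_carrier_mat[OF ca(1) cb(1)]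
      \<Psi>_lin(2)[OF a b ca(1) cb(1) ca(2) cb(2)]])
qed

lemma cross_embedding:
  assumes ok: "level_ok k m"
  shows "star_ext_embedding (N k) (N' m) (cross k m)"
proof -
  have "cross k m a \<in> nest_alg (N' m)" if a: "a \<in> nest_alg (N k)" for a
  proof -
    obtain b where b: "b \<in> nest_alg (N' m)" "\<Psi> (lin N \<alpha> k a) = lin N' \<alpha>' m b"
      using ok a by (auto simp: level_ok_def into_level_def)
    then show ?thesis using cross_unique[OF ok nest_alg_full[OF a] nest_alg_full[OF b(1)] b(2)] by simp
  qed
  moreover have "inj_on (cross k m) (nest_alg (N k))"
  proof (rule inj_onI)
    fix a b assume ab: "a \<in> nest_alg (N k)" "b \<in> nest_alg (N k)" "cross k m a = cross k m b"
    note f = nest_alg_full[OF ab(1)] nest_alg_full[OF ab(2)]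
    have "\<Psi> (lin N \<alpha> k a) = \<Psi> (lin N \<alpha> k b)" using cross(2)[OF ok f(1)] cross(2)[OF ok f(2)] ab(3) by simp
    then have "lin N \<alpha> k a = lin N \<alpha> k b" using \<Psi>_inj A.lin_carrier f by (metis inj_on_def)
    then show "a = b" using A.lin_inj f by blast
  qed
  ultimately show ?thesis using cross_hom[OF ok] by (auto simp: star_ext_embedding_def star_extends_def)
qed

end

section \<open>Crossover maps\<close>

text \<open>Treats both order notions at once, with \<open>S\<close> either \<open>Pisom_op\<close>
  or \<open>Pisom_oc\<close>.\<close>

definition ord_map :: "(nest \<Rightarrow> complex mat set) \<Rightarrow> nest \<Rightarrow> nest \<Rightarrow> (complex mat \<Rightarrow> complex mat) \<Rightarrow> bool" where
  "ord_map S N N' \<phi> \<longleftrightarrow> star_ext_embedding N N' \<phi> \<and> \<phi> ` S N \<subseteq> S N'"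

text \<open>Order preserving partial isometries are order conserving, so either notion yields the
  mixed condition of \<open>regular_embeddingI\<close>.\<close>

lemma ord_map_regular:
  assumes S: "S = Pisom_op \<or> S = Pisom_oc" and nd: "nest_data N" "nest_data N'"
    and sh: "star_hom (ndim N) (ndim N') \<pi>" and o: "ord_map S N N' \<pi>"
  shows "regular_embedding N N' \<pi>"
proof (rule regular_embeddingI[OF nd _ sh])
  have sub: "Pisom_op M \<subseteq> Pisom_oc M" if "nest_data M" for M
    using that OP_imp_OC by (auto simp: Pisom_oc_iff Pisom_op_iff)
  show "\<pi> ` Pisom_op N \<subseteq> Pisom_oc N'" using S o sub[OF nd(1)] sub[OF nd(2)] by (auto simp: ord_map_def)
qed (use o in \<open>simp add: ord_map_def\<close>)

text \<open>Carries \<open>OP_triple\<close> and \<open>OC_triple\<close> from corners back to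
  matrices; the predicate \<open>P\<close> in the inner facts stands for \<open>OP\<close> or
  \<open>OC\<close>.\<close>

lemma ord_map_triple:
  assumes S: "S = Pisom_op \<or> S = Pisom_oc"
    and nd: "nest_data N0" "nest_data N1" "nest_data N2" "nest_data N3"
    and h: "star_hom (ndim N0) (ndim N1) \<pi>0" "star_hom (ndim N1) (ndim N2) \<pi>1" "star_hom (ndim N2) (ndim N3) \<pi>2"
    and em: "star_ext_embedding N0 N1 \<pi>0" "star_ext_embedding N1 N2 \<pi>1" "star_ext_embedding N2 N3 \<pi>2"
    and o: "\<And>v. v \<in> S N0 \<Longrightarrow> \<pi>1 (\<pi>0 v) \<in> S N2" "\<And>v. v \<in> S N1 \<Longrightarrow> \<pi>2 (\<pi>1 v) \<in> S N3"
    and v: "v \<in> S N0"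
  shows "\<pi>2 (\<pi>1 (\<pi>0 v)) \<in> S N3"
proof -
  let ?b0 = "fm_hom (ndim N0) \<pi>0" and ?b1 = "fm_hom (ndim N1) \<pi>1" and ?b2 = "fm_hom (ndim N2) \<pi>2"
  have nh: "nest_hom N0 N1 ?b0" "nest_hom N1 N2 ?b1" "nest_hom N2 N3 ?b2"
    using fm_hom_nest_hom[OF nd(1,2) h(1)] fm_hom_nest_hom[OF nd(2,3) h(2)] fm_hom_nest_hom[OF nd(3,4) h(3)] em
    by (auto simp: star_ext_embedding_def)
  have two: "P M2 (fm_hom (ndim M1) \<rho>1 (fm_hom (ndim M0) \<rho>0 x))"
    if P: "\<And>M w. nest_data M \<Longrightarrow> w \<in> S M \<longleftrightarrow> w \<in> full_alg M \<and> P M (fm_of w)" "\<And>M y. P M y \<Longrightarrow> y \<in> tri M"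
      and M: "nest_data M0" "nest_data M2" and \<rho>: "star_hom (ndim M0) (ndim M1) \<rho>0" "star_hom (ndim M1) (ndim M2) \<rho>1"
      and m: "\<And>w. w \<in> S M0 \<Longrightarrow> \<rho>1 (\<rho>0 w) \<in> S M2" and x: "P M0 x"
    for P M0 M1 M2 \<rho>0 \<rho>1 x
  proof -
    let ?w = "mat_of (ndim M0) x"
    have e: "fm_of ?w = x" using tri_corner[OF P(2)[OF x]] by simp
    then have "?w \<in> S M0" using P(1)[OF M(1)] x by simp
    then have "P M2 (fm_of (\<rho>1 (\<rho>0 ?w)))" using m P(1)[OF M(2)] by simp
    moreover have "fm_of (\<rho>1 (\<rho>0 ?w)) = fm_hom (ndim M1) \<rho>1 (fm_hom (ndim M0) \<rho>0 x)"
      using star_homD(1)[OF \<rho>(1), of ?w] by (simp add: fm_hom_def)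
    ultimately show ?thesis by simp
  qed
  have concl: "\<pi>2 (\<pi>1 (\<pi>0 v)) \<in> S N3"
    if P: "\<And>M w. nest_data M \<Longrightarrow> w \<in> S M \<longleftrightarrow> w \<in> full_alg M \<and> P M (fm_of w)"
      and P3: "P N0 (fm_of v) \<Longrightarrow> P N3 (?b2 (?b1 (?b0 (fm_of v))))" for P
  proof -
    have f: "v \<in> full_alg N0" "P N0 (fm_of v)" using P[OF nd(1)] v by auto
    have c: "\<pi>0 v \<in> full_alg N1" "\<pi>1 (\<pi>0 v) \<in> full_alg N2" "\<pi>2 (\<pi>1 (\<pi>0 v)) \<in> full_alg N3"
      using f(1) star_homD(1)[OF h(1)] star_homD(1)[OF h(2)] star_homD(1)[OF h(3)] by auto
    have "?b2 (?b1 (?b0 (fm_of v))) = fm_of (\<pi>2 (\<pi>1 (\<pi>0 v)))" using f c by (simp add: fm_hom_fm_of)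
    then show ?thesis using P3[OF f(2)] P[OF nd(4)] c by simp
  qed
  from S show ?thesis
  proof
    assume S: "S = Pisom_op"
    have P: "\<And>M w. nest_data M \<Longrightarrow> w \<in> S M \<longleftrightarrow> w \<in> full_alg M \<and> OP M (fm_of w)" using Pisom_op_iff S by simp
    have t: "\<And>M y. OP M y \<Longrightarrow> y \<in> tri M" by (simp add: OP_def)
    show ?thesis
      by (rule concl[of OP, OF P]) (use OP_triple[OF nd nh two[of OP, OF P t nd(1,3) h(1,2) o(1)] two[of OP, OF P t nd(2,4) h(2,3) o(2)]] in blast)+
  next
    assume S: "S = Pisom_oc"
    have P: "\<And>M w. nest_data M \<Longrightarrow> w \<in> S M \<longleftrightarrow> w \<in> full_alg M \<and> OC M (fm_of w)" using Pisom_oc_iff S by simp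
    have t: "\<And>M y. OC M y \<Longrightarrow> y \<in> tri M" by (simp add: OC_def)
    show ?thesis
      by (rule concl[of OC, OF P]) (use OC_triple[OF nd nh two[of OC, OF P t nd(1,3) h(1,2) o(1)] two[of OC, OF P t nd(2,4) h(2,3) o(2)]] in blast)+
  qed
qed

lemma (in dsys) ord_map_lmap:
  assumes o: "\<And>k. ord_map S (N k) (N (Suc k)) (\<alpha> k)" and S: "S = Pisom_op \<or> S = Pisom_oc"
    and v: "v \<in> S (N i)" and le: "i \<le> j"
  shows "lmap N \<alpha> i j v \<in> S (N j)"
  using le
proof (induction j rule: dec_induct)
  case base
  then show ?case using v by simp
next
  case (step j)
  have "S (N j) \<subseteq> nest_alg (N j)" using S by (auto simp: Pisom_op_def Pisom_oc_def Pisom_reg_def)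
  then have "ext_maps N \<alpha> j (lmap N \<alpha> i j v) = \<alpha> j (lmap N \<alpha> i j v)" using ext_maps(2) step.IH by blast
  then have "lmap N \<alpha> i (Suc j) v = \<alpha> j (lmap N \<alpha> i j v)" using step by (simp add: lmap_def sysmap_Suc)
  then show ?case using o[of j] step.IH by (auto simp: ord_map_def)
qed

text \<open>Symmetric in the two systems, so that by \<open>swap\<close> each statement on crossover
  maps in one direction also holds in the other.\<close>

locale limpair = F: limiso N \<alpha> N' \<alpha>' \<Psi> + G: limiso N' \<alpha>' N \<alpha> \<Psi>'
  for N \<alpha> N' \<alpha>' \<Psi> \<Psi>' +
  fixes S
  assumes S: "S = Pisom_op \<or> S = Pisom_oc"
    and inv: "X \<in> acarrier (cstar_limit N \<alpha>) \<Longrightarrow> \<Psi>' (\<Psi> X) = X"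
    and inv': "Y \<in> acarrier (cstar_limit N' \<alpha>') \<Longrightarrow> \<Psi> (\<Psi>' Y) = Y"
    and ord: "\<And>k. ord_map S (N k) (N (Suc k)) (\<alpha> k)" "\<And>k. ord_map S (N' k) (N' (Suc k)) (\<alpha>' k)"
begin

lemma swap: "limpair N' \<alpha>' N \<alpha> \<Psi>' \<Psi> S"
  by unfold_locales (use S inv inv' ord in auto)

text \<open>Both sides have the same image in the C*-limit because \<Psi>' inverts \<Psi>, and the
  representative at level \<open>l\<close> is unique.\<close>

lemma cross_cross:
  assumes ok: "F.level_ok k m" "G.level_ok m l" and le: "k \<le> l" and a: "a \<in> full_alg (N k)"
  shows "G.cross m l (F.cross k m a) = lmap N \<alpha> k l a"
proof (rule G.cross_unique[OF ok(2) F.cross(1)[OF ok(1) a] F.A.lmap_carrier[OF le a]])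
  show "\<Psi>' (lin N' \<alpha>' m (F.cross k m a)) = lin N \<alpha> l (lmap N \<alpha> k l a)"
    using F.cross(2)[OF ok(1) a] inv[OF F.A.lin_carrier[OF a]] F.A.lin_shift[OF le a] by simp
qed

text \<open>A single crossover map need not respect the order, but it equals the composition of three
  of them, in which any two consecutive ones compose to a system map.\<close>

lemma cross_ord_map: "\<exists>m0. \<forall>m\<ge>m0. F.level_ok k m \<and> ord_map S (N k) (N' m) (F.cross k m)"
proof -
  interpret sw: limpair N' \<alpha>' N \<alpha> \<Psi>' \<Psi> S by (rule swap)
  \<comment> \<open>The levels \<open>m1\<close>, \<open>l\<close> and \<open>m\<close> are fixed in
    turn, each late enough for the crossover map from the preceding one; keeping \<open>l\<close>
    above \<open>k\<close> and \<open>m\<close> above \<open>m1\<close> makes the system maps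
    between them available.\<close>
  obtain m1 where m1: "\<And>m. m1 \<le> m \<Longrightarrow> F.level_ok k m" using F.level_exists[of k] by (auto simp: F.level_ok_def)
  obtain l0 where l0: "\<And>l. l0 \<le> l \<Longrightarrow> G.level_ok m1 l" using G.level_exists[of m1] by (auto simp: G.level_ok_def)
  define l where "l = max k l0"
  obtain m2 where m2: "\<And>m. m2 \<le> m \<Longrightarrow> F.level_ok l m" using F.level_exists[of l] by (auto simp: F.level_ok_def)
  have "F.level_ok k m \<and> ord_map S (N k) (N' m) (F.cross k m)" if m: "max m1 m2 \<le> m" for m
  proof -
    have ok: "F.level_ok k m1" "G.level_ok m1 l" "F.level_ok l m" "F.level_ok k m" and le: "k \<le> l" "m1 \<le> m"
      using m m1 l0 m2 by (auto simp: l_def)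
    have e: "F.cross l m (G.cross m1 l (F.cross k m1 a)) = F.cross k m a" if a: "a \<in> full_alg (N k)" for a
    proof -
      note la = F.A.lmap_carrier[OF le(1) a]
      have "F.cross k m a = F.cross l m (lmap N \<alpha> k l a)"
        by (rule F.cross_unique[OF ok(4) a F.cross(1)[OF ok(3) la]])
          (use F.cross(2)[OF ok(3) la] F.A.lin_shift[OF le(1) a] in simp)
      then show ?thesis using cross_cross[OF ok(1,2) le(1) a] by simp
    qed
    have sub: "v \<in> full_alg M" if "v \<in> S M" for v M
      using S that by (auto simp: Pisom_op_def Pisom_oc_def Pisom_reg_def nest_alg_def)
    have o: "G.cross m1 l (F.cross k m1 v) \<in> S (N l)" if "v \<in> S (N k)" for v
      using F.A.ord_map_lmap[OF ord(1) S that le(1)] cross_cross[OF ok(1,2) le(1) sub[OF that]] by simp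
    have o': "F.cross l m (G.cross m1 l v) \<in> S (N' m)" if "v \<in> S (N' m1)" for v
      using F.B.ord_map_lmap[OF ord(2) S that le(2)] sw.cross_cross[OF ok(2,3) le(2) sub[OF that]] by simp
    have "F.cross k m v \<in> S (N' m)" if v: "v \<in> S (N k)" for v
      using ord_map_triple[OF S F.A.nd F.B.nd F.A.nd F.B.nd F.cross_hom[OF ok(1)] G.cross_hom[OF ok(2)]
          F.cross_hom[OF ok(3)] F.cross_embedding[OF ok(1)] G.cross_embedding[OF ok(2)] F.cross_embedding[OF ok(3)] o o' v]
        e[OF sub[OF v]] by simp
    then show ?thesis using ok(4) F.cross_embedding[OF ok(4)] by (auto simp: ord_map_def)
  qed
  then show ?thesis by blast
qed

lemma diagram:
  obtains n m where "\<And>k. F.level_ok (n k) (m k)"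
    "regular_system_iso N \<alpha> N' \<alpha>' n m (\<lambda>k. F.cross (n k) (m k)) (\<lambda>k. G.cross (m k) (n (Suc k)))"
    "\<And>k. ord_map S (N (n k)) (N' (m k)) (F.cross (n k) (m k))"
    "\<And>k. ord_map S (N' (m k)) (N (n (Suc k))) (G.cross (m k) (n (Suc k)))"
proof -
  interpret sw: limpair N' \<alpha>' N \<alpha> \<Psi>' \<Psi> S by (rule swap)
  obtain f where f: "\<And>k m. f k \<le> m \<Longrightarrow> F.level_ok k m \<and> ord_map S (N k) (N' m) (F.cross k m)"
    using cross_ord_map by metis
  obtain g where g: "\<And>m k. g m \<le> k \<Longrightarrow> G.level_ok m k \<and> ord_map S (N' m) (N k) (G.cross m k)"
    using sw.cross_ord_map by metis
  \<comment> \<open>Each new index exceeds its predecessor and the threshold of the level mapped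
    into it. The new \<open>n'\<close> comes first, because the threshold for the new
    \<open>m\<close> depends on it.\<close>
  define p where "p = rec_nat (0, f 0) (\<lambda>_ (n, m). let n' = max (Suc n) (g m) in (n', max (Suc m) (f n')))"
  define n where "n = (\<lambda>k. fst (p k))"
  define m where "m = (\<lambda>k. snd (p k))"
  have n_Suc: "n (Suc k) = max (Suc (n k)) (g (m k))" and m_Suc: "m (Suc k) = max (Suc (m k)) (f (n (Suc k)))" for k
    by (simp_all add: n_def m_def p_def Let_def case_prod_beta)
  have fm: "f (n k) \<le> m k" for k
  proof (cases k)
    case 0
    then show ?thesis by (simp add: n_def m_def p_def)
  next
    case (Suc k)
    then show ?thesis using m_Suc[of k] by simp
  qed
  have gn: "g (m k) \<le> n (Suc k)" for k using n_Suc[of k] by simp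
  have mono: "strict_mono n" "strict_mono m" by (simp_all add: strict_mono_Suc_iff n_Suc m_Suc less_max_iff_disj)
  have le: "n k \<le> n (Suc k)" "m k \<le> m (Suc k)" for k using n_Suc[of k] m_Suc[of k] by simp_all
  have F: "F.level_ok (n k) (m k)" "ord_map S (N (n k)) (N' (m k)) (F.cross (n k) (m k))" for k
    using f[OF fm] by auto
  have G: "G.level_ok (m k) (n (Suc k))" "ord_map S (N' (m k)) (N (n (Suc k))) (G.cross (m k) (n (Suc k)))" for k
    using g[OF gn] by auto
  have "G.cross (m k) (n (Suc k)) (F.cross (n k) (m k) a) = sysmap \<alpha> (n k) (n (Suc k)) a"
    if "a \<in> nest_alg (N (n k))" for k a
    using cross_cross[OF F(1) G(1) le(1) nest_alg_full[OF that]] F.A.lmap_nest[OF le(1) that] by simp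
  moreover have "F.cross (n (Suc k)) (m (Suc k)) (G.cross (m k) (n (Suc k)) b) = sysmap \<alpha>' (m k) (m (Suc k)) b"
    if "b \<in> nest_alg (N' (m k))" for k b
    using sw.cross_cross[OF G(1) F(1) le(2) nest_alg_full[OF that]] F.B.lmap_nest[OF le(2) that] by simp
  moreover have "regular_embedding (N (n k)) (N' (m k)) (F.cross (n k) (m k))" for k
    by (rule ord_map_regular[OF S F.A.nd F.B.nd F.cross_hom[OF F(1)] F(2)])
  moreover have "regular_embedding (N' (m k)) (N (n (Suc k))) (G.cross (m k) (n (Suc k)))" for k
    by (rule ord_map_regular[OF S F.B.nd F.A.nd G.cross_hom[OF G(1)] G(2)])
  ultimately have "regular_system_iso N \<alpha> N' \<alpha>' n m (\<lambda>k. F.cross (n k) (m k)) (\<lambda>k. G.cross (m k) (n (Suc k)))"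
    using mono by (simp add: regular_system_iso_def)
  then show ?thesis using that F G by blast
qed

end

lemma star_alg_iso_inv:
  assumes \<Psi>: "star_alg_iso A B \<Psi>"
    and cl: "\<And>x y. x \<in> acarrier A \<Longrightarrow> y \<in> acarrier A \<Longrightarrow> aadd A x y \<in> acarrier A"
      "\<And>x y. x \<in> acarrier A \<Longrightarrow> y \<in> acarrier A \<Longrightarrow> amult A x y \<in> acarrier A"
      "\<And>c x. x \<in> acarrier A \<Longrightarrow> ascale A c x \<in> acarrier A"
      "\<And>x. x \<in> acarrier A \<Longrightarrow> astar A x \<in> acarrier A"
  shows "star_alg_iso B A (inv_into (acarrier A) \<Psi>)"
proof -
  let ?g = "inv_into (acarrier A) \<Psi>"
  have bij: "bij_betw \<Psi> (acarrier A) (acarrier B)" using \<Psi> by (simp add: star_alg_iso_def alg_iso_def)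
  have inj: "inj_on \<Psi> (acarrier A)" and im: "\<Psi> ` acarrier A = acarrier B" using bij by (auto simp: bij_betw_def)
  have g: "?g y \<in> acarrier A" "\<Psi> (?g y) = y" if "y \<in> acarrier B" for y
    using that im by (auto simp: inv_into_into f_inv_into_f)
  have u: "?g (\<Psi> x) = x" if "x \<in> acarrier A" for x by (rule inv_into_f_f[OF inj that])
  have e: "?g (aadd B x y) = aadd A (?g x) (?g y)" "?g (amult B x y) = amult A (?g x) (?g y)"
    "?g (ascale B c x) = ascale A c (?g x)" "?g (astar B x) = astar A (?g x)"
    if "x \<in> acarrier B" "y \<in> acarrier B" for x y c
  proof -
    note gx = g[OF that(1)] and gy = g[OF that(2)]
    have "\<Psi> (aadd A (?g x) (?g y)) = aadd B x y" "\<Psi> (amult A (?g x) (?g y)) = amult B x y"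
      "\<Psi> (ascale A c (?g x)) = ascale B c x" "\<Psi> (astar A (?g x)) = astar B x"
      using \<Psi> gx gy by (auto simp: star_alg_iso_def alg_iso_def)
    then show "?g (aadd B x y) = aadd A (?g x) (?g y)" "?g (amult B x y) = amult A (?g x) (?g y)"
      "?g (ascale B c x) = ascale A c (?g x)" "?g (astar B x) = astar A (?g x)"
      using u cl gx gy by metis+
  qed
  then show ?thesis using bij_betw_inv_into[OF bij] by (simp add: star_alg_iso_def alg_iso_def)
qed

lemma (in dsys) cstar_closed:
  assumes "X \<in> acarrier (cstar_limit N \<alpha>)" "Y \<in> acarrier (cstar_limit N \<alpha>)"
  shows "aadd (cstar_limit N \<alpha>) X Y \<in> acarrier (cstar_limit N \<alpha>)"
    "amult (cstar_limit N \<alpha>) X Y \<in> acarrier (cstar_limit N \<alpha>)"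
    "ascale (cstar_limit N \<alpha>) c X \<in> acarrier (cstar_limit N \<alpha>)"
    "astar (cstar_limit N \<alpha>) X \<in> acarrier (cstar_limit N \<alpha>)"
proof -
  obtain x where x: "x \<in> lim_seqs N \<alpha>" "X = lcls N \<alpha> x" using assms(1) unfolding cstar_carrier by blast
  obtain y where y: "y \<in> lim_seqs N \<alpha>" "Y = lcls N \<alpha> y" using assms(2) unfolding cstar_carrier by blast
  show "aadd (cstar_limit N \<alpha>) X Y \<in> acarrier (cstar_limit N \<alpha>)"
    "amult (cstar_limit N \<alpha>) X Y \<in> acarrier (cstar_limit N \<alpha>)"
    "ascale (cstar_limit N \<alpha>) c X \<in> acarrier (cstar_limit N \<alpha>)"
    "astar (cstar_limit N \<alpha>) X \<in> acarrier (cstar_limit N \<alpha>)"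
    unfolding x(2) y(2) lcls_ops[OF x(1) y(1)] cstar_carrier
    using lim_add[OF x(1) y(1)] lim_mult[OF x(1) y(1)] lim_smult[OF x(1)] lim_adjoint[OF x(1)] by blast+
qed

text \<open>Surjectivity of \<Phi> makes the inverse star isomorphism respect the algebraic limits
  as well, so crossover maps exist in both directions. That the diagram induces \<Phi> is checked in
  the C*-limit, where both sides are the value of \<Psi> at the same element.\<close>

lemma star_ext_iso_imp_diagram:
  assumes d: "dsys N \<alpha>" "dsys N' \<alpha>'" and S: "S = Pisom_op \<or> S = Pisom_oc"
    and ord: "\<And>k. ord_map S (N k) (N (Suc k)) (\<alpha> k)" "\<And>k. ord_map S (N' k) (N' (Suc k)) (\<alpha>' k)"
    and \<Phi>: "star_ext_iso N \<alpha> N' \<alpha>' \<Phi>"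
  shows "\<exists>n m \<phi> \<psi>. regular_system_iso N \<alpha> N' \<alpha>' n m \<phi> \<psi> \<and>
           (\<forall>k. ord_map S (N (n k)) (N' (m k)) (\<phi> k)) \<and> (\<forall>k. ord_map S (N' (m k)) (N (n (Suc k))) (\<psi> k)) \<and>
           induces N \<alpha> N' \<alpha>' n m \<phi> \<Phi>"
proof -
  interpret A: dsys N \<alpha> by (rule d(1))
  interpret B: dsys N' \<alpha>' by (rule d(2))
  let ?A = "acarrier (cstar_limit N \<alpha>)" and ?B = "acarrier (cstar_limit N' \<alpha>')"
  obtain \<Psi> where \<Psi>: "star_alg_iso (cstar_limit N \<alpha>) (cstar_limit N' \<alpha>') \<Psi>"
    and lim: "\<And>X. X \<in> acarrier (limit_alg N \<alpha>) \<Longrightarrow> \<Psi> (limit_incl N \<alpha> X) = limit_incl N' \<alpha>' (\<Phi> X)"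
    using \<Phi> unfolding star_ext_iso_def by blast
  have im: "\<Phi> ` acarrier (limit_alg N \<alpha>) = acarrier (limit_alg N' \<alpha>')"
    using \<Phi> by (auto simp: star_ext_iso_def alg_iso_def bij_betw_def)
  have bij: "bij_betw \<Psi> ?A ?B" using \<Psi> by (simp add: star_alg_iso_def alg_iso_def)
  define \<Psi>' where "\<Psi>' = inv_into ?A \<Psi>"
  have iso': "star_alg_iso (cstar_limit N' \<alpha>') (cstar_limit N \<alpha>) \<Psi>'"
    unfolding \<Psi>'_def by (rule star_alg_iso_inv[OF \<Psi>]) (rule A.cstar_closed; assumption)+
  have inv: "\<Psi>' (\<Psi> X) = X" if "X \<in> ?A" for X
    unfolding \<Psi>'_def by (rule bij_betw_inv_into_left[OF bij that])
  have inv': "\<Psi> (\<Psi>' Y) = Y" if "Y \<in> ?B" for Y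
    unfolding \<Psi>'_def by (rule bij_betw_inv_into_right[OF bij that])
  have lands: "\<exists>l. \<exists>b\<in>nest_alg (N' l). \<Psi> (lin N \<alpha> k a) = lin N' \<alpha>' l b" if a: "a \<in> nest_alg (N k)" for k a
  proof -
    have c: "germ N \<alpha> k a \<in> acarrier (limit_alg N \<alpha>)" using a unfolding A.limit_carrier by blast
    then have "\<Phi> (germ N \<alpha> k a) \<in> acarrier (limit_alg N' \<alpha>')" using im by blast
    then obtain l b where b: "b \<in> nest_alg (N' l)" "\<Phi> (germ N \<alpha> k a) = germ N' \<alpha>' l b"
      unfolding B.limit_carrier by blast
    have "\<Psi> (lin N \<alpha> k a) = lin N' \<alpha>' l b"
      using lim[OF c] b(2) A.limit_incl_germ[OF a] B.limit_incl_germ[OF b(1)] by simp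
    then show ?thesis using b(1) by blast
  qed
  have lands': "\<exists>k. \<exists>a\<in>nest_alg (N k). \<Psi>' (lin N' \<alpha>' l b) = lin N \<alpha> k a" if b: "b \<in> nest_alg (N' l)" for l b
  proof -
    have "germ N' \<alpha>' l b \<in> acarrier (limit_alg N' \<alpha>')" using b unfolding B.limit_carrier by blast
    then obtain X where X: "germ N' \<alpha>' l b = \<Phi> X" "X \<in> acarrier (limit_alg N \<alpha>)"
      unfolding im[symmetric] by (rule imageE)
    then obtain k a where a: "a \<in> nest_alg (N k)" "X = germ N \<alpha> k a" unfolding A.limit_carrier by blast
    have "\<Psi> (lin N \<alpha> k a) = lin N' \<alpha>' l b"
      using lim[OF X(2)] X(1)[symmetric] a(2) A.limit_incl_germ[OF a(1)] B.limit_incl_germ[OF b] by simp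
    then have "\<Psi>' (lin N' \<alpha>' l b) = lin N \<alpha> k a" using inv[OF A.lin_carrier[OF nest_alg_full[OF a(1)]]] by simp
    then show ?thesis using a(1) by blast
  qed
  interpret P: limpair N \<alpha> N' \<alpha>' \<Psi> \<Psi>' S
    by unfold_locales (fact \<Psi> lands iso' lands' S inv inv' ord)+
  obtain n m where nm: "\<And>k. P.F.level_ok (n k) (m k)"
    "regular_system_iso N \<alpha> N' \<alpha>' n m (\<lambda>k. P.F.cross (n k) (m k)) (\<lambda>k. P.G.cross (m k) (n (Suc k)))"
    "\<And>k. ord_map S (N (n k)) (N' (m k)) (P.F.cross (n k) (m k))"
    "\<And>k. ord_map S (N' (m k)) (N (n (Suc k))) (P.G.cross (m k) (n (Suc k)))"
    using P.diagram by blast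
  have "\<Phi> (germ N \<alpha> (n k) a) = germ N' \<alpha>' (m k) (P.F.cross (n k) (m k) a)" if a: "a \<in> nest_alg (N (n k))" for k a
  proof -
    have b: "P.F.cross (n k) (m k) a \<in> nest_alg (N' (m k))"
      using nm(3)[of k] a by (simp add: ord_map_def star_ext_embedding_def)
    have c: "germ N \<alpha> (n k) a \<in> acarrier (limit_alg N \<alpha>)" using a unfolding A.limit_carrier by blast
    have c': "germ N' \<alpha>' (m k) (P.F.cross (n k) (m k) a) \<in> acarrier (limit_alg N' \<alpha>')"
      using b unfolding B.limit_carrier by blast
    have c'': "\<Phi> (germ N \<alpha> (n k) a) \<in> acarrier (limit_alg N' \<alpha>')" using c im by blast
    have "limit_incl N' \<alpha>' (\<Phi> (germ N \<alpha> (n k) a)) = limit_incl N' \<alpha>' (germ N' \<alpha>' (m k) (P.F.cross (n k) (m k) a))"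
      using lim[OF c] A.limit_incl_germ[OF a] B.limit_incl_germ[OF b] P.F.cross(2)[OF nm(1) nest_alg_full[OF a]] by simp
    then show ?thesis by (rule inj_onD[OF B.incl_inj _ c'' c'])
  qed
  then have "induces N \<alpha> N' \<alpha>' n m (\<lambda>k. P.F.cross (n k) (m k)) \<Phi>" by (simp add: induces_def)
  then show ?thesis using nm by blast
qed

theorem theorem4p4:
  fixes N N' :: "nat \<Rightarrow> nest"
    and \<alpha> \<alpha>' :: "nat \<Rightarrow> complex mat \<Rightarrow> complex mat"
    and is_ord :: "nest \<Rightarrow> nest \<Rightarrow> (complex mat \<Rightarrow> complex mat) \<Rightarrow> bool"
  assumes "is_ord = order_preserving \<or> is_ord = order_conserving"
    and "direct_system N \<alpha>" and "direct_system N' \<alpha>'"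
    and "\<And>k. is_ord (N k) (N (Suc k)) (\<alpha> k)"
    and "\<And>k. is_ord (N' k) (N' (Suc k)) (\<alpha>' k)"
  shows
    "((\<exists>n m \<phi> \<psi>. regular_system_iso N \<alpha> N' \<alpha>' n m \<phi> \<psi> \<and>
         (\<forall>k. is_ord (N (n k)) (N' (m k)) (\<phi> k)) \<and> (\<forall>k. is_ord (N' (m k)) (N (n (Suc k))) (\<psi> k)))
      \<longleftrightarrow> (\<exists>\<Phi>. star_ext_iso N \<alpha> N' \<alpha>' \<Phi>)) \<and>
     (\<forall>\<Phi>. star_ext_iso N \<alpha> N' \<alpha>' \<Phi> \<longrightarrow>
        (\<exists>n m \<phi> \<psi>. regular_system_iso N \<alpha> N' \<alpha>' n m \<phi> \<psi> \<and>
           (\<forall>k. is_ord (N (n k)) (N' (m k)) (\<phi> k)) \<and> (\<forall>k. is_ord (N' (m k)) (N (n (Suc k))) (\<psi> k)) \<and>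
           induces N \<alpha> N' \<alpha>' n m \<phi> \<Phi>))"
proof -
  have d: "dsys N \<alpha>" "dsys N' \<alpha>'" using assms(2,3) by (simp_all add: dsys_def)
  obtain S where S: "S = Pisom_op \<or> S = Pisom_oc" and o: "is_ord = ord_map S"
  proof -
    have "order_preserving = ord_map Pisom_op" "order_conserving = ord_map Pisom_oc"
      by (simp_all add: fun_eq_iff order_preserving_def order_conserving_def ord_map_def)
    then show thesis using assms(1) that by auto
  qed
  have diag: "\<exists>n m \<phi> \<psi>. regular_system_iso N \<alpha> N' \<alpha>' n m \<phi> \<psi> \<and>
           (\<forall>k. is_ord (N (n k)) (N' (m k)) (\<phi> k)) \<and> (\<forall>k. is_ord (N' (m k)) (N (n (Suc k))) (\<psi> k)) \<and>
           induces N \<alpha> N' \<alpha>' n m \<phi> \<Phi>" if "star_ext_iso N \<alpha> N' \<alpha>' \<Phi>" for \<Phi>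
    using star_ext_iso_imp_diagram[OF d S _ _ that] assms(4,5) unfolding o by blast
  show ?thesis
  proof (intro conjI iffI allI impI)
    show "\<exists>\<Phi>. star_ext_iso N \<alpha> N' \<alpha>' \<Phi>"
      if "\<exists>n m \<phi> \<psi>. regular_system_iso N \<alpha> N' \<alpha>' n m \<phi> \<psi> \<and>
         (\<forall>k. is_ord (N (n k)) (N' (m k)) (\<phi> k)) \<and> (\<forall>k. is_ord (N' (m k)) (N (n (Suc k))) (\<psi> k))"
      using that regular_system_iso_imp_star_ext_iso[OF d] by blast
    show "\<exists>n m \<phi> \<psi>. regular_system_iso N \<alpha> N' \<alpha>' n m \<phi> \<psi> \<and>
         (\<forall>k. is_ord (N (n k)) (N' (m k)) (\<phi> k)) \<and> (\<forall>k. is_ord (N' (m k)) (N (n (Suc k))) (\<psi> k))"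
      if ex: "\<exists>\<Phi>. star_ext_iso N \<alpha> N' \<alpha>' \<Phi>"
    proof -
      obtain \<Phi> where "star_ext_iso N \<alpha> N' \<alpha>' \<Phi>" using ex by blast
      from diag[OF this] show ?thesis by blast
    qed
  qed (rule diag)
qed

end
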